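(* Let $G=(V,E)$ be an infinite, locally finite, connected, quasi-transitive graph with $p_c(G)<1$, and assume that $G$ contains an edge which lies both on a cycle and on a doubly-infinite self-avoiding path. Then for every $q\in(0,\infty)$ with $q\neq1$ there exist $\delta,\delta'>0$ such that for all $p\in[0,1]$: (1) if $\max(p,p')<p_c(G)+\delta'$, there exists an inhomogeneous Bernoulli bond percolation measure $\mathbb P^G_{(p_e)}$ under which almost surely there is no infinite cluster and which stochastically dominates every FK limit measure on $G$ with parameters $p,q$; in particular, each such FK limit measure almost surely has no infinite cluster; (2) if $\min(p,p')>p_c(G)-\delta$, there exists an inhomogeneous Bernoulli bond percolation measure $\mathbb P^G_{(p_e)}$ under which almost surely there is an infinite cluster and which is stochastically dominated by every FK limit measure on $G$ with parameters $p,q$; in particular, each such FK limit measure almost surely has an infinite cluster.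
   Context: Quasi-transitive: the automorphism group of $G$ has finitely many orbits on $V$. $p_c(G)$ is the critical parameter of Bernoulli bond percolation on $G$. $p':=\frac{p}{p+q(1-p)}$. For finite $\Lambda\subset V$ (with induced subgraph), $E(\Lambda)$ is the set of edges with both endpoints in $\Lambda$, $\partial\Lambda$ the set of vertices of $\Lambda$ with a neighbour outside $\Lambda$; for a partition $\alpha$ of $\partial\Lambda$, $\phi^\alpha_{\Lambda,p,q}(\omega)=Z^{-1}\prod_{e\in E(\Lambda)}p^{\omega(e)}(1-p)^{1-\omega(e)}q^{k(\omega,\alpha)}$ on $\{0,1\}^{E(\Lambda)}$, where $k(\omega,\alpha)$ is the number of open clusters after identifying vertices lying in the same block of $\alpha$. An FK limit measure with parameters $p,q$ is a weak limit $\lim_n\phi^{\alpha_n}_{\Lambda_n,p,q}$ for some increasing sequence of finite subgraphs $\Lambda_n\uparrow G$ and partitions $\alpha_n$ of $\partial\Lambda_n$. $\mathbb P^G_{(p_e)}$ is the product measure on $\{0,1\}^E$ with edge $e$ open independently with probability $p_e$; stochastic domination $\mu\preceq\mu'$ means $\mu(A)\le\mu'(A)$ for every increasing event $A$. *)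

theory Defs
  imports "HOL-Probability.Probability" "HOL-Library.Disjoint_Sets"
begin

text \<open>A simple graph on the vertex type 'v (vertex set = UNIV), given by a
symmetric irreflexive adjacency relation. Edges are two-element vertex sets.\<close>

definition edges :: "('v \<Rightarrow> 'v \<Rightarrow> bool) \<Rightarrow> 'v set set" where
  "edges adj = {{x, y} | x y. adj x y}"

definition simple_graph :: "('v \<Rightarrow> 'v \<Rightarrow> bool) \<Rightarrow> bool" where
  "simple_graph adj \<longleftrightarrow> (\<forall>x y. adj x y \<longrightarrow> adj y x) \<and> (\<forall>x. \<not> adj x x)"

definition locally_finite :: "('v \<Rightarrow> 'v \<Rightarrow> bool) \<Rightarrow> bool" where
  "locally_finite adj \<longleftrightarrow> (\<forall>x. finite {y. adj x y})"

definition connected_graph :: "('v \<Rightarrow> 'v \<Rightarrow> bool) \<Rightarrow> bool" where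
  "connected_graph adj \<longleftrightarrow> (\<forall>x y. (x, y) \<in> {(a, b). adj a b}\<^sup>*)"

definition graph_automorphisms :: "('v \<Rightarrow> 'v \<Rightarrow> bool) \<Rightarrow> ('v \<Rightarrow> 'v) set" where
  "graph_automorphisms adj = {\<sigma>. bij \<sigma> \<and> (\<forall>x y. adj (\<sigma> x) (\<sigma> y) \<longleftrightarrow> adj x y)}"

definition quasi_transitive :: "('v \<Rightarrow> 'v \<Rightarrow> bool) \<Rightarrow> bool" where
  "quasi_transitive adj \<longleftrightarrow>
     finite (range (\<lambda>x. (\<lambda>\<sigma>. \<sigma> x) ` graph_automorphisms adj))"

text \<open>Edge e lies on a cycle: a closed walk through n \<ge> 3 distinct vertices.\<close>
definition edge_on_cycle :: "('v \<Rightarrow> 'v \<Rightarrow> bool) \<Rightarrow> 'v set \<Rightarrow> bool" where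
  "edge_on_cycle adj e \<longleftrightarrow> (\<exists>vs :: 'v list. length vs \<ge> 3 \<and> distinct vs \<and>
      (\<forall>i < length vs. adj (vs ! i) (vs ! ((i + 1) mod length vs))) \<and>
      (\<exists>i < length vs. e = {vs ! i, vs ! ((i + 1) mod length vs)}))"

text \<open>Edge e lies on a doubly-infinite self-avoiding path.\<close>
definition edge_on_biinfinite_path :: "('v \<Rightarrow> 'v \<Rightarrow> bool) \<Rightarrow> 'v set \<Rightarrow> bool" where
  "edge_on_biinfinite_path adj e \<longleftrightarrow> (\<exists>f :: int \<Rightarrow> 'v. inj f \<and>
      (\<forall>i. adj (f i) (f (i + 1))) \<and> (\<exists>i. e = {f i, f (i + 1)}))"

text \<open>Configuration space {0,1}^E with the product sigma-algebra.\<close>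
definition cfg_space :: "('v \<Rightarrow> 'v \<Rightarrow> bool) \<Rightarrow> ('v set \<Rightarrow> bool) measure" where
  "cfg_space adj = PiM (edges adj) (\<lambda>_. count_space UNIV)"

text \<open>Inhomogeneous Bernoulli bond percolation P_(p_e).\<close>
definition bern_perc :: "('v \<Rightarrow> 'v \<Rightarrow> bool) \<Rightarrow> ('v set \<Rightarrow> real) \<Rightarrow> ('v set \<Rightarrow> bool) measure" where
  "bern_perc adj pe = PiM (edges adj) (\<lambda>e. measure_pmf (bernoulli_pmf (pe e)))"

definition open_rel :: "('v \<Rightarrow> 'v \<Rightarrow> bool) \<Rightarrow> ('v set \<Rightarrow> bool) \<Rightarrow> ('v \<times> 'v) set" where
  "open_rel adj \<omega> = {(x, y). adj x y \<and> \<omega> {x, y}}"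

definition has_inf_cluster :: "('v \<Rightarrow> 'v \<Rightarrow> bool) \<Rightarrow> ('v set \<Rightarrow> bool) \<Rightarrow> bool" where
  "has_inf_cluster adj \<omega> \<longleftrightarrow> (\<exists>v. infinite {w. (v, w) \<in> (open_rel adj \<omega>)\<^sup>*})"

text \<open>Critical parameter of (homogeneous) Bernoulli bond percolation.\<close>
definition p_c :: "('v \<Rightarrow> 'v \<Rightarrow> bool) \<Rightarrow> real" where
  "p_c adj = Sup {p \<in> {0..1}. AE \<omega> in bern_perc adj (\<lambda>_. p). \<not> has_inf_cluster adj \<omega>}"

definition increasing_event :: "('v \<Rightarrow> 'v \<Rightarrow> bool) \<Rightarrow> ('v set \<Rightarrow> bool) set \<Rightarrow> bool" where
  "increasing_event adj A \<longleftrightarrow> A \<in> sets (cfg_space adj) \<and>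
     (\<forall>\<omega>\<in>A. \<forall>\<omega>'\<in>space (cfg_space adj). (\<forall>e\<in>edges adj. \<omega> e \<longrightarrow> \<omega>' e) \<longrightarrow> \<omega>' \<in> A)"

text \<open>Stochastic domination mu \<preceq> nu.\<close>
definition stoch_dom :: "('v \<Rightarrow> 'v \<Rightarrow> bool) \<Rightarrow> ('v set \<Rightarrow> bool) measure \<Rightarrow> ('v set \<Rightarrow> bool) measure \<Rightarrow> bool" where
  "stoch_dom adj \<mu> \<nu> \<longleftrightarrow> (\<forall>A. increasing_event adj A \<longrightarrow> measure \<mu> A \<le> measure \<nu> A)"

text \<open>Finite volume: induced edges E(Lambda) and inner boundary.\<close>
definition ind_edges :: "('v \<Rightarrow> 'v \<Rightarrow> bool) \<Rightarrow> 'v set \<Rightarrow> 'v set set" where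
  "ind_edges adj \<Lambda> = {e \<in> edges adj. e \<subseteq> \<Lambda>}"

definition bdry :: "('v \<Rightarrow> 'v \<Rightarrow> bool) \<Rightarrow> 'v set \<Rightarrow> 'v set" where
  "bdry adj \<Lambda> = {x \<in> \<Lambda>. \<exists>y. adj x y \<and> y \<notin> \<Lambda>}"

text \<open>k(omega, alpha): number of open clusters in Lambda after identifying the
vertices in each block of alpha.\<close>
definition fk_clusters :: "('v \<Rightarrow> 'v \<Rightarrow> bool) \<Rightarrow> 'v set \<Rightarrow> 'v set set \<Rightarrow> ('v set \<Rightarrow> bool) \<Rightarrow> nat" where
  "fk_clusters adj \<Lambda> \<alpha> \<omega> = card (\<Lambda> // ({(x, y). x \<in> \<Lambda> \<and> y \<in> \<Lambda> \<and>
       (({x, y} \<in> ind_edges adj \<Lambda> \<and> \<omega> {x, y}) \<or> (\<exists>B\<in>\<alpha>. x \<in> B \<and> y \<in> B))}\<^sup>*))"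

definition fk_weight :: "('v \<Rightarrow> 'v \<Rightarrow> bool) \<Rightarrow> 'v set \<Rightarrow> 'v set set \<Rightarrow> real \<Rightarrow> real \<Rightarrow> ('v set \<Rightarrow> bool) \<Rightarrow> real" where
  "fk_weight adj \<Lambda> \<alpha> p q \<omega> =
     (\<Prod>e\<in>ind_edges adj \<Lambda>. if \<omega> e then p else 1 - p) * q ^ fk_clusters adj \<Lambda> \<alpha> \<omega>"

text \<open>phi^alpha_{Lambda,p,q} of the cylinder event {omega = xi on F} (for F \<subseteq> E(Lambda)).\<close>
definition fk_cyl :: "('v \<Rightarrow> 'v \<Rightarrow> bool) \<Rightarrow> 'v set \<Rightarrow> 'v set set \<Rightarrow> real \<Rightarrow> real \<Rightarrow> 'v set set \<Rightarrow> ('v set \<Rightarrow> bool) \<Rightarrow> real" where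
  "fk_cyl adj \<Lambda> \<alpha> p q F \<xi> =
     (\<Sum>\<omega>\<in>PiE (ind_edges adj \<Lambda>) (\<lambda>_. UNIV).
        if (\<forall>e\<in>F \<inter> ind_edges adj \<Lambda>. \<omega> e = \<xi> e) then fk_weight adj \<Lambda> \<alpha> p q \<omega> else 0)
     / (\<Sum>\<omega>\<in>PiE (ind_edges adj \<Lambda>) (\<lambda>_. UNIV). fk_weight adj \<Lambda> \<alpha> p q \<omega>)"

text \<open>FK limit measure: weak limit (convergence of all cylinder probabilities)
of finite-volume FK measures along finite Lambda_n increasing to G.\<close>
definition fk_limit :: "('v \<Rightarrow> 'v \<Rightarrow> bool) \<Rightarrow> real \<Rightarrow> real \<Rightarrow> ('v set \<Rightarrow> bool) measure \<Rightarrow> bool" where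
  "fk_limit adj p q \<mu> \<longleftrightarrow> prob_space \<mu> \<and> sets \<mu> = sets (cfg_space adj) \<and>
     (\<exists>\<Lambda> :: nat \<Rightarrow> 'v set. \<exists>\<alpha> :: nat \<Rightarrow> 'v set set.
        (\<forall>n. finite (\<Lambda> n)) \<and> (\<forall>n. \<Lambda> n \<subseteq> \<Lambda> (Suc n)) \<and> (\<Union>n. \<Lambda> n) = UNIV \<and>
        (\<forall>n. partition_on (bdry adj (\<Lambda> n)) (\<alpha> n)) \<and>
        (\<forall>F \<xi>. finite F \<longrightarrow> F \<subseteq> edges adj \<longrightarrow>
           (\<lambda>n. fk_cyl adj (\<Lambda> n) (\<alpha> n) p q F \<xi>) \<longlonglongrightarrow>
             measure \<mu> {\<omega> \<in> space (cfg_space adj). \<forall>e\<in>F. \<omega> e = \<xi> e}))"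

definition p_prime :: "real \<Rightarrow> real \<Rightarrow> real" where
  "p_prime p q = p / (p + q * (1 - p))"

end

(* Conditionally on all other edges an FK measure opens an edge with probability p or p', according
   to whether its endpoints are connected elsewhere. For an edge e of a sparse pattern S, both
   cases occur with probability bounded below whatever the far edges are: closing the other edges
   at one endpoint isolates it, opening the rest of a cycle through e connects the endpoints. So if
   each e in S is revealed before the edges of its local test, a sequential coupling compares the FK
   measure with Bernoulli percolation whose density improves on max(p,p') (resp. min(p,p')) by a
   fixed epsilon on S.

   It remains to see that a change of density by epsilon on S outweighs a change of all densities by
   c * epsilon. With a ghost field of intensity h, Russo's formula reduces this to comparing the
   influence of an arbitrary edge f with that of a nearby edge of S. This is finite-energy
   surgery unless a cut vertex x separates f from every nearby edge of S; then f is pivotal in front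
   of a side K of x. For the supremum of the connection probability over all separated patterns no
   information is lost: a nearly optimal pattern cannot be much worse on K than any other pattern
   spliced in behind x, and a Harnack inequality, valid since K is infinite and contains edges of
   the orbit of S, bounds the connection probability from the front by the one inside K. Hence the
   supremum is monotone along the path (p - c*t, r + t). Letting h tend to 0 moves the critical
   point; on the supercritical side a compactness argument selects a single pattern. *)
theory Submission
  imports Defs
begin

section \<open>Finite product measures\<close>

text \<open>The obstacle is that a pattern \<open>S\<close> need not be automorphism invariant, so
  behind a cut vertex nothing relates the connection probabilities of one fixed \<open>S\<close> at
  different places. The supremum \<open>Mbar\<close> over all patterns is invariant, and a pattern
  that nearly attains it obeys the comparison up to an additive error \<open>u\<close>. As no single
  pattern need stay nearly optimal along the whole path, one is chosen afresh on every short step.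
  The two hypotheses on the edge have separate uses. The cycle supplies the test that forces a
  connection, and the two disjoint arms by which a pivotal edge of the same block is traded for
  \<open>e\<close>. The doubly-infinite path makes every component behind a cut vertex that meets
  \<open>e\<close> infinite, hence large enough to contain an image of that vertex. Sparseness is
  combinatorial: tests of distinct pattern edges must be disjoint and contain no pattern edge, which
  fixes the separation \<open>2 * r\<close>. The ghost field makes finite boxes harmless, because a
  cluster of n vertices misses it with probability (1-h)^n.\<close>

definition wt :: "'i set \<Rightarrow> ('i \<Rightarrow> real) \<Rightarrow> 'i set \<Rightarrow> real" where
 "wt I P V = (\<Prod>i\<in>I. if i \<in> V then P i else 1 - P i)"

definition Ev :: "'i set \<Rightarrow> ('i \<Rightarrow> real) \<Rightarrow> ('i set \<Rightarrow> real) \<Rightarrow> real" where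
 "Ev I P g = (\<Sum>V\<in>Pow I. wt I P V * g V)"

definition PR :: "'i set \<Rightarrow> ('i \<Rightarrow> real) \<Rightarrow> ('i set \<Rightarrow> bool) \<Rightarrow> real" where
 "PR I P A = Ev I P (\<lambda>V. of_bool (A V))"

definition pv :: "('i \<Rightarrow> real) \<Rightarrow> bool" where
 "pv P \<longleftrightarrow> (\<forall>i. 0 \<le> P i \<and> P i \<le> 1)"

definition incr :: "('i set \<Rightarrow> bool) \<Rightarrow> bool" where
 "incr A \<longleftrightarrow> (\<forall>V V'. V \<subseteq> V' \<longrightarrow> A V \<longrightarrow> A V')"

definition piv :: "('i set \<Rightarrow> bool) \<Rightarrow> 'i \<Rightarrow> 'i set \<Rightarrow> bool" where
 "piv A i V \<longleftrightarrow> A (insert i V) \<and> \<not> A (V - {i})"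

lemma wt_nonneg: "pv P \<Longrightarrow> 0 \<le> wt I P V"
 unfolding wt_def pv_def by (intro prod_nonneg) auto

lemma Ev_empty [simp]: "Ev {} P g = g {}"
 by (simp add: Ev_def wt_def)

lemma Ev_cong: "(\<And>V. V \<subseteq> I \<Longrightarrow> f V = g V) \<Longrightarrow> Ev I P f = Ev I P g"
 unfolding Ev_def by (intro sum.cong) auto

lemma Ev_mono: "pv P \<Longrightarrow> (\<And>V. V \<subseteq> I \<Longrightarrow> f V \<le> g V) \<Longrightarrow> Ev I P f \<le> Ev I P g"
 unfolding Ev_def by (intro sum_mono mult_left_mono wt_nonneg) auto

lemma Ev_add: "Ev I P (\<lambda>V. f V + g V) = Ev I P f + Ev I P g"
 unfolding Ev_def by (simp add: algebra_simps sum.distrib)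

lemma Ev_cmult: "Ev I P (\<lambda>V. c * f V) = c * Ev I P f"
 unfolding Ev_def sum_distrib_left by (intro sum.cong) auto

lemma Ev_multc: "Ev I P (\<lambda>V. f V * c) = Ev I P f * c"
 using Ev_cmult[of I P c f] by (simp add: mult.commute)

lemma Ev_diff: "Ev I P (\<lambda>V. f V - g V) = Ev I P f - Ev I P g"
 unfolding Ev_def by (simp add: algebra_simps sum_subtractf)

lemma Ev_sum: "Ev I P (\<lambda>V. \<Sum>k\<in>K. f k V) = (\<Sum>k\<in>K. Ev I P (f k))"
 unfolding Ev_def sum_distrib_left by (rule sum.swap)

lemma Ev_nonneg: "pv P \<Longrightarrow> (\<And>V. V \<subseteq> I \<Longrightarrow> 0 \<le> g V) \<Longrightarrow> 0 \<le> Ev I P g"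
 unfolding Ev_def by (intro sum_nonneg mult_nonneg_nonneg wt_nonneg) auto

lemma Ev_param_cong: "(\<And>i. i \<in> I \<Longrightarrow> P i = Q i) \<Longrightarrow> Ev I P g = Ev I Q g"
 unfolding Ev_def wt_def by (intro sum.cong refl arg_cong2[where f="(*)"] prod.cong) auto

lemma PR_param_cong: "(\<And>i. i \<in> I \<Longrightarrow> P i = Q i) \<Longrightarrow> PR I P A = PR I Q A"
 unfolding PR_def by (rule Ev_param_cong)

lemma Ev_insert:
 assumes "finite I" "i \<notin> I"
 shows "Ev (insert i I) P g = P i * Ev I P (\<lambda>V. g (insert i V)) + (1 - P i) * Ev I P g"
proof -
 have 1: "wt (insert i I) P V = (1 - P i) * wt I P V" if "V \<in> Pow I" for V
  using assms that by (auto simp: wt_def)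
 have 2: "wt (insert i I) P (insert i V) = P i * wt I P V" if "V \<in> Pow I" for V
 proof -
  have "(\<Prod>j\<in>I. if j \<in> insert i V then P j else 1 - P j) = (\<Prod>j\<in>I. if j \<in> V then P j else 1 - P j)"
   using assms by (intro prod.cong) auto
  thus ?thesis using assms by (simp add: wt_def)
 qed
 have inj: "inj_on (insert i) (Pow I)"
  using assms by (auto simp: inj_on_def)
 have "Ev (insert i I) P g = (\<Sum>V\<in>Pow I. wt (insert i I) P V * g V) +
   (\<Sum>V\<in>insert i ` Pow I. wt (insert i I) P V * g V)"
  unfolding Ev_def Pow_insert using assms by (intro sum.union_disjoint) auto
 also have "(\<Sum>V\<in>insert i ` Pow I. wt (insert i I) P V * g V) = P i * Ev I P (\<lambda>V. g (insert i V))"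
  unfolding sum.reindex[OF inj] Ev_def sum_distrib_left
  by (intro sum.cong) (auto simp: 2)
 also have "(\<Sum>V\<in>Pow I. wt (insert i I) P V * g V) = (1 - P i) * Ev I P g"
  unfolding Ev_def sum_distrib_left by (intro sum.cong) (auto simp: 1)
 finally show ?thesis by simp
qed

lemma Ev_const: "finite I \<Longrightarrow> Ev I P (\<lambda>_. c) = c"
 by (induction I rule: finite_induct) (simp_all add: Ev_insert algebra_simps)

lemma Ev_Un:
 assumes "finite J" "finite K" "J \<inter> K = {}"
 shows "Ev (J \<union> K) P F = Ev J P (\<lambda>\<nu>. Ev K P (\<lambda>\<beta>. F (\<nu> \<union> \<beta>)))"
 using assms(1,3)
proof (induction J arbitrary: F rule: finite_induct)
 case empty
 thus ?case by simp
next
 case (insert i J)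
 hence *: "i \<notin> J \<union> K" "J \<inter> K = {}" "finite (J \<union> K)" using assms by auto
 show ?case using insert.IH[OF *(2)] insert.hyps *
  by (simp add: Ev_insert)
qed

lemma Ev_split:
 assumes "finite I"
 shows "Ev I P F = Ev (I \<inter> J) P (\<lambda>\<nu>. Ev (I - J) P (\<lambda>\<beta>. F (\<nu> \<union> \<beta>)))"
proof -
 have "I = (I \<inter> J) \<union> (I - J)" by auto
 thus ?thesis using Ev_Un[of "I \<inter> J" "I - J" P F] assms by auto
qed

lemma Ev_indep:
 assumes "finite I"
 shows "Ev I P (\<lambda>V. f (V \<inter> J) * g (V - J)) = Ev (I \<inter> J) P f * Ev (I - J) P g"
proof -
 have "Ev (I - J) P (\<lambda>\<beta>. f ((\<nu> \<union> \<beta>) \<inter> J) * g ((\<nu> \<union> \<beta>) - J)) = f \<nu> * Ev (I - J) P g"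
  if "\<nu> \<subseteq> I \<inter> J" for \<nu>
 proof -
  have "Ev (I - J) P (\<lambda>\<beta>. f ((\<nu> \<union> \<beta>) \<inter> J) * g ((\<nu> \<union> \<beta>) - J)) = Ev (I - J) P (\<lambda>\<beta>. f \<nu> * g \<beta>)"
  proof (rule Ev_cong)
   fix \<beta> assume "\<beta> \<subseteq> I - J"
   hence "(\<nu> \<union> \<beta>) \<inter> J = \<nu>" "(\<nu> \<union> \<beta>) - J = \<beta>" using that by auto
   thus "f ((\<nu> \<union> \<beta>) \<inter> J) * g ((\<nu> \<union> \<beta>) - J) = f \<nu> * g \<beta>" by simp
  qed
  thus ?thesis by (simp add: Ev_cmult)
 qed
 hence "Ev I P (\<lambda>V. f (V \<inter> J) * g (V - J)) = Ev (I \<inter> J) P (\<lambda>\<nu>. f \<nu> * Ev (I - J) P g)"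
  unfolding Ev_split[OF assms, of P _ J] by (intro Ev_cong) auto
 thus ?thesis by (simp add: Ev_multc)
qed

lemma PR_nonneg: "pv P \<Longrightarrow> 0 \<le> PR I P A"
 unfolding PR_def by (rule Ev_nonneg) auto

lemma PR_le_1: "pv P \<Longrightarrow> finite I \<Longrightarrow> PR I P A \<le> 1"
 unfolding PR_def using Ev_mono[of P I "\<lambda>V. of_bool (A V)" "\<lambda>_. 1"] by (auto simp: Ev_const)

lemma PR_cong: "(\<And>V. V \<subseteq> I \<Longrightarrow> A V = B V) \<Longrightarrow> PR I P A = PR I P B"
 unfolding PR_def by (intro Ev_cong) auto

lemma PR_mono: "pv P \<Longrightarrow> (\<And>V. V \<subseteq> I \<Longrightarrow> A V \<Longrightarrow> B V) \<Longrightarrow> PR I P A \<le> PR I P B"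
 unfolding PR_def by (intro Ev_mono) auto

lemma PR_True: "finite I \<Longrightarrow> PR I P (\<lambda>_. True) = 1"
 unfolding PR_def by (simp add: Ev_const)

lemma PR_not: "finite I \<Longrightarrow> PR I P (\<lambda>V. \<not> A V) = 1 - PR I P A"
 unfolding PR_def using Ev_diff[of I P "\<lambda>_. 1" "\<lambda>V. of_bool (A V)"]
 by (simp add: Ev_const of_bool_not_iff)

lemma PR_disj: "(\<And>V. V \<subseteq> I \<Longrightarrow> \<not> (A V \<and> B V)) \<Longrightarrow> PR I P (\<lambda>V. A V \<or> B V) = PR I P A + PR I P B"
 unfolding PR_def Ev_add[symmetric] by (intro Ev_cong) auto

lemma PR_Ex_le:
 assumes "pv P" "finite K"
 shows "PR I P (\<lambda>V. \<exists>k\<in>K. A k V) \<le> (\<Sum>k\<in>K. PR I P (A k))"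
proof -
 have "of_bool (\<exists>k\<in>K. A k V) \<le> (\<Sum>k\<in>K. of_bool (A k V) :: real)" for V
 proof (cases "\<exists>k\<in>K. A k V")
  case True
  then obtain k where "k \<in> K" "A k V" by auto
  hence "of_bool (A k V) \<le> (\<Sum>k\<in>K. of_bool (A k V) :: real)"
   using assms(2) by (intro member_le_sum) auto
  with \<open>A k V\<close> True show ?thesis by simp
 qed (auto intro!: sum_nonneg)
 thus ?thesis unfolding PR_def Ev_sum[symmetric] by (intro Ev_mono assms)
qed

lemma PR_indep:
 assumes "finite I"
 shows "PR I P (\<lambda>V. A (V \<inter> J) \<and> B (V - J)) = PR (I \<inter> J) P A * PR (I - J) P B"
 using Ev_indep[OF assms, of P "\<lambda>V. of_bool (A V)" J "\<lambda>V. of_bool (B V)"]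
 by (simp add: PR_def of_bool_conj)

lemma PR_restrict:
 assumes "finite I"
 shows "PR I P (\<lambda>V. A (V \<inter> J)) = PR (I \<inter> J) P A"
 using PR_indep[OF assms, of P A J "\<lambda>_. True"] assms by (simp add: PR_True)

lemma PR_restrict_diff:
 assumes "finite I"
 shows "PR I P (\<lambda>V. A (V - J)) = PR (I - J) P A"
 using PR_indep[OF assms, of P "\<lambda>_. True" J A] assms by (simp add: PR_True)

lemma PR_partition:
 assumes "finite K" "\<And>V. V \<subseteq> I \<Longrightarrow> A V \<Longrightarrow> U V \<in> K"
 shows "PR I P A = (\<Sum>k\<in>K. PR I P (\<lambda>V. A V \<and> U V = k))"
proof -
 have "of_bool (A V) = (\<Sum>k\<in>K. of_bool (A V \<and> U V = k) :: real)" if "V \<subseteq> I" for V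
 proof (cases "A V")
  case True
  have "(\<Sum>k\<in>K. of_bool (A V \<and> U V = k) :: real) = (\<Sum>k\<in>{U V}. of_bool (A V \<and> U V = k))"
   using assms that True by (intro sum.mono_neutral_right) auto
  thus ?thesis using True by simp
 qed auto
 thus ?thesis unfolding PR_def Ev_sum[symmetric] by (intro Ev_cong)
qed

lemma PR_insert:
 assumes "finite I" "i \<notin> I"
 shows "PR (insert i I) P A = P i * PR I P (\<lambda>V. A (insert i V)) + (1 - P i) * PR I P A"
 using Ev_insert[OF assms] by (simp add: PR_def)

lemma incrD: "incr A \<Longrightarrow> V \<subseteq> V' \<Longrightarrow> A V \<Longrightarrow> A V'"
 by (auto simp: incr_def)

lemma incr_insert:
 assumes "incr A"
 shows "incr (\<lambda>V. A (insert i V))"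
 unfolding incr_def
proof (intro allI impI)
 fix V V' :: "'a set"
 assume "V \<subseteq> V'" "A (insert i V)"
 moreover from this have "insert i V \<subseteq> insert i V'" by auto
 ultimately show "A (insert i V')" using incrD[OF assms] by blast
qed

text \<open>Closing every index outside \<open>I\<close> turns a configuration on \<open>J\<close>
  into one on \<open>I\<close> and can only destroy an increasing event. This compares boxes of
  different sizes throughout.\<close>

lemma PR_mono_index:
 assumes "incr A" "pv P" "finite J" "I \<subseteq> J"
 shows "PR I P A \<le> PR J P A"
proof -
 have "PR I P A = PR J P (\<lambda>V. A (V \<inter> I))"
  using PR_restrict[OF assms(3), of P A I] assms(4) by (simp add: Int_absorb1)
 also have "\<dots> \<le> PR J P A"
  using assms by (intro PR_mono) (auto elim: incrD)
 finally show ?thesis .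
qed

text \<open>Conditioning on one index makes the probability affine in its parameter; the slope is
  the difference of the two conditional probabilities, nonnegative for an increasing event.\<close>

lemma PR_mono_param:
 assumes "finite I" "incr A" "pv P" "pv Q" "\<And>i. i \<in> I \<Longrightarrow> P i \<le> Q i"
 shows "PR I P A \<le> PR I Q A"
 using assms(1,2,5)
proof (induction I arbitrary: A rule: finite_induct)
 case empty
 thus ?case by (simp add: PR_def)
next
 case (insert i I)
 have inc: "incr (\<lambda>V. A (insert i V))"
  using insert.prems(1) by (rule incr_insert)
 have a: "PR I P (\<lambda>V. A (insert i V)) \<le> PR I Q (\<lambda>V. A (insert i V))"
  by (rule insert.IH[OF inc]) (use insert.prems in auto)
 have b: "PR I P A \<le> PR I Q A"
  by (rule insert.IH) (use insert.prems in auto)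
 have c: "PR I P A \<le> PR I P (\<lambda>V. A (insert i V))"
  using insert.prems(1) assms(3) by (intro PR_mono) (auto elim: incrD)
 have P: "0 \<le> P i" "P i \<le> Q i" "Q i \<le> 1" using assms(3,4) insert.prems(2) by (auto simp: pv_def)
 have "PR (insert i I) P A = PR I P A + P i * (PR I P (\<lambda>V. A (insert i V)) - PR I P A)"
  using insert.hyps by (simp add: PR_insert algebra_simps)
 also have "\<dots> \<le> PR I P A + Q i * (PR I P (\<lambda>V. A (insert i V)) - PR I P A)"
  using P c by (intro add_left_mono mult_right_mono) auto
 also have "\<dots> = Q i * PR I P (\<lambda>V. A (insert i V)) + (1 - Q i) * PR I P A"
  by (simp add: algebra_simps)
 also have "\<dots> \<le> Q i * PR I Q (\<lambda>V. A (insert i V)) + (1 - Q i) * PR I Q A"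
  using P a b by (intro add_mono mult_left_mono) auto
 also have "\<dots> = PR (insert i I) Q A"
  using insert.hyps by (simp add: PR_insert)
 finally show ?case .
qed

lemma piv_insert [simp]: "piv A i (insert i V) = piv A i V" "piv A i (V - {i}) = piv A i V"
 by (auto simp: piv_def)

text \<open>Pivotality does not read the state of \<open>i\<close>, so the two are independent. With
  \<open>i\<close> closed and pivotal an increasing event fails, which is how influences are later
  bounded through clusters that miss the ghost.\<close>

lemma PR_piv_closed:
 assumes "finite I" "i \<in> I"
 shows "PR I P (\<lambda>V. piv A i V \<and> i \<notin> V) = (1 - P i) * PR I P (piv A i)"
proof -
 have I: "I = insert i (I - {i})" "i \<notin> I - {i}" "finite (I - {i})" using assms by auto
 have *: "PR (I - {i}) P (\<lambda>V. piv A i (insert i V)) = PR (I - {i}) P (piv A i)" by simp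
 have "PR (I - {i}) P (\<lambda>V. piv A i V \<and> i \<notin> V) = PR (I - {i}) P (piv A i)"
  by (rule PR_cong) auto
 moreover have "PR (I - {i}) P (\<lambda>V. False) = 0" by (simp add: PR_def Ev_def)
 ultimately show ?thesis using PR_insert[OF I(3,2), of P "\<lambda>V. piv A i V \<and> i \<notin> V"]
   PR_insert[OF I(3,2), of P "piv A i"] I(1) * by (simp add: algebra_simps)
qed

text \<open>Russo's formula with a separate parameter for each index. The induction removes one
  index; the product rule produces its term as a difference of two conditional probabilities, which
  is the probability of being pivotal.\<close>

lemma PR_has_derivative:
 assumes "finite I" "incr A"
  and "\<And>i. i \<in> I \<Longrightarrow> ((\<lambda>t. P t i) has_real_derivative P' i) (at t)"
 shows "((\<lambda>t. PR I (P t) A) has_real_derivative (\<Sum>i\<in>I. P' i * PR I (P t) (piv A i))) (at t)"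
 using assms
proof (induction I arbitrary: A rule: finite_induct)
 case empty
 thus ?case by (simp add: PR_def)
next
 case (insert i I)
 have inc: "incr (\<lambda>V. A (insert i V))"
  using insert.prems(1) by (rule incr_insert)
 have d1: "((\<lambda>t. PR I (P t) (\<lambda>V. A (insert i V))) has_real_derivative
   (\<Sum>j\<in>I. P' j * PR I (P t) (piv (\<lambda>V. A (insert i V)) j))) (at t)"
  by (rule insert.IH[OF inc]) (use insert.prems in auto)
 have d2: "((\<lambda>t. PR I (P t) A) has_real_derivative (\<Sum>j\<in>I. P' j * PR I (P t) (piv A j))) (at t)"
  by (rule insert.IH) (use insert.prems in auto)
 have d3: "((\<lambda>t. P t i) has_real_derivative P' i) (at t)" using insert.prems by auto
 have e1: "PR (insert i I) (P t) (piv A j) = P t i * PR I (P t) (piv (\<lambda>V. A (insert i V)) j)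
   + (1 - P t i) * PR I (P t) (piv A j)" if "j \<in> I" for j
 proof -
  have "i \<noteq> j" using that insert.hyps by auto
  hence "piv A j (insert i V) = piv (\<lambda>V. A (insert i V)) j V" for V
   by (simp add: piv_def insert_commute insert_Diff_if)
  thus ?thesis using PR_insert[OF insert.hyps(1,2)] by simp
 qed
 have "PR (insert i I) (P t) (piv A i) = PR I (P t) (piv A i)"
  by (simp add: PR_insert[OF insert.hyps(1,2)] algebra_simps)
 also have "\<dots> = PR I (P t) (\<lambda>V. A (insert i V)) - PR I (P t) A"
  unfolding PR_def Ev_diff[symmetric]
 proof (rule Ev_cong)
  fix V assume "V \<subseteq> I"
  hence "V - {i} = V" using insert.hyps by auto
  moreover have "A V \<Longrightarrow> A (insert i V)" using insert.prems(1) by (auto elim: incrD)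
  ultimately show "of_bool (piv A i V) = of_bool (A (insert i V)) - (of_bool (A V) :: real)"
   by (auto simp: piv_def)
 qed
 finally have e2: "PR (insert i I) (P t) (piv A i) = \<dots>" .
 have "(\<Sum>j\<in>insert i I. P' j * PR (insert i I) (P t) (piv A j)) =
   P' i * (PR I (P t) (\<lambda>V. A (insert i V)) - PR I (P t) A) +
   (\<Sum>j\<in>I. P t i * (P' j * PR I (P t) (piv (\<lambda>V. A (insert i V)) j)) + (1 - P t i) * (P' j * PR I (P t) (piv A j)))"
 proof -
  have "(\<Sum>j\<in>I. P' j * PR (insert i I) (P t) (piv A j)) =
   (\<Sum>j\<in>I. P t i * (P' j * PR I (P t) (piv (\<lambda>V. A (insert i V)) j)) + (1 - P t i) * (P' j * PR I (P t) (piv A j)))"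
   by (intro sum.cong refl) (simp add: e1 algebra_simps)
  thus ?thesis using insert.hyps by (simp add: e2)
 qed
 also have "\<dots> = P' i * PR I (P t) (\<lambda>V. A (insert i V)) + P t i * (\<Sum>j\<in>I. P' j * PR I (P t) (piv (\<lambda>V. A (insert i V)) j))
   + ((0 - P' i) * PR I (P t) A + (1 - P t i) * (\<Sum>j\<in>I. P' j * PR I (P t) (piv A j)))"
  unfolding sum.distrib sum_distrib_left[symmetric] by (simp add: algebra_simps)
 finally have e3: "(\<Sum>j\<in>insert i I. P' j * PR (insert i I) (P t) (piv A j)) = \<dots>" .
 show ?case unfolding e3 unfolding PR_insert[OF insert.hyps(1,2)]
  by (rule derivative_eq_intros d1 d2 d3 refl)+ (simp add: algebra_simps)
qed

section \<open>Finite energy: the cost of changing boundedly many indices\<close>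

lemma wt_Un:
 assumes "finite J" "finite K" "J \<inter> K = {}"
 shows "wt (J \<union> K) P V = wt J P V * wt K P V"
 unfolding wt_def using assms by (rule prod.union_disjoint)

lemma wt_const:
 assumes "finite J" "\<And>i. i \<in> J \<Longrightarrow> P i = h"
 shows "wt J P V = h ^ card (V \<inter> J) * (1 - h) ^ (card J - card (V \<inter> J))"
proof -
 have J: "J = (V \<inter> J) \<union> (J - V)" by auto
 have "wt J P V = (\<Prod>i\<in>V \<inter> J. if i \<in> V then P i else 1 - P i) * (\<Prod>i\<in>J - V. if i \<in> V then P i else 1 - P i)"
  unfolding wt_def by (subst J, rule prod.union_disjoint) (use assms in auto)
 also have "\<dots> = h ^ card (V \<inter> J) * (1 - h) ^ card (J - V)"
  using assms(2) by (simp)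
 also have "card (J - V) = card J - card (V \<inter> J)"
  using assms(1) by (metis Int_commute card_Diff_subset_Int finite_Int)
 finally show ?thesis .
qed

text \<open>For \<open>h\<close> at most 1/2, closing a ghost index multiplies the weight by
  (1-h)/h, which is at least 1. No power of \<open>h\<close> is lost, so the surgery constants stay
  bounded as \<open>h\<close> tends to 0.\<close>

lemma wt_change_green:
 assumes "finite J" "\<And>i. i \<in> J \<Longrightarrow> P i = h" "0 < h" "h \<le> 1/2"
  and "card (V' \<inter> J) \<le> card (V \<inter> J)"
 shows "wt J P V \<le> wt J P V'"
proof -
 define k k' m where "k = card (V \<inter> J)" "k' = card (V' \<inter> J)" "m = card J"
 have km: "k \<le> m" "k' \<le> k" unfolding k_k'_m_def using assms by (auto intro: card_mono)
 have "wt J P V = h ^ k' * h ^ (k - k') * (1 - h) ^ (m - k)"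
  using wt_const[OF assms(1,2)] km by (simp add: k_k'_m_def flip: power_add)
 also have "\<dots> \<le> h ^ k' * (1 - h) ^ (k - k') * (1 - h) ^ (m - k)"
  using assms by (intro mult_right_mono mult_left_mono power_mono) auto
 also have "\<dots> = h ^ k' * (1 - h) ^ (m - k')"
  using km by (simp add: mult.assoc flip: power_add)
 also have "\<dots> = wt J P V'"
  using wt_const[OF assms(1,2)] by (simp add: k_k'_m_def)
 finally show ?thesis .
qed

lemma wt_le_1: "pv P \<Longrightarrow> wt J P V \<le> 1"
 unfolding wt_def pv_def by (intro prod_le_1) auto

lemma wt_ge:
 assumes "\<And>i. i \<in> J \<Longrightarrow> a \<le> P i \<and> P i \<le> 1 - a" "0 \<le> a"
 shows "a ^ card J \<le> wt J P V"
proof -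
 have "(\<Prod>i\<in>J. a) \<le> wt J P V" unfolding wt_def using assms by (intro prod_mono) force
 thus ?thesis by simp
qed

text \<open>Finite energy: an injection-free change of configuration on \<open>Z\<close> costs at most a constant
 factor, uniformly in the density \<open>h\<close> of the ghost field as long as the number of open ghost
 indices does not increase.\<close>
lemma surgery:
 assumes I: "finite I" "Z \<subseteq> I" "card Z \<le> n" and P: "pv P"
  and G: "\<And>i. i \<in> Z \<inter> G \<Longrightarrow> P i = h" "0 < h" "h \<le> 1/2"
  and a: "\<And>i. i \<in> Z - G \<Longrightarrow> a \<le> P i \<and> P i \<le> 1 - a" "0 < a" "a \<le> 1"
  and AB: "\<And>V. V \<subseteq> I \<Longrightarrow> A V \<Longrightarrow>
    \<exists>V'\<subseteq>I. V' - Z = V - Z \<and> B V' \<and> card (V' \<inter> Z \<inter> G) \<le> card (V \<inter> Z \<inter> G)"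
 shows "PR I P A \<le> (2/a) ^ n * PR I P B"
proof -
 have fin: "finite Z" "finite (I - Z)" using I finite_subset by auto
 let ?J = "I - Z"
 have key: "Ev Z P (\<lambda>\<nu>. of_bool (A (\<nu> \<union> \<beta>))) \<le> (2/a) ^ n * Ev Z P (\<lambda>\<nu>. of_bool (B (\<nu> \<union> \<beta>)))"
  if \<beta>: "\<beta> \<subseteq> ?J" for \<beta>
 proof -
  let ?E = "Ev Z P (\<lambda>\<nu>. of_bool (B (\<nu> \<union> \<beta>)))"
  have E0: "0 \<le> ?E" using P by (intro Ev_nonneg) auto
  have each: "wt Z P \<nu> * of_bool (A (\<nu> \<union> \<beta>)) \<le> (1/a) ^ n * ?E" if \<nu>: "\<nu> \<in> Pow Z" for \<nu>
  proof (cases "A (\<nu> \<union> \<beta>)")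
   case False
   thus ?thesis using E0 a by auto
  next
   case True
   obtain V' where V': "V' \<subseteq> I" "V' - Z = \<nu> \<union> \<beta> - Z" "B V'"
    "card (V' \<inter> Z \<inter> G) \<le> card ((\<nu> \<union> \<beta>) \<inter> Z \<inter> G)"
    using AB[OF _ True] \<nu> \<beta> I by blast
   have "\<nu> \<union> \<beta> - Z = \<beta>" using \<nu> \<beta> by auto
   hence eq: "V' = (V' \<inter> Z) \<union> \<beta>" using V' by auto
   let ?\<nu> = "V' \<inter> Z"
   have "(\<nu> \<union> \<beta>) \<inter> Z \<inter> G = \<nu> \<inter> (Z \<inter> G)" using \<nu> \<beta> by auto
   moreover have "V' \<inter> Z \<inter> G = ?\<nu> \<inter> (Z \<inter> G)" by auto
   ultimately have c: "card (?\<nu> \<inter> (Z \<inter> G)) \<le> card (\<nu> \<inter> (Z \<inter> G))" using V'(4) by simp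
   have ZZ: "wt Z P \<gamma> = wt (Z \<inter> G) P \<gamma> * wt (Z - G) P \<gamma>" for \<gamma>
    using wt_Un[of "Z \<inter> G" "Z - G" P \<gamma>] fin by (auto simp: Int_Diff_Un)
   have g: "wt (Z \<inter> G) P \<nu> \<le> wt (Z \<inter> G) P ?\<nu>"
    by (rule wt_change_green[where h=h]) (use G fin c in auto)
   have e: "a ^ n \<le> wt (Z - G) P ?\<nu>"
   proof -
    have "card (Z - G) \<le> card Z" using fin by (intro card_mono) auto
    hence "a ^ n \<le> a ^ card (Z - G)" using a I(3) by (intro power_decreasing) auto
    also have "\<dots> \<le> wt (Z - G) P ?\<nu>" using a by (intro wt_ge) auto
    finally show ?thesis .
   qed
   have "a ^ n * wt Z P \<nu> = wt (Z \<inter> G) P \<nu> * (a ^ n * wt (Z - G) P \<nu>)" by (simp add: ZZ)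
   also have "\<dots> \<le> wt (Z \<inter> G) P ?\<nu> * (a ^ n * 1)"
    using g P a wt_nonneg[OF P] wt_le_1[OF P] by (intro mult_mono mult_left_mono) auto
   also have "\<dots> \<le> wt (Z \<inter> G) P ?\<nu> * wt (Z - G) P ?\<nu>"
    using e wt_nonneg[OF P] by (intro mult_left_mono) auto
   also have "\<dots> = wt Z P ?\<nu> * of_bool (B (?\<nu> \<union> \<beta>))" using V'(3) eq by (simp add: ZZ)
   also have "\<dots> \<le> ?E"
    unfolding Ev_def using fin wt_nonneg[OF P] by (intro member_le_sum) auto
   finally have "a ^ n * wt Z P \<nu> \<le> ?E" .
   thus ?thesis using True a by (simp add: field_simps)
  qed
  \<comment> \<open>The change of configuration may send many configurations on \<open>Z\<close> to
    the same one. Each of the at most \<open>2 ^ n\<close> sources is therefore charged the full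
    expectation \<open>?E\<close>.\<close>
  have "Ev Z P (\<lambda>\<nu>. of_bool (A (\<nu> \<union> \<beta>))) \<le> (\<Sum>\<nu>\<in>Pow Z. (1/a) ^ n * ?E)"
   unfolding Ev_def[of _ _ "\<lambda>\<nu>. of_bool (A (\<nu> \<union> \<beta>))"] by (intro sum_mono each)
  also have "\<dots> = 2 ^ card Z * ((1/a) ^ n * ?E)" using fin by (simp add: card_Pow)
  also have "\<dots> \<le> 2 ^ n * ((1/a) ^ n * ?E)"
   using I E0 a by (intro mult_right_mono power_increasing) auto
  also have "\<dots> = (2/a) ^ n * ?E" by (simp add: power_divide)
  finally show ?thesis .
 qed
 have sw: "PR I P C = Ev ?J P (\<lambda>\<beta>. Ev Z P (\<lambda>\<nu>. of_bool (C (\<nu> \<union> \<beta>))))" for C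
 proof -
  have "I = ?J \<union> Z" using I by auto
  thus ?thesis unfolding PR_def using Ev_Un[of ?J Z P "\<lambda>V. of_bool (C V)"] fin by (auto simp: Un_commute)
 qed
 show ?thesis unfolding sw Ev_cmult[symmetric]
  by (rule Ev_mono[OF P]) (use key in "simp add: Ev_cmult")
qed

text \<open>The weights are compared pointwise. On \<open>Z\<close> the \<open>P\<close>-weight is
  at most 1 and the \<open>Q\<close>-weight at least \<open>a ^ n\<close>; off \<open>Z\<close> they
  agree.\<close>

lemma PR_change_param:
 assumes I: "finite I" "finite Z" "card Z \<le> n" and P: "pv P" "pv Q"
  and eq: "\<And>i. i \<in> I - Z \<Longrightarrow> P i = Q i"
  and a: "\<And>i. i \<in> Z \<Longrightarrow> a \<le> Q i \<and> Q i \<le> 1 - a" "0 < a" "a \<le> 1"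
 shows "PR I P A \<le> (1/a) ^ n * PR I Q A"
proof -
 have w: "wt I P V \<le> (1/a) ^ n * wt I Q V" for V
 proof -
  have ZZ: "wt I R V = wt (I \<inter> Z) R V * wt (I - Z) R V" for R
   using wt_Un[of "I \<inter> Z" "I - Z" R V] I by (auto simp: Int_Diff_Un)
  have eqZ: "wt (I - Z) P V = wt (I - Z) Q V"
   unfolding wt_def by (intro prod.cong) (auto simp: eq)
  have "a ^ n \<le> wt (I \<inter> Z) Q V"
  proof -
   have "card (I \<inter> Z) \<le> card Z" using I by (intro card_mono) auto
   hence "a ^ n \<le> a ^ card (I \<inter> Z)" using a I(3) by (intro power_decreasing) auto
   also have "\<dots> \<le> wt (I \<inter> Z) Q V" using a by (intro wt_ge) auto
   finally show ?thesis .
  qed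
  moreover have "wt (I \<inter> Z) P V \<le> 1" using wt_le_1[OF P(1)] .
  ultimately have "wt (I \<inter> Z) P V * a ^ n \<le> 1 * wt (I \<inter> Z) Q V"
   using wt_nonneg[OF P(1), of "I \<inter> Z" V] a by (intro mult_mono) auto
  hence "(wt (I \<inter> Z) P V * a ^ n) * wt (I - Z) Q V \<le> wt (I \<inter> Z) Q V * wt (I - Z) Q V"
   using wt_nonneg[OF P(2)] by (intro mult_right_mono) auto
  hence "a ^ n * wt I P V \<le> wt I Q V"
   using eqZ ZZ[of P] ZZ[of Q] by (simp add: ac_simps)
  thus ?thesis using a by (simp add: field_simps)
 qed
 show ?thesis unfolding PR_def Ev_def sum_distrib_left
  using mult_right_mono[OF w] by (intro sum_mono) (auto simp: mult.assoc)
qed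

section \<open>Cut vertices and cycles\<close>

text \<open>The path is cut at its first visit to \<open>R\<close>; the initial piece lies outside
  \<open>R\<close> and can serve as a new arm disjoint from it.\<close>

lemma first_hit:
 assumes "(s, t) \<in> r\<^sup>*" "t \<in> R"
 shows "s \<in> R \<or> (\<exists>u y. (s, u) \<in> (r \<inter> (- R) \<times> (- R))\<^sup>* \<and> u \<notin> R \<and> (u, y) \<in> r \<and> y \<in> R \<and> (y, t) \<in> r\<^sup>*)"
 using assms(1)
proof (induction rule: converse_rtrancl_induct)
 case base
 thus ?case using assms by simp
next
 case (step s s')
 show ?case
 proof (cases "s \<in> R \<or> s' \<in> R")
  case True
  thus ?thesis using step by blast
 next
  case False
  then obtain u y where "(s', u) \<in> (r \<inter> (- R) \<times> (- R))\<^sup>*" "u \<notin> R" "(u, y) \<in> r" "y \<in> R" "(y, t) \<in> r\<^sup>*"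
   using step.IH by blast
  moreover have "(s, s') \<in> r \<inter> (- R) \<times> (- R)" using False step by auto
  ultimately show ?thesis by (meson converse_rtrancl_into_rtrancl)
 qed
qed

lemma rtrancl_distinct_path:
 assumes "(u, v) \<in> r\<^sup>*"
 shows "\<exists>ws. ws \<noteq> [] \<and> distinct ws \<and> successively (\<lambda>a b. (a, b) \<in> r) ws \<and> hd ws = u \<and> last ws = v"
 using assms
proof (induction rule: converse_rtrancl_induct)
 case base
 show ?case by (rule exI[of _ "[v]"]) auto
next
 case (step u u')
 then obtain ws where ws: "ws \<noteq> []" "distinct ws" "successively (\<lambda>a b. (a, b) \<in> r) ws"
  "hd ws = u'" "last ws = v" by blast
 show ?case
 proof (cases "u \<in> set ws")
  case True
  then obtain as bs where ab: "ws = as @ u # bs" by (meson split_list)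
  show ?thesis
   by (rule exI[of _ "u # bs"]) (use ws ab in "auto simp: successively_append_iff")
 next
  case False
  show ?thesis
   by (rule exI[of _ "u # ws"]) (use ws False step in "auto simp: successively_Cons")
 qed
qed

lemma rtrancl_closed:
 assumes "(s, t) \<in> r\<^sup>*" "s \<in> T" "\<And>a b. a \<in> T \<Longrightarrow> (a, b) \<in> r \<Longrightarrow> b \<in> T"
 shows "t \<in> T"
 using assms(1,2) by (induction rule: rtrancl_induct) (use assms(3) in auto)

locale lf_graph =
 fixes adj :: "'v \<Rightarrow> 'v \<Rightarrow> bool"
 assumes adj_sym: "adj x y \<Longrightarrow> adj y x"
  and adj_irrefl [simp]: "\<not> adj x x"
  and lf: "finite {y. adj x y}"
  and conn_graph: "(x, y) \<in> {(a, b). adj a b}\<^sup>*"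
  and inf_V: "infinite (UNIV :: 'v set)"
begin

abbreviation EG :: "'v set set" where "EG \<equiv> edges adj"

abbreviation IE :: "'v set \<Rightarrow> 'v set set" where "IE \<equiv> ind_edges adj"

abbreviation Cfg :: "('v set \<Rightarrow> bool) set" where "Cfg \<equiv> space (cfg_space adj)"

abbreviation bern :: "('v set \<Rightarrow> real) \<Rightarrow> ('v set \<Rightarrow> bool) measure" where "bern \<equiv> bern_perc adj"

abbreviation inf_cl :: "('v set \<Rightarrow> bool) \<Rightarrow> bool" where "inf_cl \<equiv> has_inf_cluster adj"

abbreviation sdom :: "('v set \<Rightarrow> bool) measure \<Rightarrow> ('v set \<Rightarrow> bool) measure \<Rightarrow> bool" where "sdom \<equiv> stoch_dom adj"

abbreviation Arel :: "('v \<times> 'v) set" where "Arel \<equiv> {(a, b). adj a b}"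

definition ball :: "nat \<Rightarrow> 'v \<Rightarrow> 'v set" where
 "ball n x = {y. \<exists>k\<le>n. (x, y) \<in> Arel ^^ k}"

definition conn :: "'v set \<Rightarrow> bool" where
 "conn A \<longleftrightarrow> (\<forall>u\<in>A. \<forall>v\<in>A. (u, v) \<in> (Arel \<inter> A \<times> A)\<^sup>*)"

text \<open>A component of the graph with \<open>x\<close> removed, as \<open>side_eq_comp\<close>
  confirms: it can be entered and left only through \<open>x\<close>.\<close>

definition side :: "'v \<Rightarrow> 'v set \<Rightarrow> bool" where
 "side x K \<longleftrightarrow> x \<notin> K \<and> K \<noteq> {} \<and> conn K \<and> (\<forall>v\<in>K. \<forall>w. adj v w \<longrightarrow> w \<in> K \<or> w = x)"

definition comp :: "'v \<Rightarrow> 'v \<Rightarrow> 'v set" where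
 "comp x v = {w. (v, w) \<in> (Arel \<inter> (- {x}) \<times> (- {x}))\<^sup>*}"

text \<open>If the open edges in \<open>R\<close> are exactly those inside \<open>A1\<close> and
  those inside \<open>A2\<close>, then \<open>e\<close> is the only bridge between the arm of
  \<open>y1\<close> and the arm of \<open>y2\<close>, hence pivotal for joining them.\<close>

definition link :: "'v set \<Rightarrow> 'v set \<Rightarrow> 'v \<Rightarrow> 'v \<Rightarrow> bool" where
 "link R e y1 y2 \<longleftrightarrow> (\<exists>A1 A2 c d. A1 \<subseteq> R \<and> A2 \<subseteq> R \<and> A1 \<inter> A2 = {} \<and> conn A1 \<and> conn A2 \<and>
   e = {c, d} \<and> adj c d \<and> y1 \<in> A1 \<and> c \<in> A1 \<and> y2 \<in> A2 \<and> d \<in> A2)"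

text \<open>The form of 2-connectedness that surgery needs: whatever distinct entry and exit
  vertices the outside imposes, \<open>e\<close> can be made the bridge between them.\<close>

definition linked :: "'v set \<Rightarrow> 'v set \<Rightarrow> bool" where
 "linked R e \<longleftrightarrow> finite R \<and> e \<subseteq> R \<and> e \<in> EG \<and> (\<forall>y1\<in>R. \<forall>y2\<in>R. y1 \<noteq> y2 \<longrightarrow> link R e y1 y2)"

lemma adj_commute: "adj x y \<longleftrightarrow> adj y x"
 using adj_sym by blast

lemma sym_Arel_on: "sym (Arel \<inter> A \<times> A)" by (auto simp: sym_def adj_commute)

lemma edgesE:
 assumes "e \<in> EG"
 obtains c d where "e = {c, d}" "adj c d" "c \<noteq> d"
 using assms adj_irrefl unfolding edges_def by blast

lemma ball_self [simp]: "x \<in> ball n x"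
 unfolding ball_def by (auto intro!: exI[of _ 0])

lemma ball_0 [simp]: "ball 0 x = {x}"
 unfolding ball_def by auto

lemma ball_mono: "m \<le> n \<Longrightarrow> ball m x \<subseteq> ball n x"
 unfolding ball_def by (auto intro: le_trans)

lemma ball_trans:
 assumes "y \<in> ball m x" "z \<in> ball n y"
 shows "z \<in> ball (m + n) x"
proof -
 obtain k l where "k \<le> m" "(x, y) \<in> Arel ^^ k" "l \<le> n" "(y, z) \<in> Arel ^^ l"
  using assms by (auto simp: ball_def)
 hence "(x, z) \<in> Arel ^^ (k + l)" "k + l \<le> m + n"
  by (auto simp: relpow_add)
 thus ?thesis unfolding ball_def by blast
qed

lemma ball_sym:
 assumes "y \<in> ball n x"
 shows "x \<in> ball n y"
proof -
 have "(x, y) \<in> Arel ^^ k \<Longrightarrow> (y, x) \<in> Arel ^^ k" for k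
 proof (induction k arbitrary: y)
  case (Suc k)
  then obtain z where z: "(x, z) \<in> Arel ^^ k" "adj z y" by auto
  have "(y, z) \<in> Arel" using z(2) by (auto intro: adj_sym)
  thus ?case using Suc.IH[OF z(1)] by (rule relpow_Suc_I2)
 qed auto
 thus ?thesis using assms by (auto simp: ball_def)
qed

lemma ball_adj: "adj x y \<Longrightarrow> y \<in> ball (Suc 0) x"
 unfolding ball_def by (auto intro!: exI[of _ "Suc 0"])

lemma ball_Suc: "ball (Suc n) x = ball n x \<union> (\<Union>y\<in>ball n x. {z. adj y z})"
proof (intro equalityI subsetI)
 fix z assume "z \<in> ball (Suc n) x"
 then obtain k where k: "k \<le> Suc n" "(x, z) \<in> Arel ^^ k" by (auto simp: ball_def)
 show "z \<in> ball n x \<union> (\<Union>y\<in>ball n x. {z. adj y z})"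
 proof (cases "k \<le> n")
  case False
  hence "k = Suc n" using k by auto
  then obtain y where "(x, y) \<in> Arel ^^ n" "adj y z" using k by auto
  thus ?thesis by (auto simp: ball_def)
 qed (use k in "auto simp: ball_def")
next
 fix z assume "z \<in> ball n x \<union> (\<Union>y\<in>ball n x. {z. adj y z})"
 then consider "z \<in> ball n x" | y where "y \<in> ball n x" "adj y z" by blast
 thus "z \<in> ball (Suc n) x"
 proof cases
  case 1
  thus ?thesis using ball_mono[of n "Suc n" x] by auto
 next
  case 2
  thus ?thesis using ball_trans[OF 2(1) ball_adj[OF 2(2)]] by simp
 qed
qed

lemma finite_ball [simp]: "finite (ball n x)"
 by (induction n) (auto simp: ball_Suc lf)

lemma ball_exists: "\<exists>n. y \<in> ball n x"
proof -
 have "(x, y) \<in> Arel\<^sup>*" by (rule conn_graph)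
 then obtain k where "(x, y) \<in> Arel ^^ k" using rtrancl_imp_relpow by blast
 thus ?thesis unfolding ball_def by blast
qed

lemma ball_exists_finite:
 assumes "finite A"
 shows "\<exists>n. A \<subseteq> ball n x"
 using assms
proof (induction A rule: finite_induct)
 case (insert a A)
 then obtain n m where "A \<subseteq> ball n x" "a \<in> ball m x" using ball_exists by blast
 hence "insert a A \<subseteq> ball (max n m) x" using ball_mono[of n "max n m" x] ball_mono[of m "max n m" x] by auto
 thus ?case ..
qed auto

lemma conn_singleton [simp]: "conn {x}" by (auto simp: conn_def)

lemma conn_empty [simp]: "conn {}" by (auto simp: conn_def)

lemma conn_step:
 assumes "conn A" "conn B" "a \<in> A" "b \<in> B" "a = b \<or> adj a b"
 shows "conn (A \<union> B)"
proof -
 let ?r = "Arel \<inter> (A \<union> B) \<times> (A \<union> B)"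
 have A: "(u, v) \<in> ?r\<^sup>*" if "u \<in> A" "v \<in> A" for u v
 proof -
  have "(u, v) \<in> (Arel \<inter> A \<times> A)\<^sup>*" using assms(1) that by (auto simp: conn_def)
  thus ?thesis by (rule rtrancl_mono[THEN subsetD, rotated]) auto
 qed
 have B: "(u, v) \<in> ?r\<^sup>*" if "u \<in> B" "v \<in> B" for u v
 proof -
  have "(u, v) \<in> (Arel \<inter> B \<times> B)\<^sup>*" using assms(2) that by (auto simp: conn_def)
  thus ?thesis by (rule rtrancl_mono[THEN subsetD, rotated]) auto
 qed
 have ab: "(a, b) \<in> ?r\<^sup>*" using assms by auto
 have AB: "(u, v) \<in> ?r\<^sup>*" if "u \<in> A" "v \<in> B" for u v
  using A[OF that(1) assms(3)] ab B[OF assms(4) that(2)] by (meson rtrancl_trans)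
 have BA: "(v, u) \<in> ?r\<^sup>*" if "u \<in> A" "v \<in> B" for u v
  using AB[OF that] sym_rtrancl[OF sym_Arel_on[of "A \<union> B"]] by (auto dest: symD)
 show ?thesis unfolding conn_def using A B AB BA by blast
qed

lemma conn_insert: "conn A \<Longrightarrow> a \<in> A \<Longrightarrow> adj a b \<Longrightarrow> conn (insert b A)"
 using conn_step[of A "{b}" a b] by simp

lemma conn_finite_sub:
 assumes "conn A" "u \<in> A" "v \<in> A"
 shows "\<exists>L\<subseteq>A. finite L \<and> conn L \<and> u \<in> L \<and> v \<in> L"
proof -
 have "(u, v) \<in> (Arel \<inter> A \<times> A)\<^sup>*" using assms by (auto simp: conn_def)
 thus ?thesis
 proof (induction rule: rtrancl_induct)
  case base
  show ?case by (rule exI[of _ "{u}"]) (use assms in auto)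
 next
  case (step y z)
  then obtain L where "L \<subseteq> A" "finite L" "conn L" "u \<in> L" "y \<in> L" by blast
  thus ?case using step by (intro exI[of _ "insert z L"]) (auto intro: conn_insert)
 qed
qed

lemma conn_successively: "successively adj ws \<Longrightarrow> conn (set ws)"
proof (induction ws rule: induct_list012)
 case (3 x y zs)
 hence "conn (set (y # zs))" "adj x y" by auto
 hence "conn (insert x (set (y # zs)))" by (intro conn_insert[of _ y]) (auto intro: adj_sym)
 thus ?case by simp
qed auto

lemma conn_ball: "conn (ball n x)"
proof (induction n)
 case (Suc n)
 let ?B = "ball (Suc n) x"
 have sub: "ball n x \<subseteq> ?B" by (rule ball_mono) simp
 have *: "(x, v) \<in> (Arel \<inter> ?B \<times> ?B)\<^sup>*" if v: "v \<in> ?B" for v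
 proof -
  have in_n: "(x, y) \<in> (Arel \<inter> ?B \<times> ?B)\<^sup>*" if "y \<in> ball n x" for y
  proof -
   have "(x, y) \<in> (Arel \<inter> ball n x \<times> ball n x)\<^sup>*" using Suc that by (auto simp: conn_def)
   thus ?thesis by (rule rtrancl_mono[THEN subsetD, rotated]) (use sub in auto)
  qed
  show ?thesis
  proof (cases "v \<in> ball n x")
   case False
   then obtain y where "y \<in> ball n x" "adj y v" using v by (auto simp: ball_Suc)
   hence "(y, v) \<in> Arel \<inter> ?B \<times> ?B" using v sub by auto
   with in_n[OF \<open>y \<in> ball n x\<close>] show ?thesis by (rule rtrancl_into_rtrancl)
  qed (use in_n in auto)
 qed
 have "sym ((Arel \<inter> ?B \<times> ?B)\<^sup>*)" by (rule sym_rtrancl[OF sym_Arel_on])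
 thus ?case unfolding conn_def using * by (meson rtrancl_trans symD)
qed auto

lemma conn_exit:
 assumes "side x K" "conn B" "u \<in> B" "u \<in> K" "v \<in> B" "v \<notin> K"
 shows "x \<in> B"
proof (rule ccontr)
 assume "x \<notin> B"
 have "(u, v) \<in> (Arel \<inter> B \<times> B)\<^sup>*" using assms by (auto simp: conn_def)
 hence "v \<in> K"
  by (rule rtrancl_closed[OF _ assms(4)]) (use assms(1) \<open>x \<notin> B\<close> in "auto simp: side_def")
 thus False using assms by simp
qed

lemma comp_self [simp]: "v \<in> comp x v" by (auto simp: comp_def)

lemma side_comp:
 assumes "v \<noteq> x"
 shows "side x (comp x v)"
proof -
 let ?r = "Arel \<inter> (- {x}) \<times> (- {x})"
 have nx: "w \<noteq> x" if "w \<in> comp x v" for w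
 proof -
  have "(v, w) \<in> ?r\<^sup>*" using that by (simp add: comp_def)
  hence "w \<in> - {x}" by (rule rtrancl_closed) (use assms in auto)
  thus ?thesis by simp
 qed
 have closed: "w' \<in> comp x v" if "w \<in> comp x v" "adj w w'" "w' \<noteq> x" for w w'
 proof -
  have "(v, w) \<in> ?r\<^sup>*" using that(1) by (simp add: comp_def)
  moreover have "(w, w') \<in> ?r" using that nx by auto
  ultimately have "(v, w') \<in> ?r\<^sup>*" by (rule rtrancl_into_rtrancl)
  thus ?thesis by (simp add: comp_def)
 qed
 have vw: "(v, w) \<in> (Arel \<inter> comp x v \<times> comp x v)\<^sup>*" if "w \<in> comp x v" for w
 proof -
  have "(v, w) \<in> ?r\<^sup>*" using that by (simp add: comp_def)
  thus ?thesis
  proof (induction rule: rtrancl_induct)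
   case (step y z)
   have "y \<in> comp x v" using step(1) by (simp add: comp_def)
   moreover have "z \<in> comp x v"
    using rtrancl_into_rtrancl[OF step(1,2)] by (simp add: comp_def)
   ultimately have "(y, z) \<in> Arel \<inter> comp x v \<times> comp x v" using step by auto
   with step.IH show ?case by (rule rtrancl_into_rtrancl)
  qed auto
 qed
 have "conn (comp x v)" unfolding conn_def
  using vw sym_rtrancl[OF sym_Arel_on[of "comp x v"]] by (meson rtrancl_trans symD)
 moreover have "x \<notin> comp x v" using nx by blast
 moreover have "comp x v \<noteq> {}" by (metis comp_self empty_iff)
 ultimately show ?thesis unfolding side_def using closed by blast
qed

lemma side_eq_comp:
 assumes "side x K" "v \<in> K"
 shows "K = comp x v"
proof
 show "K \<subseteq> comp x v"
 proof
  fix w assume "w \<in> K"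
  hence "(v, w) \<in> (Arel \<inter> K \<times> K)\<^sup>*" using assms by (auto simp: side_def conn_def)
  hence "(v, w) \<in> (Arel \<inter> (- {x}) \<times> (- {x}))\<^sup>*"
   by (rule rtrancl_mono[THEN subsetD, rotated]) (use assms in "auto simp: side_def")
  thus "w \<in> comp x v" by (simp add: comp_def)
 qed
 show "comp x v \<subseteq> K"
 proof
  fix w assume "w \<in> comp x v"
  hence "(v, w) \<in> (Arel \<inter> (- {x}) \<times> (- {x}))\<^sup>*" by (simp add: comp_def)
  thus "w \<in> K"
   by (rule rtrancl_closed[OF _ assms(2)]) (use assms(1) in "auto simp: side_def")
 qed
qed

lemma side_disjoint_eq:
 assumes "side x K" "side x K'" "v \<in> K" "v \<in> K'"
 shows "K = K'"
 using side_eq_comp assms by metis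

lemma side_out_closed:
 assumes "side x K" "v \<notin> K" "v \<noteq> x" "adj v w"
 shows "w \<notin> K"
 using assms adj_sym unfolding side_def by blast

text \<open>A walk that starts outside \<open>K\<close> can enter \<open>K\<close> only from
  \<open>x\<close>, so its portion up to the first visit to \<open>x\<close> stays outside.\<close>

lemma conn_compl:
 assumes "side x K"
 shows "conn (- K)"
proof -
 let ?r = "Arel \<inter> (- K) \<times> (- K)"
 have *: "(a, x) \<in> ?r\<^sup>*" if "a \<notin> K" for a
 proof -
  have "(a, x) \<in> Arel\<^sup>*" by (rule conn_graph)
  thus ?thesis using that
  proof (induction rule: converse_rtrancl_induct)
   case (step a a')
   show ?case
   proof (cases "a' \<in> K")
    case True
    hence "a = x" using step assms adj_sym unfolding side_def by blast
    thus ?thesis by simp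
   next
    case False
    hence "(a, a') \<in> ?r" using step by auto
    thus ?thesis using step.IH[OF False] by (rule converse_rtrancl_into_rtrancl)
   qed
  qed auto
 qed
 show ?thesis unfolding conn_def
  using * sym_rtrancl[OF sym_Arel_on[of "- K"]] by (meson ComplD rtrancl_trans symD)
qed

section \<open>Regions in which a given edge can be made the bridge\<close>

lemma linkI:
 assumes "A1 \<subseteq> R" "A2 \<subseteq> R" "A1 \<inter> A2 = {}" "conn A1" "conn A2"
   "e = {c, d}" "adj c d" "y1 \<in> A1" "c \<in> A1" "y2 \<in> A2" "d \<in> A2"
 shows "link R e y1 y2"
 unfolding link_def
 by (rule exI[of _ A1], rule exI[of _ A2], rule exI[of _ c], rule exI[of _ d]) (intro conjI assms)

lemma linkE:
 assumes "link R e y1 y2"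
 obtains A1 A2 c d where "A1 \<subseteq> R" "A2 \<subseteq> R" "A1 \<inter> A2 = {}" "conn A1" "conn A2"
   "e = {c, d}" "adj c d" "y1 \<in> A1" "c \<in> A1" "y2 \<in> A2" "d \<in> A2"
 using assms unfolding link_def by (elim exE conjE) (rule that)

lemma link_mono:
 assumes "link R e y1 y2" "R \<subseteq> R'"
 shows "link R' e y1 y2"
 using assms(1)
proof (rule linkE)
 fix A1 A2 c d
 assume "A1 \<subseteq> R" "A2 \<subseteq> R" and *: "A1 \<inter> A2 = {}" "conn A1" "conn A2"
   "e = {c, d}" "adj c d" "y1 \<in> A1" "c \<in> A1" "y2 \<in> A2" "d \<in> A2"
 hence "A1 \<subseteq> R'" "A2 \<subseteq> R'" using assms(2) by (meson order_trans)+
 thus "link R' e y1 y2" using * by (rule linkI)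
qed

lemma link_sym:
 assumes "link R e y1 y2"
 shows "link R e y2 y1"
 using assms
proof (rule linkE)
 fix A1 A2 c d
 assume *: "A1 \<subseteq> R" "A2 \<subseteq> R" "A1 \<inter> A2 = {}" "conn A1" "conn A2"
   "e = {c, d}" "adj c d" "y1 \<in> A1" "c \<in> A1" "y2 \<in> A2" "d \<in> A2"
 have "A2 \<inter> A1 = {}" "e = {d, c}" "adj d c"
  using *(3,6) adj_sym[OF *(7)] by (simp_all add: Int_commute insert_commute)
 thus "link R e y2 y1" by (intro linkI[of A2 R A1 e d c] *)
qed

lemma link_extend2:
 assumes "link R e y1 y2" "conn L" "L \<inter> R = {}" "z \<in> L" "adj y2 z" "w \<in> L"
 shows "link (R \<union> L) e y1 w"
 using assms(1)
proof (rule linkE)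
 fix A1 A2 c d
 assume *: "A1 \<subseteq> R" "A2 \<subseteq> R" "A1 \<inter> A2 = {}" "conn A1" "conn A2"
   "e = {c, d}" "adj c d" "y1 \<in> A1" "c \<in> A1" "y2 \<in> A2" "d \<in> A2"
 have "conn (A2 \<union> L)" by (rule conn_step[OF *(5) assms(2) *(10) assms(4)]) (use assms(5) in simp)
 moreover have "A1 \<subseteq> R \<union> L" "A2 \<union> L \<subseteq> R \<union> L" "A1 \<inter> (A2 \<union> L) = {}" "w \<in> A2 \<union> L" "d \<in> A2 \<union> L"
  using * assms by blast+
 ultimately show ?thesis by (intro linkI[of A1 _ "A2 \<union> L" e c d] *)
qed

lemma link_extend1:
 assumes "link R e y1 y2" "conn L" "L \<inter> R = {}" "z \<in> L" "adj y1 z" "w \<in> L"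
 shows "link (R \<union> L) e w y2"
 by (rule link_sym, rule link_extend2[OF link_sym[OF assms(1)] assms(2-6)])

lemma link_extend12:
 assumes "link R e y1 y2" "conn L1" "L1 \<inter> R = {}" "z1 \<in> L1" "adj y1 z1" "w1 \<in> L1"
  "conn L2" "L2 \<inter> R = {}" "L1 \<inter> L2 = {}" "z2 \<in> L2" "adj y2 z2" "w2 \<in> L2"
 shows "link (R \<union> L1 \<union> L2) e w1 w2"
proof -
 have "link (R \<union> L1) e w1 y2" by (rule link_extend1) (use assms in auto)
 thus ?thesis by (rule link_extend2) (use assms in auto)
qed

lemma linkedD:
 assumes "linked R e"
 shows "finite R" "e \<subseteq> R" "e \<in> EG" "y1 \<in> R \<Longrightarrow> y2 \<in> R \<Longrightarrow> y1 \<noteq> y2 \<Longrightarrow> link R e y1 y2"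
 using assms unfolding linked_def by simp_all

text \<open>An ear with distinct ends preserves the property. A vertex of the ear is attached to an
  end different from \<open>y1\<close>; two vertices of the ear are separated by cutting it between
  them and using both ends.\<close>

lemma linked_ear:
 assumes R: "linked R e" and ls: "ls \<noteq> []" "distinct ls" "successively adj ls" "set ls \<inter> R = {}"
  and ends: "v \<in> R" "y \<in> R" "v \<noteq> y" "adj v (hd ls)" "adj (last ls) y"
 shows "linked (R \<union> set ls) e"
proof -
 have RR: "link R e y1 y2" if "y1 \<in> R" "y2 \<in> R" "y1 \<noteq> y2" for y1 y2
  using R that by (auto simp: linked_def)
 have RL: "link (R \<union> set ls) e y1 w" if "y1 \<in> R" "w \<in> set ls" for y1 w
 proof (cases "y1 = v")
  case False
  show ?thesis using link_extend2[OF RR[OF that(1) ends(1) False] conn_successively[OF ls(3)] ls(4), of "hd ls" w]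
   ends ls that by auto
 next
  case True
  hence "y1 \<noteq> y" using ends by simp
  show ?thesis using link_extend2[OF RR[OF that(1) ends(2) \<open>y1 \<noteq> y\<close>] conn_successively[OF ls(3)] ls(4), of "last ls" w]
   ends ls that by (auto simp: adj_commute)
 qed
 \<comment> \<open>The ear is split between \<open>w1\<close> and \<open>w2\<close>: the front piece
   leaves through \<open>v\<close>, the rear piece through \<open>y\<close>.\<close>
 have LL: "link (R \<union> set ls) e w1 w2" if w: "ls = as @ bs" "w1 \<in> set as" "w2 \<in> set bs" for as bs w1 w2
 proof -
  have nn: "as \<noteq> []" "bs \<noteq> []" using w by auto
  have s: "successively adj as" "successively adj bs" using ls w by (auto simp: successively_append_iff)
  have "link (R \<union> set as \<union> set bs) e w1 w2"
   by (rule link_extend12[OF RR[OF ends(1,2,3)] conn_successively[OF s(1)] _ _ _ w(2)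
      conn_successively[OF s(2)] _ _ _ _ w(3), of "hd as" "last bs"])
    (use nn w ls ends in "auto simp: adj_commute")
  thus ?thesis using w by (simp add: Un_assoc)
 qed
 have LL': "link (R \<union> set ls) e w1 w2" if w: "w1 \<in> set ls" "w2 \<in> set ls" "w1 \<noteq> w2" for w1 w2
 proof -
  obtain as bs where ab: "ls = as @ w1 # bs" using w(1) by (meson split_list)
  then consider "w2 \<in> set as" | "w2 \<in> set bs" using w by auto
  thus ?thesis
  proof cases
   case 1
   hence "link (R \<union> set ls) e w2 w1" by (intro LL[OF ab]) auto
   thus ?thesis by (rule link_sym)
  next
   case 2
   thus ?thesis using ab by (intro LL[of "as @ [w1]" bs]) auto
  qed
 qed
 show ?thesis unfolding linked_def
 proof (intro conjI ballI impI)
  fix y1 y2 assume *: "y1 \<in> R \<union> set ls" "y2 \<in> R \<union> set ls" "y1 \<noteq> y2"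
  then consider "y1 \<in> R" "y2 \<in> R" | "y1 \<in> R" "y2 \<in> set ls" | "y1 \<in> set ls" "y2 \<in> R" | "y1 \<in> set ls" "y2 \<in> set ls"
   by auto
  thus "link (R \<union> set ls) e y1 y2"
  proof cases
   case 1
   thus ?thesis using RR *(3) by (meson Un_upper1 link_mono)
  next
   case 2 thus ?thesis by (rule RL)
  next
   case 3 thus ?thesis using RL link_sym by blast
  next
   case 4 thus ?thesis using LL' * by blast
  qed
 qed (use R in "auto simp: linked_def")
qed

text \<open>A cycle through \<open>e\<close> opened at \<open>e\<close>: the list runs along the
  rest of the cycle and \<open>e\<close> closes it up.\<close>

definition cyc_path :: "'v set \<Rightarrow> 'v list \<Rightarrow> bool" where
 "cyc_path e ws \<longleftrightarrow> length ws \<ge> 3 \<and> distinct ws \<and> successively adj ws \<and> adj (hd ws) (last ws) \<and> e = {hd ws, last ws}"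

lemma cyc_path_exists:
 assumes "edge_on_cycle adj e"
 shows "\<exists>ws. cyc_path e ws"
proof -
 obtain vs i where vs: "length vs \<ge> 3" "distinct vs" "\<And>i. i < length vs \<Longrightarrow> adj (vs ! i) (vs ! ((i + 1) mod length vs))"
  "i < length vs" "e = {vs ! i, vs ! ((i + 1) mod length vs)}"
  using assms unfolding edge_on_cycle_def by blast
 \<comment> \<open>Rotating by i + 1 makes the edge at position i the one from the last vertex back
   to the head.\<close>
 let ?n = "length vs" and ?ws = "rotate (i + 1) vs"
 have nth: "?ws ! k = vs ! ((i + 1 + k) mod ?n)" if "k < ?n" for k
  using that by (rule nth_rotate)
 have ne: "?ws \<noteq> []" "vs \<noteq> []" using vs by auto
 have h: "hd ?ws = vs ! ((i + 1) mod ?n)" using nth[of 0] ne by (simp add: hd_conv_nth)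
 have "last ?ws = ?ws ! (?n - 1)" using ne by (simp add: last_conv_nth)
 also have "\<dots> = vs ! ((i + 1 + (?n - 1)) mod ?n)" using vs by (intro nth) auto
 also have "i + 1 + (?n - 1) = i + ?n" using vs(1) by simp
 also have "(i + ?n) mod ?n = i" using vs(4) by simp
 finally have l: "last ?ws = vs ! i" .
 have s: "successively adj ?ws"
  unfolding successively_conv_nth
 proof (intro allI impI)
  fix k assume k: "Suc k < length ?ws"
  have "adj (vs ! ((i + 1 + k) mod ?n)) (vs ! (((i + 1 + k) mod ?n + 1) mod ?n))"
   by (intro vs(3) mod_less_divisor) (use vs(4) in linarith)
  moreover have "((i + 1 + k) mod ?n + 1) mod ?n = (i + 1 + Suc k) mod ?n"
   by (simp add: mod_simps)
  ultimately show "adj (?ws ! k) (?ws ! Suc k)" using nth[of k] nth[of "Suc k"] k by simp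
 qed
 have "adj (hd ?ws) (last ?ws)" using vs(3)[OF vs(4)] h l by (simp add: adj_commute)
 thus ?thesis using vs s h l unfolding cyc_path_def by (intro exI[of _ ?ws]) auto
qed

text \<open>The initial region for the ears: cutting the list anywhere leaves a prefix and a suffix,
  and \<open>e\<close> joins the head of the first to the last vertex of the second.\<close>

lemma linked_cyc:
 assumes "cyc_path e ws"
 shows "linked (set ws) e"
proof -
 have ws: "length ws \<ge> 3" "distinct ws" "successively adj ws" "adj (hd ws) (last ws)" "e = {hd ws, last ws}" "ws \<noteq> []"
  using assms by (auto simp: cyc_path_def)
 have *: "link (set ws) e w1 w2" if w: "ws = as @ bs" "w1 \<in> set as" "w2 \<in> set bs" for as bs w1 w2
 proof -
  have nn: "as \<noteq> []" "bs \<noteq> []" using w by auto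
  have s: "conn (set as)" "conn (set bs)" using ws w by (auto simp: successively_append_iff intro: conn_successively)
  show ?thesis
   by (rule linkI[of "set as" _ "set bs" e "hd ws" "last ws"]) (use s ws w nn in auto)
 qed
 have "link (set ws) e w1 w2" if w: "w1 \<in> set ws" "w2 \<in> set ws" "w1 \<noteq> w2" for w1 w2
 proof -
  obtain as bs where ab: "ws = as @ w1 # bs" using w(1) by (meson split_list)
  then consider "w2 \<in> set as" | "w2 \<in> set bs" using w by auto
  thus ?thesis
  proof cases
   case 1
   hence "link (set ws) e w2 w1" by (intro *[OF ab]) auto
   thus ?thesis by (rule link_sym)
  next
   case 2
   thus ?thesis using ab by (intro *[of "as @ [w1]" bs]) auto
  qed
 qed
 thus ?thesis using ws unfolding linked_def edges_def by auto
qed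

text \<open>In a link from \<open>y\<close> to \<open>x\<close> the arm of \<open>y\<close> avoids
  \<open>x\<close> and contains an endpoint of \<open>e\<close> lying in \<open>K\<close>; a
  connected set that avoids \<open>x\<close> cannot leave \<open>K\<close>.\<close>

lemma linked_minus_sub:
 assumes "linked R e" "x \<in> R" "side x K" "e \<inter> K \<noteq> {}"
 shows "R - {x} \<subseteq> K"
proof
 fix y assume y: "y \<in> R - {x}"
 hence "link R e y x" using assms by (auto simp: linked_def)
 then obtain A1 A2 c d where *: "A1 \<inter> A2 = {}" "conn A1" "e = {c, d}" "adj c d" "y \<in> A1" "c \<in> A1" "x \<in> A2" "d \<in> A2"
  by (elim linkE)
 have "x \<notin> A1" using * by auto
 have "c \<noteq> x" using * by auto
 have "c \<in> K"
 proof (cases "d \<in> K")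
  case True
  thus ?thesis using * assms(3) \<open>c \<noteq> x\<close> adj_sym unfolding side_def by blast
 next
  case False
  thus ?thesis using * assms(4) by auto
 qed
 thus "y \<in> K" using conn_exit[OF assms(3) *(2,6) _ *(5)] \<open>x \<notin> A1\<close> by blast
qed

text \<open>Suppose \<open>b\<close> is in the component of \<open>e\<close> after deleting
  \<open>a\<close>. A path from \<open>b\<close> back to the region inside this component ends at a
  vertex other than \<open>a\<close>, so with the edge from \<open>a\<close> it forms an ear.
  Otherwise \<open>a\<close> itself separates \<open>b\<close> from \<open>e\<close>.\<close>

lemma block_step:
 assumes R: "linked R e" and a: "a \<in> R" "adj a b"
 shows "(\<exists>R'. linked R' e \<and> R \<subseteq> R' \<and> b \<in> R') \<or> (\<exists>K. side a K \<and> e \<inter> K \<noteq> {} \<and> b \<notin> K)"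
proof (cases "b \<in> R")
 case True
 thus ?thesis using R by blast
next
 case False
 obtain y0 where y0: "y0 \<in> e" "y0 \<noteq> a" "y0 \<in> R"
 proof -
  obtain c d where "e = {c, d}" "c \<noteq> d" "e \<subseteq> R" using R edgesE unfolding linked_def by metis
  thus ?thesis using that by (metis insertCI subset_eq)
 qed
 have s: "side a (comp a y0)" by (rule side_comp) (use y0 in auto)
 have eK: "e \<inter> comp a y0 \<noteq> {}" using y0 comp_self[of y0 a] by blast
 show ?thesis
 proof (cases "b \<in> comp a y0")
  case False
  thus ?thesis using s eK by blast
 next
  case True
  let ?r = "Arel \<inter> comp a y0 \<times> comp a y0"
  have "(b, y0) \<in> ?r\<^sup>*" using s True comp_self by (auto simp: side_def conn_def)
  hence "b \<in> R \<or> (\<exists>u y. (b, u) \<in> (?r \<inter> (- R) \<times> (- R))\<^sup>* \<and> u \<notin> R \<and> (u, y) \<in> ?r \<and> y \<in> R \<and> (y, y0) \<in> ?r\<^sup>*)"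
   by (rule first_hit) (use y0 in auto)
  then obtain u y where uy: "(b, u) \<in> (?r \<inter> (- R) \<times> (- R))\<^sup>*" "u \<notin> R" "(u, y) \<in> ?r" "y \<in> R"
   using False by blast
  obtain ls where ls: "ls \<noteq> []" "distinct ls" "successively (\<lambda>a b. (a, b) \<in> ?r \<inter> (- R) \<times> (- R)) ls" "hd ls = b" "last ls = u"
   using rtrancl_distinct_path[OF uy(1)] by blast
  have sl: "successively adj ls" by (rule successively_mono[OF ls(3)]) auto
  have "set ls \<inter> R = {}"
  proof (cases ls)
   case (Cons b' ls')
   have "w \<notin> R" if "w \<in> set ls" for w
    using ls(1,3,4) that False
   proof (induction ls arbitrary: b rule: induct_list012)
    case (3 x y zs)
    thus ?case by auto
   qed auto
   thus ?thesis by blast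
  qed (use ls in auto)
  moreover have "y \<noteq> a" using uy s by (auto simp: side_def)
  ultimately have "linked (R \<union> set ls) e"
   using R ls sl a uy by (intro linked_ear[of R e ls a y]) auto
  moreover have "b \<in> set ls" using ls by (metis hd_in_set)
  ultimately show ?thesis by blast
 qed
qed

text \<open>The region grows along a walk to \<open>v\<close> until a cut vertex \<open>x\<close>
  blocks it. A walk strictly beyond \<open>x\<close> cannot step into \<open>K\<close>; if it
  returns to \<open>x\<close>, it is back in the region and growth resumes. This is why the second
  alternative records that \<open>v\<close> differs from \<open>x\<close>.\<close>

lemma vertex_dichotomy:
 assumes "linked R0 e"
 shows "(\<exists>R. linked R e \<and> v \<in> R) \<or> (\<exists>x R K. linked R e \<and> x \<in> R \<and> side x K \<and> e \<inter> K \<noteq> {} \<and> v \<notin> K \<and> v \<noteq> x)"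
proof -
 obtain c where c: "c \<in> R0" using assms edgesE unfolding linked_def by (metis insertCI subset_eq)
 have "(c, v) \<in> Arel\<^sup>*" by (rule conn_graph)
 thus ?thesis
 proof (induction rule: rtrancl_induct)
  case base
  thus ?case using c assms by blast
 next
  case (step v' v)
  hence adj: "adj v' v" by simp
  from step.IH show ?case
  proof
   assume "\<exists>R. linked R e \<and> v' \<in> R"
   then obtain R where R: "linked R e" "v' \<in> R" by blast
   from block_step[OF R adj] show ?thesis
   proof
    assume "\<exists>K. side v' K \<and> e \<inter> K \<noteq> {} \<and> v \<notin> K"
    thus ?thesis using R adj adj_irrefl by metis
   qed blast
  next
   assume "\<exists>x R K. linked R e \<and> x \<in> R \<and> side x K \<and> e \<inter> K \<noteq> {} \<and> v' \<notin> K \<and> v' \<noteq> x"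
   then obtain x R K where *: "linked R e" "x \<in> R" "side x K" "e \<inter> K \<noteq> {}" "v' \<notin> K" "v' \<noteq> x" by blast
   have "v \<notin> K" using side_out_closed[OF *(3,5,6) adj] .
   thus ?thesis using * by (cases "v = x") blast+
  qed
 qed
qed

lemma edge_dichotomy:
 assumes "linked R0 e" "f \<in> EG"
 shows "(\<exists>R. linked R e \<and> f \<subseteq> R) \<or> (\<exists>x R K. linked R e \<and> x \<in> R \<and> side x K \<and> e \<inter> K \<noteq> {} \<and> f \<inter> K = {})"
proof -
 obtain a b where f: "f = {a, b}" "adj a b" using assms(2) edgesE by metis
 from vertex_dichotomy[OF assms(1), of a] show ?thesis
 proof
  assume "\<exists>R. linked R e \<and> a \<in> R"
  then obtain R where R: "linked R e" "a \<in> R" by blast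
  from block_step[OF this f(2)] show ?thesis
  proof
   assume "\<exists>R'. linked R' e \<and> R \<subseteq> R' \<and> b \<in> R'"
   thus ?thesis using f R by (metis empty_subsetI insert_subset subset_eq)
  next
   assume "\<exists>K. side a K \<and> e \<inter> K \<noteq> {} \<and> b \<notin> K"
   then obtain K where "side a K" "e \<inter> K \<noteq> {}" "b \<notin> K" by blast
   moreover hence "f \<inter> K = {}" using f by (auto simp: side_def)
   ultimately show ?thesis using R by blast
  qed
 next
  assume "\<exists>x R K. linked R e \<and> x \<in> R \<and> side x K \<and> e \<inter> K \<noteq> {} \<and> a \<notin> K \<and> a \<noteq> x"
  then obtain x R K where *: "linked R e" "x \<in> R" "side x K" "e \<inter> K \<noteq> {}" "a \<notin> K" "a \<noteq> x" by blast
  have "b \<notin> K" using side_out_closed[OF *(3,5,6) f(2)] .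
  hence "f \<inter> K = {}" using f * by auto
  thus ?thesis using * by blast
 qed
qed

lemma beta_outside:
 assumes "side x K" "f \<in> EG" "f \<inter> K = {}"
 shows "\<exists>R. finite R \<and> conn R \<and> x \<in> R \<and> f \<subseteq> R \<and> R \<inter> K = {}"
proof -
 obtain a b where f: "f = {a, b}" "adj a b" using assms(2) edgesE by metis
 have "a \<in> - K" "x \<in> - K" "b \<notin> K" using f assms by (auto simp: side_def)
 then obtain L where L: "L \<subseteq> - K" "finite L" "conn L" "a \<in> L" "x \<in> L"
  using conn_finite_sub[OF conn_compl[OF assms(1)]] by blast
 show ?thesis
  by (rule exI[of _ "insert b L"]) (use L f \<open>b \<notin> K\<close> in "auto intro: conn_insert")
qed

text \<open>All neighbours of \<open>x\<close> in \<open>K\<close> are included so that a path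
  inside \<open>K\<close> meets \<open>R2\<close> before it reaches \<open>x\<close>. Each of them
  is joined back to \<open>R\<close> inside \<open>K\<close>, which prolongs the arm away from
  \<open>x\<close> and leaves the arm at \<open>x\<close> unchanged.\<close>

lemma beta_inside:
 assumes R: "linked R e" "x \<in> R" "side x K" "e \<inter> K \<noteq> {}"
 shows "\<exists>R2. finite R2 \<and> R2 \<subseteq> insert x K \<and> x \<in> R2 \<and> e \<subseteq> R2 \<and> (\<forall>w\<in>K. adj x w \<longrightarrow> w \<in> R2) \<and>
   (\<forall>y\<in>R2 - {x}. link R2 e x y)"
proof -
 have RK: "R - {x} \<subseteq> K" by (rule linked_minus_sub[OF R])
 have each: "\<exists>L. finite L \<and> L \<subseteq> K \<and> w \<in> R \<union> L \<and> (\<forall>y\<in>L. link (R \<union> L) e x y)" if w: "w \<in> K" for w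
 proof (cases "w \<in> R")
  case True
  thus ?thesis by (intro exI[of _ "{}"]) auto
 next
  case False
  obtain y0 where y0: "y0 \<in> e" "y0 \<in> K" using R(4) by blast
  moreover have "e \<subseteq> R" by (rule linkedD[OF R(1)])
  ultimately have "y0 \<in> R" by blast
  note y0 = y0 this
  let ?r = "Arel \<inter> K \<times> K"
  have "(w, y0) \<in> ?r\<^sup>*" using R(3) y0(2) w unfolding side_def conn_def by blast
  hence "w \<in> R \<or> (\<exists>u y. (w, u) \<in> (?r \<inter> (- R) \<times> (- R))\<^sup>* \<and> u \<notin> R \<and> (u, y) \<in> ?r \<and> y \<in> R \<and> (y, y0) \<in> ?r\<^sup>*)"
   by (rule first_hit) (use y0 in auto)
  then obtain u y where uy: "(w, u) \<in> (?r \<inter> (- R) \<times> (- R))\<^sup>*" "u \<notin> R" "(u, y) \<in> ?r" "y \<in> R"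
   using False by blast
  \<comment> \<open>The component of \<open>w\<close> in \<open>K - R\<close> may be infinite; only
    a finite connected piece joining \<open>w\<close> to \<open>u\<close> is kept.\<close>
  define L0 where "L0 = {z. (w, z) \<in> (?r \<inter> (- R) \<times> (- R))\<^sup>*}"
  have L0K: "L0 \<subseteq> K - R"
  proof
   fix z assume "z \<in> L0"
   hence "(w, z) \<in> (?r \<inter> (- R) \<times> (- R))\<^sup>*" by (simp add: L0_def)
   thus "z \<in> K - R" by (rule rtrancl_closed) (use w False in auto)
  qed
  have wz: "(w, z) \<in> (Arel \<inter> L0 \<times> L0)\<^sup>*" if "z \<in> L0" for z
  proof -
   have "(w, z) \<in> (?r \<inter> (- R) \<times> (- R))\<^sup>*" using that by (simp add: L0_def)
   thus ?thesis
   proof (induction rule: rtrancl_induct)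
    case (step y z)
    have "y \<in> L0" using step(1) by (simp add: L0_def)
    moreover have "z \<in> L0" using rtrancl_into_rtrancl[OF step(1,2)] by (simp add: L0_def)
    ultimately have "(y, z) \<in> Arel \<inter> L0 \<times> L0" using step by auto
    with step.IH show ?case by (rule rtrancl_into_rtrancl)
   qed auto
  qed
  have "conn L0" unfolding conn_def
   using wz sym_rtrancl[OF sym_Arel_on[of L0]] by (meson rtrancl_trans symD)
  moreover have "w \<in> L0" "u \<in> L0" using uy by (auto simp: L0_def)
  ultimately obtain L where L: "L \<subseteq> L0" "finite L" "conn L" "w \<in> L" "u \<in> L"
   using conn_finite_sub by blast
  have "x \<noteq> y" using uy(3) R(3) unfolding side_def by blast
  hence "link R e x y" by (rule linkedD(4)[OF R(1,2) uy(4)])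
  have LR: "L \<inter> R = {}" "L \<subseteq> K" using L(1) L0K by auto
  have "adj y u" using uy(3) by (simp add: adj_commute[of y u])
  have "link (R \<union> L) e x z" if "z \<in> L" for z
   by (rule link_extend2[OF \<open>link R e x y\<close> L(3) LR(1) L(5) \<open>adj y u\<close> that])
  thus ?thesis using L(2,4) LR(2) by blast
 qed
 note each = this
 define Q where "Q w L \<longleftrightarrow> finite L \<and> L \<subseteq> K \<and> w \<in> R \<union> L \<and> (\<forall>y\<in>L. link (R \<union> L) e x y)" for w L
 define L where "L w = (SOME L. Q w L)" for w
 have LQ: "Q w (L w)" if "w \<in> K" for w
  unfolding L_def by (rule someI_ex) (use each[OF that] in "simp add: Q_def")
 note L = LQ[unfolded Q_def]
 let ?N = "{w\<in>K. adj x w}"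
 let ?R2 = "R \<union> (\<Union>w\<in>?N. L w)"
 have fN: "finite ?N" by (rule finite_subset[OF _ lf[of x]]) blast
 have "link ?R2 e x y" if y: "y \<in> ?R2 - {x}" for y
 proof (cases "y \<in> R")
  case True
  hence "link R e x y" using y by (intro linkedD(4)[OF R(1,2)]) auto
  thus ?thesis by (rule link_mono) auto
 next
  case False
  then obtain w where w: "w \<in> ?N" "y \<in> L w" using y by auto
  hence "link (R \<union> L w) e x y" using L[of w] by simp
  thus ?thesis by (rule link_mono) (use w in auto)
 qed
 hence "\<forall>y\<in>?R2 - {x}. link ?R2 e x y" by (rule ballI)
 moreover have "finite ?R2"
  using fN L linkedD(1)[OF R(1)] by simp
 moreover have "?R2 \<subseteq> insert x K"
 proof -
  have "L w \<subseteq> K" if "w \<in> ?N" for w using L[of w] that by simp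
  thus ?thesis using RK by blast
 qed
 moreover have "w \<in> ?R2" if "w \<in> K" "adj x w" for w
 proof (cases "w \<in> R")
  case False
  hence "w \<in> L w" using L[OF that(1)] by simp
  thus ?thesis using that by auto
 qed simp
 hence "\<forall>w\<in>K. adj x w \<longrightarrow> w \<in> ?R2" by blast
 moreover have "x \<in> ?R2" using R(2) by simp
 moreover have "e \<subseteq> ?R2" using linkedD(2)[OF R(1)] by blast
 ultimately show ?thesis by (intro exI[of _ ?R2] conjI)
qed

text \<open>From a vertex of a finite \<open>K\<close> both halves of the path would have to leave,
  hence pass through \<open>x\<close>, and an injective path visits \<open>x\<close> only
  once.\<close>

lemma biinf_side_infinite:
 assumes "edge_on_biinfinite_path adj e" "side x K" "e \<inter> K \<noteq> {}"
 shows "infinite K"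
proof
 assume fin: "finite K"
 obtain g :: "int \<Rightarrow> 'v" and i where g: "inj g" "\<And>i. adj (g i) (g (i + 1))" "e = {g i, g (i + 1)}"
  using assms(1) unfolding edge_on_biinfinite_path_def by blast
 obtain j where j: "g j \<in> K" using g assms(3) by auto
 have up: "\<exists>k>j. g k = x"
 proof (rule ccontr)
  assume no: "\<not> (\<exists>k>j. g k = x)"
  have "g (j + int n) \<in> K" for n
  proof (induction n)
   case (Suc n)
   have "adj (g (j + int n)) (g (j + int n + 1))" by (rule g)
   moreover have "j < j + int n + 1" by simp
   hence "g (j + int n + 1) \<noteq> x" using no by blast
   ultimately have "g (j + int n + 1) \<in> K" using Suc assms(2) by (auto simp: side_def)
   thus ?case by (simp add: add_ac)
  qed (use j in simp)
  hence "range (\<lambda>n. g (j + int n)) \<subseteq> K" by auto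
  moreover have "inj (\<lambda>n. g (j + int n))" by (rule injI, drule injD[OF g(1)], simp)
  ultimately show False using fin by (meson finite_subset range_inj_infinite)
 qed
 have down: "\<exists>k<j. g k = x"
 proof (rule ccontr)
  assume no: "\<not> (\<exists>k<j. g k = x)"
  have "g (j - int n) \<in> K" for n
  proof (induction n)
   case (Suc n)
   have "adj (g (j - int n - 1)) (g (j - int n))" using g(2)[of "j - int n - 1"] by simp
   hence "adj (g (j - int n)) (g (j - int n - 1))" by (rule adj_sym)
   moreover have "j - int n - 1 < j" by simp
   hence "g (j - int n - 1) \<noteq> x" using no by blast
   ultimately have "g (j - int n - 1) \<in> K" using Suc assms(2) by (auto simp: side_def)
   moreover have eq: "j - int (Suc n) = j - int n - 1" by simp
   ultimately show ?case unfolding eq by blast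
  qed (use j in simp)
  hence "range (\<lambda>n. g (j - int n)) \<subseteq> K" by auto
  moreover have "inj (\<lambda>n. g (j - int n))" by (rule injI, drule injD[OF g(1)], simp)
  ultimately show False using fin by (meson finite_subset range_inj_infinite)
 qed
 from up down obtain k k' where "k > j" "k' < j" "g k = g k'" by metis
 thus False using g(1) by (metis injD less_asym)
qed

end

section \<open>Quasi-transitivity\<close>

lemma finite_uniform:
 assumes "finite X" "\<And>x. x \<in> X \<Longrightarrow> \<exists>n. P x n" "\<And>x m n. m \<le> n \<Longrightarrow> P x m \<Longrightarrow> P x (n::nat)"
 shows "\<exists>n. \<forall>x\<in>X. P x n"
 using assms(1,2)
proof (induction X rule: finite_induct)
 case (insert x X)
 then obtain n m where "\<forall>x\<in>X. P x n" "P x m" by blast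
 hence "\<forall>y\<in>insert x X. P y (max n m)"
  using assms(3)[of n "max n m"] assms(3)[of m "max n m"] by auto
 thus ?case ..
qed auto

context lf_graph
begin

abbreviation "Aut \<equiv> graph_automorphisms adj"

lemma aut_bij: "H \<in> Aut \<Longrightarrow> bij H" by (auto simp: graph_automorphisms_def)
lemma aut_inj: "H \<in> Aut \<Longrightarrow> inj H" using aut_bij bij_is_inj by blast
lemma aut_adj: "H \<in> Aut \<Longrightarrow> adj (H x) (H y) \<longleftrightarrow> adj x y" by (auto simp: graph_automorphisms_def)
lemma aut_id: "id \<in> Aut" "(\<lambda>x. x) \<in> Aut"
proof -
 show "id \<in> Aut" by (simp add: graph_automorphisms_def)
 thus "(\<lambda>x. x) \<in> Aut" by (simp add: id_def)
qed
lemma aut_mem [simp]: "H \<in> Aut \<Longrightarrow> H x \<in> H ` A \<longleftrightarrow> x \<in> A" using aut_inj inj_image_mem_iff by metis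
lemma aut_comp: "H \<in> Aut \<Longrightarrow> \<tau> \<in> Aut \<Longrightarrow> H \<circ> \<tau> \<in> Aut"
 by (simp add: graph_automorphisms_def bij_comp)

lemma aut_inv:
 assumes "H \<in> Aut"
 shows "inv H \<in> Aut"
proof -
 have b: "bij H" by (rule aut_bij[OF assms])
 have "adj (inv H x) (inv H y) \<longleftrightarrow> adj x y" for x y
  using aut_adj[OF assms, of "inv H x" "inv H y"] b by (simp add: bij_is_surj surj_f_inv_f)
 thus ?thesis using bij_imp_bij_inv[OF b] by (simp add: graph_automorphisms_def)
qed

lemma aut_inv_f [simp]: "H \<in> Aut \<Longrightarrow> inv H (H x) = x" "H \<in> Aut \<Longrightarrow> H (inv H x) = x"
 using aut_bij by (simp_all add: bij_is_inj bij_is_surj surj_f_inv_f)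

lemma aut_inv_image [simp]: "H \<in> Aut \<Longrightarrow> inv H ` H ` A = A" "H \<in> Aut \<Longrightarrow> H ` inv H ` A = A"
 by (simp_all add: image_image)

lemma ball_aut_sub: "H \<in> Aut \<Longrightarrow> H ` ball n x \<subseteq> ball n (H x)"
proof (induction n)
 case (Suc n)
 hence "H ` ball n x \<subseteq> ball n (H x)" by blast
 thus ?case using aut_adj[OF Suc.prems] by (fastforce simp: ball_Suc)
qed auto

lemma ball_aut:
 assumes "H \<in> Aut"
 shows "H ` ball n x = ball n (H x)"
proof
 have "inv H ` ball n (H x) \<subseteq> ball n x"
  using ball_aut_sub[OF aut_inv[OF assms], of n "H x"] assms by simp
 hence "H ` inv H ` ball n (H x) \<subseteq> H ` ball n x" by (rule image_mono)
 thus "ball n (H x) \<subseteq> H ` ball n x" using assms by simp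
qed (rule ball_aut_sub[OF assms])

lemma conn_aut:
 assumes H: "H \<in> Aut" and "conn A"
 shows "conn (H ` A)"
 unfolding conn_def
proof (intro ballI)
 fix u' v' assume "u' \<in> H ` A" "v' \<in> H ` A"
 then obtain u v where uv: "u' = H u" "v' = H v" "u \<in> A" "v \<in> A" by auto
 hence "(u, v) \<in> (Arel \<inter> A \<times> A)\<^sup>*" using assms by (auto simp: conn_def)
 hence "(H u, H v) \<in> (Arel \<inter> H ` A \<times> H ` A)\<^sup>*"
 proof (induction rule: rtrancl_induct)
  case (step y z)
  hence "(H y, H z) \<in> Arel \<inter> H ` A \<times> H ` A" using aut_adj[OF H] by auto
  with step.IH show ?case by (rule rtrancl_into_rtrancl)
 qed auto
 thus "(u', v') \<in> (Arel \<inter> H ` A \<times> H ` A)\<^sup>*" using uv by simp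
qed

lemma side_aut:
 assumes H: "H \<in> Aut" and "side x K"
 shows "side (H x) (H ` K)"
 unfolding side_def
proof (intro conjI ballI allI impI)
 fix v' w assume v': "v' \<in> H ` K" and "adj v' w"
 then obtain v where v: "v' = H v" "v \<in> K" by auto
 have "adj (H v) (H (inv H w))" using \<open>adj v' w\<close> v H by simp
 hence "adj v (inv H w)" using aut_adj[OF H] by blast
 hence "inv H w \<in> K \<or> inv H w = x" using assms v by (auto simp: side_def)
 thus "w \<in> H ` K \<or> w = H x" 
  using aut_mem[OF H, of "inv H w" K] aut_inv_f(2)[OF H, of w] by auto
qed (use assms conn_aut in "auto simp: side_def")

lemma link_aut:
 assumes H: "H \<in> Aut" and "link R e y1 y2"
 shows "link (H ` R) (H ` e) (H y1) (H y2)"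
 using assms(2)
proof (rule linkE)
 fix A1 A2 c d
 assume *: "A1 \<subseteq> R" "A2 \<subseteq> R" "A1 \<inter> A2 = {}" "conn A1" "conn A2"
   "e = {c, d}" "adj c d" "y1 \<in> A1" "c \<in> A1" "y2 \<in> A2" "d \<in> A2"
 have "H ` A1 \<inter> H ` A2 = {}" using *(3) image_Int[OF aut_inj[OF H], of A1 A2] by simp
 thus ?thesis
  by (intro linkI[of "H ` A1" _ "H ` A2" _ "H c" "H d"]) (use * aut_adj[OF H] conn_aut[OF H] in auto)
qed

lemma edges_aut:
 assumes "H \<in> Aut" "e \<in> EG"
 shows "H ` e \<in> EG"
proof -
 obtain c d where "e = {c, d}" "adj c d" using assms edgesE by metis
 hence "H ` e = {H c, H d}" "adj (H c) (H d)" using aut_adj[OF assms(1)] by auto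
 thus ?thesis unfolding edges_def by blast
qed

lemma linked_aut:
 assumes H: "H \<in> Aut" and R: "linked R e"
 shows "linked (H ` R) (H ` e)"
 unfolding linked_def
proof (intro conjI ballI impI)
 fix y1 y2 assume "y1 \<in> H ` R" "y2 \<in> H ` R" "y1 \<noteq> y2"
 then obtain z1 z2 where "y1 = H z1" "y2 = H z2" "z1 \<in> R" "z2 \<in> R" "z1 \<noteq> z2" by auto
 thus "link (H ` R) (H ` e) y1 y2" using link_aut[OF H] R by (auto simp: linked_def)
qed (use R edges_aut[OF H] in "auto simp: linked_def")

lemma side_adj:
 assumes "side x K"
 shows "\<exists>w\<in>K. adj x w"
proof (rule ccontr)
 assume no: "\<not> (\<exists>w\<in>K. adj x w)"
 obtain v where v: "v \<in> K" using assms by (auto simp: side_def)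
 have "x \<in> K"
  by (rule rtrancl_closed[OF conn_graph v]) (use assms no in "auto simp: side_def adj_commute")
 thus False using assms by (auto simp: side_def)
qed

lemma conn_insert_side: "side x K \<Longrightarrow> conn (insert x K)"
 using side_adj[of x K] by (auto simp: side_def adj_commute intro: conn_insert)

lemma finite_sides: "finite {K. side x K}"
proof -
 have "{K. side x K} \<subseteq> comp x ` {y. adj x y}"
  using side_adj side_eq_comp by blast
 thus ?thesis using lf finite_subset by blast
qed

lemma side_ball_sub:
 assumes "side x K" "w \<in> K" "x \<notin> ball n w"
 shows "ball n w \<subseteq> K"
proof
 fix v assume "v \<in> ball n w"
 thus "v \<in> K" using conn_exit[OF assms(1) conn_ball[of n w], of w v] assms by auto
qed

lemma side_far:
 assumes J: "side x J" "infinite J"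
 shows "\<exists>w\<in>J. w \<in> ball (Suc r) x \<and> w \<notin> ball r x"
proof -
 obtain y where y: "y \<in> J" "y \<notin> ball r x"
  using J(2) finite_ball[of r x] by (meson finite_subset subsetI)
 obtain j where "y \<in> ball j x" using ball_exists by blast
 thus ?thesis using y
 proof (induction j arbitrary: y)
  case 0
  thus ?case by (metis ball_0 ball_self singletonD)
 next
  case (Suc j)
  show ?case
  proof (cases "y \<in> ball j x")
   case True
   thus ?thesis using Suc by blast
  next
   case False
   then obtain y' where y': "y' \<in> ball j x" "adj y' y" using Suc.prems by (auto simp: ball_Suc)
   show ?thesis
   proof (cases "y' \<in> ball r x")
    case True
    hence "y \<in> ball (Suc r) x" using y' by (auto simp: ball_Suc)
    thus ?thesis using Suc by blast
   next
    case False
    hence "y' \<noteq> x" by (metis ball_self)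
    hence "y' \<in> J" using J Suc.prems(2) y'(2) adj_sym by (metis side_def)
    thus ?thesis using Suc.IH y' False by blast
   qed
  qed
 qed
qed

text \<open>The strict inequality is the point: passing from \<open>x\<close> to \<open>x2\<close>
  decreases the distance from \<open>v\<close>, which contradicts the minimal choice made in
  \<open>good_edge\<close>.\<close>

lemma side_separates:
 assumes "side x2 K2" "x \<in> K2" "v \<notin> K2" "x \<in> ball k v"
 shows "\<exists>k'<k. x2 \<in> ball k' v"
 using assms(2,4)
proof (induction k arbitrary: x)
 case 0
 thus ?case using assms by auto
next
 case (Suc k)
 show ?case
 proof (cases "x \<in> ball k v")
  case True
  thus ?thesis using Suc.IH[OF Suc.prems(1)] less_SucI by blast
 next
  case False
  then obtain y where y: "y \<in> ball k v" "adj y x" using Suc.prems by (auto simp: ball_Suc)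
  hence "y \<in> K2 \<or> y = x2" using assms(1) Suc.prems(1) adj_sym by (metis side_def)
  thus ?thesis using Suc.IH y less_SucI by blast
 qed
qed

text \<open>The easy situation: \<open>f\<close> and \<open>e\<close> share a region of bounded
  size, and a pivotal \<open>f\<close> is traded for a pivotal \<open>e\<close> by changes near that
  region.\<close>

definition alpha :: "'v \<Rightarrow> nat \<Rightarrow> 'v set \<Rightarrow> 'v set \<Rightarrow> bool" where
 "alpha v n f e \<longleftrightarrow> (\<exists>R\<subseteq>ball n v. linked R e \<and> f \<subseteq> R)"

text \<open>The cut-vertex situation, with the data for both surgeries: \<open>R1\<close> in front
  of \<open>K\<close> joins \<open>f\<close> to \<open>x\<close>, and \<open>R2\<close> behind
  \<open>x\<close> contains \<open>e\<close> together with a link from \<open>x\<close> to each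
  possible exit vertex.\<close>

definition beta :: "'v \<Rightarrow> nat \<Rightarrow> 'v set \<Rightarrow> 'v set \<Rightarrow> 'v \<Rightarrow> 'v set \<Rightarrow> bool" where
 "beta v n f e x K \<longleftrightarrow> side x K \<and> e \<inter> K \<noteq> {} \<and> f \<inter> K = {} \<and>
   (\<exists>R1\<subseteq>ball n v. conn R1 \<and> x \<in> R1 \<and> f \<subseteq> R1 \<and> R1 \<inter> K = {}) \<and>
   (\<exists>R2\<subseteq>ball n v. R2 \<subseteq> insert x K \<and> x \<in> R2 \<and> e \<subseteq> R2 \<and> (\<forall>w\<in>K. adj x w \<longrightarrow> w \<in> R2) \<and>
    (\<forall>y\<in>R2 - {x}. link R2 e x y))"

text \<open>Here \<open>f\<close> hangs at \<open>x\<close> in a bounded pocket \<open>J\<close>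
  that does not contain \<open>z\<close>. A pivotal \<open>f\<close> then forces an open ghost index
  inside the pocket, and this index pays for one opened at \<open>e\<close>.\<close>

definition dangling :: "'v \<Rightarrow> nat \<Rightarrow> 'v \<Rightarrow> 'v set \<Rightarrow> 'v set \<Rightarrow> bool" where
 "dangling v n z f e \<longleftrightarrow> (\<exists>x J R. side x J \<and> f \<subseteq> insert x J \<and> z \<notin> J \<and> R \<subseteq> ball n v \<and>
   conn R \<and> insert x J \<subseteq> R \<and> e \<subseteq> R)"

lemma alpha_mono: "m \<le> n \<Longrightarrow> alpha v m f e \<Longrightarrow> alpha v n f e"
 unfolding alpha_def using ball_mono by (meson order_trans)

lemma beta_mono: "m \<le> n \<Longrightarrow> beta v m f e x K \<Longrightarrow> beta v n f e x K"
 unfolding beta_def using ball_mono[of m n v] by (meson order_trans)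

lemma alpha_aut:
 assumes "H \<in> Aut" "alpha v n f e"
 shows "alpha (H v) n (H ` f) (H ` e)"
proof -
 obtain R where "R \<subseteq> ball n v" "linked R e" "f \<subseteq> R" using assms by (auto simp: alpha_def)
 thus ?thesis unfolding alpha_def
  using linked_aut[OF assms(1)] ball_aut[OF assms(1), of n v] by (metis image_mono)
qed

lemma beta_aut:
 assumes H: "H \<in> Aut" and "beta v n f e x K"
 shows "beta (H v) n (H ` f) (H ` e) (H x) (H ` K)"
proof -
 obtain R1 R2 where *: "side x K" "e \<inter> K \<noteq> {}" "f \<inter> K = {}"
  "R1 \<subseteq> ball n v" "conn R1" "x \<in> R1" "f \<subseteq> R1" "R1 \<inter> K = {}"
  "R2 \<subseteq> ball n v" "R2 \<subseteq> insert x K" "x \<in> R2" "e \<subseteq> R2" "\<forall>w\<in>K. adj x w \<longrightarrow> w \<in> R2" "\<forall>y\<in>R2 - {x}. link R2 e x y"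
  using assms(2) unfolding beta_def by blast
 have int: "H ` A \<inter> H ` B = H ` (A \<inter> B)" for A B using image_Int[OF aut_inj[OF H]] by blast
 have b: "H ` R \<subseteq> ball n (H v)" if "R \<subseteq> ball n v" for R using ball_aut[OF H, of n v] that by blast
 have R1: "\<exists>R1\<subseteq>ball n (H v). conn R1 \<and> H x \<in> R1 \<and> H ` f \<subseteq> R1 \<and> R1 \<inter> H ` K = {}"
  by (rule exI[of _ "H ` R1"]) (use * b conn_aut[OF H] in "auto simp: int")
 have R2: "\<exists>R2\<subseteq>ball n (H v). R2 \<subseteq> insert (H x) (H ` K) \<and> H x \<in> R2 \<and> H ` e \<subseteq> R2 \<and>
   (\<forall>w\<in>H ` K. adj (H x) w \<longrightarrow> w \<in> R2) \<and> (\<forall>y\<in>R2 - {H x}. link R2 (H ` e) (H x) y)"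
 proof (intro exI[of _ "H ` R2"] conjI ballI impI)
  fix y assume "y \<in> H ` R2 - {H x}"
  then obtain z where "y = H z" "z \<in> R2 - {x}" by auto
  thus "link (H ` R2) (H ` e) (H x) y" using link_aut[OF H] *(14) by blast
 qed (use * b H aut_adj[OF H] in auto)
 show ?thesis unfolding beta_def
  using side_aut[OF H *(1)] * R1 R2 by (simp add: int)
qed

end

section \<open>Uniform constants from finitely many vertex orbits\<close>

locale qt_graph = lf_graph adj for adj :: "'v \<Rightarrow> 'v \<Rightarrow> bool" +
 fixes e0 :: "'v set"
 assumes qt: "quasi_transitive adj"
  and e0_edge: "e0 \<in> edges adj"
  and e0_cyc: "edge_on_cycle adj e0"
  and e0_biinf: "edge_on_biinfinite_path adj e0"
begin

lemma orbit_reps: "\<exists>V0. finite V0 \<and> (\<forall>v. \<exists>H\<in>Aut. \<exists>v0\<in>V0. H v0 = v)"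
proof -
 let ?O = "\<lambda>x. (\<lambda>H. H x) ` Aut"
 define V0 where "V0 = (\<lambda>X. SOME x. ?O x = X) ` range ?O"
 have "finite V0" unfolding V0_def using qt by (auto simp: quasi_transitive_def)
 moreover have "\<exists>H\<in>Aut. \<exists>v0\<in>V0. H v0 = v" for v
 proof -
  define v0 where "v0 = (SOME x. ?O x = ?O v)"
  have "?O v0 = ?O v" unfolding v0_def by (rule someI[of _ v]) simp
  moreover have "v \<in> ?O v" using aut_id(2) by (intro image_eqI[of _ _ "\<lambda>x. x"]) auto
  ultimately have "v \<in> ?O v0" by simp
  moreover have "v0 \<in> V0" unfolding V0_def v0_def by auto
  ultimately show ?thesis by auto
 qed
 ultimately show ?thesis by blast
qed

text \<open>An automorphism-invariant property has to be checked on orbit representatives only, and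
  monotonicity in \<open>n\<close> lets their finitely many radii be replaced by the
  maximum.\<close>

lemma uniform:
 assumes "\<And>v. \<exists>n. Q v n" "\<And>H v n. H \<in> Aut \<Longrightarrow> Q v n \<Longrightarrow> Q (H v) n"
  and "\<And>v m n. m \<le> n \<Longrightarrow> Q v m \<Longrightarrow> Q v (n::nat)"
 shows "\<exists>n. \<forall>v. Q v n"
proof -
 obtain V0 where V0: "finite V0" "\<And>v. \<exists>H\<in>Aut. \<exists>v0\<in>V0. H v0 = v" using orbit_reps by blast
 obtain n where "\<forall>v\<in>V0. Q v n" using finite_uniform[of V0 Q] V0 assms by blast
 hence "Q v n" for v using V0(2)[of v] assms(2) by blast
 thus ?thesis by blast
qed

lemma ball_card_bound: "\<exists>N. \<forall>v. card (ball n v) \<le> N"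
proof (rule uniform)
 show "card (ball n (H v)) \<le> N" if "H \<in> Aut" "card (ball n v) \<le> N" for H v N
  using that ball_aut[OF that(1), of n v] card_image[OF inj_on_subset[OF aut_inj[OF that(1)]], of "ball n v"] by simp
qed auto

definition Cand :: "'v set set" where
 "Cand = {H ` e0 |H. H \<in> Aut}"

lemma Cand_edge: "e \<in> Cand \<Longrightarrow> e \<in> EG"
 unfolding Cand_def using edges_aut e0_edge by auto

lemma Cand_aut: "H \<in> Aut \<Longrightarrow> e \<in> Cand \<Longrightarrow> H ` e \<in> Cand"
proof -
 assume H: "H \<in> Aut" "e \<in> Cand"
 then obtain \<tau> where "\<tau> \<in> Aut" "e = \<tau> ` e0" by (auto simp: Cand_def)
 moreover from this have "H ` e = (H \<circ> \<tau>) ` e0" by (simp add: image_comp)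
 ultimately show ?thesis unfolding Cand_def using aut_comp[OF H(1)] by blast
qed

lemma Cand_linked: "e \<in> Cand \<Longrightarrow> \<exists>R. linked R e"
 unfolding Cand_def using cyc_path_exists[OF e0_cyc] linked_cyc linked_aut by blast

lemma Cand_side_infinite:
 assumes "e \<in> Cand" "side x K" "e \<inter> K \<noteq> {}"
 shows "infinite K"
proof
 assume fin: "finite K"
 obtain H where H: "H \<in> Aut" "e = H ` e0" using assms by (auto simp: Cand_def)
 have "side (inv H x) (inv H ` K)" using side_aut[OF aut_inv[OF H(1)] assms(2)] .
 moreover have "inv H ` e = e0" using H by simp
 hence "e0 \<inter> inv H ` K \<noteq> {}" using assms(3) by blast
 ultimately have "infinite (inv H ` K)" using biinf_side_infinite[OF e0_biinf] by blast
 thus False using fin by simp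
qed

lemma Cand_dense: "\<exists>n. \<forall>v. \<exists>e\<in>Cand. e \<subseteq> ball n v"
proof (rule uniform)
 fix v
 have "finite e0" using e0_edge edgesE by (metis finite.emptyI finite_insert)
 then obtain n where "e0 \<subseteq> ball n v" using ball_exists_finite by blast
 moreover have "e0 \<in> Cand" using aut_id(2) by (auto simp: Cand_def intro!: exI[of _ "\<lambda>x. x"])
 ultimately show "\<exists>n. \<exists>e\<in>Cand. e \<subseteq> ball n v" by blast
next
 fix H v n assume "H \<in> Aut" "\<exists>e\<in>Cand. e \<subseteq> ball n v"
 thus "\<exists>e\<in>Cand. e \<subseteq> ball n (H v)" using Cand_aut ball_aut by (metis image_mono)
next
 fix v m n assume "m \<le> n" "\<exists>e\<in>Cand. e \<subseteq> ball m v"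
 thus "\<exists>e\<in>Cand. e \<subseteq> ball n v" using ball_mono by (meson order_trans)
qed

lemma dichotomy_uniform:
 "\<exists>n. \<forall>v f e. f \<in> EG \<longrightarrow> v \<in> f \<longrightarrow> e \<in> Cand \<longrightarrow> e \<subseteq> ball r v \<longrightarrow>
   alpha v n f e \<or> (\<exists>x K. beta v n f e x K)"
proof -
 define Q where "Q v n \<longleftrightarrow> (\<forall>f e. f \<in> EG \<longrightarrow> v \<in> f \<longrightarrow> e \<in> Cand \<longrightarrow> e \<subseteq> ball r v \<longrightarrow>
   alpha v n f e \<or> (\<exists>x K. beta v n f e x K))" for v n
 have "\<exists>n. \<forall>v. Q v n"
 proof (rule uniform)
  fix v
  let ?X = "{(f, e). f \<in> EG \<and> v \<in> f \<and> e \<in> Cand \<and> e \<subseteq> ball r v}"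
  have "f \<subseteq> ball 1 v" if f: "f \<in> EG" "v \<in> f" for f
  proof -
   obtain c d where cd: "f = {c, d}" "adj c d" using edgesE[OF f(1)] by blast
   hence "c \<in> ball (Suc 0) d" "d \<in> ball (Suc 0) c" using ball_adj adj_sym by blast+
   thus ?thesis using f cd by auto
  qed
  hence "?X \<subseteq> Pow (ball 1 v) \<times> Pow (ball r v)" by auto
  hence fin: "finite ?X" by (rule finite_subset) auto
  have "\<exists>n. \<forall>p\<in>?X. (\<lambda>(f, e) n. alpha v n f e \<or> (\<exists>x K. beta v n f e x K)) p n"
  proof (rule finite_uniform[OF fin])
   fix p assume "p \<in> ?X"
   then obtain f e where p: "p = (f, e)" "f \<in> EG" "v \<in> f" "e \<in> Cand" by auto
   obtain R0 where "linked R0 e" using Cand_linked p by blast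
   from edge_dichotomy[OF this p(2)] show "\<exists>n. (\<lambda>(f, e) n. alpha v n f e \<or> (\<exists>x K. beta v n f e x K)) p n"
   proof
    assume "\<exists>R. linked R e \<and> f \<subseteq> R"
    then obtain R where R: "linked R e" "f \<subseteq> R" by blast
    then obtain n where "R \<subseteq> ball n v" using ball_exists_finite by (metis linked_def)
    hence "alpha v n f e" using R by (auto simp: alpha_def)
    thus ?thesis using p by auto
   next
    assume "\<exists>x R K. linked R e \<and> x \<in> R \<and> side x K \<and> e \<inter> K \<noteq> {} \<and> f \<inter> K = {}"
    then obtain x R K where *: "linked R e" "x \<in> R" "side x K" "e \<inter> K \<noteq> {}" "f \<inter> K = {}" by blast
    obtain R1 where R1: "finite R1" "conn R1" "x \<in> R1" "f \<subseteq> R1" "R1 \<inter> K = {}"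
     using beta_outside[OF *(3) p(2) *(5)] by blast
    obtain R2 where R2: "finite R2" "R2 \<subseteq> insert x K" "x \<in> R2" "e \<subseteq> R2" "\<forall>w\<in>K. adj x w \<longrightarrow> w \<in> R2"
     "\<forall>y\<in>R2 - {x}. link R2 e x y" using beta_inside[OF *(1-4)] by blast
    obtain n where "R1 \<union> R2 \<subseteq> ball n v" using ball_exists_finite[of "R1 \<union> R2" v] R1 R2 by auto
    hence "beta v n f e x K" unfolding beta_def using * R1 R2 by (metis le_sup_iff)
    thus ?thesis using p by auto
   qed
  next
   fix p m n assume "(m::nat) \<le> n" "(\<lambda>(f, e) n. alpha v n f e \<or> (\<exists>x K. beta v n f e x K)) p m"
   thus "(\<lambda>(f, e) n. alpha v n f e \<or> (\<exists>x K. beta v n f e x K)) p n"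
    using alpha_mono beta_mono by (cases p) blast
  qed
  then obtain n where "\<forall>p\<in>?X. (\<lambda>(f, e) n. alpha v n f e \<or> (\<exists>x K. beta v n f e x K)) p n" ..
  hence "Q v n" unfolding Q_def by auto
  thus "\<exists>n. Q v n" ..
 next
  fix H v n assume H: "H \<in> Aut" and Q: "Q v n"
  show "Q (H v) n" unfolding Q_def
  proof (intro allI impI)
   fix f e assume *: "f \<in> EG" "H v \<in> f" "e \<in> Cand" "e \<subseteq> ball r (H v)"
   let ?f = "inv H ` f" and ?e = "inv H ` e"
   have i: "inv H \<in> Aut" by (rule aut_inv[OF H])
   have "?f \<in> EG" "?e \<in> Cand" using edges_aut[OF i] Cand_aut[OF i] * by auto
   moreover have "v \<in> ?f" using *(2) H by (metis aut_inv_f(1) imageI)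
   moreover have "?e \<subseteq> ball r v" using *(4) ball_aut[OF i, of r "H v"] H by auto
   ultimately have "alpha v n ?f ?e \<or> (\<exists>x K. beta v n ?f ?e x K)" using Q by (auto simp: Q_def)
   thus "alpha (H v) n f e \<or> (\<exists>x K. beta (H v) n f e x K)"
    using alpha_aut[OF H, of v n ?f ?e] beta_aut[OF H, of v n ?f ?e] H by auto
  qed
 next
  fix v m n assume "(m::nat) \<le> n" "Q v m"
  thus "Q v n" unfolding Q_def using alpha_mono beta_mono by blast
 qed
 thus ?thesis unfolding Q_def .
qed

lemma finite_side_uniform: "\<exists>n. \<forall>x J. side x J \<longrightarrow> finite J \<longrightarrow> J \<subseteq> ball n x"
proof -
 have "\<exists>n. \<forall>x. \<forall>J. side x J \<longrightarrow> finite J \<longrightarrow> J \<subseteq> ball n x"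
 proof (rule uniform)
  fix x
  have "\<exists>n. \<forall>J\<in>{K. side x K}. finite J \<longrightarrow> J \<subseteq> ball n x"
   by (rule finite_uniform[OF finite_sides]) (use ball_exists_finite ball_mono in "meson order_trans")+
  thus "\<exists>n. \<forall>J. side x J \<longrightarrow> finite J \<longrightarrow> J \<subseteq> ball n x" by auto
 next
  fix H x n assume H: "H \<in> Aut" and *: "\<forall>J. side x J \<longrightarrow> finite J \<longrightarrow> J \<subseteq> ball n x"
  show "\<forall>J. side (H x) J \<longrightarrow> finite J \<longrightarrow> J \<subseteq> ball n (H x)"
  proof (intro allI impI)
   fix J assume "side (H x) J" "finite J"
   hence "side x (inv H ` J)" "finite (inv H ` J)" using side_aut[OF aut_inv[OF H], of "H x" J] H by auto
   hence "inv H ` J \<subseteq> ball n x" using * by blast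
   hence "H ` inv H ` J \<subseteq> H ` ball n x" by (rule image_mono)
   thus "J \<subseteq> ball n (H x)" using H ball_aut[OF H] by simp
  qed
 next
  fix x m n assume "(m::nat) \<le> n" "\<forall>J. side x J \<longrightarrow> finite J \<longrightarrow> J \<subseteq> ball m x"
  thus "\<forall>J. side x J \<longrightarrow> finite J \<longrightarrow> J \<subseteq> ball n x" using ball_mono by (meson order_trans)
 qed
 thus ?thesis by blast
qed

text \<open>Data for the Harnack comparison: an image of \<open>x\<close> lies in \<open>K\<close>
  and is joined to \<open>x\<close> by a bounded connected set that does not leave
  \<open>insert x K\<close>.\<close>

definition harn :: "'v \<Rightarrow> nat \<Rightarrow> 'v set \<Rightarrow> bool" where
 "harn x n K \<longleftrightarrow> (\<exists>H\<in>Aut. H x \<in> K \<and> (\<exists>L\<subseteq>ball n x. L \<subseteq> insert x K \<and> conn L \<and> x \<in> L \<and> H x \<in> L))"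

text \<open>An infinite component contains a ball of any prescribed radius, centred far from
  \<open>x\<close>; quasi-transitivity provides one radius for which every ball contains an image of
  \<open>x\<close>.\<close>

lemma harn_exists:
 assumes "side x K" "infinite K"
 shows "\<exists>n. harn x n K"
proof -
 obtain r where r: "\<And>v. \<exists>\<tau>\<in>Aut. \<tau> x \<in> ball r v"
 proof -
  have "\<exists>r. \<forall>v. \<exists>\<tau>\<in>Aut. \<tau> x \<in> ball r v"
  proof (rule uniform)
   fix v
   obtain n where "x \<in> ball n v" using ball_exists by blast
   thus "\<exists>n. \<exists>\<tau>\<in>Aut. \<tau> x \<in> ball n v" 
    using aut_id(2) by (intro exI[of _ n] bexI[of _ "\<lambda>x. x"]) auto
  next
   fix H v n assume H: "H \<in> Aut" "\<exists>\<tau>\<in>Aut. \<tau> x \<in> ball n v"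
   then obtain \<tau> where \<tau>: "\<tau> \<in> Aut" "\<tau> x \<in> ball n v" by blast
   have "H (\<tau> x) \<in> H ` ball n v" using \<tau> by blast
   hence "(H \<circ> \<tau>) x \<in> ball n (H v)" using ball_aut[OF H(1)] by simp
   thus "\<exists>\<tau>\<in>Aut. \<tau> x \<in> ball n (H v)" using aut_comp[OF H(1) \<tau>(1)] by blast
  next
   fix v m n assume "(m::nat) \<le> n" "\<exists>\<tau>\<in>Aut. \<tau> x \<in> ball m v"
   thus "\<exists>\<tau>\<in>Aut. \<tau> x \<in> ball n v" using ball_mono by blast
  qed
  thus ?thesis using that by blast
 qed
 obtain w where w: "w \<in> K" "w \<notin> ball r x" using side_far[OF assms, of r] by blast
 have "x \<notin> ball r w" using w ball_sym by blast
 hence wK: "ball r w \<subseteq> K" using side_ball_sub[OF assms(1) w(1)] by blast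
 obtain \<tau> where \<tau>: "\<tau> \<in> Aut" "\<tau> x \<in> ball r w" using r by blast
 obtain L where L: "L \<subseteq> insert x K" "finite L" "conn L" "x \<in> L" "\<tau> x \<in> L"
  using conn_finite_sub[OF conn_insert_side[OF assms(1)], of x "\<tau> x"] \<tau> wK by blast
 obtain n where "L \<subseteq> ball n x" using ball_exists_finite[OF L(2)] by blast
 thus ?thesis unfolding harn_def using \<tau> wK L by blast
qed

lemma harn_mono: "m \<le> n \<Longrightarrow> harn x m K \<Longrightarrow> harn x n K"
 unfolding harn_def using ball_mono[of m n x] by (meson order_trans)

lemma harn_aut:
 assumes H: "H \<in> Aut" and "harn x n K"
 shows "harn (H x) n (H ` K)"
proof -
 obtain \<tau> L where *: "\<tau> \<in> Aut" "\<tau> x \<in> K" "L \<subseteq> ball n x" "L \<subseteq> insert x K" "conn L" "x \<in> L" "\<tau> x \<in> L"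
  using assms(2) unfolding harn_def by blast
 let ?t = "H \<circ> \<tau> \<circ> inv H"
 have t: "?t \<in> Aut" using aut_comp aut_inv * H by blast
 have tx: "?t (H x) = H (\<tau> x)" using H by simp
 have "H ` L \<subseteq> ball n (H x)" using *(3) ball_aut[OF H, of n x] by blast
 moreover have "H ` L \<subseteq> insert (H x) (H ` K)" "conn (H ` L)" "H x \<in> H ` L" "?t (H x) \<in> H ` L"
  using * conn_aut[OF H] unfolding tx by auto
 moreover have "?t (H x) \<in> H ` K" unfolding tx using * by blast
 ultimately show ?thesis unfolding harn_def using t by blast
qed

lemma harn_uniform: "\<exists>n. \<forall>x K. side x K \<longrightarrow> infinite K \<longrightarrow> harn x n K"
proof -
 have "\<exists>n. \<forall>x. \<forall>K. side x K \<longrightarrow> infinite K \<longrightarrow> harn x n K"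
 proof (rule uniform)
  fix x
  have "\<exists>n. \<forall>K\<in>{K. side x K}. infinite K \<longrightarrow> harn x n K"
   by (rule finite_uniform[OF finite_sides]) (use harn_exists harn_mono in blast)+
  thus "\<exists>n. \<forall>K. side x K \<longrightarrow> infinite K \<longrightarrow> harn x n K" by auto
 next
  fix H x n assume H: "H \<in> Aut" and *: "\<forall>K. side x K \<longrightarrow> infinite K \<longrightarrow> harn x n K"
  show "\<forall>K. side (H x) K \<longrightarrow> infinite K \<longrightarrow> harn (H x) n K"
  proof (intro allI impI)
   fix K assume K: "side (H x) K" "infinite K"
   have "inj (inv H)" using aut_inj[OF aut_inv[OF H]] .
   hence "infinite (inv H ` K)" using K by (meson finite_imageD inj_on_subset subset_UNIV)
   moreover have "side x (inv H ` K)" using side_aut[OF aut_inv[OF H] K(1)] H by simp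
   ultimately have "harn x n (inv H ` K)" using * by blast
   thus "harn (H x) n K" using harn_aut[OF H, of x n "inv H ` K"] H by simp
  qed
 next
  fix x m n assume "(m::nat) \<le> n" "\<forall>K. side x K \<longrightarrow> infinite K \<longrightarrow> harn x m K"
  thus "\<forall>K. side x K \<longrightarrow> infinite K \<longrightarrow> harn x n K" using harn_mono by blast
 qed
 thus ?thesis by blast
qed

text \<open>The cut vertex nearest to \<open>f\<close> that separates it from \<open>z\<close> leaves \<open>f\<close> in a part which is either
 finite or contains an edge of \<open>S\<close> that is usable from the far side.\<close>
lemma good_edge:
 "\<exists>n \<rho>. \<forall>S z f v. S \<subseteq> Cand \<longrightarrow> (\<forall>w. \<exists>e\<in>S. e \<subseteq> ball r w) \<longrightarrow> f \<in> EG \<longrightarrow> v \<in> f \<longrightarrow>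
   (\<exists>e\<in>S. e \<subseteq> ball \<rho> v \<and> (alpha v n f e \<or> (\<exists>x K. beta v n f e x K \<and> z \<notin> K) \<or> dangling v n z f e))"
proof -
 obtain n1 where n1: "\<And>v f e. f \<in> EG \<Longrightarrow> v \<in> f \<Longrightarrow> e \<in> Cand \<Longrightarrow> e \<subseteq> ball r v \<Longrightarrow>
   alpha v n1 f e \<or> (\<exists>x K. beta v n1 f e x K)" using dichotomy_uniform[of r] by blast
 \<comment> \<open>Room for the second candidate: at most \<open>n1\<close> from \<open>v\<close> to
   the cut vertex, \<open>Suc r\<close> from there to the centre \<open>w\<close> of a ball inside
   \<open>J\<close>, and \<open>r\<close> to the edge \<open>e2\<close> in that ball.\<close>
 define \<rho> where "\<rho> = n1 + Suc r + r"
 obtain n2 where n2: "\<And>v f e. f \<in> EG \<Longrightarrow> v \<in> f \<Longrightarrow> e \<in> Cand \<Longrightarrow> e \<subseteq> ball \<rho> v \<Longrightarrow>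
   alpha v n2 f e \<or> (\<exists>x K. beta v n2 f e x K)" using dichotomy_uniform[of \<rho>] by blast
 obtain m where m: "\<And>x J. side x J \<Longrightarrow> finite J \<Longrightarrow> J \<subseteq> ball m x" using finite_side_uniform by blast
 define n where "n = n1 + n2 + m + r"
 have n: "n1 \<le> n" "n2 \<le> n" by (auto simp: n_def)
 have key: "\<exists>e\<in>S. e \<subseteq> ball \<rho> v \<and> (alpha v n f e \<or> (\<exists>x K. beta v n f e x K \<and> z \<notin> K) \<or> dangling v n z f e)"
  if S: "S \<subseteq> Cand" "\<forall>w. \<exists>e\<in>S. e \<subseteq> ball r w" and f: "f \<in> EG" "v \<in> f" for S z f v
 proof (rule ccontr)
  assume contra: "\<not> ?thesis"
  obtain e1 where e1: "e1 \<in> S" "e1 \<subseteq> ball r v" using S by blast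
  hence e1\<rho>: "e1 \<subseteq> ball \<rho> v" using ball_mono[of r \<rho> v] by (auto simp: \<rho>_def)
  \<comment> \<open>The cut vertices that separate \<open>f\<close> from \<open>z\<close>. If
    \<open>e1\<close> is unusable, its cut vertex \<open>x1\<close> is one of them, so some element
    lies within \<open>n1\<close> of \<open>v\<close>; a nearest one is taken.\<close>
  define Cut where "Cut = {x. \<exists>K. side x K \<and> z \<in> K \<and> f \<inter> K = {}}"
  have "alpha v n1 f e1 \<or> (\<exists>x K. beta v n1 f e1 x K)" by (rule n1) (use f e1 S in auto)
  moreover have na: "\<not> alpha v n f e1" "\<And>x K. beta v n f e1 x K \<Longrightarrow> z \<in> K" "\<not> dangling v n z f e1"
   using contra e1 e1\<rho> by blast+
  ultimately obtain x1 K1 where x1: "beta v n1 f e1 x1 K1"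
   using alpha_mono[OF n(1), of v f e1] by blast
  hence "z \<in> K1" using na(2) beta_mono[OF n(1)] by blast
  hence "x1 \<in> Cut" "x1 \<in> ball n1 v" using x1 unfolding beta_def Cut_def by auto
  hence ex: "\<exists>k. \<exists>x\<in>Cut. x \<in> ball k v" by blast
  define k where "k = (LEAST k. \<exists>x\<in>Cut. x \<in> ball k v)"
  have k1: "k \<le> n1" unfolding k_def using \<open>x1 \<in> Cut\<close> \<open>x1 \<in> ball n1 v\<close> by (intro Least_le) blast
  have kmin: "\<And>k'. k' < k \<Longrightarrow> \<not> (\<exists>x\<in>Cut. x \<in> ball k' v)" unfolding k_def by (rule not_less_Least)
  obtain x where x: "x \<in> Cut" "x \<in> ball k v" using LeastI_ex[OF ex] unfolding k_def by blast
  then obtain K where K: "side x K" "z \<in> K" "f \<inter> K = {}" by (auto simp: Cut_def)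
  obtain b where b: "b \<in> f" "b \<noteq> x" using f edgesE by (metis insertCI)
  define J where "J = comp x b"
  have J: "side x J" "b \<in> J" using side_comp[OF b(2)] by (auto simp: J_def)
  have fJ: "f \<subseteq> insert x J"
  proof -
   obtain c d where cd: "f = {c, d}" "adj c d" using f edgesE by metis
   thus ?thesis using J b adj_sym[of c d] unfolding side_def by blast
  qed
  have zJ: "z \<notin> J"
  proof
   assume "z \<in> J"
   hence "K = J" using side_disjoint_eq[OF K(1) J(1) K(2)] by simp
   thus False using K(3) b J by blast
  qed
  show False
  proof (cases "finite J")
   case True
   hence "J \<subseteq> ball m x" using m J by blast
   moreover have "x \<in> ball n v" using x ball_mono[of k n v] k1 by (auto simp: n_def)
   moreover have "ball m x \<subseteq> ball n v"
   proof
    fix y assume "y \<in> ball m x"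
    hence "y \<in> ball (k + m) v" using ball_trans[OF x(2)] by blast
    thus "y \<in> ball n v" using ball_mono[of "k + m" n v] k1 by (auto simp: n_def)
   qed
   moreover have "e1 \<subseteq> ball n v" using e1 ball_mono[of r n v] by (auto simp: n_def)
   ultimately have "insert x J \<subseteq> ball n v" "e1 \<subseteq> ball n v" by auto
   hence "dangling v n z f e1" unfolding dangling_def using J fJ zJ conn_ball[of n v] by blast
   thus False using na(3) by blast
  next
   case False
   obtain w where w: "w \<in> J" "w \<in> ball (Suc r) x" "w \<notin> ball r x" using side_far[OF J(1) False] by blast
   have "x \<notin> ball r w" using w ball_sym by blast
   hence wJ: "ball r w \<subseteq> J" using side_ball_sub[OF J(1) w(1)] by blast
   obtain e2 where e2: "e2 \<in> S" "e2 \<subseteq> ball r w" using S by blast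
   have e2\<rho>: "e2 \<subseteq> ball \<rho> v"
   proof
    fix y assume "y \<in> e2"
    hence "y \<in> ball (k + Suc r + r) v" using ball_trans[OF ball_trans[OF x(2) w(2)]] e2 by blast
    thus "y \<in> ball \<rho> v" using ball_mono[of "k + Suc r + r" \<rho> v] k1 by (auto simp: \<rho>_def)
   qed
   have "alpha v n2 f e2 \<or> (\<exists>x K. beta v n2 f e2 x K)" by (rule n2) (use f e2 e2\<rho> S in auto)
   moreover have nb: "\<not> alpha v n f e2" "\<And>x K. beta v n f e2 x K \<Longrightarrow> z \<in> K"
    using contra e2 e2\<rho> by blast+
   ultimately obtain x2 K2 where x2: "beta v n2 f e2 x2 K2"
    using alpha_mono[OF n(2), of v f e2] by blast
   hence z2: "z \<in> K2" using nb(2) beta_mono[OF n(2)] by blast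
   have s2: "side x2 K2" "e2 \<inter> K2 \<noteq> {}" "f \<inter> K2 = {}" using x2 by (auto simp: beta_def)
   hence "x2 \<in> Cut" using z2 by (auto simp: Cut_def)
   obtain y where y: "y \<in> e2" "y \<in> K2" using s2 by blast
   hence "y \<in> J" using e2 wJ by blast
   have "conn K2" using s2 by (auto simp: side_def)
   \<comment> \<open>\<open>K2\<close> is connected, contains \<open>z\<close> outside
     \<open>J\<close> and a point of \<open>e2\<close> in \<open>J\<close>, so it contains
     \<open>x\<close>. Then \<open>x2\<close> separates \<open>v\<close> from \<open>x\<close> and
     is a cut vertex nearer to \<open>v\<close>, against minimality.\<close>
   hence "x \<in> K2" using conn_exit[OF J(1) _ y(2) \<open>y \<in> J\<close> z2 zJ] by blast
   moreover have "v \<notin> K2" using f s2 by blast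
   ultimately obtain k' where "k' < k" "x2 \<in> ball k' v" using side_separates[OF s2(1) _ _ x(2)] by blast
   thus False using kmin \<open>x2 \<in> Cut\<close> by blast
  qed
 qed
 show ?thesis by (rule exI[of _ n], rule exI[of _ \<rho>]) (intro allI impI, rule key, assumption+)
qed

end

section \<open>Clusters, the ghost field and surgery\<close>

definition Rw :: "'v set set \<Rightarrow> ('v \<times> 'v) set" where
 "Rw V = {(x, y). {x, y} \<in> V}"

definition cl :: "'v set set \<Rightarrow> 'v \<Rightarrow> 'v set" where
 "cl V z = {v. (z, v) \<in> (Rw V)\<^sup>*}"

definition hits :: "'v \<Rightarrow> 'v set set \<Rightarrow> bool" where
 "hits z V \<longleftrightarrow> (\<exists>w\<in>cl V z. {w} \<in> V)"

definition touch :: "'v set \<Rightarrow> 'v set set" where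
 "touch U = {i. i \<inter> U \<noteq> {}}"

definition Dev :: "'v \<Rightarrow> 'v \<Rightarrow> 'v set set \<Rightarrow> bool" where
 "Dev z x V \<longleftrightarrow> x \<in> cl V z \<and> \<not> hits z V"

text \<open>A configuration is a set of open indices: an edge, or a singleton \<open>{x}\<close> standing for the edge from
 \<open>x\<close> to the ghost vertex.\<close>
abbreviation "greens \<equiv> range (\<lambda>x. {x})"

lemma sym_Rw: "sym (Rw V)" by (auto simp: sym_def Rw_def insert_commute)

lemma cl_self [simp]: "z \<in> cl V z" by (simp add: cl_def)

lemma cl_step: "s \<in> cl V z \<Longrightarrow> {s, t} \<in> V \<Longrightarrow> t \<in> cl V z"
 unfolding cl_def mem_Collect_eq by (erule rtrancl_into_rtrancl) (simp add: Rw_def)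

lemma cl_subI:
 assumes "z \<in> T" "\<And>s t. s \<in> T \<Longrightarrow> {s, t} \<in> V \<Longrightarrow> t \<in> T"
 shows "cl V z \<subseteq> T"
proof
 fix v assume "v \<in> cl V z"
 hence "(z, v) \<in> (Rw V)\<^sup>*" by (simp add: cl_def)
 thus "v \<in> T" by (rule rtrancl_closed[OF _ assms(1)]) (use assms(2) in "auto simp: Rw_def")
qed

lemma cl_sym: "v \<in> cl V z \<Longrightarrow> z \<in> cl V v"
 using sym_rtrancl[OF sym_Rw[of V]] unfolding cl_def by (auto dest: symD)

lemma cl_trans: "v \<in> cl V z \<Longrightarrow> w \<in> cl V v \<Longrightarrow> w \<in> cl V z"
 unfolding cl_def mem_Collect_eq by (rule rtrancl_trans)

lemma cl_eq:
 assumes "v \<in> cl V z"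
 shows "cl V v = cl V z"
 using cl_trans[OF assms] cl_trans[OF cl_sym[OF assms]] by (intro equalityI subsetI)

lemma cl_mono: "V \<subseteq> V' \<Longrightarrow> cl V z \<subseteq> cl V' z"
proof -
 assume w: "V \<subseteq> V'"
 show "cl V z \<subseteq> cl V' z"
 proof (rule cl_subI)
  fix s t assume "s \<in> cl V' z" "{s, t} \<in> V"
  thus "t \<in> cl V' z" using cl_step[of s V' z t] w by blast
 qed simp
qed

lemma hits_mono:
 assumes "V \<subseteq> V'" "hits z V"
 shows "hits z V'"
proof -
 obtain w where "w \<in> cl V z" "{w} \<in> V" using assms(2) by (auto simp: hits_def)
 hence "w \<in> cl V' z" "{w} \<in> V'" using cl_mono[OF assms(1), of z] assms(1) by auto
 thus ?thesis by (auto simp: hits_def)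
qed

lemma incr_hits: "incr (hits z)"
 unfolding incr_def by (intro allI impI) (rule hits_mono)

lemma hits_cl: "v \<in> cl V z \<Longrightarrow> hits v V \<Longrightarrow> hits z V"
 unfolding hits_def by (simp add: cl_eq)

lemma cl_touch: "cl (V \<inter> touch (cl V z)) z = cl V z"
proof
 show "cl V z \<subseteq> cl (V \<inter> touch (cl V z)) z"
 proof -
  have "cl V z \<subseteq> cl V z \<inter> cl (V \<inter> touch (cl V z)) z"
  proof (rule cl_subI)
   fix s t assume s: "s \<in> cl V z \<inter> cl (V \<inter> touch (cl V z)) z" "{s, t} \<in> V"
   hence "{s, t} \<in> V \<inter> touch (cl V z)" by (auto simp: touch_def)
   with s show "t \<in> cl V z \<inter> cl (V \<inter> touch (cl V z)) z"
    using cl_step[of s V z t] cl_step[of s "V \<inter> touch (cl V z)" z t] by simp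
  qed simp
  thus ?thesis by blast
 qed
qed (rule cl_mono, blast)

text \<open>A cluster is found by inspecting only indices that touch it. Hence the event that it
  equals \<open>U\<close> carries no information on the other indices.\<close>

lemma cl_touch_iff: "cl V z = U \<longleftrightarrow> cl (V \<inter> touch U) z = U"
proof
 assume U: "cl V z = U"
 show "cl (V \<inter> touch U) z = U" unfolding U[symmetric] by (rule cl_touch)
next
 define V0 where "V0 = V \<inter> touch U"
 assume "cl (V \<inter> touch U) z = U"
 hence U: "cl V0 z = U" by (simp only: V0_def)
 have mem: "v \<in> U \<longleftrightarrow> v \<in> cl V0 z" for v by (simp only: U)
 have "cl V z \<subseteq> U"
 proof (rule cl_subI)
  show "z \<in> U" unfolding mem by (rule cl_self)
  fix s t assume s: "s \<in> U" and "{s, t} \<in> V"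
  hence "{s, t} \<in> V0" unfolding V0_def touch_def by blast
  with s show "t \<in> U" unfolding mem by (rule cl_step)
 qed
 moreover have "cl V0 z \<subseteq> cl V z" by (rule cl_mono) (simp add: V0_def)
 ultimately show "cl V z = U" unfolding U by (rule equalityI)
qed

text \<open>For \<open>Rw\<close> a singleton index is merely a loop, so clusters are decided by the
  edges alone and the ghost indices stay independent of them.\<close>

lemma cl_greens:
 assumes "\<beta> \<subseteq> greens"
 shows "cl (\<nu> \<union> \<beta>) z = cl \<nu> z"
proof
 show "cl (\<nu> \<union> \<beta>) z \<subseteq> cl \<nu> z"
 proof (rule cl_subI)
  fix s t assume s: "s \<in> cl \<nu> z" "{s, t} \<in> \<nu> \<union> \<beta>"
  show "t \<in> cl \<nu> z"
  proof (cases "{s, t} \<in> \<nu>")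
   case False
   then obtain x where "{s, t} = {x}" using s assms by auto
   hence "s = t" by auto
   thus ?thesis using s by simp
  qed (rule cl_step[OF s(1)])
 qed simp
qed (rule cl_mono, blast)

lemma piv_hits_edge:
 assumes "piv (hits z) {a, b} V" "a \<noteq> b"
 shows "\<exists>a' b'. {a, b} = {a', b'} \<and> a' \<in> cl (V - {{a, b}}) z \<and> b' \<notin> cl (V - {{a, b}}) z \<and> hits b' (V - {{a, b}})"
proof -
 let ?V = "V - {{a, b}}" and ?C = "cl (V - {{a, b}}) z"
 have h: "hits z (insert {a, b} V)" "\<not> hits z ?V" using assms(1) by (auto simp: piv_def)
 then obtain w where w: "w \<in> cl (insert {a, b} V) z" "{w} \<in> insert {a, b} V" by (auto simp: hits_def)
 have w': "{w} \<in> ?V" using w(2) assms(2) by auto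
 have wC: "w \<notin> ?C" using h(2) w' by (auto simp: hits_def)
 have main: "\<exists>a' b'. {a, b} = {a', b'} \<and> a' \<in> ?C \<and> b' \<notin> ?C"
 proof (rule ccontr)
  assume no: "\<not> ?thesis"
  have "cl (insert {a, b} V) z \<subseteq> ?C"
  proof (rule cl_subI)
   fix s t assume s: "s \<in> ?C" "{s, t} \<in> insert {a, b} V"
   show "t \<in> ?C"
   proof (cases "{s, t} = {a, b}")
    case True
    thus ?thesis using no s by metis
   next
    case False
    hence "{s, t} \<in> ?V" using s by auto
    thus ?thesis using cl_step[OF s(1)] by simp
   qed
  qed simp
  thus False using w wC by blast
 qed
 then obtain a' b' where ab: "{a, b} = {a', b'}" "a' \<in> ?C" "b' \<notin> ?C" by blast
 have "cl (insert {a, b} V) z \<subseteq> ?C \<union> cl ?V b'"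
 proof (rule cl_subI)
  fix s t assume s: "s \<in> ?C \<union> cl ?V b'" "{s, t} \<in> insert {a, b} V"
  show "t \<in> ?C \<union> cl ?V b'"
  proof (cases "{s, t} = {a, b}")
   case True
   hence "t = a' \<or> t = b'" using ab(1) by (metis doubleton_eq_iff)
   thus ?thesis using ab by auto
  next
   case False
   hence "{s, t} \<in> ?V" using s by auto
   thus ?thesis using cl_step[of s ?V z t] cl_step[of s ?V b' t] s(1) by auto
  qed
 qed simp
 hence "w \<in> cl ?V b'" using w wC by blast
 hence "hits b' ?V" using w' by (auto simp: hits_def)
 thus ?thesis using ab by blast
qed

text \<open>The cluster of \<open>z\<close> explored without inspecting any index that touches
  \<open>R\<close>. The default \<open>{}\<close> covers the case that \<open>z\<close> already lies
  in \<open>R\<close> and there is nothing to explore.\<close>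

definition Ux :: "'v \<Rightarrow> 'v set \<Rightarrow> 'v set set \<Rightarrow> 'v set" where
 "Ux z R V = (if z \<in> R then {} else cl (V - touch R) z)"

definition reaches :: "'v \<Rightarrow> 'v set \<Rightarrow> 'v set set \<Rightarrow> bool" where
 "reaches z R V \<longleftrightarrow> (\<forall>w\<in>Ux z R V. {w} \<notin> V) \<and> (z \<in> R \<or> (\<exists>u\<in>Ux z R V. \<exists>y\<in>R. {u, y} \<in> V))"

lemma Ux_out:
 assumes "z \<notin> R"
 shows "Ux z R V \<inter> R = {}"
proof -
 have "cl (V - touch R) z \<subseteq> - R"
  by (rule cl_subI) (use assms in "auto simp: touch_def")
 thus ?thesis using assms by (auto simp: Ux_def)
qed

lemma first_hit_cl:
 assumes "t \<in> cl V s" "t \<in> R"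
 shows "s \<in> R \<or> (\<exists>u y. u \<in> cl (V - touch R) s \<and> u \<notin> R \<and> {u, y} \<in> V \<and> y \<in> R \<and> u \<in> cl V s \<and> y \<in> cl V s)"
proof -
 have "(s, t) \<in> (Rw V)\<^sup>*" using assms by (simp add: cl_def)
 from first_hit[OF this assms(2)] show ?thesis
 proof
  assume "\<exists>u y. (s, u) \<in> (Rw V \<inter> (- R) \<times> (- R))\<^sup>* \<and> u \<notin> R \<and> (u, y) \<in> Rw V \<and> y \<in> R \<and> (y, t) \<in> (Rw V)\<^sup>*"
  then obtain u y where uy: "(s, u) \<in> (Rw V \<inter> (- R) \<times> (- R))\<^sup>*" "u \<notin> R" "(u, y) \<in> Rw V" "y \<in> R" by blast
  have "Rw V \<inter> (- R) \<times> (- R) \<subseteq> Rw (V - touch R)" by (auto simp: Rw_def touch_def)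
  hence u: "u \<in> cl (V - touch R) s" 
   using rtrancl_mono[THEN subsetD, OF _ uy(1)] by (simp add: cl_def)
  hence "u \<in> cl V s" using cl_mono[of "V - touch R" V s] by blast
  moreover have "{u, y} \<in> V" using uy by (simp add: Rw_def)
  moreover from calculation have "y \<in> cl V s" by (rule cl_step)
  ultimately show ?thesis using u uy by blast
 qed simp
qed

text \<open>The part of the cluster of \<open>z\<close> outside \<open>R\<close> and the part of the cluster behind the pivotal
 edge outside \<open>R\<close> are disjoint, so they can be reconnected inside \<open>R\<close>.\<close>
lemma piv_reaches:
 assumes p: "piv (hits z) f V" and f: "f = {a, b}" "a \<noteq> b" "f \<subseteq> R"
 shows "reaches z R V \<and> (\<exists>y1\<in>R. \<exists>y2\<in>R. y1 \<noteq> y2 \<and>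
   (if z \<in> R then y1 = z else \<exists>u\<in>Ux z R V. {u, y1} \<in> V) \<and>
   ({y2} \<in> V \<or> (\<exists>u. u \<notin> R \<and> u \<notin> Ux z R V \<and> {u, y2} \<in> V \<and> hits u (V - touch R))) \<and>
   hits y2 (V - touch (Ux z R V)))"
proof -
 let ?V = "V - {f}" and ?C = "cl (V - {f}) z"
 have nh: "\<not> hits z ?V" using p by (simp add: piv_def)
 obtain a' b' where ab: "f = {a', b'}" "a' \<in> ?C" "b' \<notin> ?C" "hits b' ?V"
  using piv_hits_edge[of z a b V] p f by auto
 have abR: "a' \<in> R" "b' \<in> R" using ab f by auto
 \<comment> \<open>The pivotal edge lies inside \<open>R\<close>, so deleting it does not affect
   anything explored off \<open>R\<close>.\<close>
 have tR: "?V - touch R = V - touch R" using abR ab by (auto simp: touch_def)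
 have UC: "Ux z R V \<subseteq> ?C" unfolding Ux_def using cl_mono[of "V - touch R" ?V z] tR by auto
 have noC: "{w} \<notin> V" if "w \<in> ?C" for w
 proof
  assume "{w} \<in> V"
  hence "{w} \<in> ?V" using f by auto
  thus False using nh that by (auto simp: hits_def)
 qed
 have y1: "\<exists>y1\<in>R. y1 \<in> ?C \<and> (if z \<in> R then y1 = z else \<exists>u\<in>Ux z R V. {u, y1} \<in> V)"
 proof (cases "z \<in> R")
  case False
  then obtain u y where "u \<in> cl (V - touch R) z" "{u, y} \<in> ?V" "y \<in> R" "y \<in> ?C"
   using first_hit_cl[OF ab(2) abR(1)] tR by auto
  thus ?thesis using False by (auto simp: Ux_def)
 qed auto
 obtain w where w: "w \<in> cl ?V b'" "{w} \<in> ?V" using ab(4) by (auto simp: hits_def)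
 have disj: "v \<notin> ?C" if "v \<in> cl ?V b'" for v
 proof
  assume v: "v \<in> ?C"
  have "b' \<in> cl ?V v" using that by (rule cl_sym)
  hence "b' \<in> ?C" by (rule cl_trans[OF v])
  thus False using ab(3) by simp
 qed
 have cw: "cl ?V w = cl ?V b'" using w(1) by (rule cl_eq)
 have hU: "hits y (V - touch (Ux z R V))" if y: "y \<in> cl ?V b'" for y
 proof -
  have "cl ?V y \<subseteq> cl ?V b' \<inter> cl (V - touch (Ux z R V)) y"
  proof (rule cl_subI)
   fix s t assume s: "s \<in> cl ?V b' \<inter> cl (V - touch (Ux z R V)) y" "{s, t} \<in> ?V"
   hence t: "t \<in> cl ?V b'" using cl_step[of s ?V b' t] by simp
   hence "s \<notin> Ux z R V" "t \<notin> Ux z R V" using UC disj s by auto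
   hence "{s, t} \<in> V - touch (Ux z R V)" using s by (auto simp: touch_def)
   thus "t \<in> cl ?V b' \<inter> cl (V - touch (Ux z R V)) y" 
    using t s cl_step[of s "V - touch (Ux z R V)" y t] by simp
  qed (use y in simp)
  moreover have "w \<in> cl ?V y" using cl_eq[OF y] w by simp
  ultimately have "w \<in> cl (V - touch (Ux z R V)) y" by blast
  moreover have "{w} \<in> V - touch (Ux z R V)" using w disj[OF w(1)] UC by (auto simp: touch_def)
  ultimately show ?thesis by (auto simp: hits_def)
 qed
 have y2: "\<exists>y2\<in>R. y2 \<in> cl ?V b' \<and> ({y2} \<in> V \<or> (\<exists>u. u \<notin> R \<and> u \<notin> Ux z R V \<and> {u, y2} \<in> V \<and> hits u (V - touch R)))"
 proof (cases "w \<in> R")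
  case True
  thus ?thesis using w by auto
 next
  case False
  have "b' \<in> cl ?V w" using w(1) by (rule cl_sym)
  from first_hit_cl[OF this abR(2)] obtain u y where uy: "u \<in> cl (V - touch R) w" "u \<notin> R" "{u, y} \<in> ?V" "y \<in> R"
   "u \<in> cl ?V b'" "y \<in> cl ?V b'" using False tR cw by auto
  have "w \<in> cl (V - touch R) u" using uy(1) by (rule cl_sym)
  moreover have "{w} \<in> V - touch R" using False w by (auto simp: touch_def)
  ultimately have "hits u (V - touch R)" by (auto simp: hits_def)
  moreover have "u \<notin> Ux z R V" using uy disj UC by blast
  ultimately show ?thesis using uy by auto
 qed
 have re: "reaches z R V" unfolding reaches_def
 proof (intro conjI ballI)
  fix w assume "w \<in> Ux z R V" thus "{w} \<notin> V" using noC UC by blast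
 next
  show "z \<in> R \<or> (\<exists>u\<in>Ux z R V. \<exists>y\<in>R. {u, y} \<in> V)" using y1 by (auto split: if_splits)
 qed
 obtain y1 where y1: "y1 \<in> R" "y1 \<in> ?C" "if z \<in> R then y1 = z else \<exists>u\<in>Ux z R V. {u, y1} \<in> V" using y1 by blast
 obtain y2 where y2: "y2 \<in> R" "y2 \<in> cl ?V b'" "{y2} \<in> V \<or> (\<exists>u. u \<notin> R \<and> u \<notin> Ux z R V \<and> {u, y2} \<in> V \<and> hits u (V - touch R))"
  using y2 by blast
 have "y1 \<noteq> y2" using y1 disj[OF y2(2)] by blast
 thus ?thesis using re y1(1,3) y2(1,3) hU[OF y2(2)] by blast
qed

section \<open>Reconnection inside a finite region and factorisation at a cut vertex\<close>

context lf_graph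
begin

definition Idx :: "'v set set" where "Idx = EG \<union> greens"

definition EA :: "'v set \<Rightarrow> 'v set set" where "EA A = {i \<in> EG. i \<subseteq> A}"

lemma Idx_adj: "{s, t} \<in> Idx \<Longrightarrow> s \<noteq> t \<Longrightarrow> adj s t"
 unfolding Idx_def edges_def using adj_sym by (auto simp: doubleton_eq_iff)

lemma conn_cl:
 assumes "conn A" "u \<in> A" "v \<in> A" "EA A \<subseteq> V"
 shows "v \<in> cl V u"
proof -
 have "Arel \<inter> A \<times> A \<subseteq> Rw V"
  using assms(4) by (auto simp: Rw_def EA_def edges_def)
 moreover have "(u, v) \<in> (Arel \<inter> A \<times> A)\<^sup>*" using assms by (auto simp: conn_def)
 ultimately have "(u, v) \<in> (Rw V)\<^sup>*" using rtrancl_mono[THEN subsetD] by metis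
 thus ?thesis by (simp add: cl_def)
qed

lemma edge_not_green: "i \<in> EG \<Longrightarrow> i \<notin> greens"
 by (erule edgesE) (auto simp: doubleton_eq_iff)

text \<open>The reconnection step: after closing everything that touches \<open>R\<close>, the two sides are joined
 through \<open>e\<close> alone.\<close>
lemma core_surgery:
 assumes V: "V \<subseteq> I" "I \<subseteq> Idx" and I: "EA R \<subseteq> I"
  and lnk: "link R e y1 y2" and re: "\<And>w. w \<in> Ux z R V \<Longrightarrow> {w} \<notin> V"
  and y1: "if z \<in> R then y1 = z else \<exists>u\<in>Ux z R V. {u, y1} \<in> V"
  and y2: "X = {{y2}} \<and> {y2} \<in> I \<or> (\<exists>u. X = {{u, y2}} \<and> u \<notin> R \<and> u \<notin> Ux z R V \<and> {u, y2} \<in> V \<and> hits u (V - touch R))"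
 shows "\<exists>V'\<subseteq>I. V' - (I \<inter> touch R) = V - (I \<inter> touch R) \<and> piv (hits z) e V' \<and> V' \<inter> (I \<inter> touch R) \<inter> greens \<subseteq> X \<inter> greens"
 using lnk
proof (rule linkE)
 fix A1 A2 c d
 assume A: "A1 \<subseteq> R" "A2 \<subseteq> R" "A1 \<inter> A2 = {}" "conn A1" "conn A2"
   "e = {c, d}" "adj c d" "y1 \<in> A1" "c \<in> A1" "y2 \<in> A2" "d \<in> A2"
 \<comment> \<open>The single open edge by which the explored part is attached to its entry vertex
   \<open>y1\<close>; none is required when \<open>z\<close> itself is the entry.\<close>
 obtain X1 where X1: "if z \<in> R then X1 = {} \<and> y1 = z else \<exists>u\<in>Ux z R V. X1 = {{u, y1}} \<and> {u, y1} \<in> V"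
  using y1 by (cases "z \<in> R") auto
 have y12: "y1 \<in> R" "y2 \<in> R" using A by auto
 have X1t: "X1 \<subseteq> touch R" "X1 \<subseteq> I" using X1 y12 V by (auto simp: touch_def split: if_splits)
 have Xt: "X \<subseteq> touch R" "X \<subseteq> I" using y2 y12 V by (auto simp: touch_def)
 have EAt: "EA A1 \<subseteq> touch R" "EA A2 \<subseteq> touch R" "EA A1 \<subseteq> I" "EA A2 \<subseteq> I"
 proof -
  have "i \<inter> R \<noteq> {}" if "i \<in> EA R" for i using that edgesE unfolding EA_def by blast
  moreover have "EA A1 \<subseteq> EA R" "EA A2 \<subseteq> EA R" using A by (auto simp: EA_def)
  ultimately show "EA A1 \<subseteq> touch R" "EA A2 \<subseteq> touch R" "EA A1 \<subseteq> I" "EA A2 \<subseteq> I" using I by (auto simp: touch_def)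
 qed
 \<comment> \<open>\<open>X\<close> is the single index through which \<open>y2\<close> gets access
   to the ghost: its own ghost index, or an edge to a vertex \<open>u\<close> that sees the ghost
   off \<open>R\<close>. Everything else touching \<open>R\<close>, apart from the two arms and
   \<open>X1\<close>, is closed.\<close>
 define V' where "V' = (V - touch R) \<union> X1 \<union> EA A1 \<union> EA A2 \<union> X"
 have sub: "V' \<subseteq> I" using V X1t Xt EAt by (auto simp: V'_def)
 have diff: "V' - (I \<inter> touch R) = V - (I \<inter> touch R)" using V X1t Xt EAt by (auto simp: V'_def)
 have UxR: "Ux z R V \<inter> R = {}" using Ux_out[of z R V] by (cases "z \<in> R") (auto simp: Ux_def)
 \<comment> \<open>The explored part and the first arm: an enclosure for the cluster of
   \<open>z\<close> once \<open>e\<close> is closed, without any open ghost index.\<close>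
 define T where "T = Ux z R V \<union> A1"
 have green: "V' \<inter> (I \<inter> touch R) \<inter> greens \<subseteq> X \<inter> greens"
 proof
  fix i assume i: "i \<in> V' \<inter> (I \<inter> touch R) \<inter> greens"
  have "i \<notin> EA A1" "i \<notin> EA A2" using i edge_not_green by (auto simp: EA_def)
  moreover have "i \<notin> X1"
  proof
   assume "i \<in> X1"
   then obtain u where "u \<in> Ux z R V" "i = {u, y1}" using X1 by (auto split: if_splits)
   moreover from this have "u \<noteq> y1" using UxR y12 by auto
   ultimately show False using i by (auto simp: doubleton_eq_iff)
  qed
  ultimately show "i \<in> X \<inter> greens" using i by (auto simp: V'_def)
 qed
 have up: "hits z (insert e V')"
 proof -
  let ?w = "insert e V'"
  have z1: "y1 \<in> cl ?w z"
  proof (cases "z \<in> R")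
   case False
   then obtain u where u: "u \<in> cl (V - touch R) z" "{u, y1} \<in> ?w" using X1 by (auto simp: V'_def Ux_def)
   have "cl (V - touch R) z \<subseteq> cl ?w z" by (rule cl_mono) (auto simp: V'_def)
   thus ?thesis using u cl_step[of u ?w z y1] by auto
  qed (use X1 in auto)
  have "c \<in> cl ?w y1" by (rule conn_cl[OF A(4,8,9)]) (auto simp: V'_def)
  hence "c \<in> cl ?w z" by (rule cl_trans[OF z1])
  hence "d \<in> cl ?w z" using cl_step[of c ?w z d] A(6) by auto
  moreover have "y2 \<in> cl ?w d" by (rule conn_cl[OF A(5,11,10)]) (auto simp: V'_def)
  ultimately have y2z: "y2 \<in> cl ?w z" by (rule cl_trans)
  from y2 show ?thesis
  proof
   assume "X = {{y2}} \<and> {y2} \<in> I"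
   hence "{y2} \<in> ?w" by (auto simp: V'_def)
   thus ?thesis using y2z by (auto simp: hits_def)
  next
   assume "\<exists>u. X = {{u, y2}} \<and> u \<notin> R \<and> u \<notin> Ux z R V \<and> {u, y2} \<in> V \<and> hits u (V - touch R)"
   then obtain u where u: "X = {{u, y2}}" "hits u (V - touch R)" by blast
   have "{y2, u} \<in> ?w" using u by (auto simp: V'_def insert_commute)
   hence "u \<in> cl ?w z" using cl_step[OF y2z] by blast
   moreover have "hits u ?w" using hits_mono[OF _ u(2), of ?w] by (auto simp: V'_def)
   ultimately show ?thesis by (rule hits_cl)
  qed
 qed
 have "cl (V' - {e}) z \<subseteq> T"
 proof (rule cl_subI)
  show "z \<in> T" using X1 A by (auto simp: T_def Ux_def split: if_splits)
  fix s t assume s: "s \<in> T" "{s, t} \<in> V' - {e}"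
  then consider "{s, t} \<in> V - touch R" | "{s, t} \<in> X1" | "{s, t} \<in> EA A1" | "{s, t} \<in> EA A2" | "{s, t} \<in> X"
   by (auto simp: V'_def)
  thus "t \<in> T"
  proof cases
   case 1
   hence "s \<notin> R" by (auto simp: touch_def)
   hence "s \<in> Ux z R V" using s A by (auto simp: T_def)
   hence "t \<in> Ux z R V" using 1 cl_step[of s "V - touch R" z t] by (auto simp: Ux_def split: if_splits)
   thus ?thesis by (simp add: T_def)
  next
   case 2
   then obtain u where "u \<in> Ux z R V" "{s, t} = {u, y1}" using X1 by (auto split: if_splits)
   thus ?thesis using A by (auto simp: T_def doubleton_eq_iff)
  next
   case 3
   thus ?thesis by (auto simp: T_def EA_def)
  next
   case 4
   hence "s \<in> A2" by (auto simp: EA_def)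
   thus ?thesis using s A UxR by (auto simp: T_def)
  next
   case 5
   from y2 show ?thesis
   proof
    assume "X = {{y2}} \<and> {y2} \<in> I"
    hence "s = y2" using 5 by auto
    thus ?thesis using s A UxR by (auto simp: T_def)
   next
    assume "\<exists>u. X = {{u, y2}} \<and> u \<notin> R \<and> u \<notin> Ux z R V \<and> {u, y2} \<in> V \<and> hits u (V - touch R)"
    then obtain u where "{s, t} = {u, y2}" "u \<notin> R" "u \<notin> Ux z R V" using 5 by auto
    hence "s = u \<or> s = y2" by (auto simp: doubleton_eq_iff)
    thus ?thesis using s A UxR \<open>u \<notin> R\<close> \<open>u \<notin> Ux z R V\<close> by (auto simp: T_def)
   qed
  qed
 qed
 moreover have "{w} \<notin> V'" if w: "w \<in> T" for w
 proof
  assume "{w} \<in> V'"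
  show False
  proof (cases "w \<in> R")
   case True
   hence "{w} \<in> X" using green \<open>{w} \<in> V'\<close> sub by (auto simp: touch_def)
   hence "w = y2" using y2 by (auto simp: doubleton_eq_iff)
   thus False using w A UxR by (auto simp: T_def)
  next
   case False
   hence "w \<in> Ux z R V" using w A by (auto simp: T_def)
   moreover have "{w} \<notin> touch R" using False by (auto simp: touch_def)
   hence "{w} \<in> V" using \<open>{w} \<in> V'\<close> X1t Xt EAt by (auto simp: V'_def)
   ultimately show False using re by blast
  qed
 qed
 ultimately have "\<not> hits z (V' - {e})" by (auto simp: hits_def)
 hence "piv (hits z) e V'" using up by (simp add: piv_def)
 thus ?thesis using sub diff green by blast
qed

text \<open>Since \<open>x\<close> is the only gate to \<open>K\<close>, a connection to the ghost
  is completed in front or goes through \<open>x\<close>. The front events read only indices off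
  \<open>touch K\<close> and the last one only indices in \<open>touch K\<close>, which is what
  \<open>M_decomp\<close> turns into a product.\<close>

lemma side_hits:
 assumes s: "side x K" "z \<notin> K" and V: "V \<subseteq> Idx"
 shows "hits z V \<longleftrightarrow> hits z (V - touch K) \<or> (x \<in> cl (V - touch K) z \<and> hits x (V \<inter> touch K))"
proof
 let ?C = "cl (V - touch K) z"
 have CK: "?C \<subseteq> - K" by (rule cl_subI) (use s in "auto simp: touch_def")
 define T where "T = ?C \<union> {v \<in> K. x \<in> ?C \<and> v \<in> cl (V \<inter> touch K) x}"
 have "cl V z \<subseteq> T"
 proof (rule cl_subI)
  show "z \<in> T" by (simp add: T_def)
  fix s' t assume st: "s' \<in> T" "{s', t} \<in> V"
  show "t \<in> T"
  proof (cases "s' = t")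
   case False
   hence adj: "adj s' t" using Idx_adj st V by blast
   show ?thesis
   proof (cases "s' \<in> K")
    case True
    hence x: "x \<in> ?C" "s' \<in> cl (V \<inter> touch K) x" using st CK by (auto simp: T_def)
    have "{s', t} \<in> V \<inter> touch K" using st True by (auto simp: touch_def)
    with x(2) have "t \<in> cl (V \<inter> touch K) x" by (rule cl_step)
    moreover have "t \<in> K \<or> t = x" using True adj s by (auto simp: side_def)
    ultimately show ?thesis using x by (auto simp: T_def)
   next
    case nK: False
    hence C: "s' \<in> ?C" using st by (auto simp: T_def)
    show ?thesis
    proof (cases "t \<in> K")
     case True
     hence "s' = x" using nK adj s side_out_closed[of x K s' t] by auto
     moreover have "{s', t} \<in> V \<inter> touch K" using st True by (auto simp: touch_def)
     ultimately have "t \<in> cl (V \<inter> touch K) x" using cl_step[of x "V \<inter> touch K" x t] by auto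
     thus ?thesis using True C \<open>s' = x\<close> by (auto simp: T_def)
    next
     case False
     hence "{s', t} \<in> V - touch K" using st nK by (auto simp: touch_def)
     thus ?thesis using cl_step[OF C] by (auto simp: T_def)
    qed
   qed
  qed (use st in simp)
 qed
 moreover assume "hits z V"
 then obtain w where w: "w \<in> cl V z" "{w} \<in> V" by (auto simp: hits_def)
 ultimately have "w \<in> T" by blast
 thus "hits z (V - touch K) \<or> (x \<in> ?C \<and> hits x (V \<inter> touch K))"
 proof (cases "w \<in> K")
  case True
  hence "x \<in> ?C" "w \<in> cl (V \<inter> touch K) x" using \<open>w \<in> T\<close> CK by (auto simp: T_def)
  moreover have "{w} \<in> V \<inter> touch K" using w True by (auto simp: touch_def)
  ultimately show ?thesis by (auto simp: hits_def)
 next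
  case False
  hence "w \<in> ?C" "{w} \<in> V - touch K" using \<open>w \<in> T\<close> w by (auto simp: T_def touch_def)
  thus ?thesis by (auto simp: hits_def)
 qed
next
 assume "hits z (V - touch K) \<or> (x \<in> cl (V - touch K) z \<and> hits x (V \<inter> touch K))"
 thus "hits z V"
 proof
  assume "hits z (V - touch K)" thus ?thesis by (rule hits_mono[rotated]) auto
 next
  assume *: "x \<in> cl (V - touch K) z \<and> hits x (V \<inter> touch K)"
  have "x \<in> cl V z" using * cl_mono[of "V - touch K" V z] by auto
  moreover have "hits x V" using * hits_mono[of "V \<inter> touch K" V x] by auto
  ultimately show ?thesis by (rule hits_cl)
 qed
qed

lemma side_hits_inside:
 assumes s: "side x K" "z \<in> K" and V: "V \<subseteq> Idx" and h: "hits z V"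
 shows "hits z (V \<inter> touch K) \<or> (x \<in> cl (V \<inter> touch K) z \<and> hits x (V - touch K))"
proof -
 let ?C = "cl (V \<inter> touch K) z"
 have CK: "?C \<subseteq> insert x K"
 proof (rule cl_subI)
  fix s' t assume st: "s' \<in> insert x K" "{s', t} \<in> V \<inter> touch K"
  show "t \<in> insert x K"
  proof (cases "s' = t")
   case False
   hence "adj s' t" using Idx_adj st V by blast
   thus ?thesis using st s by (auto simp: side_def touch_def)
  qed (use st in simp)
 qed (use s in simp)
 define T where "T = ?C \<union> {v. x \<in> ?C \<and> v \<in> cl (V - touch K) x}"
 have xK: "cl (V - touch K) x \<subseteq> - K" by (rule cl_subI) (use s in "auto simp: touch_def side_def")
 have "cl V z \<subseteq> T"
 proof (rule cl_subI)
  show "z \<in> T" by (simp add: T_def)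
  fix s' t assume st: "s' \<in> T" "{s', t} \<in> V"
  show "t \<in> T"
  proof (cases "s' \<in> ?C")
   case True
   show ?thesis
   proof (cases "{s', t} \<in> touch K")
    case T: True
    hence "{s', t} \<in> V \<inter> touch K" using st by simp
    thus ?thesis using cl_step[OF True] by (auto simp: T_def)
   next
    case False
    hence "s' = x" using True CK by (auto simp: touch_def)
    moreover have "{s', t} \<in> V - touch K" using st False by simp
    ultimately have "t \<in> cl (V - touch K) x" using cl_step[of x "V - touch K" x t] by auto
    thus ?thesis using True \<open>s' = x\<close> by (auto simp: T_def)
   qed
  next
   case False
   hence *: "x \<in> ?C" "s' \<in> cl (V - touch K) x" using st by (auto simp: T_def)
   show ?thesis
   proof (cases "{s', t} \<in> touch K")
    case True
    have "s' \<notin> K" using * xK by auto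
    hence "t \<in> K" "s' \<noteq> t" using True by (auto simp: touch_def)
    hence "adj s' t" using Idx_adj st V by blast
    hence "s' = x" using \<open>s' \<notin> K\<close> \<open>t \<in> K\<close> side_out_closed[of x K s' t] s by auto
    thus ?thesis using False * by auto
   next
    case nT: False
    hence "{s', t} \<in> V - touch K" using st by simp
    thus ?thesis using cl_step[OF *(2)] * by (auto simp: T_def)
   qed
  qed
 qed
 moreover obtain w where w: "w \<in> cl V z" "{w} \<in> V" using h by (auto simp: hits_def)
 ultimately have wT: "w \<in> T" by blast
 show ?thesis
 proof (cases "w \<in> K")
  case True
  hence "w \<in> ?C" using wT xK by (auto simp: T_def)
  moreover have "{w} \<in> V \<inter> touch K" using w True by (auto simp: touch_def)
  ultimately show ?thesis by (auto simp: hits_def)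
 next
  case False
  hence nt: "{w} \<in> V - touch K" using w by (auto simp: touch_def)
  have "x \<in> ?C \<and> w \<in> cl (V - touch K) x"
  proof (cases "w \<in> ?C")
   case True
   hence "w = x" using CK False by auto
   thus ?thesis using True by simp
  qed (use wT in "auto simp: T_def")
  thus ?thesis using nt by (auto simp: hits_def)
 qed
qed

lemma side_piv:
 assumes s: "side x K" "z \<notin> K" and V: "V \<subseteq> Idx" "e \<in> Idx" "e \<in> touch K"
  and D: "Dev z x (V - touch K)" and p: "piv (hits x) e (V \<inter> touch K)"
 shows "piv (hits z) e V"
proof -
 have 1: "insert e V - touch K = V - touch K" "insert e V \<inter> touch K = insert e (V \<inter> touch K)"
  "V - {e} - touch K = V - touch K" "(V - {e}) \<inter> touch K = V \<inter> touch K - {e}" using V by auto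
 have "hits z (insert e V)"
  using side_hits[OF s, of "insert e V"] V D p unfolding 1 Dev_def piv_def by auto
 moreover have "\<not> hits z (V - {e})"
  using side_hits[OF s, of "V - {e}"] V D p unfolding 1 Dev_def piv_def by auto
 ultimately show ?thesis by (simp add: piv_def)
qed

end

lemma Ev_reindex:
 assumes "finite I" "inj g"
 shows "Ev (g ` I) P G = Ev I (\<lambda>i. P (g i)) (\<lambda>V. G (g ` V))"
 using assms(1)
proof (induction I arbitrary: G rule: finite_induct)
 case (insert i I)
 have "g i \<notin> g ` I" using insert.hyps assms(2) by (auto dest: injD)
 thus ?case using insert by (simp add: Ev_insert)
qed simp

lemma PR_reindex:
 assumes "finite I" "inj g"
 shows "PR (g ` I) P A = PR I (\<lambda>i. P (g i)) (\<lambda>V. A (g ` V))"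
 unfolding PR_def by (rule Ev_reindex[OF assms])

lemma PR_none:
 assumes "finite I" "S \<subseteq> I"
 shows "PR I P (\<lambda>V. \<forall>i\<in>S. i \<notin> V) = (\<Prod>i\<in>S. 1 - P i)"
proof -
 have fS: "finite S" using assms finite_subset by blast
 have "PR I P (\<lambda>V. \<forall>i\<in>S. i \<notin> V) = PR I P (\<lambda>V. V \<inter> S = {})"
  by (rule PR_cong) auto
 also have "\<dots> = PR (I \<inter> S) P (\<lambda>\<nu>. \<nu> = {})"
  by (rule PR_restrict[OF assms(1)])
 also have "I \<inter> S = S" using assms by auto
 also have "PR S P (\<lambda>\<nu>. \<nu> = {}) = wt S P {}"
 proof -
  have "(\<Sum>V\<in>Pow S. wt S P V * of_bool (V = {})) = (\<Sum>V\<in>{{}}. wt S P V * of_bool (V = {}))"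
   using fS by (intro sum.mono_neutral_right) auto
  thus ?thesis by (simp add: PR_def Ev_def)
 qed
 finally show ?thesis by (simp add: wt_def)
qed

section \<open>Separated patterns, densities and comparison of influences\<close>

context lf_graph
begin

definition near :: "nat \<Rightarrow> 'v set \<Rightarrow> 'v set \<Rightarrow> bool" where
 "near L e e' \<longleftrightarrow> (\<exists>v\<in>e. \<exists>w\<in>e'. w \<in> ball L v)"

definition sep :: "nat \<Rightarrow> 'v set set \<Rightarrow> bool" where
 "sep L S \<longleftrightarrow> (\<forall>e\<in>S. \<forall>e'\<in>S. e \<noteq> e' \<longrightarrow> \<not> near L e e')"

lemma near_sym: "near L e e' \<Longrightarrow> near L e' e"
 unfolding near_def using ball_sym by blast

lemma near_aut: "H \<in> Aut \<Longrightarrow> near L (H ` e) (H ` e') \<longleftrightarrow> near L e e'"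
 unfolding near_def using ball_aut[of H L] aut_mem[of H] by (auto simp flip: ball_aut)

lemma edge_in_ball:
 assumes "e \<in> EG" "v \<in> e"
 shows "e \<subseteq> ball (Suc 0) v"
proof -
 obtain c d where cd: "e = {c, d}" "adj c d" "c \<noteq> d" using assms(1) by (erule edgesE)
 have "c \<in> ball (Suc 0) d" "d \<in> ball (Suc 0) c" using ball_adj[OF cd(2)] ball_adj[OF adj_sym[OF cd(2)]] by auto
 thus ?thesis using cd assms(2) by auto
qed

lemma edge_in_ball_Suc:
 assumes "e \<in> EG" "e \<inter> ball n v \<noteq> {}"
 shows "e \<subseteq> ball (Suc n) v"
proof
 fix w assume w: "w \<in> e"
 obtain u where u: "u \<in> e" "u \<in> ball n v" using assms(2) by blast
 have "w \<in> ball (Suc 0) u" using edge_in_ball[OF assms(1) u(1)] w by blast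
 thus "w \<in> ball (Suc n) v" using ball_trans[OF u(2), of w "Suc 0"] by simp
qed

text \<open>Maximality will give density, because a rejected candidate is near a member. Conflicts
  concern pairs of edges only, so unions of chains remain separated and Zorn's lemma applies to
  infinitely many candidates.\<close>

lemma sep_maximal:
 assumes "sep L S0"
 shows "\<exists>S. S0 \<subseteq> S \<and> S \<subseteq> S0 \<union> F \<and> sep L S \<and> (\<forall>e\<in>F. e \<in> S \<or> (\<exists>e'\<in>S. near L e e'))"
proof -
 define \<A> where "\<A> = {S. S0 \<subseteq> S \<and> S \<subseteq> S0 \<union> F \<and> sep L S}"
 have "\<exists>M\<in>\<A>. \<forall>X\<in>\<A>. M \<subseteq> X \<longrightarrow> X = M"
 proof (rule subset_Zorn_nonempty)
  show "\<A> \<noteq> {}" using assms by (auto simp: \<A>_def)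
  fix C assume C: "C \<noteq> {}" "subset.chain \<A> C"
  have sub: "C \<subseteq> \<A>" and ch: "\<And>X Y. X \<in> C \<Longrightarrow> Y \<in> C \<Longrightarrow> X \<subseteq> Y \<or> Y \<subseteq> X"
   using C(2) by (auto simp: subset_chain_def)
  have "sep L (\<Union>C)" unfolding sep_def
  proof (intro ballI impI)
   fix e e' assume e: "e \<in> \<Union>C" "e' \<in> \<Union>C" "e \<noteq> e'"
   then obtain X Y where XY: "X \<in> C" "Y \<in> C" "e \<in> X" "e' \<in> Y" by blast
   then obtain W where "W \<in> C" "e \<in> W" "e' \<in> W" using ch[OF XY(1,2)] by blast
   moreover from this have "sep L W" using sub by (auto simp: \<A>_def)
   ultimately show "\<not> near L e e'" using e(3) by (auto simp: sep_def)
  qed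
  moreover have "S0 \<subseteq> \<Union>C" "\<Union>C \<subseteq> S0 \<union> F" using C(1) sub by (auto simp: \<A>_def)
  ultimately show "\<Union>C \<in> \<A>" by (simp add: \<A>_def)
 qed
 then obtain M where M: "M \<in> \<A>" "\<And>X. X \<in> \<A> \<Longrightarrow> M \<subseteq> X \<Longrightarrow> X = M" by blast
 have "e \<in> M \<or> (\<exists>e'\<in>M. near L e e')" if e: "e \<in> F" for e
 proof (rule ccontr)
  assume n: "\<not> ?thesis"
  have "sep L (insert e M)" unfolding sep_def
  proof (intro ballI impI)
   fix a b assume ab: "a \<in> insert e M" "b \<in> insert e M" "a \<noteq> b"
   have "sep L M" using M by (simp add: \<A>_def)
   thus "\<not> near L a b" using ab n near_sym[of L a e] unfolding sep_def by blast
  qed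
  hence "insert e M \<in> \<A>" using M(1) e by (auto simp: \<A>_def)
  hence "insert e M = M" by (rule M(2)) auto
  thus False using n by blast
 qed
 thus ?thesis using M(1) by (intro exI[of _ M]) (simp add: \<A>_def)
qed

definition IB :: "nat \<Rightarrow> 'v \<Rightarrow> 'v set set" where
 "IB n v = {i \<in> Idx. i \<subseteq> ball n v}"

lemma finite_IB [simp]: "finite (IB n v)"
 unfolding IB_def by (rule finite_subset[of _ "Pow (ball n v)"]) auto

lemma IB_sub_Idx: "IB n v \<subseteq> Idx" by (auto simp: IB_def)

lemma IB_mono: "m \<le> n \<Longrightarrow> IB m v \<subseteq> IB n v"
 unfolding IB_def using ball_mono[of m n v] by blast

lemma touch_IB:
 assumes "R \<subseteq> ball n v"
 shows "Idx \<inter> touch R \<subseteq> IB (Suc n) v"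
proof
 fix i assume i: "i \<in> Idx \<inter> touch R"
 then obtain u where u: "u \<in> i" "u \<in> ball n v" using assms by (auto simp: touch_def)
 have "i \<subseteq> ball (Suc n) v"
 proof (cases "i \<in> EG")
  case True
  thus ?thesis using edge_in_ball_Suc[of i n v] u by blast
 next
  case False
  hence "i = {u}" using i u by (auto simp: Idx_def)
  thus ?thesis using u ball_mono[of n "Suc n" v] by auto
 qed
 thus "i \<in> IB (Suc n) v" using i by (simp add: IB_def)
qed

text \<open>In a merely connected region only the entry vertex can be prescribed; the exit is the
  far endpoint of \<open>e\<close> as seen by a path from \<open>y\<close>. This is enough when a
  ghost index may be opened at the exit.\<close>

lemma link_to_edge:
 assumes R: "conn R" "e \<subseteq> R" "e \<in> EG" "y \<in> R"
 shows "\<exists>d\<in>R. link R e y d"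
proof -
 obtain c d where e: "e = {c, d}" "adj c d" "c \<noteq> d" using R(3) by (erule edgesE)
 show ?thesis
 proof (cases "y \<in> e")
  case True
  show ?thesis
  proof (cases "y = c")
   case yc: True
   have "link R e y d" by (rule linkI[of "{c}" R "{d}" e c d]) (use yc e R in auto)
   thus ?thesis using e R by blast
  next
   case False
   hence "y = d" using True e by auto
   hence "link R e y c" by (intro linkI[of "{d}" R "{c}" e d c]) (use e R adj_sym[OF e(2)] in auto)
   thus ?thesis using e R by blast
  qed
 next
  case False
  let ?r = "Arel \<inter> R \<times> R" and ?q = "(Arel \<inter> R \<times> R) \<inter> (- e) \<times> (- e)"
  have "(y, c) \<in> ?r\<^sup>*" using R e unfolding conn_def by blast
  hence "y \<in> e \<or> (\<exists>u w. (y, u) \<in> ?q\<^sup>* \<and> u \<notin> e \<and> (u, w) \<in> ?r \<and> w \<in> e \<and> (w, c) \<in> ?r\<^sup>*)"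
   by (rule first_hit) (simp add: e)
  then obtain u w where uw: "(y, u) \<in> ?q\<^sup>*" "u \<notin> e" "(u, w) \<in> ?r" "w \<in> e" using False by blast
  define L where "L = {v. (y, v) \<in> ?q\<^sup>*}"
  have LR: "L \<subseteq> R - e"
  proof
   fix v assume "v \<in> L"
   hence "(y, v) \<in> ?q\<^sup>*" by (simp add: L_def)
   thus "v \<in> R - e" by (rule rtrancl_closed) (use R False in auto)
  qed
  have yv: "(y, v) \<in> (Arel \<inter> L \<times> L)\<^sup>*" if "v \<in> L" for v
  proof -
   have "(y, v) \<in> ?q\<^sup>*" using that by (simp add: L_def)
   thus ?thesis
   proof (induction rule: rtrancl_induct)
    case (step s t)
    have "s \<in> L" using step(1) by (simp add: L_def)
    moreover have "t \<in> L" using rtrancl_into_rtrancl[OF step(1,2)] by (simp add: L_def)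
    ultimately have "(s, t) \<in> Arel \<inter> L \<times> L" using step(2) by auto
    with step.IH show ?case by (rule rtrancl_into_rtrancl)
   qed simp
  qed
  have "conn L" unfolding conn_def
  proof (intro ballI)
   fix s t assume "s \<in> L" "t \<in> L"
   have "(s, y) \<in> (Arel \<inter> L \<times> L)\<^sup>*"
    using sym_rtrancl[OF sym_Arel_on[of L]] yv[OF \<open>s \<in> L\<close>] by (rule symD)
   thus "(s, t) \<in> (Arel \<inter> L \<times> L)\<^sup>*" using yv[OF \<open>t \<in> L\<close>] by (rule rtrancl_trans)
  qed
  moreover have "u \<in> L" "y \<in> L" using uw by (auto simp: L_def)
  moreover have "adj u w" using uw by auto
  ultimately have cL: "conn (insert w L)" by (intro conn_insert)
  obtain w' where w': "e = {w, w'}" "adj w w'" "w \<noteq> w'" using e uw(4) adj_sym[OF e(2)] by auto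
  have "link R e y w'"
   by (rule linkI[of "insert w L" R "{w'}" e w w']) (use cL w' LR R \<open>y \<in> L\<close> in auto)
  thus ?thesis using w' R by blast
 qed
qed

definition Pm :: "'v set set \<Rightarrow> real \<Rightarrow> real \<Rightarrow> real \<Rightarrow> 'v set \<Rightarrow> real" where
 "Pm S p r h i = (if i \<in> greens then h else if i \<in> S then r else p)"

definition okp :: "real \<Rightarrow> real \<Rightarrow> real \<Rightarrow> real \<Rightarrow> bool" where
 "okp a p r h \<longleftrightarrow> 0 < a \<and> a \<le> p \<and> p \<le> 1 - a \<and> a \<le> r \<and> r \<le> 1 - a \<and> 0 < h \<and> h \<le> 1/2"

abbreviation HP :: "nat \<Rightarrow> 'v set set \<Rightarrow> real \<Rightarrow> real \<Rightarrow> real \<Rightarrow> 'v \<Rightarrow> real" where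
 "HP N S p r h z \<equiv> PR (IB N z) (Pm S p r h) (hits z)"

abbreviation QP :: "nat \<Rightarrow> 'v set set \<Rightarrow> real \<Rightarrow> real \<Rightarrow> real \<Rightarrow> 'v \<Rightarrow> 'v set \<Rightarrow> real" where
 "QP N S p r h z f \<equiv> PR (IB N z) (Pm S p r h) (piv (hits z) f)"

lemma okp_pv: "okp a p r h \<Longrightarrow> pv (Pm S p r h)"
 unfolding okp_def pv_def Pm_def by auto

lemma okp_edge: "okp a p r h \<Longrightarrow> i \<notin> greens \<Longrightarrow> a \<le> Pm S p r h i \<and> Pm S p r h i \<le> 1 - a"
 unfolding okp_def Pm_def by auto

lemma okp_a: "okp a p r h \<Longrightarrow> 0 < a \<and> a \<le> 1" unfolding okp_def by auto

abbreviation ngr :: "'v set set \<Rightarrow> 'v set set \<Rightarrow> 'v set \<Rightarrow> nat" where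
 "ngr X I R \<equiv> card (X \<inter> (I \<inter> touch R) \<inter> greens)"

lemma surg:
 assumes I: "finite I" "I \<subseteq> Idx" and R: "R \<subseteq> ball n v" "card (IB (Suc n) v) \<le> N" and ok: "okp a p r h"
  and AB: "\<And>V. V \<subseteq> I \<Longrightarrow> A V \<Longrightarrow>
    \<exists>V'\<subseteq>I. V' - (I \<inter> touch R) = V - (I \<inter> touch R) \<and> B V' \<and>
     ngr V' I R \<le> ngr V I R"
 shows "PR I (Pm S p r h) A \<le> (2/a) ^ N * PR I (Pm S p r h) B"
proof (rule surgery[where Z = "I \<inter> touch R" and G = greens and h = h])
 have "card (I \<inter> touch R) \<le> card (IB (Suc n) v)"
  using touch_IB[OF R(1)] I by (intro card_mono) auto
 thus "card (I \<inter> touch R) \<le> N" using R(2) by simp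
 show "pv (Pm S p r h)" by (rule okp_pv[OF ok])
 show "Pm S p r h i = h" if "i \<in> I \<inter> touch R \<inter> greens" for i using that by (simp add: Pm_def)
 show "a \<le> Pm S p r h i \<and> Pm S p r h i \<le> 1 - a" if "i \<in> I \<inter> touch R - greens" for i
  using okp_edge[OF ok, of i] that by simp
qed (use ok I AB in "auto simp: okp_def")

text \<open>Ghost indices have density \<open>h\<close>, which will tend to 0, so surgery must not
  increase the number of open ones. The one at \<open>w\<close> pays for the one at
  \<open>y\<close>.\<close>

lemma green_card_one:
 assumes "finite I" "V' \<inter> (I \<inter> touch R) \<inter> greens \<subseteq> X \<inter> greens" "X = {{y}}"
  and "{w} \<in> V" "{w} \<in> I" "w \<in> R"
 shows "ngr V' I R \<le> ngr V I R"
proof -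
 have "ngr V' I R \<le> card {{y}}"
  using assms(2,3) by (intro card_mono) auto
 also have "\<dots> = card {{w}}" by simp
 also have "\<dots> \<le> ngr V I R"
  using assms by (intro card_mono) (auto simp: touch_def)
 finally show ?thesis .
qed

lemma green_card_zero:
 assumes "V' \<inter> (I \<inter> touch R) \<inter> greens \<subseteq> X \<inter> greens" "X = {{u, y}}" "u \<noteq> y"
 shows "ngr V' I R \<le> k"
proof -
 have "{u, y} \<notin> greens" using assms(3) by (auto simp: doubleton_eq_iff)
 hence "V' \<inter> (I \<inter> touch R) \<inter> greens = {}" using assms(1,2) by auto
 thus ?thesis by simp
qed

lemma piv_alpha:
 assumes I: "finite I" "I \<subseteq> Idx" "EA R \<subseteq> I" and R: "R \<subseteq> ball n v" "card (IB (Suc n) v) \<le> N"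
  and ok: "okp a p r h" and l: "linked R e" and f: "f \<in> EG" "f \<subseteq> R"
 shows "PR I (Pm S p r h) (piv (hits z) f) \<le> (2/a) ^ N * PR I (Pm S p r h) (piv (hits z) e)"
proof (rule surg[OF I(1,2) R ok])
 fix V assume V: "V \<subseteq> I" and p: "piv (hits z) f V"
 obtain c d where cd: "f = {c, d}" "adj c d" "c \<noteq> d" using f(1) by (erule edgesE)
 from piv_reaches[OF p cd(1,3) f(2)] obtain y1 y2 where re: "reaches z R V" and y: "y1 \<in> R" "y2 \<in> R" "y1 \<noteq> y2"
   and y1: "if z \<in> R then y1 = z else \<exists>u\<in>Ux z R V. {u, y1} \<in> V"
   and y2: "{y2} \<in> V \<or> (\<exists>u. u \<notin> R \<and> u \<notin> Ux z R V \<and> {u, y2} \<in> V \<and> hits u (V - touch R))"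
  by blast
 have lnk: "link R e y1 y2" by (rule linkedD(4)[OF l y])
 have nog: "\<And>w. w \<in> Ux z R V \<Longrightarrow> {w} \<notin> V" using re by (simp add: reaches_def)
 show "\<exists>V'\<subseteq>I. V' - (I \<inter> touch R) = V - (I \<inter> touch R) \<and> piv (hits z) e V' \<and>
     ngr V' I R \<le> ngr V I R"
 proof (cases "{y2} \<in> V")
  case True
  have "{{y2}} = {{y2}} \<and> {y2} \<in> I \<or> (\<exists>u. {{y2}} = {{u, y2}} \<and> u \<notin> R \<and> u \<notin> Ux z R V \<and> {u, y2} \<in> V \<and> hits u (V - touch R))"
   using True V by blast
  from core_surgery[OF V I(2,3) lnk nog y1 this] obtain V' where *: "V' \<subseteq> I" "V' - (I \<inter> touch R) = V - (I \<inter> touch R)"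
   "piv (hits z) e V'" "V' \<inter> (I \<inter> touch R) \<inter> greens \<subseteq> {{y2}} \<inter> greens" by blast
  have "ngr V' I R \<le> ngr V I R"
   by (rule green_card_one[OF I(1) *(4) refl True]) (use True V y in auto)
  thus ?thesis using * by blast
 next
  case False
  then obtain u where u: "u \<notin> R" "u \<notin> Ux z R V" "{u, y2} \<in> V" "hits u (V - touch R)" using y2 by blast
  hence "{{u, y2}} = {{y2}} \<and> {y2} \<in> I \<or> (\<exists>u'. {{u, y2}} = {{u', y2}} \<and> u' \<notin> R \<and> u' \<notin> Ux z R V \<and> {u', y2} \<in> V \<and> hits u' (V - touch R))"
   by blast
  from core_surgery[OF V I(2,3) lnk nog y1 this] obtain V' where *: "V' \<subseteq> I" "V' - (I \<inter> touch R) = V - (I \<inter> touch R)"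
   "piv (hits z) e V'" "V' \<inter> (I \<inter> touch R) \<inter> greens \<subseteq> {{u, y2}} \<inter> greens" by blast
  have "u \<noteq> y2" using u y by auto
  hence "ngr V' I R \<le> ngr V I R"
   by (rule green_card_zero[OF *(4) refl])
  thus ?thesis using * by blast
 qed
qed

text \<open>Behind a pivotal \<open>f\<close> the cluster is trapped in \<open>J\<close>, so its
  open ghost index lies in \<open>R\<close>. Closing it allows a new one to be opened at whichever
  endpoint of \<open>e\<close> is the far one.\<close>

lemma piv_dangling:
 assumes I: "finite I" "I \<subseteq> Idx" "EA R \<subseteq> I" "\<And>w. w \<in> R \<Longrightarrow> {w} \<in> I" and R: "R \<subseteq> ball n v" "card (IB (Suc n) v) \<le> N"
  and ok: "okp a p r h" and f: "f \<in> EG" "f \<subseteq> insert x J" and J: "side x J" "z \<notin> J" "insert x J \<subseteq> R" "conn R"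
  and e: "e \<in> EG" "e \<subseteq> R"
 shows "PR I (Pm S p r h) (piv (hits z) f) \<le> (2/a) ^ N * PR I (Pm S p r h) (piv (hits z) e)"
proof (rule surg[OF I(1,2) R ok])
 fix V assume V: "V \<subseteq> I" and p: "piv (hits z) f V"
 obtain c d where cd: "f = {c, d}" "adj c d" "c \<noteq> d" using f(1) by (erule edgesE)
 have fR: "f \<subseteq> R" using f J by blast
 from piv_reaches[OF p cd(1,3) fR] obtain y1 where re: "reaches z R V" and y: "y1 \<in> R"
   and y1: "if z \<in> R then y1 = z else \<exists>u\<in>Ux z R V. {u, y1} \<in> V"
  by blast
 have nog: "\<And>w. w \<in> Ux z R V \<Longrightarrow> {w} \<notin> V" using re by (simp add: reaches_def)
 let ?V = "V - {f}" and ?C = "cl (V - {f}) z"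
 obtain a' b' where ab: "f = {a', b'}" "a' \<in> ?C" "b' \<notin> ?C" "hits b' ?V"
  using piv_hits_edge[of z c d V] p cd by auto
 \<comment> \<open>With \<open>f\<close> removed, a cluster that meets \<open>J\<close> and avoids
   \<open>x\<close> remains in \<open>J\<close>. For the cluster of \<open>z\<close> this is
   impossible, so it contains \<open>x\<close>; the cluster beyond \<open>f\<close> then avoids
   \<open>x\<close> and is trapped.\<close>
 have stay: "cl ?V s \<subseteq> J" if s: "s \<in> J" "x \<notin> cl ?V s" for s
 proof -
  have "cl ?V s \<subseteq> J \<inter> cl ?V s"
  proof (rule cl_subI)
   fix u t assume u: "u \<in> J \<inter> cl ?V s" "{u, t} \<in> ?V"
   have t: "t \<in> cl ?V s" using cl_step[of u ?V s t] u by simp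
   hence "t \<noteq> x" using s by blast
   moreover have "t = u \<or> adj u t" using Idx_adj[of u t] u V I by blast
   ultimately show "t \<in> J \<inter> cl ?V s" using u t J(1) unfolding side_def by blast
  qed (use s in simp)
  thus ?thesis by blast
 qed
 have xC: "x \<in> ?C"
 proof (rule ccontr)
  assume x: "x \<notin> ?C"
  hence "a' \<in> J" using ab f by auto
  moreover have "cl ?V a' = ?C" by (rule cl_eq[OF ab(2)])
  ultimately have "?C \<subseteq> J" using stay[of a'] x by simp
  thus False using J(2) cl_self[of z ?V] by blast
 qed
 have "b' \<in> J" using ab f xC by auto
 moreover have "x \<notin> cl ?V b'"
 proof
  assume "x \<in> cl ?V b'"
  hence "b' \<in> cl ?V x" by (rule cl_sym)
  hence "b' \<in> ?C" by (rule cl_trans[OF xC])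
  thus False using ab by simp
 qed
 ultimately have "cl ?V b' \<subseteq> J" by (rule stay)
 then obtain w where w: "w \<in> J" "{w} \<in> V" using ab(4) by (auto simp: hits_def)
 have wR: "w \<in> R" using w J by blast
 obtain y2 where y2: "y2 \<in> R" "link R e y1 y2" using link_to_edge[OF J(4) e(2,1) y] by blast
 have "{{y2}} = {{y2}} \<and> {y2} \<in> I \<or> (\<exists>u. {{y2}} = {{u, y2}} \<and> u \<notin> R \<and> u \<notin> Ux z R V \<and> {u, y2} \<in> V \<and> hits u (V - touch R))"
  using I(4)[OF y2(1)] by blast
 from core_surgery[OF V I(2,3) y2(2) nog y1 this] obtain V' where *: "V' \<subseteq> I" "V' - (I \<inter> touch R) = V - (I \<inter> touch R)"
   "piv (hits z) e V'" "V' \<inter> (I \<inter> touch R) \<inter> greens \<subseteq> {{y2}} \<inter> greens" by blast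
 have "ngr V' I R \<le> ngr V I R"
  by (rule green_card_one[OF I(1) *(4) refl w(2) I(4)[OF wR] wR])
 thus "\<exists>V'\<subseteq>I. V' - (I \<inter> touch R) = V - (I \<inter> touch R) \<and> piv (hits z) e V' \<and>
     ngr V' I R \<le> ngr V I R" using * by blast
qed

lemma EA_two: "i \<in> EA R \<Longrightarrow> R \<subseteq> insert x K \<Longrightarrow> i \<in> touch K"
 unfolding EA_def touch_def by (auto elim!: edgesE)

text \<open>The start \<open>x\<close> lies in \<open>R\<close> and is itself the entry, while a
  connection to the ghost inside \<open>K\<close> supplies the exit. This converts a connection
  probability behind the cut vertex back into an influence of \<open>e\<close>.\<close>

lemma hits_piv_inside:
 assumes I: "finite I" "I \<subseteq> Idx" "EA R \<subseteq> I" and R: "R \<subseteq> ball n v" "card (IB (Suc n) v) \<le> N"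
  and ok: "okp a p r h" and K: "side x K" "R \<subseteq> insert x K" "x \<in> R" "\<forall>w\<in>K. adj x w \<longrightarrow> w \<in> R"
  and l: "\<forall>y\<in>R - {x}. link R e x y"
 shows "PR (I \<inter> touch K) (Pm S p r h) (hits x) \<le> (2/a) ^ N * PR (I \<inter> touch K) (Pm S p r h) (piv (hits x) e)"
proof (rule surg[OF _ _ R ok])
 let ?I = "I \<inter> touch K"
 show fI: "finite ?I" and II: "?I \<subseteq> Idx" using I by auto
 have EAI: "EA R \<subseteq> ?I" using I(3) EA_two[OF _ K(2)] by blast
 have xK: "x \<notin> K" using K by (simp add: side_def)
 fix V assume V: "V \<subseteq> ?I" and "hits x V"
 then obtain w where w: "w \<in> cl V x" "{w} \<in> V" by (auto simp: hits_def)
 have wK: "w \<in> K" using w V by (auto simp: touch_def)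
 have Ux: "Ux x R V = {}" using K by (simp add: Ux_def)
 have y2: "\<exists>y2\<in>R - {x}. {y2} \<in> V \<or> (\<exists>u. u \<notin> R \<and> {u, y2} \<in> V \<and> hits u (V - touch R))"
 proof (cases "w \<in> R")
  case True
  thus ?thesis using w wK xK by blast
 next
  case False
  have "x \<in> cl V w" using w(1) by (rule cl_sym)
  from first_hit_cl[OF this K(3)] False obtain u y where uy: "u \<in> cl (V - touch R) w" "u \<notin> R" "{u, y} \<in> V" "y \<in> R" by blast
  have "w \<in> cl (V - touch R) u" using uy(1) by (rule cl_sym)
  moreover have "{w} \<in> V - touch R" using False w by (auto simp: touch_def)
  ultimately have "hits u (V - touch R)" by (auto simp: hits_def)
  \<comment> \<open>An open edge from \<open>u\<close> outside \<open>R\<close> to \<open>x\<close>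
    would make \<open>u\<close> a neighbour of \<open>x\<close> in \<open>K\<close>, and all of
    these belong to \<open>R\<close>.\<close>
  moreover have "y \<noteq> x"
  proof
   assume yx: "y = x"
   have "u \<noteq> x" using uy K by blast
   hence "u \<in> K" using uy(3) V yx xK by (auto simp: touch_def)
   moreover have "{u, x} \<in> Idx" using uy(3) V I yx by blast
   hence "adj u x" using Idx_adj[of u x] \<open>u \<noteq> x\<close> by blast
   hence "adj x u" by (rule adj_sym)
   ultimately show False using K(4) uy(2) by blast
  qed
  ultimately show ?thesis using uy by blast
 qed
 then obtain y2 where y2: "y2 \<in> R - {x}" "{y2} \<in> V \<or> (\<exists>u. u \<notin> R \<and> {u, y2} \<in> V \<and> hits u (V - touch R))" by blast
 have lnk: "link R e x y2" using l y2 by blast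
 have nog: "\<And>w. w \<in> Ux x R V \<Longrightarrow> {w} \<notin> V" by (simp add: Ux)
 have y1: "if x \<in> R then x = x else \<exists>u\<in>Ux x R V. {u, x} \<in> V" by (simp add: K)
 show "\<exists>V'\<subseteq>?I. V' - (?I \<inter> touch R) = V - (?I \<inter> touch R) \<and> piv (hits x) e V' \<and>
     card (V' \<inter> (?I \<inter> touch R) \<inter> greens) \<le> card (V \<inter> (?I \<inter> touch R) \<inter> greens)"
 proof (cases "{y2} \<in> V")
  case True
  have "{{y2}} = {{y2}} \<and> {y2} \<in> ?I \<or> (\<exists>u. {{y2}} = {{u, y2}} \<and> u \<notin> R \<and> u \<notin> Ux x R V \<and> {u, y2} \<in> V \<and> hits u (V - touch R))"
   using True V by blast
  from core_surgery[OF V II EAI lnk nog y1 this] obtain V' where *: "V' \<subseteq> ?I" "V' - (?I \<inter> touch R) = V - (?I \<inter> touch R)"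
   "piv (hits x) e V'" "V' \<inter> (?I \<inter> touch R) \<inter> greens \<subseteq> {{y2}} \<inter> greens" by blast
  have "{y2} \<in> ?I" "y2 \<in> R" using True V y2 by auto
  hence "card (V' \<inter> (?I \<inter> touch R) \<inter> greens) \<le> card (V \<inter> (?I \<inter> touch R) \<inter> greens)"
   by (rule green_card_one[OF fI *(4) refl True])
  thus ?thesis using * by blast
 next
  case False
  then obtain u where u: "u \<notin> R" "{u, y2} \<in> V" "hits u (V - touch R)" using y2 by blast
  hence "{{u, y2}} = {{y2}} \<and> {y2} \<in> ?I \<or> (\<exists>u'. {{u, y2}} = {{u', y2}} \<and> u' \<notin> R \<and> u' \<notin> Ux x R V \<and> {u', y2} \<in> V \<and> hits u' (V - touch R))"
   unfolding Ux by blast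
  from core_surgery[OF V II EAI lnk nog y1 this] obtain V' where *: "V' \<subseteq> ?I" "V' - (?I \<inter> touch R) = V - (?I \<inter> touch R)"
   "piv (hits x) e V'" "V' \<inter> (?I \<inter> touch R) \<inter> greens \<subseteq> {{u, y2}} \<inter> greens" by blast
  have "u \<noteq> y2" using u y2 by auto
  hence "card (V' \<inter> (?I \<inter> touch R) \<inter> greens) \<le> card (V \<inter> (?I \<inter> touch R) \<inter> greens)"
   by (rule green_card_zero[OF *(4) refl])
  thus ?thesis using * by blast
 qed
qed

text \<open>The exploration from \<open>z\<close> is continued to \<open>x\<close> by opening the
  edges inside \<open>R\<close>. Neither the explored part nor \<open>R\<close> meets
  \<open>K\<close>, so no index touching \<open>K\<close> has to be opened, and no ghost index
  either.\<close>

lemma reaches_Dev: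
 assumes I: "finite I" "I \<subseteq> Idx" "EA R \<subseteq> I" and R: "R \<subseteq> ball n v" "card (IB (Suc n) v) \<le> N"
  and ok: "okp a p r h" and K: "side x K" "z \<notin> K" "R \<inter> K = {}" "x \<in> R" "conn R"
 shows "PR I (Pm S p r h) (reaches z R) \<le> (2/a) ^ N * PR (I - touch K) (Pm S p r h) (Dev z x)"
proof -
 have "PR I (Pm S p r h) (reaches z R) \<le> (2/a) ^ N * PR I (Pm S p r h) (\<lambda>V. Dev z x (V - touch K))"
 proof (rule surg[OF I(1,2) R ok])
  fix V assume V: "V \<subseteq> I" and re: "reaches z R V"
  let ?U = "Ux z R V"
  obtain X1 y1 where X1: "y1 \<in> R" "if z \<in> R then X1 = {} \<and> y1 = z else \<exists>u\<in>?U. X1 = {{u, y1}} \<and> {u, y1} \<in> V"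
   using re unfolding reaches_def by (cases "z \<in> R") auto
  have UR: "?U \<inter> R = {}" using Ux_out[of z R V] by (cases "z \<in> R") (auto simp: Ux_def)
  \<comment> \<open>A path into \<open>K\<close> must pass through \<open>x\<close>, which belongs
    to \<open>R\<close>, and the exploration avoids \<open>R\<close>.\<close>
  have UK: "?U \<inter> K = {}"
  proof (cases "z \<in> R")
   case False
   have "cl (V - touch R) z \<subseteq> - K - R"
   proof (rule cl_subI)
    fix s t assume s: "s \<in> - K - R" "{s, t} \<in> V - touch R"
    have tR: "t \<notin> R" using s by (auto simp: touch_def)
    have "s = t \<or> adj s t" using s V I Idx_adj[of s t] by blast
    moreover have "s \<noteq> x" using s K by blast
    ultimately show "t \<in> - K - R" using s tR side_out_closed[OF K(1), of s t] by blast
   qed (use K False in simp)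
   thus ?thesis using False by (auto simp: Ux_def)
  qed (simp add: Ux_def)
  have EAt: "EA R \<subseteq> touch R" unfolding EA_def touch_def by (auto elim!: edgesE)
  have X1t: "X1 \<subseteq> touch R" "X1 \<subseteq> I" using X1 V by (auto simp: touch_def split: if_splits)
  have X1K: "X1 \<inter> touch K = {}"
  proof (cases "z \<in> R")
   case False
   then obtain u where "u \<in> ?U" "X1 = {{u, y1}}" using X1 by auto
   thus ?thesis using UK X1(1) K(3) by (auto simp: touch_def)
  qed (use X1 in auto)
  have EAK: "EA R \<inter> touch K = {}" using K(3) by (auto simp: EA_def touch_def)
  define V' where "V' = (V - touch R) \<union> X1 \<union> EA R"
  have sub: "V' \<subseteq> I" using V X1t I by (auto simp: V'_def)
  have diff: "V' - (I \<inter> touch R) = V - (I \<inter> touch R)" using V X1t EAt I by (auto simp: V'_def)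
  have gr: "V' \<inter> (I \<inter> touch R) \<inter> greens = {}"
  proof -
   have "X1 \<inter> greens = {}"
   proof (cases "z \<in> R")
    case False
    then obtain u where "u \<in> ?U" "X1 = {{u, y1}}" using X1 by auto
    moreover from this have "u \<noteq> y1" using UR X1(1) by auto
    ultimately show ?thesis by (auto simp: doubleton_eq_iff)
   qed (use X1 in auto)
   moreover have "EA R \<inter> greens = {}" using edge_not_green by (auto simp: EA_def)
   ultimately show ?thesis by (auto simp: V'_def)
  qed
  let ?w = "V' - touch K"
  have "cl ?w z \<subseteq> ?U \<union> R"
  proof (rule cl_subI)
   show "z \<in> ?U \<union> R" by (auto simp: Ux_def)
   fix s t assume s: "s \<in> ?U \<union> R" "{s, t} \<in> ?w"
   then consider "{s, t} \<in> V - touch R" | "{s, t} \<in> X1" | "{s, t} \<in> EA R" by (auto simp: V'_def)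
   thus "t \<in> ?U \<union> R"
   proof cases
    case 1
    hence "s \<notin> R" by (auto simp: touch_def)
    hence "s \<in> ?U" using s by simp
    hence "z \<notin> R" "s \<in> cl (V - touch R) z" by (auto simp: Ux_def split: if_splits)
    thus ?thesis using cl_step[OF _ 1, of z] by (simp add: Ux_def)
   next
    case 2
    then obtain u where "u \<in> ?U" "{s, t} = {u, y1}" using X1 by (auto split: if_splits)
    thus ?thesis using X1 by (auto simp: doubleton_eq_iff)
   next
    case 3
    thus ?thesis by (auto simp: EA_def)
   qed
  qed
  moreover have "{w} \<notin> ?w" if w: "w \<in> ?U \<union> R" for w
  proof
   assume "{w} \<in> ?w"
   hence w': "{w} \<in> V'" by simp
   show False
   proof (cases "w \<in> R")
    case True
    thus False using gr w' sub by (auto simp: touch_def)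
   next
    case False
    hence "w \<in> ?U" "{w} \<notin> touch R" using w by (auto simp: touch_def)
    moreover from this have "{w} \<in> V" using w' X1t EAt by (auto simp: V'_def)
    ultimately show False using re by (simp add: reaches_def)
   qed
  qed
  ultimately have nh: "\<not> hits z ?w" by (auto simp: hits_def)
  have EAw: "EA R \<subseteq> ?w" using EAK by (auto simp: V'_def)
  have xy: "x \<in> cl ?w y1" by (rule conn_cl[OF K(5) X1(1) K(4) EAw])
  have "y1 \<in> cl ?w z"
  proof (cases "z \<in> R")
   case False
   then obtain u where u: "u \<in> ?U" "X1 = {{u, y1}}" using X1 by auto
   have "V - touch R - touch K \<subseteq> ?w" by (auto simp: V'_def)
   have "cl (V - touch R) z \<subseteq> cl (V - touch R) z \<inter> cl ?w z"
   proof (rule cl_subI)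
    fix s t assume s: "s \<in> cl (V - touch R) z \<inter> cl ?w z" "{s, t} \<in> V - touch R"
    have t: "t \<in> cl (V - touch R) z" using cl_step[of s "V - touch R" z t] s by simp
    have "s \<in> ?U" "t \<in> ?U" using s t False by (auto simp: Ux_def)
    hence "{s, t} \<notin> touch K" using UK by (auto simp: touch_def)
    hence "{s, t} \<in> ?w" using s by (auto simp: V'_def)
    thus "t \<in> cl (V - touch R) z \<inter> cl ?w z" using cl_step[of s ?w z t] s t by simp
   qed simp
   hence "u \<in> cl ?w z" using u(1) False by (auto simp: Ux_def)
   moreover have "{u, y1} \<in> ?w" using u X1K by (auto simp: V'_def)
   ultimately show ?thesis by (rule cl_step)
  qed (use X1 in auto)
  hence "x \<in> cl ?w z" using xy by (rule cl_trans)
  hence "Dev z x ?w" using nh by (simp add: Dev_def)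
  thus "\<exists>V'\<subseteq>I. V' - (I \<inter> touch R) = V - (I \<inter> touch R) \<and> Dev z x (V' - touch K) \<and>
     ngr V' I R \<le> ngr V I R"
   using sub diff gr by (intro exI[of _ V']) simp
 qed
 thus ?thesis using PR_restrict_diff[OF I(1), of "Pm S p r h" "Dev z x" "touch K"] by simp
qed

text \<open>Conditionally on the explored set, the indices not touching it are fresh. The second
  connection uses only these and is bounded by its unconditional probability, since it is
  increasing.\<close>

lemma exploration:
 assumes I: "finite I" and P: "pv P"
 shows "PR I P (\<lambda>V. reaches z R V \<and> hits y (V - touch (Ux z R V))) \<le> PR I P (reaches z R) * PR I P (hits y)"
proof (cases "z \<in> R")
 case True
 have U: "Ux z R V = {}" for V using True by (simp add: Ux_def)
 have re: "reaches z R = (\<lambda>_. True)" by (rule ext) (simp add: reaches_def U True)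
 have t: "touch {} = {}" by (simp add: touch_def)
 show ?thesis by (simp add: U re t PR_True[OF I])
next
 case False
 have U: "Ux z R V = cl (V - touch R) z" for V using False by (simp add: Ux_def)
 define K where "K = Ux z R ` Pow I"
 have fK: "finite K" using I by (simp add: K_def)
 let ?A = "\<lambda>V. reaches z R V \<and> hits y (V - touch (Ux z R V))"
 have each: "PR I P (\<lambda>V. ?A V \<and> Ux z R V = U0) \<le> PR I P (\<lambda>V. reaches z R V \<and> Ux z R V = U0) * PR I P (hits y)" for U0
 proof -
  \<comment> \<open>Given that the explored set is \<open>U0\<close>, reaching \<open>R\<close> and
    meeting no ghost index are both decided by indices touching \<open>U0\<close>.\<close>
  define Q where "Q V \<longleftrightarrow> reaches z R V \<and> Ux z R V = U0" for V
  have Qt: "Q V \<longleftrightarrow> Q (V \<inter> touch U0)" for V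
  proof -
   have "(V \<inter> touch U0) - touch R = (V - touch R) \<inter> touch U0" by auto
   hence u: "Ux z R V = U0 \<longleftrightarrow> Ux z R (V \<inter> touch U0) = U0"
    unfolding U using cl_touch_iff[of "V - touch R" z U0] by simp
   show ?thesis
   proof (cases "Ux z R V = U0")
    case True
    hence "Ux z R (V \<inter> touch U0) = U0" using u by blast
    moreover have "\<And>w. w \<in> U0 \<Longrightarrow> {w} \<in> touch U0" "\<And>w y. w \<in> U0 \<Longrightarrow> {w, y} \<in> touch U0" by (auto simp: touch_def)
    ultimately show ?thesis using True unfolding Q_def reaches_def by auto
   next
    case nU: False
    thus ?thesis using u unfolding Q_def by blast
   qed
  qed
  have "PR I P (\<lambda>V. ?A V \<and> Ux z R V = U0) = PR I P (\<lambda>V. Q (V \<inter> touch U0) \<and> hits y (V - touch U0))"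
  proof (rule PR_cong)
   fix V
   show "(?A V \<and> Ux z R V = U0) = (Q (V \<inter> touch U0) \<and> hits y (V - touch U0))"
    unfolding Qt[symmetric] unfolding Q_def by auto
  qed
  also have "\<dots> = PR (I \<inter> touch U0) P Q * PR (I - touch U0) P (hits y)" by (rule PR_indep[OF I])
  also have "PR (I \<inter> touch U0) P Q = PR I P (\<lambda>V. Q (V \<inter> touch U0))" using PR_restrict[OF I] by metis
  also have "\<dots> = PR I P Q" using Qt by (intro PR_cong) blast
  also have "PR I P Q * PR (I - touch U0) P (hits y) \<le> PR I P Q * PR I P (hits y)"
   using PR_mono_index[OF incr_hits P I, of "I - touch U0" y] PR_nonneg[OF P] by (intro mult_left_mono) auto
  finally show ?thesis unfolding Q_def .
 qed
 have "PR I P ?A = (\<Sum>U0\<in>K. PR I P (\<lambda>V. ?A V \<and> Ux z R V = U0))"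
  by (rule PR_partition[OF fK]) (auto simp: K_def)
 also have "\<dots> \<le> (\<Sum>U0\<in>K. PR I P (\<lambda>V. reaches z R V \<and> Ux z R V = U0) * PR I P (hits y))"
  by (rule sum_mono[OF each])
 also have "\<dots> = (\<Sum>U0\<in>K. PR I P (\<lambda>V. reaches z R V \<and> Ux z R V = U0)) * PR I P (hits y)"
  by (rule sum_distrib_right[symmetric])
 also have "(\<Sum>U0\<in>K. PR I P (\<lambda>V. reaches z R V \<and> Ux z R V = U0)) = PR I P (reaches z R)"
  by (rule PR_partition[OF fK, symmetric]) (auto simp: K_def)
 finally show ?thesis .
qed

text \<open>A union bound over the vertices \<open>y\<close> of \<open>R\<close> that see the ghost
  off the explored part. The bound \<open>B\<close> covers full connection probabilities, not only
  those inside \<open>K\<close>; the Harnack inequality will relate the two.\<close>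

lemma piv_beta_upper:
 assumes I: "finite I" "I \<subseteq> Idx" "EA R \<subseteq> I" and R: "R \<subseteq> ball n v" "card (IB (Suc n) v) \<le> N"
  and ok: "okp a p r h" and K: "side x K" "z \<notin> K" "R \<inter> K = {}" "x \<in> R" "conn R"
  and f: "f \<in> EG" "f \<subseteq> R"
  and B: "\<And>y. y \<in> R \<Longrightarrow> PR I (Pm S p r h) (hits y) \<le> B"
 shows "PR I (Pm S p r h) (piv (hits z) f) \<le> (2/a) ^ N * card R * (PR (I - touch K) (Pm S p r h) (Dev z x) * B)"
proof -
 let ?P = "Pm S p r h"
 have P: "pv ?P" by (rule okp_pv[OF ok])
 have fR: "finite R" using R(1) finite_ball by (rule finite_subset)
 obtain c d where cd: "f = {c, d}" "adj c d" "c \<noteq> d" using f(1) by (erule edgesE)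
 have B0: "0 \<le> B" using B[OF K(4)] PR_nonneg[OF P, of I "hits x"] by simp
 have "PR I ?P (piv (hits z) f) \<le> PR I ?P (\<lambda>V. \<exists>y\<in>R. reaches z R V \<and> hits y (V - touch (Ux z R V)))"
  by (rule PR_mono[OF P]) (use piv_reaches[OF _ cd(1,3) f(2)] in blast)
 also have "\<dots> \<le> (\<Sum>y\<in>R. PR I ?P (\<lambda>V. reaches z R V \<and> hits y (V - touch (Ux z R V))))"
  by (rule PR_Ex_le[OF P fR])
 also have "\<dots> \<le> (\<Sum>y\<in>R. PR I ?P (reaches z R) * B)"
 proof (rule sum_mono)
  fix y assume y: "y \<in> R"
  have "PR I ?P (\<lambda>V. reaches z R V \<and> hits y (V - touch (Ux z R V))) \<le> PR I ?P (reaches z R) * PR I ?P (hits y)"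
   by (rule exploration[OF I(1) P])
  also have "\<dots> \<le> PR I ?P (reaches z R) * B"
   by (intro mult_left_mono B y PR_nonneg P)
  finally show "PR I ?P (\<lambda>V. reaches z R V \<and> hits y (V - touch (Ux z R V))) \<le> PR I ?P (reaches z R) * B" .
 qed
 also have "\<dots> = card R * B * PR I ?P (reaches z R)" by simp
 also have "\<dots> \<le> card R * B * ((2/a) ^ N * PR (I - touch K) ?P (Dev z x))"
  using B0 by (intro mult_left_mono reaches_Dev[OF I R ok K]) auto
 also have "\<dots> = (2/a) ^ N * card R * (PR (I - touch K) ?P (Dev z x) * B)" by simp
 finally show ?thesis .
qed

lemma piv_beta_lower:
 assumes I: "finite I" "I \<subseteq> Idx" and P: "pv P" and K: "side x K" "z \<notin> K" and e: "e \<in> EG" "e \<inter> K \<noteq> {}"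
 shows "PR (I - touch K) P (Dev z x) * PR (I \<inter> touch K) P (piv (hits x) e) \<le> PR I P (piv (hits z) e)"
proof -
 have "PR (I - touch K) P (Dev z x) * PR (I \<inter> touch K) P (piv (hits x) e) =
   PR I P (\<lambda>V. piv (hits x) e (V \<inter> touch K) \<and> Dev z x (V - touch K))"
  by (simp add: PR_indep[OF I(1)])
 also have "\<dots> \<le> PR I P (piv (hits z) e)"
 proof (rule PR_mono[OF P])
  fix V assume "V \<subseteq> I" "piv (hits x) e (V \<inter> touch K) \<and> Dev z x (V - touch K)"
  thus "piv (hits z) e V" using I e by (intro side_piv[OF K]) (auto simp: Idx_def touch_def)
 qed
 finally show ?thesis .
qed

lemma M_decomp:
 assumes I: "finite I" "I \<subseteq> Idx" and K: "side x K" "z \<notin> K"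
 shows "PR I P (hits z) = PR (I - touch K) P (hits z) + PR (I - touch K) P (Dev z x) * PR (I \<inter> touch K) P (hits x)"
proof -
 have "PR I P (hits z) = PR I P (\<lambda>V. hits z (V - touch K) \<or> (hits x (V \<inter> touch K) \<and> Dev z x (V - touch K)))"
 proof (rule PR_cong)
  fix V assume "V \<subseteq> I"
  hence "V \<subseteq> Idx" using I by blast
  from side_hits[OF K this] show "hits z V = (hits z (V - touch K) \<or> (hits x (V \<inter> touch K) \<and> Dev z x (V - touch K)))"
   unfolding Dev_def by blast
 qed
 also have "\<dots> = PR I P (\<lambda>V. hits z (V - touch K)) + PR I P (\<lambda>V. hits x (V \<inter> touch K) \<and> Dev z x (V - touch K))"
  by (rule PR_disj) (auto simp: Dev_def)
 also have "PR I P (\<lambda>V. hits z (V - touch K)) = PR (I - touch K) P (hits z)" by (rule PR_restrict_diff[OF I(1)])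
 also have "PR I P (\<lambda>V. hits x (V \<inter> touch K) \<and> Dev z x (V - touch K)) = PR (I \<inter> touch K) P (hits x) * PR (I - touch K) P (Dev z x)"
  by (rule PR_indep[OF I(1)])
 finally show ?thesis by simp
qed

lemma hits_connect:
 assumes I: "finite I" "I \<subseteq> Idx" "EA R \<subseteq> I" and R: "R \<subseteq> ball n v" "card (IB (Suc n) v) \<le> N"
  and ok: "okp a p r h" and c: "conn R" "x \<in> R" "y \<in> R"
 shows "PR I (Pm S p r h) (hits y) \<le> (2/a) ^ N * PR I (Pm S p r h) (hits x)"
proof (rule surg[OF I(1,2) R ok])
 fix V assume V: "V \<subseteq> I" "hits y V"
 let ?w = "V \<union> EA R"
 have EAt: "EA R \<subseteq> touch R" unfolding EA_def touch_def by (auto elim!: edgesE)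
 have "y \<in> cl ?w x" by (rule conn_cl[OF c]) auto
 moreover have "hits y ?w" by (rule hits_mono[OF _ V(2)]) auto
 ultimately have "hits x ?w" by (rule hits_cl)
 moreover have "?w \<inter> (I \<inter> touch R) \<inter> greens = V \<inter> (I \<inter> touch R) \<inter> greens"
  using edge_not_green by (auto simp: EA_def)
 ultimately show "\<exists>V'\<subseteq>I. V' - (I \<inter> touch R) = V - (I \<inter> touch R) \<and> hits x V' \<and>
     ngr V' I R \<le> ngr V I R"
  using V I EAt by (intro exI[of _ ?w]) auto
qed

text \<open>Conditioning on the edges fixes the cluster; its k available ghost indices are then all
  closed with probability (1-h)^k. Every decay estimate rests on this, for varying
  \<open>g\<close>.\<close>

lemma Ev_nogreen:
 assumes I: "finite I" and P: "pv P" "\<And>i. i \<in> I \<Longrightarrow> i \<in> greens \<Longrightarrow> P i = h"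
  and g: "\<And>k. g k * (1 - h) ^ k \<le> B"
 shows "Ev I P (\<lambda>V. g (card (cl V z \<inter> {v. {v} \<in> I})) * of_bool (\<forall>w\<in>cl V z. {w} \<notin> V)) \<le> (B :: real)"
proof -
 let ?W = "{v. {v} \<in> I}"
 let ?F = "\<lambda>V. g (card (cl V z \<inter> ?W)) * of_bool (\<forall>w\<in>cl V z. {w} \<notin> V)"
 have inner: "Ev (I - (- greens)) P (\<lambda>\<beta>. ?F (\<nu> \<union> \<beta>)) \<le> B" if \<nu>: "\<nu> \<subseteq> I \<inter> - greens" for \<nu>
 proof -
  let ?C = "cl \<nu> z"
  let ?T = "(\<lambda>w. {w}) ` (?C \<inter> ?W)"
  have "Ev (I - (- greens)) P (\<lambda>\<beta>. ?F (\<nu> \<union> \<beta>)) =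
    Ev (I - (- greens)) P (\<lambda>\<beta>. g (card (?C \<inter> ?W)) * of_bool (\<forall>i\<in>?T. i \<notin> \<beta>))"
  proof (rule Ev_cong)
   fix \<beta> assume \<beta>: "\<beta> \<subseteq> I - (- greens)"
   have c: "cl (\<nu> \<union> \<beta>) z = ?C" by (rule cl_greens) (use \<beta> in auto)
   have "(\<forall>w\<in>?C. {w} \<notin> \<nu> \<union> \<beta>) \<longleftrightarrow> (\<forall>i\<in>?T. i \<notin> \<beta>)" using \<nu> \<beta> by auto
   thus "?F (\<nu> \<union> \<beta>) = g (card (?C \<inter> ?W)) * of_bool (\<forall>i\<in>?T. i \<notin> \<beta>)" unfolding c by simp
  qed
  also have "\<dots> = g (card (?C \<inter> ?W)) * PR (I - (- greens)) P (\<lambda>\<beta>. \<forall>i\<in>?T. i \<notin> \<beta>)"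
   unfolding PR_def by (rule Ev_cmult)
  also have "PR (I - (- greens)) P (\<lambda>\<beta>. \<forall>i\<in>?T. i \<notin> \<beta>) = (\<Prod>i\<in>?T. 1 - P i)"
   by (rule PR_none) (use I in auto)
  also have "\<dots> = (\<Prod>i\<in>?T. 1 - h)" by (rule prod.cong) (auto simp: P(2))
  also have "\<dots> = (1 - h) ^ card (?C \<inter> ?W)" by (simp add: card_image inj_on_def)
  finally show ?thesis using g by simp
 qed
 have "Ev I P ?F = Ev (I \<inter> - greens) P (\<lambda>\<nu>. Ev (I - (- greens)) P (\<lambda>\<beta>. ?F (\<nu> \<union> \<beta>)))"
  by (rule Ev_split[OF I])
 also have "\<dots> \<le> Ev (I \<inter> - greens) P (\<lambda>_. B)" by (rule Ev_mono[OF P(1)]) (rule inner)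
 also have "\<dots> = B" using I by (intro Ev_const) auto
 finally show ?thesis .
qed

lemma cl_step_ball:
 assumes "V \<subseteq> Idx" "{s, t} \<in> V" "s \<in> ball k x"
 shows "t \<in> ball (Suc k) x"
proof (cases "s = t")
 case True
 thus ?thesis using assms(3) ball_mono[of k "Suc k" x] by auto
next
 case False
 hence "adj s t" using Idx_adj assms by blast
 thus ?thesis using assms(3) by (auto simp: ball_Suc)
qed

text \<open>A cluster that leaves \<open>ball k x\<close> contains a vertex at each of the distances
  0 to k.\<close>

lemma cluster_far:
 assumes V: "V \<subseteq> Idx" and "v \<in> cl V x" "v \<notin> ball k x"
 shows "Suc k \<le> card (cl V x \<inter> ball k x)"
 using assms(3)
proof (induction k)
 case 0
 have "cl V x \<inter> ball 0 x = {x}" by auto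
 thus ?case by simp
next
 case (Suc k)
 have vk: "v \<notin> ball k x" using Suc.prems ball_mono[of k "Suc k" x] by auto
 have "\<exists>t\<in>cl V x. t \<in> ball (Suc k) x \<and> t \<notin> ball k x"
 proof (rule ccontr)
  assume no: "\<not> ?thesis"
  have "cl V x \<subseteq> cl V x \<inter> ball k x"
  proof (rule cl_subI)
   fix s t assume s: "s \<in> cl V x \<inter> ball k x" "{s, t} \<in> V"
   have "t \<in> cl V x" using cl_step[of s V x t] s by simp
   moreover have "t \<in> ball (Suc k) x" using cl_step_ball[OF V s(2)] s by simp
   ultimately show "t \<in> cl V x \<inter> ball k x" using no by blast
  qed simp
  thus False using assms(2) vk by blast
 qed
 then obtain t where t: "t \<in> cl V x" "t \<in> ball (Suc k) x" "t \<notin> ball k x" by blast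
 have "insert t (cl V x \<inter> ball k x) \<subseteq> cl V x \<inter> ball (Suc k) x"
  using t ball_mono[of k "Suc k" x] by auto
 hence "card (insert t (cl V x \<inter> ball k x)) \<le> card (cl V x \<inter> ball (Suc k) x)"
  by (intro card_mono) auto
 moreover have "card (insert t (cl V x \<inter> ball k x)) = Suc (card (cl V x \<inter> ball k x))"
  using t by (intro card_insert_disjoint) auto
 ultimately show ?case using Suc.IH[OF vk] by simp
qed

text \<open>Within \<open>ball k x\<close> the smaller set \<open>I\<close> misses nothing of
  \<open>J\<close>. If the ghost is reached in \<open>J\<close> but not in \<open>I\<close>, the
  cluster in \<open>I\<close> must leave the ball and hence has at least \<open>k\<close> closed
  ghost indices.\<close>

lemma truncation:
 assumes J: "finite J" "J \<subseteq> Idx" "I \<subseteq> J" and P: "pv P" "\<And>i. i \<in> I \<Longrightarrow> i \<in> greens \<Longrightarrow> P i = h" "0 \<le> h" "h \<le> 1"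
  and in_I: "\<And>i. i \<in> J \<Longrightarrow> i \<inter> ball k x \<noteq> {} \<Longrightarrow> i \<in> I"
  and W: "\<And>V w. V \<subseteq> I \<Longrightarrow> w \<in> cl V x \<Longrightarrow> w \<in> ball k x \<Longrightarrow> w \<noteq> x \<Longrightarrow> {w} \<in> I"
 shows "PR J P (hits x) \<le> PR I P (hits x) + (1 - h) ^ k"
proof -
 let ?W = "{v. {v} \<in> I}"
 have fI: "finite I" using J finite_subset by blast
 define Bad where "Bad V \<longleftrightarrow> (\<forall>w\<in>cl V x. {w} \<notin> V) \<and> k \<le> card (cl V x \<inter> ?W)" for V
 have fW: "finite ?W"
 proof -
  have "(\<lambda>v. {v}) ` ?W \<subseteq> I" by auto
  hence "finite ((\<lambda>v. {v}) ` ?W)" using fI by (rule finite_subset)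
  thus ?thesis by (rule finite_imageD) (auto simp: inj_on_def)
 qed
 have pw: "hits x (V \<inter> I) \<or> Bad (V \<inter> I)" if V: "V \<subseteq> J" and h: "hits x V" for V
 proof (rule ccontr)
  assume n: "\<not> ?thesis"
  let ?C = "cl (V \<inter> I) x"
  have nog: "\<forall>w\<in>?C. {w} \<notin> V \<inter> I" using n by (auto simp: hits_def)
  show False
  proof (cases "?C \<subseteq> ball k x")
   case True
   have "cl V x \<subseteq> ?C"
   proof (rule cl_subI)
    fix s t assume s: "s \<in> ?C" "{s, t} \<in> V"
    hence "{s, t} \<in> V \<inter> I" using True V in_I[of "{s, t}"] by blast
    with s(1) show "t \<in> ?C" by (rule cl_step)
   qed simp
   moreover obtain w where w: "w \<in> cl V x" "{w} \<in> V" using h by (auto simp: hits_def)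
   ultimately have "w \<in> ?C" "{w} \<in> V \<inter> I" using True V in_I[of "{w}"] by blast+
   thus False using nog by blast
  next
   case False
   then obtain v where v: "v \<in> ?C" "v \<notin> ball k x" by blast
   have "V \<inter> I \<subseteq> Idx" using J by blast
   from cluster_far[OF this v] have "Suc k \<le> card (?C \<inter> ball k x)" .
   \<comment> \<open>The ghost index at \<open>x\<close> is not assumed to be available: in
     \<open>exchange\<close> the singleton \<open>{x}\<close> does not touch \<open>K\<close>. This
     costs one vertex, so the exponent is \<open>k\<close>.\<close>
   also have "\<dots> \<le> card (insert x (?C \<inter> ?W))"
    using W[of "V \<inter> I"] fW by (intro card_mono) auto
   also have "\<dots> \<le> Suc (card (?C \<inter> ?W))" by (rule card_insert_le_m1) auto
   finally have "k \<le> card (?C \<inter> ?W)" by simp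
   thus False using n nog unfolding Bad_def by blast
  qed
 qed
 have "PR J P (hits x) \<le> PR J P (\<lambda>V. \<exists>b\<in>{True, False}. if b then hits x (V \<inter> I) else Bad (V \<inter> I))"
  by (rule PR_mono[OF P(1)]) (use pw in auto)
 also have "\<dots> \<le> (\<Sum>b\<in>{True, False}. PR J P (\<lambda>V. if b then hits x (V \<inter> I) else Bad (V \<inter> I)))"
  by (rule PR_Ex_le[OF P(1)]) simp
 also have "\<dots> = PR J P (\<lambda>V. hits x (V \<inter> I)) + PR J P (\<lambda>V. Bad (V \<inter> I))" by simp
 also have "\<dots> = PR I P (hits x) + PR I P Bad"
  using PR_restrict[OF J(1), of P _ I] J(3) by (simp add: Int_absorb1)
 also have "PR I P Bad \<le> (1 - h) ^ k"
 proof -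
  have "PR I P Bad = Ev I P (\<lambda>V. (\<lambda>n. of_bool (k \<le> n)) (card (cl V x \<inter> ?W)) * of_bool (\<forall>w\<in>cl V x. {w} \<notin> V))"
   unfolding PR_def by (rule Ev_cong) (auto simp: Bad_def)
  also have "\<dots> \<le> (1 - h) ^ k"
  proof (rule Ev_nogreen[OF fI P(1,2)])
   show "of_bool (k \<le> n) * (1 - h) ^ n \<le> (1 - h) ^ k" for n
    using P(3,4) by (cases "k \<le> n") (auto intro: power_decreasing)
  qed auto
  finally show ?thesis .
 qed
 finally show ?thesis by simp
qed

lemma card_edges_at:
 assumes "card {y. adj v y} \<le> D"
 shows "finite {i \<in> EG. v \<in> i}" "card {i \<in> EG. v \<in> i} \<le> D"
proof -
 have sub: "{i \<in> EG. v \<in> i} \<subseteq> (\<lambda>y. {v, y}) ` {y. adj v y}"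
 proof
  fix i assume i: "i \<in> {i \<in> EG. v \<in> i}"
  then obtain c d where cd: "i = {c, d}" "adj c d" "c \<noteq> d" by (auto elim: edgesE)
  hence "v = c \<or> v = d" using i by auto
  thus "i \<in> (\<lambda>y. {v, y}) ` {y. adj v y}"
   using cd adj_sym[OF cd(2)] by (auto simp: insert_commute)
 qed
 show "finite {i \<in> EG. v \<in> i}" by (rule finite_subset[OF sub]) (simp add: lf)
 have "card {i \<in> EG. v \<in> i} \<le> card ((\<lambda>y. {v, y}) ` {y. adj v y})"
  by (rule card_mono[OF _ sub]) (simp add: lf)
 also have "\<dots> \<le> card {y. adj v y}" by (rule card_image_le) (simp add: lf)
 finally show "card {i \<in> EG. v \<in> i} \<le> D" using assms by simp
qed

lemma card_edges_touching:
 assumes D: "\<And>v. card {y. adj v y} \<le> D" and C: "finite C"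
 shows "finite {i \<in> EG. i \<inter> C \<noteq> {}}" "card {i \<in> EG. i \<inter> C \<noteq> {}} \<le> D * card C"
proof -
 have eq: "{i \<in> EG. i \<inter> C \<noteq> {}} = (\<Union>v\<in>C. {i \<in> EG. v \<in> i})" by auto
 show "finite {i \<in> EG. i \<inter> C \<noteq> {}}" unfolding eq using C card_edges_at[OF D] by auto
 have "card {i \<in> EG. i \<inter> C \<noteq> {}} \<le> (\<Sum>v\<in>C. card {i \<in> EG. v \<in> i})"
  unfolding eq by (rule card_UN_le[OF C])
 also have "\<dots> \<le> (\<Sum>v\<in>C. D)" by (rule sum_mono) (rule card_edges_at[OF D])
 finally show "card {i \<in> EG. i \<inter> C \<noteq> {}} \<le> D * card C" by (simp add: mult.commute)
qed

text \<open>The sum of the influences is, up to 1/a, the expected number of closed pivotal edges.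
  Such edges touch the cluster of \<open>z\<close>, which misses the ghost, so there are at most
  \<open>D\<close> times its size. With m = 0 this bounds all influences, with m large those far
  away.\<close>

lemma piv_tail:
 assumes P: "pv P" "\<And>i. i \<in> IB N z \<Longrightarrow> i \<in> greens \<Longrightarrow> P i = h"
  and D: "\<And>v. card {y. adj v y} \<le> D"
  and F: "F \<subseteq> IB N z \<inter> EG" "\<And>f. f \<in> F \<Longrightarrow> P f \<le> 1 - a" "0 < a"
  and m: "\<And>V f. V \<subseteq> IB N z \<Longrightarrow> f \<in> F \<Longrightarrow> f \<inter> cl V z \<noteq> {} \<Longrightarrow> m \<le> card (cl V z)"
  and B: "\<And>n. m \<le> n \<Longrightarrow> real D * real n * (1 - h) ^ n \<le> B" "0 \<le> B"
 shows "(\<Sum>f\<in>F. PR (IB N z) P (piv (hits z) f)) \<le> B / a"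
proof -
 let ?I = "IB N z"
 define g where "g n = (if m \<le> n then real D * real n else 0)" for n
 have fF: "finite F" using F(1) by (rule finite_subset) simp
 have W: "{v. {v} \<in> ?I} = ball N z" by (auto simp: IB_def Idx_def)
 have CW: "cl V z \<subseteq> ball N z" if "V \<subseteq> ?I" for V
  by (rule cl_subI) (use that in "auto simp: IB_def")
 have each: "a * PR ?I P (piv (hits z) f) \<le> PR ?I P (\<lambda>V. piv (hits z) f V \<and> f \<notin> V)" if "f \<in> F" for f
 proof -
  have "a * PR ?I P (piv (hits z) f) \<le> (1 - P f) * PR ?I P (piv (hits z) f)"
   using F(2)[OF that] PR_nonneg[OF P(1)] by (intro mult_right_mono) auto
  also have "\<dots> = PR ?I P (\<lambda>V. piv (hits z) f V \<and> f \<notin> V)"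
   by (rule PR_piv_closed[symmetric]) (use that F in auto)
  finally show ?thesis .
 qed
 have pw: "(\<Sum>f\<in>F. of_bool (piv (hits z) f V \<and> f \<notin> V)) \<le>
   g (card (cl V z \<inter> {v. {v} \<in> ?I})) * of_bool (\<forall>w\<in>cl V z. {w} \<notin> V)" if V: "V \<subseteq> ?I" for V
 proof -
  let ?C = "cl V z"
  let ?F' = "{f \<in> F. piv (hits z) f V \<and> f \<notin> V}"
  have fC: "finite ?C" using CW[OF V] by (rule finite_subset) simp
  have Ceq: "?C \<inter> {v. {v} \<in> ?I} = ?C" unfolding W using CW[OF V] by blast
  have "(\<Sum>f\<in>F. of_bool (piv (hits z) f V \<and> f \<notin> V)) = real (card ?F')"
   using fF by (simp add: sum.If_cases of_bool_def Int_def conj_commute)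
  also have "\<dots> \<le> g (card ?C) * of_bool (\<forall>w\<in>?C. {w} \<notin> V)"
  proof (cases "?F' = {}")
   case True
   show ?thesis unfolding True by (simp add: g_def)
  next
   case False
   have touchC: "f \<inter> ?C \<noteq> {} \<and> \<not> hits z V" if f: "f \<in> ?F'" for f
   proof -
    have "f \<in> EG" using f F by auto
    then obtain c d where cd: "f = {c, d}" "adj c d" "c \<noteq> d" by (erule edgesE)
    have eq: "V - {{c, d}} = V" using f cd by auto
    have p: "piv (hits z) {c, d} V" using f cd by auto
    have nh: "\<not> hits z V" using p eq by (auto simp: piv_def)
    from piv_hits_edge[OF p cd(3)] obtain a' b' where ab: "{c, d} = {a', b'}" "a' \<in> cl (V - {{c, d}}) z"
     by blast
    have "a' \<in> ?C" using ab(2) unfolding eq .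
    moreover have "a' \<in> f" using ab(1) cd(1) by blast
    ultimately show ?thesis using nh by blast
   qed
   obtain f0 where f0: "f0 \<in> ?F'" using False by blast
   have "\<not> hits z V" using touchC[OF f0] by (rule conjunct2)
   hence nog: "\<forall>w\<in>?C. {w} \<notin> V" by (simp add: hits_def)
   have "f0 \<in> F" "f0 \<inter> ?C \<noteq> {}" using f0 touchC[OF f0] by simp_all
   hence "m \<le> card ?C" by (rule m[OF V])
   have "card ?F' \<le> card {i \<in> EG. i \<inter> ?C \<noteq> {}}"
    by (rule card_mono[OF card_edges_touching(1)[OF D fC]]) (use touchC F in auto)
   also have "\<dots> \<le> D * card ?C" by (rule card_edges_touching(2)[OF D fC])
   finally have "real (card ?F') \<le> real (D * card ?C)" by (rule of_nat_mono)
   hence "real (card ?F') \<le> real D * real (card ?C)" by simp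
   thus ?thesis using nog \<open>m \<le> card ?C\<close> by (simp add: g_def)
  qed
  finally show ?thesis unfolding Ceq .
 qed
 have "a * (\<Sum>f\<in>F. PR ?I P (piv (hits z) f)) \<le> (\<Sum>f\<in>F. PR ?I P (\<lambda>V. piv (hits z) f V \<and> f \<notin> V))"
  unfolding sum_distrib_left by (rule sum_mono[OF each])
 also have "\<dots> = Ev ?I P (\<lambda>V. \<Sum>f\<in>F. of_bool (piv (hits z) f V \<and> f \<notin> V))"
  unfolding PR_def Ev_sum ..
 also have "\<dots> \<le> Ev ?I P (\<lambda>V. g (card (cl V z \<inter> {v. {v} \<in> ?I})) * of_bool (\<forall>w\<in>cl V z. {w} \<notin> V))"
  by (rule Ev_mono[OF P(1) pw])
 also have "\<dots> \<le> B"
  by (rule Ev_nogreen[OF finite_IB P]) (use B in "auto simp: g_def")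
 finally show ?thesis using F(3) by (simp add: field_simps)
qed

text \<open>All edges at \<open>z\<close> are closed simultaneously with probability at least
  \<open>a ^ D\<close>, and then \<open>z\<close> is alone in its cluster.\<close>

lemma PR_isolated:
 assumes I: "finite I" "I \<subseteq> Idx" and ok: "okp a p r h" and D: "card {y. adj z y} \<le> D" and x: "x \<noteq> z"
 shows "PR I (Pm S p r h) (\<lambda>V. x \<in> cl V z) \<le> 1 - a ^ D"
proof -
 let ?P = "Pm S p r h"
 let ?E = "{i \<in> I \<inter> EG. z \<in> i}"
 have P: "pv ?P" by (rule okp_pv[OF ok])
 have cE: "card ?E \<le> D"
 proof -
  have "card ?E \<le> card {i \<in> EG. z \<in> i}" by (rule card_mono[OF card_edges_at(1)[OF D]]) auto
  also have "\<dots> \<le> D" by (rule card_edges_at(2)[OF D])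
  finally show ?thesis .
 qed
 have "a ^ D \<le> a ^ card ?E" using cE okp_a[OF ok] by (intro power_decreasing) auto
 also have "\<dots> = (\<Prod>i\<in>?E. a)" by simp
 also have "\<dots> \<le> (\<Prod>i\<in>?E. 1 - ?P i)"
 proof (rule prod_mono)
  fix i assume "i \<in> ?E"
  hence "i \<notin> greens" using edge_not_green by blast
  from okp_edge[OF ok this, of S] show "0 \<le> a \<and> a \<le> 1 - ?P i" using okp_a[OF ok] by simp
 qed
 also have "\<dots> = PR I ?P (\<lambda>V. \<forall>i\<in>?E. i \<notin> V)" by (rule PR_none[OF I(1), symmetric]) auto
 also have "\<dots> \<le> PR I ?P (\<lambda>V. \<not> (x \<in> cl V z))"
 proof (rule PR_mono[OF P])
  fix V assume V: "V \<subseteq> I" "\<forall>i\<in>?E. i \<notin> V"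
  have "cl V z \<subseteq> {z}"
  proof (rule cl_subI)
   fix s t assume s: "s \<in> {z}" "{s, t} \<in> V"
   hence "{s, t} \<in> I" "{s, t} \<notin> ?E" using V by auto
   hence "{s, t} \<notin> EG" using s by auto
   hence "{s, t} \<in> greens" using \<open>{s, t} \<in> I\<close> I by (auto simp: Idx_def)
   hence "s = t" by auto
   thus "t \<in> {z}" using s by simp
  qed simp
  thus "\<not> (x \<in> cl V z)" using x by blast
 qed
 also have "\<dots> = 1 - PR I ?P (\<lambda>V. x \<in> cl V z)" by (rule PR_not[OF I(1)])
 finally show ?thesis by simp
qed

lemma cl_aut:
 assumes "H \<in> Aut"
 shows "cl (image H ` V) (H x) = H ` cl V x"
proof
 show "cl (image H ` V) (H x) \<subseteq> H ` cl V x"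
 proof (rule cl_subI)
  fix s t assume s: "s \<in> H ` cl V x" "{s, t} \<in> image H ` V"
  then obtain s' i where s': "s = H s'" "s' \<in> cl V x" "i \<in> V" "{s, t} = H ` i" by auto
  have "i = inv H ` {s, t}" using s'(4) assms by simp
  hence "i = {s', inv H t}" using s'(1) assms by simp
  hence "inv H t \<in> cl V x" using cl_step[OF s'(2)] s'(3) by blast
  hence "H (inv H t) \<in> H ` cl V x" by (rule imageI)
  thus "t \<in> H ` cl V x" using assms by simp
 qed simp
 show "H ` cl V x \<subseteq> cl (image H ` V) (H x)"
 proof -
  have "cl V x \<subseteq> {v. H v \<in> cl (image H ` V) (H x)}"
  proof (rule cl_subI)
   fix s t assume s: "s \<in> {v. H v \<in> cl (image H ` V) (H x)}" "{s, t} \<in> V"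
   have "{H s, H t} \<in> image H ` V" using imageI[OF s(2), of "image H"] by simp
   thus "t \<in> {v. H v \<in> cl (image H ` V) (H x)}" using s(1) cl_step[of "H s" _ "H x" "H t"] by simp
  qed simp
  thus ?thesis by blast
 qed
qed

lemma inj_image_aut: "H \<in> Aut \<Longrightarrow> inj (image H)"
 by (rule injI) (metis aut_inv_image(1))

lemma green_aut: "H \<in> Aut \<Longrightarrow> H ` i \<in> greens \<longleftrightarrow> i \<in> greens"
proof
 assume H: "H \<in> Aut" "H ` i \<in> greens"
 then obtain y where "H ` i = {y}" by auto
 hence "inv H ` H ` i = {inv H y}" by simp
 hence "i = {inv H y}" using H by simp
 thus "i \<in> greens" by blast
qed auto

lemma hits_aut:
 assumes "H \<in> Aut"
 shows "hits (H x) (image H ` V) \<longleftrightarrow> hits x V"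
proof -
 have "{H w} \<in> image H ` V \<longleftrightarrow> {w} \<in> V" for w
  using inj_image_mem_iff[OF inj_image_aut[OF assms], of "{w}" V] by simp
 thus ?thesis unfolding hits_def cl_aut[OF assms] by simp
qed

lemma Idx_aut:
 assumes "H \<in> Aut" "i \<in> Idx"
 shows "H ` i \<in> Idx"
 using assms green_aut[OF assms(1), of i] edges_aut[OF assms(1), of i] unfolding Idx_def by blast

lemma PR_aut:
 assumes H: "H \<in> Aut" and I: "finite I"
 shows "PR (image H ` I) (Pm (image H ` S) p r h) (hits (H x)) = PR I (Pm S p r h) (hits x)"
proof -
 have "Pm (image H ` S) p r h (H ` i) = Pm S p r h i" for i
  unfolding Pm_def using green_aut[OF H] inj_image_mem_iff[OF inj_image_aut[OF H], of i S] by simp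
 thus ?thesis
  using PR_reindex[OF I inj_image_aut[OF H], of "Pm (image H ` S) p r h" "hits (H x)"]
  by (simp add: hits_aut[OF H])
qed

end

section \<open>Admissible patterns and their gluing across a cut vertex\<close>

context qt_graph
begin

definition R0 :: nat where "R0 = (SOME n. \<forall>v. \<exists>e\<in>Cand. e \<subseteq> ball n v)"

lemma R0: "\<exists>e\<in>Cand. e \<subseteq> ball R0 v"
 using someI_ex[OF Cand_dense] unfolding R0_def by blast

text \<open>The density radius is what maximality yields: a candidate within \<open>R0\<close> of
  \<open>v\<close>, a member within distance \<open>L\<close> of it, and one more step to the other
  endpoint of that member.\<close>

definition Fam :: "nat \<Rightarrow> 'v set set set" where
 "Fam L = {S. S \<subseteq> Cand \<and> sep L S \<and> (\<forall>v. \<exists>e\<in>S. e \<subseteq> ball (R0 + L + 1) v)}"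

lemma near_ball:
 assumes "e \<subseteq> ball m v" "e' \<in> EG" "near L e e'"
 shows "e' \<subseteq> ball (m + L + 1) v"
proof -
 obtain u w where uw: "u \<in> e" "w \<in> e'" "w \<in> ball L u" using assms(3) by (auto simp: near_def)
 have "w \<in> ball (m + L) v" using ball_trans[of u m v w L] uw assms(1) by blast
 thus ?thesis using edge_in_ball_Suc[OF assms(2), of "m + L" v] uw by auto
qed

lemma Fam_nonempty: "Fam L \<noteq> {}"
proof -
 have "sep L {}" by (simp add: sep_def)
 from sep_maximal[OF this, of Cand] obtain S where S: "S \<subseteq> Cand" "sep L S"
  "\<And>e. e \<in> Cand \<Longrightarrow> e \<in> S \<or> (\<exists>e'\<in>S. near L e e')" by auto
 have "\<exists>e\<in>S. e \<subseteq> ball (R0 + L + 1) v" for v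
 proof -
  obtain e where e: "e \<in> Cand" "e \<subseteq> ball R0 v" using R0 by blast
  from S(3)[OF e(1)] show ?thesis
  proof
   assume "e \<in> S"
   thus ?thesis using e ball_mono[of R0 "R0 + L + 1" v] by auto
  next
   assume "\<exists>e'\<in>S. near L e e'"
   then obtain e' where "e' \<in> S" "near L e e'" by blast
   moreover from this have "e' \<in> EG" using S(1) Cand_edge by blast
   ultimately show ?thesis using near_ball[OF e(2)] by blast
  qed
 qed
 thus ?thesis using S by (auto simp: Fam_def)
qed

lemma Fam_aut:
 assumes H: "H \<in> Aut" and S: "S \<in> Fam L"
 shows "image H ` S \<in> Fam L"
proof -
 have "image H ` S \<subseteq> Cand" using S Cand_aut[OF H] by (auto simp: Fam_def)
 moreover have "sep L (image H ` S)" unfolding sep_def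
 proof (intro ballI impI)
  fix e e' assume "e \<in> image H ` S" "e' \<in> image H ` S" "e \<noteq> e'"
  then obtain d d' where d: "e = H ` d" "e' = H ` d'" "d \<in> S" "d' \<in> S" "d \<noteq> d'" by auto
  have "\<not> near L d d'" using S d(3,4,5) by (auto simp: Fam_def sep_def)
  thus "\<not> near L e e'" using d(1,2) near_aut[OF H] by simp
 qed
 moreover have "\<exists>e\<in>image H ` S. e \<subseteq> ball (R0 + L + 1) v" for v
 proof -
  obtain e where e: "e \<in> S" "e \<subseteq> ball (R0 + L + 1) (inv H v)" using S unfolding Fam_def by blast
  have "H ` e \<subseteq> H ` ball (R0 + L + 1) (inv H v)" using e(2) by (rule image_mono)
  also have "\<dots> = ball (R0 + L + 1) v" using ball_aut[OF H, of "R0 + L + 1" "inv H v"] H by simp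
  finally show ?thesis using e(1) by blast
 qed
 ultimately show ?thesis by (auto simp: Fam_def)
qed

text \<open>Away from the cut vertex the two patterns are kept unchanged; in a bounded transition zone
 inside \<open>K\<close> they are completed to a maximal separated set.\<close>
lemma glue:
 "\<exists>T. \<forall>S S2 x K. S \<in> Fam L \<longrightarrow> S2 \<in> Fam L \<longrightarrow> side x K \<longrightarrow>
   (\<exists>S'\<in>Fam L. S' - touch K = S - touch K \<and> (\<forall>i\<in>touch K. i \<notin> IB T x \<longrightarrow> (i \<in> S' \<longleftrightarrow> i \<in> S2)))"
proof -
 \<comment> \<open>Up to \<rho> inside \<open>K\<close> the old edges stay, which serves all
   vertices outside \<open>K\<close> or within \<open>R\<close> of \<open>x\<close>. The new pattern
   starts beyond \<tau>, far enough from the retained edges in \<open>K\<close> (reaching to \<rho>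
   + 1) and from those outside \<open>K\<close> (seen only through \<open>x\<close>) to be separated
   by more than \<open>L\<close>. Candidates up to \<rho>2 serve the vertices of \<open>K\<close>
   within \<tau> + \<open>R\<close>.\<close>
 define R where "R = R0 + L + 1"
 define \<rho> where "\<rho> = 2 * R"
 define \<tau> where "\<tau> = \<rho> + 2 * L + 2"
 define \<rho>2 where "\<rho>2 = \<tau> + 2 * R"
 have "\<exists>S'\<in>Fam L. S' - touch K = S - touch K \<and> (\<forall>i\<in>touch K. i \<notin> IB (Suc \<rho>2) x \<longrightarrow> (i \<in> S' \<longleftrightarrow> i \<in> S2))"
  if S: "S \<in> Fam L" and S2: "S2 \<in> Fam L" and K: "side x K" for S S2 x K
 proof -
  have SC: "S \<subseteq> Cand" "sep L S" "\<And>v. \<exists>e\<in>S. e \<subseteq> ball R v" using S by (auto simp: Fam_def R_def)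
  have S2C: "S2 \<subseteq> Cand" "sep L S2" "\<And>v. \<exists>e\<in>S2. e \<subseteq> ball R v" using S2 by (auto simp: Fam_def R_def)
  have edge: "\<And>e. e \<in> S \<Longrightarrow> e \<in> EG" "\<And>e. e \<in> S2 \<Longrightarrow> e \<in> EG"
   using SC S2C Cand_edge by auto
  define Sa where "Sa = (S - touch K) \<union> {e \<in> S \<inter> touch K. e \<inter> ball \<rho> x \<noteq> {}}"
  define Sb where "Sb = {e \<in> S2 \<inter> touch K. e \<inter> ball \<tau> x = {}}"
  define F where "F = {e \<in> Cand \<inter> touch K. e \<inter> ball \<rho>2 x \<noteq> {}}"
  have cross: "\<not> near L e e2" if e: "e \<in> Sa" "e2 \<in> Sb" for e e2
  proof
   assume "near L e e2"
   then obtain v w where vw: "v \<in> e" "w \<in> e2" "w \<in> ball L v" by (auto simp: near_def)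
   have w: "w \<notin> ball \<tau> x" "e2 \<in> touch K" using e vw by (auto simp: Sb_def)
   have xe2: "x \<notin> e2" using e by (auto simp: Sb_def)
   have e2K: "e2 \<subseteq> K"
   proof -
    have "e2 \<in> EG" using e edge(2) by (auto simp: Sb_def)
    then obtain c d where cd: "e2 = {c, d}" "adj c d" "c \<noteq> d" by (rule edgesE)
    thus ?thesis using w(2) xe2 K adj_sym[OF cd(2)] unfolding touch_def side_def by blast
   qed
   show False
   proof (cases "e \<in> touch K")
    case False
    hence "v \<notin> K" using vw by (auto simp: touch_def)
    moreover have "w \<in> K" using e2K vw by blast
    ultimately have "x \<in> ball L v" using conn_exit[OF K conn_ball[of L v] vw(3) _ ball_self] by blast
    hence "v \<in> ball L x" by (rule ball_sym)
    hence "w \<in> ball (L + L) x" using vw(3) by (rule ball_trans)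
    thus False using w(1) ball_mono[of "L + L" \<tau> x] by (auto simp: \<tau>_def)
   next
    case True
    hence "e \<inter> ball \<rho> x \<noteq> {}" "e \<in> EG" using e edge(1) by (auto simp: Sa_def)
    hence "v \<in> ball (Suc \<rho>) x" using edge_in_ball_Suc vw by blast
    hence "w \<in> ball (Suc \<rho> + L) x" using vw(3) by (rule ball_trans)
    thus False using w(1) ball_mono[of "Suc \<rho> + L" \<tau> x] by (auto simp: \<tau>_def)
   qed
  qed
  have "sep L (Sa \<union> Sb)" unfolding sep_def
  proof (intro ballI impI)
   fix e e' assume ee: "e \<in> Sa \<union> Sb" "e' \<in> Sa \<union> Sb" "e \<noteq> e'"
   have aa: "Sa \<subseteq> S" "Sb \<subseteq> S2" by (auto simp: Sa_def Sb_def)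
   consider "e \<in> Sa" "e' \<in> Sa" | "e \<in> Sb" "e' \<in> Sb" | "e \<in> Sa" "e' \<in> Sb" | "e \<in> Sb" "e' \<in> Sa" using ee by blast
   thus "\<not> near L e e'"
   proof cases
    case 1 thus ?thesis using aa SC(2) ee(3) unfolding sep_def by blast
   next
    case 2 thus ?thesis using aa S2C(2) ee(3) unfolding sep_def by blast
   next
    case 3 thus ?thesis by (rule cross)
   next
    case 4 thus ?thesis using cross near_sym by blast
   qed
  qed
  \<comment> \<open>Filling up inside the bounded zone \<open>F\<close> restores density there: a
    candidate left out is near a chosen edge.\<close>
  from sep_maximal[OF this, of F] obtain S' where S': "Sa \<union> Sb \<subseteq> S'" "S' \<subseteq> Sa \<union> Sb \<union> F" "sep L S'"
   "\<And>e. e \<in> F \<Longrightarrow> e \<in> S' \<or> (\<exists>e'\<in>S'. near L e e')" by blast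
  have S'C: "S' \<subseteq> Cand" using S'(2) SC S2C by (auto simp: Sa_def Sb_def F_def)
  have dens: "\<exists>e\<in>S'. e \<subseteq> ball R v" for v
  proof -
   obtain e where e: "e \<in> S" "e \<subseteq> ball R v" using SC by blast
   have keep: "e \<in> S'" if "e \<notin> touch K \<or> e \<inter> ball \<rho> x \<noteq> {}"
    using S'(1) e that by (auto simp: Sa_def)
   show ?thesis
   proof (cases "v \<in> K")
    case False
    have "e \<notin> touch K \<or> e \<inter> ball \<rho> x \<noteq> {}"
    proof (rule disjCI)
     assume "\<not> e \<inter> ball \<rho> x \<noteq> {}"
     show "e \<notin> touch K"
     proof
      assume "e \<in> touch K"
      then obtain w where w: "w \<in> e" "w \<in> K" by (auto simp: touch_def)
      hence "w \<in> ball R v" using e by blast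
      hence "x \<in> ball R v" using conn_exit[OF K conn_ball[of R v] _ w(2) ball_self False] by simp
      hence "v \<in> ball R x" by (rule ball_sym)
      hence "w \<in> ball (R + R) x" using \<open>w \<in> ball R v\<close> by (rule ball_trans)
      hence "w \<in> ball \<rho> x" by (simp add: \<rho>_def mult_2)
      thus False using w \<open>\<not> e \<inter> ball \<rho> x \<noteq> {}\<close> by blast
     qed
    qed
    thus ?thesis using keep e by blast
   next
    case vK: True
    show ?thesis
    proof (cases "v \<in> ball R x")
     case True
     obtain c where c: "c \<in> e" using edge(1)[OF e(1)] by (auto elim: edgesE)
     hence "c \<in> ball (R + R) x" using ball_trans[OF True] e by blast
     hence "e \<inter> ball \<rho> x \<noteq> {}" using c by (auto simp: \<rho>_def mult_2)
     thus ?thesis using keep e by blast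
    next
     case far: False
     hence "x \<notin> ball R v" using ball_sym by blast
     hence bK: "ball R v \<subseteq> K" by (rule side_ball_sub[OF K vK])
     show ?thesis
     proof (cases "v \<in> ball (\<tau> + R) x")
      case False
      obtain e2 where e2: "e2 \<in> S2" "e2 \<subseteq> ball R v" using S2C by blast
      obtain c where c: "c \<in> e2" using edge(2)[OF e2(1)] by (auto elim: edgesE)
      have "e2 \<in> touch K" using c e2 bK by (auto simp: touch_def)
      moreover have "e2 \<inter> ball \<tau> x = {}"
      proof (rule ccontr)
       assume "e2 \<inter> ball \<tau> x \<noteq> {}"
       then obtain u where u: "u \<in> e2" "u \<in> ball \<tau> x" by blast
       hence "v \<in> ball R u" using e2 ball_sym by blast
       hence "v \<in> ball (\<tau> + R) x" by (rule ball_trans[OF u(2)])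
       thus False using False by simp
      qed
      ultimately have "e2 \<in> S'" using S'(1) e2 by (auto simp: Sb_def)
      thus ?thesis using e2 by blast
     next
      case True
      obtain e3 where e3: "e3 \<in> Cand" "e3 \<subseteq> ball R0 v" using R0 by blast
      hence e3R: "e3 \<subseteq> ball R v" using ball_mono[of R0 R v] by (auto simp: R_def)
      obtain c where c: "c \<in> e3" using Cand_edge[OF e3(1)] by (auto elim: edgesE)
      have "c \<in> ball (\<tau> + R + R) x" using ball_trans[OF True] c e3R by blast
      hence "e3 \<in> F" using e3 c e3R bK by (auto simp: F_def touch_def \<rho>2_def mult_2 add.assoc)
      from S'(4)[OF this] show ?thesis
      proof
       assume "e3 \<in> S'" thus ?thesis using e3R by blast
      next
       assume "\<exists>e'\<in>S'. near L e3 e'"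
       then obtain e' where e': "e' \<in> S'" "near L e3 e'" by blast
       hence "e' \<in> EG" using S'C Cand_edge by blast
       hence "e' \<subseteq> ball (R0 + L + 1) v" using near_ball[OF e3(2)] e' by blast
       thus ?thesis using e' by (auto simp: R_def)
      qed
     qed
    qed
   qed
  qed
  have fam: "S' \<in> Fam L" using S'C S'(3) dens by (auto simp: Fam_def R_def)
  have out: "S' - touch K = S - touch K" using S'(1,2) by (auto simp: Sa_def Sb_def F_def)
  have "i \<in> S' \<longleftrightarrow> i \<in> S2" if i: "i \<in> touch K" "i \<notin> IB (Suc \<rho>2) x" for i
  proof -
   have far: "i \<inter> ball \<rho>2 x = {}" if "i \<in> EG"
   proof (rule ccontr)
    assume "i \<inter> ball \<rho>2 x \<noteq> {}"
    hence "i \<subseteq> ball (Suc \<rho>2) x" by (rule edge_in_ball_Suc[OF that])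
    thus False using i that by (auto simp: IB_def Idx_def)
   qed
   have b: "ball \<rho> x \<subseteq> ball \<rho>2 x" "ball \<tau> x \<subseteq> ball \<rho>2 x" by (rule ball_mono; simp add: \<rho>2_def \<tau>_def)+
   show ?thesis
   proof
    assume "i \<in> S'"
    moreover from this have i2: "i \<inter> ball \<rho>2 x = {}" using far S'C Cand_edge by blast
    moreover have "i \<inter> ball \<rho> x = {}" using i2 b(1) by blast
    ultimately have "i \<notin> Sa" "i \<notin> F" "i \<in> Sa \<union> Sb \<union> F" using S'(2) i by (auto simp: Sa_def F_def)
    thus "i \<in> S2" by (simp add: Sb_def)
   next
    assume "i \<in> S2"
    moreover from this have "i \<inter> ball \<rho>2 x = {}" using far edge by blast
    moreover from calculation have "i \<inter> ball \<tau> x = {}" using b(2) by blast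
    ultimately have "i \<in> Sb" using i by (simp add: Sb_def)
    thus "i \<in> S'" using S'(1) by blast
   qed
  qed
  thus ?thesis using fam out by blast
 qed
 thus ?thesis by blast
qed

section \<open>The exchange argument\<close>

definition Fin :: "'v set set set" where "Fin = {I. finite I \<and> I \<subseteq> Idx}"

definition Mset :: "nat \<Rightarrow> real \<Rightarrow> real \<Rightarrow> real \<Rightarrow> 'v \<Rightarrow> real set" where
 "Mset L p r h x = {PR I (Pm S p r h) (hits x) |S I. S \<in> Fam L \<and> I \<in> Fin}"

text \<open>Both the pattern and the finite index set vary, so an automorphism only permutes the
  competitors and the value is constant on orbits. Its analogue \<open>kbar\<close> is optimised on
  the single component \<open>K\<close>.\<close>

definition Mbar :: "nat \<Rightarrow> real \<Rightarrow> real \<Rightarrow> real \<Rightarrow> 'v \<Rightarrow> real" where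
 "Mbar L p r h x = Sup (Mset L p r h x)"

definition kset :: "nat \<Rightarrow> real \<Rightarrow> real \<Rightarrow> real \<Rightarrow> 'v \<Rightarrow> 'v set \<Rightarrow> real set" where
 "kset L p r h x K = {PR (I \<inter> touch K) (Pm S p r h) (hits x) |S I. S \<in> Fam L \<and> I \<in> Fin}"

definition kbar :: "nat \<Rightarrow> real \<Rightarrow> real \<Rightarrow> real \<Rightarrow> 'v \<Rightarrow> 'v set \<Rightarrow> real" where
 "kbar L p r h x K = Sup (kset L p r h x K)"

lemma FinD: "I \<in> Fin \<Longrightarrow> finite I" "I \<in> Fin \<Longrightarrow> I \<subseteq> Idx" by (auto simp: Fin_def)

lemma IB_Fin: "IB n v \<in> Fin" using IB_sub_Idx by (simp add: Fin_def)

lemma Un_Fin: "I \<in> Fin \<Longrightarrow> J \<in> Fin \<Longrightarrow> I \<union> J \<in> Fin" by (auto simp: Fin_def)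

lemma Mset_nonempty: "Mset L p r h x \<noteq> {}" "kset L p r h x K \<noteq> {}"
proof -
 obtain S where S: "S \<in> Fam L" using Fam_nonempty by blast
 have "PR {} (Pm S p r h) (hits x) \<in> Mset L p r h x" using S by (auto simp: Mset_def Fin_def)
 thus "Mset L p r h x \<noteq> {}" by blast
 have "PR ({} \<inter> touch K) (Pm S p r h) (hits x) \<in> kset L p r h x K"
  unfolding kset_def Fin_def using S by blast
 thus "kset L p r h x K \<noteq> {}" by blast
qed

lemma Mset_bdd:
 assumes "okp a p r h"
 shows "bdd_above (Mset L p r h x)" "bdd_above (kset L p r h x K)"
proof -
 have P: "\<And>S. pv (Pm S p r h)" by (rule okp_pv[OF assms])
 show "bdd_above (Mset L p r h x)"
  by (rule bdd_aboveI[of _ 1]) (auto simp: Mset_def Fin_def intro: PR_le_1[OF P])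
 show "bdd_above (kset L p r h x K)"
  by (rule bdd_aboveI[of _ 1]) (auto simp: kset_def Fin_def intro: PR_le_1[OF P])
qed

lemma Mbar_upper:
 assumes "okp a p r h" "S \<in> Fam L" "I \<in> Fin"
 shows "PR I (Pm S p r h) (hits x) \<le> Mbar L p r h x"
 unfolding Mbar_def
 by (rule cSup_upper[OF _ Mset_bdd(1)[OF assms(1)]]) (use assms(2,3) in "auto simp: Mset_def")

lemma kbar_upper:
 assumes "okp a p r h" "S \<in> Fam L" "I \<in> Fin"
 shows "PR (I \<inter> touch K) (Pm S p r h) (hits x) \<le> kbar L p r h x K"
 unfolding kbar_def
 by (rule cSup_upper[OF _ Mset_bdd(2)[OF assms(1)]]) (use assms(2,3) in "auto simp: kset_def")

lemma Mbar_least: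
 assumes "\<And>S I. S \<in> Fam L \<Longrightarrow> I \<in> Fin \<Longrightarrow> PR I (Pm S p r h) (hits x) \<le> B"
 shows "Mbar L p r h x \<le> B"
 unfolding Mbar_def by (rule cSup_least[OF Mset_nonempty(1)]) (use assms in "auto simp: Mset_def")

lemma kbar_least:
 assumes "\<And>S I. S \<in> Fam L \<Longrightarrow> I \<in> Fin \<Longrightarrow> PR (I \<inter> touch K) (Pm S p r h) (hits x) \<le> B"
 shows "kbar L p r h x K \<le> B"
 unfolding kbar_def by (rule cSup_least[OF Mset_nonempty(2)]) (use assms in "auto simp: kset_def")

lemma Mbar_nonneg:
 assumes "okp a p r h"
 shows "0 \<le> Mbar L p r h x" "0 \<le> kbar L p r h x K"
proof -
 obtain S where S: "S \<in> Fam L" using Fam_nonempty by blast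
 have P: "pv (Pm S p r h)" by (rule okp_pv[OF assms])
 have F: "{} \<in> Fin" by (simp add: Fin_def)
 show "0 \<le> Mbar L p r h x" using Mbar_upper[OF assms S F, of x] PR_nonneg[OF P] by (rule order_trans[rotated])
 show "0 \<le> kbar L p r h x K" using kbar_upper[OF assms S F, of K x] PR_nonneg[OF P] by (rule order_trans[rotated])
qed

lemma Fin_sub_IB: "I \<in> Fin \<Longrightarrow> \<exists>N. I \<subseteq> IB N x"
proof -
 assume I: "I \<in> Fin"
 have "finite (\<Union>I)"
 proof (rule finite_Union[OF FinD(1)[OF I]])
  fix i assume "i \<in> I"
  hence "i \<in> Idx" using FinD(2)[OF I] by blast
  thus "finite i" unfolding Idx_def by (auto elim: edgesE)
 qed
 then obtain N where "\<Union>I \<subseteq> ball N x" using ball_exists_finite by blast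
 hence "I \<subseteq> IB N x" using FinD(2)[OF I] by (auto simp: IB_def)
 thus ?thesis ..
qed

lemma Mbar_approx:
 assumes ok: "okp a p r h" and u: "0 < u"
 shows "\<exists>S\<in>Fam L. \<exists>N0. \<forall>N\<ge>N0. Mbar L p r h z - u < HP N S p r h z"
proof -
 have "Mbar L p r h z - u < Sup (Mset L p r h z)" using u by (simp add: Mbar_def)
 then obtain y where y: "y \<in> Mset L p r h z" "Mbar L p r h z - u < y"
  using less_cSup_iff[OF Mset_nonempty(1) Mset_bdd(1)[OF ok]] by blast
 then obtain S I where S: "S \<in> Fam L" "I \<in> Fin" "y = PR I (Pm S p r h) (hits z)" by (auto simp: Mset_def)
 obtain N0 where N0: "I \<subseteq> IB N0 z" using Fin_sub_IB[OF S(2)] by blast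
 have "Mbar L p r h z - u < HP N S p r h z" if "N0 \<le> N" for N
 proof -
  have "y \<le> HP N S p r h z" unfolding S(3)
   using N0 IB_mono[OF that, of z] by (intro PR_mono_index[OF incr_hits okp_pv[OF ok] finite_IB]) auto
  thus ?thesis using y by simp
 qed
 thus ?thesis using S(1) by blast
qed

lemma Mbar_aut_le:
 assumes ok: "okp a p r h" and H: "H \<in> Aut"
 shows "Mbar L p r h x \<le> Mbar L p r h (H x)"
proof (rule Mbar_least)
 fix S I assume S: "S \<in> Fam L" and I: "I \<in> Fin"
 have "image H ` I \<in> Fin" using I Idx_aut[OF H] by (auto simp: Fin_def)
 from Mbar_upper[OF ok Fam_aut[OF H S] this, of "H x"]
 show "PR I (Pm S p r h) (hits x) \<le> Mbar L p r h (H x)" using PR_aut[OF H FinD(1)[OF I]] by simp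
qed

lemma EA_IB: "R \<subseteq> ball n v \<Longrightarrow> EA R \<subseteq> IB n v"
 by (auto simp: EA_def IB_def Idx_def)

lemma Mbar_near:
 assumes ok: "okp a p r h" and x: "x \<in> ball n y" and N: "\<And>v. card (IB (Suc n) v) \<le> N"
 shows "Mbar L p r h y \<le> (2/a) ^ N * Mbar L p r h x"
proof (rule Mbar_least)
 fix S I assume S: "S \<in> Fam L" and I: "I \<in> Fin"
 let ?P = "Pm S p r h" and ?I = "I \<union> IB n y"
 have I': "?I \<in> Fin" by (rule Un_Fin[OF I IB_Fin])
 have "PR I ?P (hits y) \<le> PR ?I ?P (hits y)"
  by (rule PR_mono_index[OF incr_hits okp_pv[OF ok] FinD(1)[OF I']]) simp
 also have "\<dots> \<le> (2/a) ^ N * PR ?I ?P (hits x)"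
  by (rule hits_connect[OF FinD[OF I'] _ order_refl N ok conn_ball x ball_self]) (use EA_IB[OF order_refl] in blast)
 also have "\<dots> \<le> (2/a) ^ N * Mbar L p r h x"
  using okp_a[OF ok] by (intro mult_left_mono Mbar_upper[OF ok S I']) auto
 finally show "PR I ?P (hits y) \<le> (2/a) ^ N * Mbar L p r h x" .
qed

text \<open>A Harnack inequality: the image \<open>H x\<close> inside \<open>K\<close> sees the ghost either within \<open>K\<close> or through
 \<open>x\<close>, and the latter costs a factor less than one of the same quantity.\<close>
lemma Mbar_kbar:
 assumes ok: "okp a p r h" and K: "side x K" "harn x n K" and N: "\<And>v. card (IB (Suc n) v) \<le> N"
  and D: "\<And>v. card {y. adj v y} \<le> D"
 shows "Mbar L p r h x \<le> (1/a) ^ D * (2/a) ^ N * kbar L p r h x K"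
proof -
 obtain H R where H: "H \<in> Aut" "H x \<in> K" "R \<subseteq> ball n x" "R \<subseteq> insert x K" "conn R" "x \<in> R" "H x \<in> R"
  using K(2) unfolding harn_def by blast
 let ?z = "H x"
 let ?M = "Mbar L p r h x" and ?k = "kbar L p r h x K"
 have a: "0 < a" "a \<le> 1" using okp_a[OF ok] by auto
 have xz: "x \<noteq> ?z" using H(2) K(1) by (auto simp: side_def)
 \<comment> \<open>Applied at an image of \<open>x\<close>, the estimate bounds the supremum by
   itself: invariance replaces the left-hand side by \<open>?M\<close>, and the factor
   \<open>1 - a ^ D\<close>, from the chance that the image is isolated, lets \<open>?M\<close> be
   absorbed.\<close>
 have "Mbar L p r h ?z \<le> (2/a) ^ N * ?k + (1 - a ^ D) * ?M"
 proof (rule Mbar_least)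
  fix S I assume S: "S \<in> Fam L" and I: "I \<in> Fin"
  let ?P = "Pm S p r h" and ?I = "I \<union> IB n x"
  have P: "pv ?P" by (rule okp_pv[OF ok])
  have I': "?I \<in> Fin" by (rule Un_Fin[OF I IB_Fin])
  note fI = FinD(1)[OF I'] and II = FinD(2)[OF I']
  have "PR I ?P (hits ?z) \<le> PR ?I ?P (hits ?z)"
   by (rule PR_mono_index[OF incr_hits P fI]) simp
  also have "\<dots> \<le> PR ?I ?P (\<lambda>V. \<exists>b\<in>{True, False}. if b then hits ?z (V \<inter> touch K) else
    (x \<in> cl (V \<inter> touch K) ?z \<and> hits x (V - touch K)))"
  proof (rule PR_mono[OF P])
   fix V assume "V \<subseteq> ?I" "hits ?z V"
   thus "\<exists>b\<in>{True, False}. if b then hits ?z (V \<inter> touch K) else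
    (x \<in> cl (V \<inter> touch K) ?z \<and> hits x (V - touch K))"
    using side_hits_inside[OF K(1) H(2), of V] II by auto
  qed
  also have "\<dots> \<le> (\<Sum>b\<in>{True, False}. PR ?I ?P (\<lambda>V. if b then hits ?z (V \<inter> touch K) else
    (x \<in> cl (V \<inter> touch K) ?z \<and> hits x (V - touch K))))"
   by (rule PR_Ex_le[OF P]) simp
  also have "\<dots> = PR ?I ?P (\<lambda>V. hits ?z (V \<inter> touch K)) + PR ?I ?P (\<lambda>V. x \<in> cl (V \<inter> touch K) ?z \<and> hits x (V - touch K))"
   by simp
  also have "PR ?I ?P (\<lambda>V. hits ?z (V \<inter> touch K)) = PR (?I \<inter> touch K) ?P (hits ?z)"
   by (rule PR_restrict[OF fI])
  also have "PR ?I ?P (\<lambda>V. x \<in> cl (V \<inter> touch K) ?z \<and> hits x (V - touch K)) =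
    PR (?I \<inter> touch K) ?P (\<lambda>V. x \<in> cl V ?z) * PR (?I - touch K) ?P (hits x)"
   by (rule PR_indep[OF fI])
  also have "PR (?I \<inter> touch K) ?P (hits ?z) \<le> (2/a) ^ N * ?k"
  proof -
   have "EA R \<subseteq> ?I \<inter> touch K" using EA_IB[OF H(3)] EA_two[OF _ H(4)] by blast
   hence "PR (?I \<inter> touch K) ?P (hits ?z) \<le> (2/a) ^ N * PR (?I \<inter> touch K) ?P (hits x)"
    by (intro hits_connect[OF _ _ _ H(3) N ok H(5,6,7)]) (use fI II in auto)
   also have "\<dots> \<le> (2/a) ^ N * ?k"
    using a by (intro mult_left_mono kbar_upper[OF ok S I']) auto
   finally show ?thesis .
  qed
  also have "PR (?I \<inter> touch K) ?P (\<lambda>V. x \<in> cl V ?z) * PR (?I - touch K) ?P (hits x) \<le> (1 - a ^ D) * ?M"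
  proof (rule mult_mono)
   show "PR (?I \<inter> touch K) ?P (\<lambda>V. x \<in> cl V ?z) \<le> 1 - a ^ D"
    by (rule PR_isolated[OF _ _ ok D xz]) (use fI II in auto)
   have "?I - touch K \<in> Fin" using I' by (auto simp: Fin_def)
   thus "PR (?I - touch K) ?P (hits x) \<le> ?M" by (rule Mbar_upper[OF ok S])
   show "0 \<le> 1 - a ^ D" using a by (simp add: power_le_one)
  qed (rule PR_nonneg[OF P])
  finally show "PR I ?P (hits ?z) \<le> (2/a) ^ N * ?k + (1 - a ^ D) * ?M" by simp
 qed
 hence "?M \<le> (2/a) ^ N * ?k + (1 - a ^ D) * ?M" using Mbar_aut_le[OF ok H(1), of L x] by linarith
 hence "a ^ D * ?M \<le> (2/a) ^ N * ?k" by (simp add: algebra_simps)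
 hence "(1/a) ^ D * (a ^ D * ?M) \<le> (1/a) ^ D * ((2/a) ^ N * ?k)" using a by (intro mult_left_mono) auto
 thus ?thesis using a by (simp add: power_divide)
qed

text \<open>Splicing a competitor \<open>S2\<close> into \<open>S\<close> behind \<open>x\<close>
  leaves both front factors of \<open>M_decomp\<close> unchanged. As \<open>S\<close> is optimal up
  to \<open>u\<close>, the improvement on \<open>K\<close> weighted by the front factor is at most
  \<open>u\<close>. The transition zone costs \<open>(1/a) ^ NT\<close>, and passing from an
  arbitrary index set to the box costs \<open>(1 - h) ^ k\<close>.\<close>

lemma exchange:
 assumes ok: "okp a p r h" and S: "S \<in> Fam L" and K: "side x K" "z \<notin> K"
  and T: "\<And>S S2 x K. S \<in> Fam L \<Longrightarrow> S2 \<in> Fam L \<Longrightarrow> side x K \<Longrightarrow>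
   \<exists>S'\<in>Fam L. S' - touch K = S - touch K \<and> (\<forall>i\<in>touch K. i \<notin> IB T x \<longrightarrow> (i \<in> S' \<longleftrightarrow> i \<in> S2))"
  and NT: "\<And>v. card (IB T v) \<le> NT"
  and near: "\<And>S'. S' \<in> Fam L \<Longrightarrow> HP N S' p r h z \<le> HP N S p r h z + u"
  and u: "0 \<le> u" and k: "ball (Suc k) x \<subseteq> ball N z"
 shows "PR (IB N z - touch K) (Pm S p r h) (Dev z x) * kbar L p r h x K \<le>
  (1/a) ^ NT * (PR (IB N z - touch K) (Pm S p r h) (Dev z x) * PR (IB N z \<inter> touch K) (Pm S p r h) (hits x) + u) + (1 - h) ^ k"
proof -
 let ?I = "IB N z" and ?P = "\<lambda>S. Pm S p r h"
 let ?D = "PR (?I - touch K) (?P S) (Dev z x)" and ?k = "PR (?I \<inter> touch K) (?P S) (hits x)"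
 have P: "\<And>S. pv (?P S)" by (rule okp_pv[OF ok])
 have a: "0 < a" "a \<le> 1" using okp_a[OF ok] by auto
 have h: "0 \<le> h" "h \<le> 1" using ok by (auto simp: okp_def)
 have D01: "0 \<le> ?D" "?D \<le> 1" using PR_nonneg[OF P] PR_le_1[OF P] by auto
 have dec: "PR ?I (?P S') (hits z) = PR (?I - touch K) (?P S') (hits z) + PR (?I - touch K) (?P S') (Dev z x) * PR (?I \<inter> touch K) (?P S') (hits x)" for S'
  by (rule M_decomp[OF finite_IB IB_sub_Idx K])
 have step: "?D * PR (J \<inter> touch K) (?P S2) (hits x) \<le> (1/a) ^ NT * (?D * ?k + u) + (1 - h) ^ k"
  if S2: "S2 \<in> Fam L" and J: "J \<in> Fin" for S2 J
 proof -
  let ?J = "(J \<union> ?I) \<inter> touch K"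
  have J': "J \<union> ?I \<in> Fin" by (rule Un_Fin[OF J IB_Fin])
  have "PR (J \<inter> touch K) (?P S2) (hits x) \<le> PR ?J (?P S2) (hits x)"
   by (rule PR_mono_index[OF incr_hits P]) (use FinD(1)[OF J'] in auto)
  also have "\<dots> \<le> PR (?I \<inter> touch K) (?P S2) (hits x) + (1 - h) ^ k"
  proof (rule truncation)
   show "finite ?J" "?J \<subseteq> Idx" using FinD[OF J'] by auto
   show "?I \<inter> touch K \<subseteq> ?J" by blast
   show "Pm S2 p r h i = h" if "i \<in> greens" for i using that by (simp add: Pm_def)
   show "i \<in> ?I \<inter> touch K" if i: "i \<in> ?J" "i \<inter> ball k x \<noteq> {}" for i
   proof -
    have "i \<in> Idx" using i FinD(2)[OF J'] by blast
    moreover have "i \<in> touch (ball k x)" using i by (simp add: touch_def)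
    ultimately have "i \<in> IB (Suc k) x" using touch_IB[OF order_refl, of k x] by blast
    thus ?thesis using k i by (auto simp: IB_def)
   qed
   show "{w} \<in> ?I \<inter> touch K" if w: "V \<subseteq> ?I \<inter> touch K" "w \<in> cl V x" "w \<in> ball k x" "w \<noteq> x" for V w
   proof -
    have "cl V x \<subseteq> insert x K"
    proof (rule cl_subI)
     fix s t assume st: "s \<in> insert x K" "{s, t} \<in> V"
     hence "{s, t} \<in> Idx" "{s, t} \<in> touch K" using w(1) IB_sub_Idx by blast+
     thus "t \<in> insert x K" using st(1) K(1) Idx_adj[of s t] by (auto simp: side_def touch_def)
    qed simp
    hence "w \<in> K" using w by blast
    moreover have "w \<in> ball N z" using w(3) k ball_mono[of k "Suc k" x] by auto
    ultimately show ?thesis by (auto simp: IB_def Idx_def touch_def)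
   qed
  qed (use P h in auto)
  finally have 1: "PR (J \<inter> touch K) (?P S2) (hits x) \<le> PR (?I \<inter> touch K) (?P S2) (hits x) + (1 - h) ^ k" .
  obtain S' where S': "S' \<in> Fam L" "S' - touch K = S - touch K" "\<forall>i\<in>touch K. i \<notin> IB T x \<longrightarrow> (i \<in> S' \<longleftrightarrow> i \<in> S2)"
   using T[OF S S2 K(1)] by blast
  have out: "?P S' i = ?P S i" if "i \<in> ?I - touch K" for i
  proof -
   have "i \<in> S' \<longleftrightarrow> i \<in> S" using that S'(2) by blast
   thus ?thesis by (simp add: Pm_def)
  qed
  have 2: "PR (?I \<inter> touch K) (?P S2) (hits x) \<le> (1/a) ^ NT * PR (?I \<inter> touch K) (?P S') (hits x)"
  proof (rule PR_change_param[where Z = "IB T x - greens"])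
   have "card (IB T x - greens) \<le> card (IB T x)" by (rule card_mono) auto
   thus "card (IB T x - greens) \<le> NT" using NT[of x] by simp
   show "?P S2 i = ?P S' i" if "i \<in> ?I \<inter> touch K - (IB T x - greens)" for i
    using that S'(3) unfolding Pm_def by auto
   show "a \<le> ?P S' i \<and> ?P S' i \<le> 1 - a" if "i \<in> IB T x - greens" for i
    using okp_edge[OF ok] that by blast
  qed (use P a in auto)
  \<comment> \<open>Near-optimality is used only for the spliced pattern; equality of the front
    terms cancels everything except the back factor.\<close>
  have "PR ?I (?P S') (hits z) \<le> PR ?I (?P S) (hits z) + u" by (rule near[OF S'(1)])
  moreover have "PR (?I - touch K) (?P S') A = PR (?I - touch K) (?P S) A" for A
   by (rule PR_param_cong[OF out])
  ultimately have 3: "?D * PR (?I \<inter> touch K) (?P S') (hits x) \<le> ?D * ?k + u"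
   unfolding dec by simp
  have "?D * PR (J \<inter> touch K) (?P S2) (hits x) \<le> ?D * (PR (?I \<inter> touch K) (?P S2) (hits x) + (1 - h) ^ k)"
   by (rule mult_left_mono[OF 1 D01(1)])
  also have "\<dots> = ?D * PR (?I \<inter> touch K) (?P S2) (hits x) + ?D * (1 - h) ^ k" by (simp add: algebra_simps)
  also have "\<dots> \<le> ?D * ((1/a) ^ NT * PR (?I \<inter> touch K) (?P S') (hits x)) + 1 * (1 - h) ^ k"
   using D01 h by (intro add_mono mult_left_mono[OF 2] mult_right_mono) auto
  also have "\<dots> = (1/a) ^ NT * (?D * PR (?I \<inter> touch K) (?P S') (hits x)) + (1 - h) ^ k" by simp
  also have "\<dots> \<le> (1/a) ^ NT * (?D * ?k + u) + (1 - h) ^ k"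
   using a by (intro add_right_mono mult_left_mono[OF 3]) auto
  finally show ?thesis .
 qed
 show ?thesis
 \<comment> \<open>For positive \<open>?D\<close>, dividing by it turns the bound for each
   competitor into a bound for the supremum \<open>kbar\<close>.\<close>
 proof (cases "?D = 0")
  case True
  have "0 \<le> (1/a) ^ NT * (?D * ?k + u) + (1 - h) ^ k"
   using True a u h by simp
  thus ?thesis using True by simp
 next
  case False
  hence D: "0 < ?D" using D01 by simp
  have "kbar L p r h x K \<le> ((1/a) ^ NT * (?D * ?k + u) + (1 - h) ^ k) / ?D"
   by (rule kbar_least) (use step D in "simp add: pos_le_divide_eq mult.commute")
  thus ?thesis using D by (simp add: pos_le_divide_eq mult.commute)
 qed
qed

lemma IB_card_bound: "\<exists>N. \<forall>v. card (IB n v) \<le> N"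
proof -
 obtain N where N: "\<And>v. card (ball n v) \<le> N" using ball_card_bound by blast
 have "card (IB n v) \<le> 2 ^ N" for v
 proof -
  have "card (IB n v) \<le> card (Pow (ball n v))" by (rule card_mono) (auto simp: IB_def)
  also have "\<dots> = 2 ^ card (ball n v)" by (simp add: card_Pow)
  also have "\<dots> \<le> 2 ^ N" using N by (intro power_increasing) auto
  finally show ?thesis .
 qed
 thus ?thesis by blast
qed

lemma degree_bound: "\<exists>D. \<forall>v. card {y. adj v y} \<le> D"
proof -
 obtain N where N: "\<And>v. card (ball (Suc 0) v) \<le> N" using ball_card_bound by blast
 have "card {y. adj v y} \<le> N" for v
 proof -
  have "card {y. adj v y} \<le> card (ball (Suc 0) v)" by (rule card_mono) (auto intro: ball_adj)
  thus ?thesis using N[of v] by simp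
 qed
 thus ?thesis by blast
qed

text \<open>In the cut-vertex case the chain is: influence of \<open>f\<close>, front factor times
  connection probability near \<open>x\<close>, by Harnack front factor times \<open>kbar\<close>,
  by exchange front factor times the back probability of \<open>S\<close>, and by surgery the
  influence of \<open>e\<close>. Here \<open>u\<close> measures how far \<open>S\<close> is from
  optimal and \<open>k\<close> how far the box extends beyond \<open>v\<close>.\<close>

lemma piv_bound:
 assumes a: "0 < a" "a \<le> 1"
 shows "\<exists>C n0 \<rho>. 1 \<le> C \<and> (\<forall>p r h z S N f v u k. okp a p r h \<longrightarrow> S \<in> Fam L \<longrightarrow> f \<in> EG \<longrightarrow> v \<in> f \<longrightarrow>
   (\<forall>S'\<in>Fam L. HP N S' p r h z \<le> HP N S p r h z + u) \<longrightarrow> 0 \<le> u \<longrightarrow>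
   ball (n0 + k) v \<subseteq> ball N z \<longrightarrow>
   (\<exists>e\<in>S \<inter> IB N z. e \<subseteq> ball \<rho> v \<and> QP N S p r h z f \<le>
    C * (QP N S p r h z e + u + (1 - h) ^ k)))"
proof -
 obtain n \<rho> where ge: "\<And>S z f v. S \<subseteq> Cand \<Longrightarrow> (\<forall>w. \<exists>e\<in>S. e \<subseteq> ball (R0 + L + 1) w) \<Longrightarrow> f \<in> EG \<Longrightarrow> v \<in> f \<Longrightarrow>
   \<exists>e\<in>S. e \<subseteq> ball \<rho> v \<and> (alpha v n f e \<or> (\<exists>x K. beta v n f e x K \<and> z \<notin> K) \<or> dangling v n z f e)"
  using good_edge[of "R0 + L + 1"] by blast
 obtain T where T: "\<And>S S2 x K. S \<in> Fam L \<Longrightarrow> S2 \<in> Fam L \<Longrightarrow> side x K \<Longrightarrow>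
   \<exists>S'\<in>Fam L. S' - touch K = S - touch K \<and> (\<forall>i\<in>touch K. i \<notin> IB T x \<longrightarrow> (i \<in> S' \<longleftrightarrow> i \<in> S2))"
  using glue[of L] by blast
 obtain NT where NT: "\<And>v. card (IB T v) \<le> NT" using IB_card_bound by blast
 obtain N1 where N1: "\<And>v. card (IB (Suc n) v) \<le> N1" using IB_card_bound by blast
 obtain N2 where N2: "\<And>v. card (IB (Suc (n + n)) v) \<le> N2" using IB_card_bound by blast
 obtain N3 where N3: "\<And>v. card (ball n v) \<le> N3" using ball_card_bound by blast
 obtain m where m: "\<And>x K. side x K \<Longrightarrow> infinite K \<Longrightarrow> harn x m K" using harn_uniform by blast
 obtain N4 where N4: "\<And>v. card (IB (Suc m) v) \<le> N4" using IB_card_bound by blast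
 obtain D where D: "\<And>v. card {y. adj v y} \<le> D" using degree_bound by blast
 \<comment> \<open>Large enough for the surgery regions of radius \<open>n\<close>, the candidate
   edge within \<rho>, and the ball of radius \<open>Suc k\<close> about a cut vertex within
   \<open>n\<close> of \<open>v\<close>.\<close>
 define n0 where "n0 = n + \<rho> + 1"
 \<comment> \<open>\<open>C1\<close> is the price of one surgery near \<open>f\<close>,
   \<open>C2\<close> that of moving to \<open>x\<close> and applying Harnack, \<open>C3\<close> that
   of the transition zone; \<open>N3\<close> counts the vertices in the union bound.\<close>
 define C1 where "C1 = (2/a) ^ N1"
 define C2 where "C2 = (2/a) ^ N2 * ((1/a) ^ D * (2/a) ^ N4)"
 define C3 where "C3 = (1/a) ^ NT"
 define C where "C = C1 + C1 * N3 * C2 * (C3 * C1 + C3 + 1)"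
 have ge1: "1 \<le> 2/a" "1 \<le> 1/a" using a by (auto simp: field_simps)
 have C123: "1 \<le> C1" "1 \<le> C2" "1 \<le> C3"
 proof -
  show "1 \<le> C1" "1 \<le> C3" unfolding C1_def C3_def using ge1 one_le_power by blast+
  have "1 * (1 * 1) \<le> (2/a) ^ N2 * ((1/a) ^ D * (2/a) ^ N4)"
   using a ge1 one_le_power[OF ge1(1)] one_le_power[OF ge1(2)] by (intro mult_mono) auto
  thus "1 \<le> C2" unfolding C2_def by simp
 qed
 have C0: "0 \<le> C1 * N3 * C2 * (C3 * C1 + C3 + 1)" using C123 by (intro mult_nonneg_nonneg add_nonneg_nonneg) auto
 have CC: "C1 \<le> C" "1 \<le> C" using C0 C123 unfolding C_def by linarith+
 have main: "\<exists>e\<in>S \<inter> IB N z. e \<subseteq> ball \<rho> v \<and> QP N S p r h z f \<le>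
    C * (QP N S p r h z e + u + (1 - h) ^ k)"
  if ok: "okp a p r h" and S: "S \<in> Fam L" and f: "f \<in> EG" "v \<in> f"
   and near: "\<forall>S'\<in>Fam L. HP N S' p r h z \<le> HP N S p r h z + u"
   and u: "0 \<le> u" and bN: "ball (n0 + k) v \<subseteq> ball N z" for p r h z S N f v u k
 proof -
  let ?I = "IB N z" and ?P = "Pm S p r h"
  have P: "pv ?P" by (rule okp_pv[OF ok])
  have h: "0 \<le> (1 - h) ^ k" using ok by (auto simp: okp_def)
  have "S \<subseteq> Cand" "\<forall>w. \<exists>e\<in>S. e \<subseteq> ball (R0 + L + 1) w" using S by (auto simp: Fam_def)
  from ge[OF this f, of z] obtain e where e: "e \<in> S" "e \<subseteq> ball \<rho> v"
   and cases: "alpha v n f e \<or> (\<exists>x K. beta v n f e x K \<and> z \<notin> K) \<or> dangling v n z f e" by blast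
  have eC: "e \<in> Cand" using e S by (auto simp: Fam_def)
  have ee: "e \<in> EG" by (rule Cand_edge[OF eC])
  have sub: "ball j v \<subseteq> ball N z" if "j \<le> n0 + k" for j using ball_mono[OF that, of v] bN by blast
  have eI: "e \<in> ?I" using e(2) sub[of \<rho>] ee by (auto simp: IB_def Idx_def n0_def)
  have RI: "EA R \<subseteq> ?I" "\<And>w. w \<in> R \<Longrightarrow> {w} \<in> ?I" if "R \<subseteq> ball n v" for R
   using that sub[of n] by (auto simp: EA_def IB_def Idx_def n0_def)
  let ?p = "PR ?I ?P (piv (hits z) e)"
  have p0: "0 \<le> ?p" by (rule PR_nonneg[OF P])
  have simple: "PR ?I ?P (piv (hits z) f) \<le> C * (?p + u + (1 - h) ^ k)" if *: "PR ?I ?P (piv (hits z) f) \<le> C1 * ?p"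
  proof -
   have "C1 * ?p \<le> C * (?p + u + (1 - h) ^ k)" using CC C123 p0 u h by (intro mult_mono) auto
   thus ?thesis using * by simp
  qed
  have "PR ?I ?P (piv (hits z) f) \<le> C * (?p + u + (1 - h) ^ k)"
   using cases
  proof (elim disjE exE conjE)
   assume "alpha v n f e"
   then obtain R where R: "R \<subseteq> ball n v" "linked R e" "f \<subseteq> R" unfolding alpha_def by blast
   show ?thesis
    by (rule simple, unfold C1_def, rule piv_alpha[OF finite_IB IB_sub_Idx RI(1)[OF R(1)] R(1) N1 ok R(2) f(1) R(3)])
  next
   assume "dangling v n z f e"
   then obtain x J R where R: "side x J" "f \<subseteq> insert x J" "z \<notin> J" "R \<subseteq> ball n v" "conn R" "insert x J \<subseteq> R" "e \<subseteq> R"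
    unfolding dangling_def by blast
   show ?thesis
    by (rule simple, unfold C1_def,
      rule piv_dangling[OF finite_IB IB_sub_Idx RI(1)[OF R(4)] RI(2)[OF R(4)] R(4) N1 ok f(1) R(2,1,3,6,5) ee R(7)])
  next
   fix x K assume b: "beta v n f e x K" and zK: "z \<notin> K"
   hence sK: "side x K" "e \<inter> K \<noteq> {}" "f \<inter> K = {}" unfolding beta_def by blast+
   obtain R1 where R1: "R1 \<subseteq> ball n v" "conn R1" "x \<in> R1" "f \<subseteq> R1" "R1 \<inter> K = {}" using b unfolding beta_def by blast
   obtain R2 where R2: "R2 \<subseteq> ball n v" "R2 \<subseteq> insert x K" "x \<in> R2" "e \<subseteq> R2" "\<forall>w\<in>K. adj x w \<longrightarrow> w \<in> R2"
    "\<forall>y\<in>R2 - {x}. link R2 e x y" using b unfolding beta_def by blast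
   have xv: "x \<in> ball n v" using R1 by blast
   have infK: "infinite K" by (rule Cand_side_infinite[OF eC sK(1,2)])
   let ?D = "PR (?I - touch K) ?P (Dev z x)" and ?k = "PR (?I \<inter> touch K) ?P (hits x)"
   let ?kb = "kbar L p r h x K"
   have D0: "0 \<le> ?D" by (rule PR_nonneg[OF P])
   have B: "PR ?I ?P (hits y) \<le> C2 * ?kb" if y: "y \<in> R1" for y
   proof -
    have "y \<in> ball n v" using y R1 by blast
    hence "v \<in> ball n y" by (rule ball_sym)
    hence xy: "x \<in> ball (n + n) y" using xv by (rule ball_trans)
    have "PR ?I ?P (hits y) \<le> Mbar L p r h y" by (rule Mbar_upper[OF ok S IB_Fin])
    also have "\<dots> \<le> (2/a) ^ N2 * Mbar L p r h x" by (rule Mbar_near[OF ok xy N2])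
    also have "\<dots> \<le> (2/a) ^ N2 * ((1/a) ^ D * (2/a) ^ N4 * ?kb)"
     using a by (intro mult_left_mono Mbar_kbar[OF ok sK(1) m[OF sK(1) infK] N4 D]) auto
    finally show ?thesis by (simp add: C2_def mult.assoc)
   qed
   have kb0: "0 \<le> ?kb" by (rule Mbar_nonneg[OF ok])
   have "PR ?I ?P (piv (hits z) f) \<le> C1 * card R1 * (?D * (C2 * ?kb))"
    unfolding C1_def
    by (rule piv_beta_upper[OF finite_IB IB_sub_Idx RI(1)[OF R1(1)] R1(1) N1 ok sK(1) zK R1(5,3,2) f(1) R1(4) B])
   also have "\<dots> \<le> C1 * N3 * (?D * (C2 * ?kb))"
   proof -
    have "card R1 \<le> card (ball n v)" by (rule card_mono[OF finite_ball R1(1)])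
    hence "card R1 \<le> N3" using N3[of v] by simp
    thus ?thesis using C123 D0 kb0 by (intro mult_right_mono mult_left_mono mult_nonneg_nonneg) auto
   qed
   also have "\<dots> = C1 * N3 * C2 * (?D * ?kb)" by simp
   also have "\<dots> \<le> C1 * N3 * C2 * (C3 * (?D * ?k + u) + (1 - h) ^ k)"
   proof -
    have "ball (Suc k) x \<subseteq> ball N z"
    proof
     fix w assume "w \<in> ball (Suc k) x"
     hence "w \<in> ball (n + Suc k) v" by (rule ball_trans[OF xv])
     thus "w \<in> ball N z" using sub[of "n + Suc k"] by (auto simp: n0_def)
    qed
    from exchange[OF ok S sK(1) zK T NT _ u this] near
    have "?D * ?kb \<le> C3 * (?D * ?k + u) + (1 - h) ^ k" unfolding C3_def by blast
    thus ?thesis using C123 by (intro mult_left_mono) auto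
   qed
   also have "\<dots> \<le> C1 * N3 * C2 * (C3 * (C1 * ?p + u) + (1 - h) ^ k)"
   proof -
    have "?D * ?k \<le> ?D * (C1 * PR (?I \<inter> touch K) ?P (piv (hits x) e))"
     unfolding C1_def
     by (rule mult_left_mono[OF hits_piv_inside[OF finite_IB IB_sub_Idx RI(1)[OF R2(1)] R2(1) N1 ok sK(1) R2(2,3,5,6)] D0])
    also have "\<dots> = C1 * (?D * PR (?I \<inter> touch K) ?P (piv (hits x) e))" by simp
    also have "\<dots> \<le> C1 * ?p"
     using C123 by (intro mult_left_mono piv_beta_lower[OF finite_IB IB_sub_Idx P sK(1) zK ee sK(2)]) auto
    finally show ?thesis using C123 by (intro mult_left_mono add_right_mono) auto
   qed
   also have "\<dots> \<le> C1 * N3 * C2 * ((C3 * C1 + C3 + 1) * (?p + u + (1 - h) ^ k))"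
   proof -
    have "C3 * (C1 * ?p + u) + (1 - h) ^ k \<le> (C3 * C1 + C3 + 1) * (?p + u + (1 - h) ^ k)"
    proof -
     have "0 \<le> C3 * C1 * (u + (1 - h) ^ k) + C3 * (?p + (1 - h) ^ k) + (?p + u)"
      using C123 p0 u h by (intro add_nonneg_nonneg mult_nonneg_nonneg) auto
     thus ?thesis by (simp add: algebra_simps)
    qed
    thus ?thesis using C123 by (intro mult_left_mono) auto
   qed
   also have "\<dots> = (C1 * N3 * C2 * (C3 * C1 + C3 + 1)) * (?p + u + (1 - h) ^ k)" by simp
   also have "\<dots> \<le> C * (?p + u + (1 - h) ^ k)"
    using C123 p0 u h by (intro mult_right_mono) (auto simp: C_def)
   finally show ?thesis .
  qed
  thus ?thesis using e eI by blast
 qed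
 show ?thesis
  by (rule exI[of _ C], rule exI[of _ n0], rule exI[of _ \<rho>], intro conjI allI impI CC(2), rule main, assumption+)
qed

section \<open>The differential inequality\<close>

text \<open>Each edge \<open>f\<close> near \<open>z\<close> is charged to a pattern edge within
  bounded distance. A pattern edge receives at most \<open>N4\<close> charges, so the factor
  \<open>c\<close> makes the total at most its own influence; edges far from \<open>z\<close> go
  into the tail.\<close>

lemma charge:
 fixes Q :: "'v set \<Rightarrow> real" and c C w B :: real
 assumes Q: "\<And>i. 0 \<le> Q i" and c: "0 < c" "c \<le> 1" "c * (C * real N4) \<le> 1" and C: "1 \<le> C" and w: "0 \<le> w"
  and N4: "\<And>v. card (IB (Suc \<rho>) v) \<le> N4"
  and PB: "\<And>f v. f \<in> EG \<Longrightarrow> v \<in> f \<Longrightarrow> v \<in> ball m z \<Longrightarrow>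
    \<exists>e\<in>S \<inter> IB N z. e \<subseteq> ball \<rho> v \<and> Q f \<le> C * (Q e + w)"
  and S: "S \<subseteq> EG"
  and tail: "(\<Sum>f | f \<in> IB N z \<inter> EG - S \<and> f \<inter> ball m z = {}. Q f) \<le> B"
 shows "c * (\<Sum>f\<in>IB N z \<inter> EG - S. Q f) \<le> (\<Sum>e\<in>S \<inter> IB N z. Q e) + C * real (card (IB (Suc m) z)) * w + B"
proof -
 let ?I = "IB N z"
 let ?F1 = "{f \<in> ?I \<inter> EG - S. f \<inter> ball m z \<noteq> {}}"
 let ?F2 = "{f \<in> ?I \<inter> EG - S. f \<inter> ball m z = {}}"
 have fin: "finite ?F1" "finite ?F2" "finite (S \<inter> ?I)" by auto
 have "(\<Sum>f\<in>?I \<inter> EG - S. Q f) = (\<Sum>f\<in>?F1 \<union> ?F2. Q f)" by (rule sum.cong) auto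
 also have "\<dots> = (\<Sum>f\<in>?F1. Q f) + (\<Sum>f\<in>?F2. Q f)" by (rule sum.union_disjoint) (use fin in auto)
 finally have split: "(\<Sum>f\<in>?I \<inter> EG - S. Q f) = (\<Sum>f\<in>?F1. Q f) + (\<Sum>f\<in>?F2. Q f)" .
 have "\<forall>f\<in>?F1. \<exists>e. e \<in> S \<inter> ?I \<and> (\<exists>v\<in>f. e \<subseteq> ball \<rho> v) \<and> Q f \<le> C * (Q e + w)"
 proof
  fix f assume f: "f \<in> ?F1"
  then obtain v where v: "v \<in> f" "v \<in> ball m z" by blast
  have "f \<in> EG" using f by blast
  from PB[OF this v] show "\<exists>e. e \<in> S \<inter> ?I \<and> (\<exists>v\<in>f. e \<subseteq> ball \<rho> v) \<and> Q f \<le> C * (Q e + w)" using v by blast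
 qed
 from bchoice[OF this] obtain g where g0: "\<forall>f\<in>?F1. g f \<in> S \<inter> ?I \<and> (\<exists>v\<in>f. g f \<subseteq> ball \<rho> v) \<and> Q f \<le> C * (Q (g f) + w)" ..
 have g: "g f \<in> S \<inter> ?I" "\<exists>v\<in>f. g f \<subseteq> ball \<rho> v" "Q f \<le> C * (Q (g f) + w)" if "f \<in> ?F1" for f
  using bspec[OF g0 that] by simp_all
 \<comment> \<open>All edges charged to \<open>e\<close> have an endpoint within \<rho> of a fixed
   endpoint of \<open>e\<close>.\<close>
 have fib: "real (card {f \<in> ?F1. g f = e}) \<le> real N4" if e: "e \<in> S \<inter> ?I" for e
 proof -
  have "e \<in> EG" using S e by blast
  then obtain x y where xy: "e = {x, y}" by (rule edgesE)
  have "{f \<in> ?F1. g f = e} \<subseteq> IB (Suc \<rho>) x"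
  proof
   fix f assume f: "f \<in> {f \<in> ?F1. g f = e}"
   hence f1: "f \<in> ?F1" by blast
   obtain v where v: "v \<in> f" "e \<subseteq> ball \<rho> v" using g(2)[OF f1] f by blast
   have "x \<in> ball \<rho> v" using v(2) xy by blast
   hence "v \<in> ball \<rho> x" by (rule ball_sym)
   hence "f \<subseteq> ball (Suc \<rho>) x" using edge_in_ball_Suc[of f \<rho> x] f1 v by blast
   thus "f \<in> IB (Suc \<rho>) x" using f1 by (simp add: IB_def)
  qed
  hence "card {f \<in> ?F1. g f = e} \<le> card (IB (Suc \<rho>) x)" by (rule card_mono[OF finite_IB])
  thus ?thesis using N4[of x] by simp
 qed
 have "(\<Sum>f\<in>?F1. Q (g f)) = (\<Sum>e\<in>S \<inter> ?I. \<Sum>f | f \<in> ?F1 \<and> g f = e. Q (g f))"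
  by (rule sum.group[symmetric, OF fin(1,3)]) (use g(1) in blast)
 also have "\<dots> = (\<Sum>e\<in>S \<inter> ?I. real (card {f \<in> ?F1. g f = e}) * Q e)"
  by (rule sum.cong) auto
 also have "\<dots> \<le> (\<Sum>e\<in>S \<inter> ?I. real N4 * Q e)" by (rule sum_mono) (rule mult_right_mono[OF fib Q])
 finally have g4: "(\<Sum>f\<in>?F1. Q (g f)) \<le> real N4 * (\<Sum>e\<in>S \<inter> ?I. Q e)" by (simp add: sum_distrib_left)
 have sub: "?F1 \<subseteq> IB (Suc m) z"
 proof
  fix f assume f: "f \<in> ?F1"
  hence "f \<subseteq> ball (Suc m) z" using edge_in_ball_Suc[of f m z] by blast
  thus "f \<in> IB (Suc m) z" using f by (auto simp: IB_def)
 qed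
 have q: "real (card ?F1) \<le> real (card (IB (Suc m) z))" using card_mono[OF finite_IB sub] by simp
 have "(\<Sum>f\<in>?F1. Q f) \<le> (\<Sum>f\<in>?F1. C * (Q (g f) + w))" by (rule sum_mono) (rule g(3))
 also have "\<dots> = C * (\<Sum>f\<in>?F1. Q (g f)) + C * (real (card ?F1) * w)"
  by (simp add: sum_distrib_left[symmetric] sum.distrib distrib_left)
 also have "\<dots> \<le> C * (real N4 * (\<Sum>e\<in>S \<inter> ?I. Q e)) + C * (real (card (IB (Suc m) z)) * w)"
  using C w q by (intro add_mono mult_left_mono g4 mult_right_mono) auto
 finally have F1: "(\<Sum>f\<in>?F1. Q f) \<le> C * (real N4 * (\<Sum>e\<in>S \<inter> ?I. Q e)) + C * (real (card (IB (Suc m) z)) * w)" .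
 have s0: "0 \<le> (\<Sum>e\<in>S \<inter> ?I. Q e)" by (intro sum_nonneg Q)
 have t0: "0 \<le> (\<Sum>f\<in>?F2. Q f)" by (intro sum_nonneg Q)
 have w0: "0 \<le> C * (real (card (IB (Suc m) z)) * w)" using C w by simp
 have "c * (\<Sum>f\<in>?F1. Q f) \<le> c * (C * (real N4 * (\<Sum>e\<in>S \<inter> ?I. Q e)) + C * (real (card (IB (Suc m) z)) * w))"
  using c by (intro mult_left_mono[OF F1]) auto
 also have "\<dots> = (c * (C * real N4)) * (\<Sum>e\<in>S \<inter> ?I. Q e) + c * (C * (real (card (IB (Suc m) z)) * w))"
  by (simp add: algebra_simps)
 also have "\<dots> \<le> 1 * (\<Sum>e\<in>S \<inter> ?I. Q e) + 1 * (C * (real (card (IB (Suc m) z)) * w))"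
  using c by (intro add_mono mult_right_mono s0 w0) auto
 finally have A: "c * (\<Sum>f\<in>?F1. Q f) \<le> (\<Sum>e\<in>S \<inter> ?I. Q e) + C * (real (card (IB (Suc m) z)) * w)" by simp
 have "c * (\<Sum>f\<in>?F2. Q f) \<le> 1 * (\<Sum>f\<in>?F2. Q f)" using c t0 by (intro mult_right_mono) auto
 thus ?thesis using A tail unfolding split by (simp add: distrib_left mult.assoc)
qed

lemma PR_path_derivative:
 fixes c \<eta> p r h :: real
 assumes S: "S \<subseteq> EG"
 shows "((\<lambda>t. HP N S (p - c * \<eta> * t) (r + \<eta> * t) h z) has_real_derivative
   (\<eta> * (\<Sum>e\<in>S \<inter> IB N z. QP N S (p - c * \<eta> * t) (r + \<eta> * t) h z e) -
   c * \<eta> * (\<Sum>f\<in>IB N z \<inter> EG - S. QP N S (p - c * \<eta> * t) (r + \<eta> * t) h z f))) (at t)"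
proof -
 let ?I = "IB N z" and ?P = "\<lambda>t. Pm S (p - c * \<eta> * t) (r + \<eta> * t) h"
 let ?d = "\<lambda>i. if i \<in> greens then 0 else if i \<in> S then \<eta> else - (c * \<eta>)"
 let ?Q = "\<lambda>i. PR ?I (?P t) (piv (hits z) i)"
 have D: "((\<lambda>t. PR ?I (?P t) (hits z)) has_real_derivative (\<Sum>i\<in>?I. ?d i * ?Q i)) (at t)"
 proof (rule PR_has_derivative[OF finite_IB incr_hits])
  fix i assume "i \<in> ?I"
  show "((\<lambda>t. ?P t i) has_real_derivative ?d i) (at t)"
   unfolding Pm_def by (cases "i \<in> greens"; cases "i \<in> S") (auto intro!: derivative_eq_intros)
 qed
 have Sg: "i \<notin> greens" if "i \<in> S" for i using S that edge_not_green by blast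
 have "(\<Sum>i\<in>?I. ?d i * ?Q i) = (\<Sum>i\<in>(S \<inter> ?I) \<union> (?I \<inter> EG - S) \<union> (?I \<inter> greens). ?d i * ?Q i)"
  using IB_sub_Idx[of N z] by (intro sum.cong) (auto simp: Idx_def)
 also have "\<dots> = (\<Sum>i\<in>(S \<inter> ?I) \<union> (?I \<inter> EG - S). ?d i * ?Q i) + (\<Sum>i\<in>?I \<inter> greens. ?d i * ?Q i)"
  by (rule sum.union_disjoint) (use Sg edge_not_green in auto)
 also have "(\<Sum>i\<in>?I \<inter> greens. ?d i * ?Q i) = 0" by (rule sum.neutral) auto
 also have "(\<Sum>i\<in>(S \<inter> ?I) \<union> (?I \<inter> EG - S). ?d i * ?Q i) = (\<Sum>i\<in>S \<inter> ?I. ?d i * ?Q i) + (\<Sum>i\<in>?I \<inter> EG - S. ?d i * ?Q i)"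
  by (rule sum.union_disjoint) auto
 also have "(\<Sum>i\<in>S \<inter> ?I. ?d i * ?Q i) = (\<Sum>i\<in>S \<inter> ?I. \<eta> * ?Q i)" by (rule sum.cong) (use Sg in auto)
 also have "(\<Sum>i\<in>?I \<inter> EG - S. ?d i * ?Q i) = (\<Sum>i\<in>?I \<inter> EG - S. - (c * \<eta>) * ?Q i)"
  by (rule sum.cong) (use edge_not_green in auto)
 finally have "(\<Sum>i\<in>?I. ?d i * ?Q i) = \<eta> * (\<Sum>e\<in>S \<inter> ?I. ?Q e) - c * \<eta> * (\<Sum>f\<in>?I \<inter> EG - S. ?Q f)"
  by (simp add: sum_distrib_left[symmetric] sum_negf)
 thus ?thesis using D by simp
qed

lemma okp_path:
 assumes "okp a p r h" "okp a (p - c * \<eta>) (r + \<eta>) h" "0 \<le> \<eta>" "0 \<le> c" "0 \<le> t" "t \<le> 1"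
 shows "okp a (p - c * \<eta> * t) (r + \<eta> * t) h"
proof -
 have "0 \<le> \<eta> * t" "\<eta> * t \<le> \<eta>" "0 \<le> c * \<eta> * t" "c * \<eta> * t \<le> c * \<eta>"
  using assms by (auto intro!: mult_nonneg_nonneg mult_left_le)
 thus ?thesis using assms(1,2) unfolding okp_def by auto
qed

text \<open>Influences are compared only for a nearly optimal pattern. The path is therefore cut
  into short pieces; on each, a pattern nearly optimal at the start remains so by a uniform
  Lipschitz bound, and its derivative is at least \<open>- err\<close>. Summing over the pieces
  loses at most \<open>err\<close>, which is arbitrary.\<close>

lemma improvement:
 assumes a: "0 < a" "a \<le> 1"
 shows "\<exists>c>0. c \<le> 1 \<and> (\<forall>p r h \<eta> z. okp a p r h \<longrightarrow> 0 \<le> \<eta> \<longrightarrow> okp a (p - c * \<eta>) (r + \<eta>) h \<longrightarrow>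
  Mbar L p r h z \<le> Mbar L (p - c * \<eta>) (r + \<eta>) h z)"
proof -
 obtain C n0 \<rho> where C: "1 \<le> C" and PB: "\<And>p r h z S N f v u k. okp a p r h \<Longrightarrow> S \<in> Fam L \<Longrightarrow> f \<in> EG \<Longrightarrow> v \<in> f \<Longrightarrow>
   (\<forall>S'\<in>Fam L. HP N S' p r h z \<le> HP N S p r h z + u) \<Longrightarrow> 0 \<le> u \<Longrightarrow>
   ball (n0 + k) v \<subseteq> ball N z \<Longrightarrow>
   (\<exists>e\<in>S \<inter> IB N z. e \<subseteq> ball \<rho> v \<and> QP N S p r h z f \<le>
    C * (QP N S p r h z e + u + (1 - h) ^ k))"
  using piv_bound[OF a, of L] by blast
 obtain N4' where N4': "\<And>v. card (IB (Suc \<rho>) v) \<le> N4'" using IB_card_bound by blast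
 obtain D where D: "\<And>v. card {y. adj v y} \<le> D" using degree_bound by blast
 define N4 where "N4 = Suc N4'"
 have N4: "\<And>v. card (IB (Suc \<rho>) v) \<le> N4" using N4' by (simp add: N4_def le_SucI)
 \<comment> \<open>Calibrated to \<open>charge\<close>: after the factor \<open>C\<close> per
   comparison and at most \<open>N4\<close> edges per pattern edge, the loss from lowering
   \<open>p\<close> does not exceed the gain from raising \<open>r\<close>.\<close>
 define c where "c = 1 / (C * real N4)"
 have CN: "1 \<le> C * real N4" using mult_mono[OF C, of 1 "real N4"] C by (simp add: N4_def)
 have c: "0 < c" "c \<le> 1" "c * (C * real N4) \<le> 1" unfolding c_def using CN by (auto simp: divide_le_eq_1)
 have main: "Mbar L p r h z \<le> Mbar L (p - c * \<eta>) (r + \<eta>) h z"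
  if ok0: "okp a p r h" and e0: "0 \<le> \<eta>" and ok1: "okp a (p - c * \<eta>) (r + \<eta>) h" for p r h \<eta> z
 proof -
  define P where "P S t = Pm S (p - c * \<eta> * t) (r + \<eta> * t) h" for S t
  define F where "F N S t = PR (IB N z) (P S t) (hits z)" for N S t
  define Q where "Q N S t i = PR (IB N z) (P S t) (piv (hits z) i)" for N S t i
  define M where "M t = Mbar L (p - c * \<eta> * t) (r + \<eta> * t) h z" for t
  have ok: "okp a (p - c * \<eta> * t) (r + \<eta> * t) h" if "0 \<le> t" "t \<le> 1" for t
   by (rule okp_path[OF ok0 ok1 e0]) (use c that in auto)
  have pvP: "pv (P S t)" if "0 \<le> t" "t \<le> 1" for S t unfolding P_def by (rule okp_pv[OF ok[OF that]])
  have h: "0 < h" "h \<le> 1/2" using ok0 by (auto simp: okp_def)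
  have Q0: "0 \<le> Q N S t i" if "0 \<le> t" "t \<le> 1" for N S t i
   unfolding Q_def by (rule PR_nonneg[OF pvP[OF that]])
  have edge: "S \<subseteq> EG" if "S \<in> Fam L" for S using that Cand_edge by (auto simp: Fam_def)
  have der: "(F N S has_real_derivative (\<eta> * (\<Sum>e\<in>S \<inter> IB N z. Q N S t e) - c * \<eta> * (\<Sum>f\<in>IB N z \<inter> EG - S. Q N S t f))) (at t)"
   if "S \<in> Fam L" for N S t
   unfolding F_def[abs_def] Q_def P_def by (rule PR_path_derivative[OF edge[OF that]])
  have lim0: "(\<lambda>n. real D * real n * (1 - h) ^ n) \<longlonglongrightarrow> 0"
  proof -
   have "(\<lambda>n. real n * (1 - h) ^ n) \<longlonglongrightarrow> 0" by (rule powser_times_n_limit_0) (use h in auto)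
   from tendsto_mult_left[OF this, of "real D"] show ?thesis by (simp add: mult.assoc)
  qed
  obtain B0 where B0: "\<And>n. real D * real n * (1 - h) ^ n \<le> B0" "0 < B0"
  proof -
   have "Bseq (\<lambda>n. real D * real n * (1 - h) ^ n)" using lim0 convergentI convergent_imp_Bseq by blast
   then obtain K where K: "0 < K" "\<And>n. norm (real D * real n * (1 - h) ^ n) \<le> K" by (auto elim: BseqE)
   show thesis by (rule that[of K]) (use K(1) abs_le_D1[OF K(2)[unfolded real_norm_def]] in auto)
  qed
  have Qtail: "(\<Sum>f\<in>G. Q N S t f) \<le> B / a"
   if "0 \<le> t" "t \<le> 1" "S \<in> Fam L" "G \<subseteq> IB N z \<inter> EG"
    "\<And>V f. V \<subseteq> IB N z \<Longrightarrow> f \<in> G \<Longrightarrow> f \<inter> cl V z \<noteq> {} \<Longrightarrow> m \<le> card (cl V z)"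
    "\<And>n. m \<le> n \<Longrightarrow> real D * real n * (1 - h) ^ n \<le> B" "0 \<le> B" for N S t G m B
   unfolding Q_def
  proof (rule piv_tail[OF pvP[OF that(1,2)] _ D that(4) _ a(1) that(5,6,7)])
   show "P S t i = h" if "i \<in> greens" for i using that by (simp add: P_def Pm_def)
   show "P S t f \<le> 1 - a" if "f \<in> G" for f
    unfolding P_def using okp_edge[OF ok, of t f S] edge_not_green \<open>0 \<le> t\<close> \<open>t \<le> 1\<close> that \<open>G \<subseteq> IB N z \<inter> EG\<close> by blast
  qed
  define \<A> where "\<A> = \<eta> * (B0 / a) + 1"
  have L0: "0 < \<A>" unfolding \<A>_def using e0 B0 a by (intro add_nonneg_pos mult_nonneg_nonneg) auto
  \<comment> \<open>The constant depends on \<open>h\<close>, but neither on the box nor on the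
    pattern. This uniformity lets near-optimality at time \<open>t\<close> persist on a whole
    interval, against all competitors at once.\<close>
  have lip: "\<bar>F N S t - F N S s\<bar> \<le> \<A> * (t - s)"
   if st: "0 \<le> s" "s \<le> t" "t \<le> 1" and S: "S \<in> Fam L" for N S s t
  proof -
   have dbound: "\<bar>\<eta> * (\<Sum>e\<in>S \<inter> IB N z. Q N S x e) - c * \<eta> * (\<Sum>f\<in>IB N z \<inter> EG - S. Q N S x f)\<bar> \<le> \<A>"
    if x: "0 \<le> x" "x \<le> 1" for x
   proof -
    let ?A = "\<Sum>e\<in>S \<inter> IB N z. Q N S x e" and ?B = "\<Sum>f\<in>IB N z \<inter> EG - S. Q N S x f"
    have AB: "0 \<le> ?A" "0 \<le> ?B" by (auto intro!: sum_nonneg Q0 x)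
    have A1: "?A \<le> B0 / a" by (rule Qtail[OF x S, where m = 0]) (use edge[OF S] B0 in auto)
    have B1: "?B \<le> B0 / a" by (rule Qtail[OF x S, where m = 0]) (use B0 in auto)
    note 1 = mult_left_mono[OF A1 e0] mult_left_mono[OF B1 e0]
    have "c * (\<eta> * ?B) \<le> 1 * (\<eta> * ?B)" using c e0 AB by (intro mult_right_mono) auto
    moreover have "0 \<le> \<eta> * ?A" "0 \<le> c * (\<eta> * ?B)" using c e0 AB by auto
    ultimately show ?thesis using 1 unfolding \<A>_def mult.assoc by linarith
   qed
   have "\<bar>F N S t - F N S s\<bar> \<le> \<A> * \<bar>t - s\<bar>"
   proof (cases "s = t")
    case False
    hence "s < t" using st by simp
    from MVT2[OF this, of "F N S", OF der[OF S]] obtain x where x: "s < x" "x < t"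
     "F N S t - F N S s = (t - s) * (\<eta> * (\<Sum>e\<in>S \<inter> IB N z. Q N S x e) - c * \<eta> * (\<Sum>f\<in>IB N z \<inter> EG - S. Q N S x f))"
     by blast
    show ?thesis unfolding x(3) abs_mult using dbound[of x] x st by (subst mult.commute) (intro mult_right_mono, auto)
   qed simp
   thus ?thesis using st by simp
  qed
  have step: "\<exists>s0>0. \<forall>t s. 0 \<le> t \<longrightarrow> t + s \<le> 1 \<longrightarrow> 0 < s \<longrightarrow> s \<le> s0 \<longrightarrow> M t \<le> M (t + s) + s * err"
   if err: "0 < err" for err
  proof -
   \<comment> \<open>The error \<open>err\<close> is split into three parts: one for the tail beyond
     \<open>m0\<close>, and two for the term with \<open>u0\<close> and \<open>(1 - h) ^ k\<close>,
     both at most \<open>u0\<close>. As \<open>q\<close> depends on \<open>m0\<close>, the tail is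
     fixed before \<open>u0\<close>.\<close>
   define B where "B = a * err / (3 * (\<eta> + 1))"
   have Bp: "0 < B" unfolding B_def using a err e0 by (intro divide_pos_pos mult_pos_pos) auto
   obtain m0 where m0: "\<And>n. m0 \<le> n \<Longrightarrow> real D * real n * (1 - h) ^ n \<le> B"
   proof -
    have "eventually (\<lambda>n. real D * real n * (1 - h) ^ n < B) sequentially" by (rule order_tendstoD(2)[OF lim0 Bp])
    thus thesis using that unfolding eventually_sequentially by (meson less_imp_le)
   qed
   define q where "q = real (card (IB (Suc m0) z))"
   define u0 where "u0 = err / (3 * (C * (q + 1) * (\<eta> + 1)))"
   have den: "0 < C * (q + 1) * (\<eta> + 1)" using C e0 by (intro mult_pos_pos) (auto simp: q_def add_nonneg_pos)
   have u0: "0 < u0" unfolding u0_def using err den by simp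
   obtain k where k: "(1 - h) ^ k < u0" using real_arch_pow_inv[OF u0, of "1 - h"] h by auto
   define s0 where "s0 = u0 / (4 * \<A>)"
   have s0: "0 < s0" unfolding s0_def using u0 L0 by simp
   have "M t \<le> M (t + s) + s * err" if t: "0 \<le> t" "t + s \<le> 1" "0 < s" "s \<le> s0" for t s
   proof (rule field_le_epsilon)
    fix \<zeta>' :: real assume "0 < \<zeta>'"
    define \<zeta> where "\<zeta> = min \<zeta>' (u0 / 2)"
    have z: "0 < \<zeta>" "\<zeta> \<le> \<zeta>'" "\<zeta> \<le> u0 / 2" using \<open>0 < \<zeta>'\<close> u0 by (auto simp: \<zeta>_def)
    have tt: "t \<le> 1" using t by simp
    obtain S N0 where S: "S \<in> Fam L" and N0: "\<And>N. N0 \<le> N \<Longrightarrow> M t - \<zeta> < F N S t"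
     using Mbar_approx[OF ok[OF t(1) tt] z(1), of L z] unfolding M_def F_def P_def by blast
    define N where "N = N0 + (m0 + (n0 + k))"
    have N: "M t - \<zeta> < F N S t" by (rule N0) (simp add: N_def)
    have Ls: "\<A> * s \<le> u0 / 4"
    proof -
     have "\<A> * s \<le> \<A> * s0" using L0 t by (intro mult_left_mono) auto
     thus ?thesis using L0 by (simp add: s0_def)
    qed
    \<comment> \<open>The allowance \<open>u0\<close> consists of \<zeta>, at most half of it, for
      the choice at time \<open>t\<close>, and a quarter for the variation of each of the two
      patterns.\<close>
    have nearS: "F N S' x \<le> F N S x + u0" if S': "S' \<in> Fam L" and x: "t \<le> x" "x \<le> t + s" for S' x
    proof -
     have xt: "\<A> * (x - t) \<le> \<A> * s" using L0 x by (intro mult_left_mono) auto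
     have "\<bar>F N S' x - F N S' t\<bar> \<le> \<A> * (x - t)" by (rule lip[OF t(1) x(1) _ S']) (use x t in simp)
     moreover have "\<bar>F N S x - F N S t\<bar> \<le> \<A> * (x - t)" by (rule lip[OF t(1) x(1) _ S]) (use x t in simp)
     moreover have "F N S' t \<le> M t" unfolding F_def P_def M_def by (rule Mbar_upper[OF ok[OF t(1) tt] S' IB_Fin])
     ultimately show ?thesis using N z(3) Ls xt unfolding abs_le_iff by linarith
    qed
    have dlow: "- err \<le> \<eta> * (\<Sum>e\<in>S \<inter> IB N z. Q N S x e) - c * \<eta> * (\<Sum>f\<in>IB N z \<inter> EG - S. Q N S x f)"
     if x: "t \<le> x" "x \<le> t + s" for x
    proof -
     have x01: "0 \<le> x" "x \<le> 1" using x t by auto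
     have w: "0 \<le> u0 + (1 - h) ^ k" using u0 h by (intro add_nonneg_nonneg) auto
     have "c * (\<Sum>f\<in>IB N z \<inter> EG - S. Q N S x f) \<le>
       (\<Sum>e\<in>S \<inter> IB N z. Q N S x e) + C * real (card (IB (Suc m0) z)) * (u0 + (1 - h) ^ k) + B / a"
     proof (rule charge[OF Q0[OF x01] c C w N4 _ edge[OF S]])
      fix f v assume f: "f \<in> EG" "v \<in> f" "v \<in> ball m0 z"
      have "ball (n0 + k) v \<subseteq> ball N z"
      proof
       fix y assume "y \<in> ball (n0 + k) v"
       from ball_trans[OF f(3) this] show "y \<in> ball N z" using ball_mono[of "m0 + (n0 + k)" N z] by (auto simp: N_def)
      qed
      moreover have "\<forall>S'\<in>Fam L. F N S' x \<le> F N S x + u0" using nearS x by blast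
      ultimately show "\<exists>e\<in>S \<inter> IB N z. e \<subseteq> ball \<rho> v \<and> Q N S x f \<le> C * (Q N S x e + (u0 + (1 - h) ^ k))"
       using PB[OF ok[OF x01] S f(1,2), of N z u0 k] u0 unfolding F_def Q_def P_def add.assoc by simp
     next
      show "(\<Sum>f | f \<in> IB N z \<inter> EG - S \<and> f \<inter> ball m0 z = {}. Q N S x f) \<le> B / a"
      proof (rule Qtail[OF x01 S, where m = m0])
       fix V f assume w: "V \<subseteq> IB N z" and f: "f \<in> {f. f \<in> IB N z \<inter> EG - S \<and> f \<inter> ball m0 z = {}}" "f \<inter> cl V z \<noteq> {}"
       then obtain v where v: "v \<in> cl V z" "v \<notin> ball m0 z" by blast
       have sub: "V \<subseteq> Idx" using w IB_sub_Idx by blast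
       have "cl V z \<subseteq> ball N z" by (rule cl_subI) (use w in "auto simp: IB_def")
       hence "finite (cl V z)" by (rule finite_subset) simp
       hence "card (cl V z \<inter> ball m0 z) \<le> card (cl V z)" by (intro card_mono) auto
       thus "m0 \<le> card (cl V z)" using cluster_far[OF sub v] by simp
      qed (use m0 Bp in auto)
     qed
     hence "\<eta> * (c * (\<Sum>f\<in>IB N z \<inter> EG - S. Q N S x f)) \<le>
       \<eta> * ((\<Sum>e\<in>S \<inter> IB N z. Q N S x e) + C * q * (u0 + (1 - h) ^ k) + B / a)"
      unfolding q_def by (rule mult_left_mono[OF _ e0])
     moreover have "\<eta> * (B / a) \<le> err / 3"
     proof -
      have "B / a = err / (3 * (\<eta> + 1))" unfolding B_def using a by simp
      hence "\<eta> * (B / a) = (\<eta> / (\<eta> + 1)) * (err / 3)" by simp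
      also have "\<dots> \<le> 1 * (err / 3)" using e0 err by (intro mult_right_mono) (auto simp: field_simps)
      finally show ?thesis by simp
     qed
     moreover have "\<eta> * (C * q * (u0 + (1 - h) ^ k)) \<le> 2 * (err / 3)"
     proof -
      have "\<eta> * (C * q * (u0 + (1 - h) ^ k)) \<le> (\<eta> + 1) * (C * (q + 1) * (2 * u0))"
       using e0 C u0 k h by (intro mult_mono mult_nonneg_nonneg) (auto simp: q_def)
      also have "\<dots> = 2 * ((C * (q + 1) * (\<eta> + 1)) * u0)" by (simp add: algebra_simps)
      also have "(C * (q + 1) * (\<eta> + 1)) * u0 = err / 3"
     proof -
      define X where "X = C * (q + 1) * (\<eta> + 1)"
      show ?thesis using den unfolding u0_def X_def[symmetric] by simp
     qed
      finally show ?thesis by simp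
     qed
     moreover have "c * \<eta> * (\<Sum>f\<in>IB N z \<inter> EG - S. Q N S x f) = \<eta> * (c * (\<Sum>f\<in>IB N z \<inter> EG - S. Q N S x f))" by simp
     ultimately show ?thesis unfolding distrib_left by linarith
    qed
    obtain x where x: "t < x" "x < t + s"
     "F N S (t + s) - F N S t = (t + s - t) * (\<eta> * (\<Sum>e\<in>S \<inter> IB N z. Q N S x e) - c * \<eta> * (\<Sum>f\<in>IB N z \<inter> EG - S. Q N S x f))"
     using MVT2[of t "t + s" "F N S", OF _ der[OF S]] t by auto
    have "s * (- err) \<le> F N S (t + s) - F N S t" unfolding x(3) add_diff_cancel_left'
     by (rule mult_left_mono[OF dlow]) (use x t in auto)
    moreover have "F N S (t + s) \<le> M (t + s)" unfolding F_def P_def M_def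
     by (rule Mbar_upper[OF ok S IB_Fin]) (use t in auto)
    ultimately show "M t \<le> M (t + s) + s * err + \<zeta>'" using N z by simp
   qed
   thus ?thesis using s0 by blast
  qed
  have "M 0 \<le> M 1"
  \<comment> \<open>The step length \<open>s0\<close> does not depend on the starting time, so a
    uniform subdivision suffices and the errors add up to \<open>err\<close>.\<close>
  proof (rule field_le_epsilon)
   fix err :: real assume err: "0 < err"
   obtain s0 where s0: "0 < s0" "\<And>t s. 0 \<le> t \<Longrightarrow> t + s \<le> 1 \<Longrightarrow> 0 < s \<Longrightarrow> s \<le> s0 \<Longrightarrow> M t \<le> M (t + s) + s * err"
    using step[OF err] by blast
   obtain n' where n': "inverse (real (Suc n')) < s0" using reals_Archimedean[OF s0(1)] by blast
   define n where "n = Suc n'"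
   have n: "0 < real n" "1 / real n \<le> s0" using n' by (auto simp: n_def inverse_eq_divide)
   have "M 0 \<le> M (real i / real n) + real i / real n * err" if "i \<le> n" for i
    using that
   proof (induction i)
    case (Suc i)
    have eq: "real i / real n + 1 / real n = real (Suc i) / real n" using n by (simp add: field_simps)
    have "M (real i / real n) \<le> M (real i / real n + 1 / real n) + 1 / real n * err"
     by (rule s0(2)) (use n Suc.prems in "auto simp: eq simp del: of_nat_Suc")
    hence "M (real i / real n) \<le> M (real (Suc i) / real n) + 1 / real n * err" unfolding eq .
    moreover have "M 0 \<le> M (real i / real n) + real i / real n * err" using Suc by simp
    moreover have "real (Suc i) / real n * err = real i / real n * err + 1 / real n * err"
     unfolding eq[symmetric] by (rule distrib_right)
    ultimately show ?case by linarith
   qed simp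
   from this[of n] show "M 0 \<le> M 1 + err" using n by simp
  qed
  thus ?thesis unfolding M_def by simp
 qed
 thus ?thesis using c by blast
qed

end

section \<open>Infinite clusters under Bernoulli percolation\<close>

text \<open>Stated for an arbitrary sigma-algebra because it serves both for the product space and
  for the sigma-algebra generated by the edges beyond the first \<open>m\<close>.\<close>

lemma cyl_in_algebra:
 assumes A: "sigma_algebra \<Omega> \<A>" and I: "finite I" "\<And>i. i \<in> I \<Longrightarrow> {V \<in> \<Omega>. V i} \<in> \<A>"
 shows "{V \<in> \<Omega>. B {i \<in> I. V i}} \<in> \<A>"
proof -
 interpret sigma_algebra \<Omega> \<A> by (rule A)
 show ?thesis using I
 proof (induction I arbitrary: B rule: finite_induct)
  case empty
  show ?case by (cases "B {}") auto
 next
  case (insert j I)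
  let ?E = "{V \<in> \<Omega>. V j}"
  have 1: "{V \<in> \<Omega>. B (insert j {i \<in> I. V i})} \<in> \<A>" by (rule insert.IH) (use insert.prems in auto)
  have 2: "{V \<in> \<Omega>. B {i \<in> I. V i}} \<in> \<A>" by (rule insert.IH) (use insert.prems in auto)
  have E: "?E \<in> \<A>" by (rule insert.prems) simp
  have "{V \<in> \<Omega>. B {i \<in> insert j I. V i}} =
   ({V \<in> \<Omega>. B (insert j {i \<in> I. V i})} \<inter> ?E) \<union> ({V \<in> \<Omega>. B {i \<in> I. V i}} - ?E)" (is "?L = ?R")
  proof (rule set_eqI)
   fix V
   have "{i \<in> insert j I. V i} = (if V j then insert j {i \<in> I. V i} else {i \<in> I. V i})" by auto
   thus "V \<in> ?L \<longleftrightarrow> V \<in> ?R" by auto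
  qed
  also have "\<dots> \<in> \<A>" using 1 2 E by auto
  finally show ?case .
 qed
qed

definition pe_ok :: "('i \<Rightarrow> real) \<Rightarrow> 'i set \<Rightarrow> bool" where
 "pe_ok pe E \<longleftrightarrow> (\<forall>e\<in>E. 0 \<le> pe e \<and> pe e \<le> 1)"

context lf_graph
begin

definition EB :: "nat \<Rightarrow> 'v \<Rightarrow> 'v set set" where "EB k z = {e \<in> EG. e \<subseteq> ball k z}"

definition exits :: "nat \<Rightarrow> 'v \<Rightarrow> 'v set set \<Rightarrow> bool" where
 "exits k z V \<longleftrightarrow> \<not> cl V z \<subseteq> ball k z"

definition os :: "('v set \<Rightarrow> bool) \<Rightarrow> 'v set set" where "os V = {e \<in> EG. V e}"

lemma finite_EB [simp]: "finite (EB k z)"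
 unfolding EB_def by (rule finite_subset[of _ "Pow (ball k z)"]) auto

lemma EB_edges: "EB k z \<subseteq> EG" by (auto simp: EB_def)

lemma EB_IB: "EB k z \<subseteq> IB k z" by (auto simp: EB_def IB_def Idx_def)

lemma edges_Idx: "EG \<subseteq> Idx" by (auto simp: Idx_def)

lemma incr_exits: "incr (exits k z)"
 unfolding incr_def exits_def
proof (intro allI impI)
 fix V V' :: "'v set set" assume "V \<subseteq> V'" "\<not> cl V z \<subseteq> ball k z"
 thus "\<not> cl V' z \<subseteq> ball k z" using cl_mono[of V V' z] by (meson order_trans)
qed

text \<open>Up to and including the step that leaves \<open>ball k z\<close>, a path uses only edges
  inside \<open>ball (Suc k) z\<close>; hence the larger box.\<close>

lemma exits_local:
 assumes "V \<subseteq> Idx"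
 shows "exits k z (V \<inter> EB (Suc k) z) \<longleftrightarrow> exits k z V"
proof
 assume "exits k z (V \<inter> EB (Suc k) z)"
 thus "exits k z V" by (rule incrD[OF incr_exits, rotated]) blast
next
 assume e: "exits k z V"
 show "exits k z (V \<inter> EB (Suc k) z)"
 proof (rule ccontr)
  assume "\<not> ?thesis"
  hence sub: "cl (V \<inter> EB (Suc k) z) z \<subseteq> ball k z" by (simp add: exits_def)
  have "cl V z \<subseteq> cl (V \<inter> EB (Suc k) z) z"
  proof (rule cl_subI)
   fix s t assume s: "s \<in> cl (V \<inter> EB (Suc k) z) z" "{s, t} \<in> V"
   show "t \<in> cl (V \<inter> EB (Suc k) z) z"
   proof (cases "s = t")
    case False
    hence "adj s t" using Idx_adj s(2) assms by blast
    hence e: "{s, t} \<in> EG" by (auto simp: edges_def)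
    moreover have "{s, t} \<subseteq> ball (Suc k) z" by (rule edge_in_ball_Suc[OF e]) (use s sub in blast)
    ultimately have "{s, t} \<in> V \<inter> EB (Suc k) z" using s by (simp add: EB_def)
    thus ?thesis by (rule cl_step[OF s(1)])
   qed (use s in simp)
  qed simp
  thus False using e sub by (auto simp: exits_def)
 qed
qed

lemma infinite_cl_iff: "infinite (cl V z) \<longleftrightarrow> (\<forall>k. exits k z V)"
proof
 assume "infinite (cl V z)"
 thus "\<forall>k. exits k z V" unfolding exits_def using finite_subset[OF _ finite_ball] by blast
next
 assume "\<forall>k. exits k z V"
 thus "infinite (cl V z)" unfolding exits_def using ball_exists_finite by blast
qed

lemma has_inf_cluster_iff: "inf_cl V \<longleftrightarrow> (\<exists>v. \<forall>k. exits k v (os V))"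
proof -
 have "open_rel adj V = Rw (os V)"
  unfolding open_rel_def Rw_def os_def edges_def using adj_sym by (auto simp: doubleton_eq_iff insert_commute)
 thus ?thesis unfolding has_inf_cluster_def infinite_cl_iff[symmetric] cl_def by simp
qed

lemma exits_decseq: "exits (Suc k) z V \<Longrightarrow> exits k z V"
 unfolding exits_def using ball_mono[of k "Suc k" z] by auto

lemma countable_V: "countable (UNIV :: 'v set)"
proof -
 fix z :: 'v
 have "UNIV = (\<Union>n. ball n z)" using ball_exists by auto
 moreover have "countable (\<Union>n. ball n z)" by (rule countable_UN) (auto intro: countable_finite)
 ultimately show ?thesis by simp
qed

lemma countable_edges: "countable EG"
proof -
 have "EG \<subseteq> (\<lambda>(x, y). {x, y}) ` (UNIV \<times> UNIV)" by (auto simp: edges_def)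
 thus ?thesis using countable_V by (meson countable_SIGMA countable_image countable_subset)
qed

lemma infinite_edges: "infinite EG"
proof
 assume fin: "finite EG"
 have "finite (\<Union>(EG))" using fin by (auto elim: edgesE)
 moreover have "UNIV \<subseteq> \<Union>(EG)"
 proof
  fix v :: 'v
  have "infinite (UNIV - {v})" using inf_V by simp
  then obtain w where "w \<noteq> v" by (metis DiffE finite.emptyI insertI1 ex_in_conv)
  obtain n where "w \<in> ball n v" using ball_exists by blast
  hence "\<not> {v} = ball n v" using \<open>w \<noteq> v\<close> by blast
  have "\<exists>y. adj v y"
  proof (rule ccontr)
   assume no: "\<not> ?thesis"
   have "(v, w) \<in> {(a, b). adj a b}\<^sup>*" using conn_graph by (simp add: connected_graph_def)
   thus False using no \<open>w \<noteq> v\<close> by (cases rule: converse_rtranclE) auto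
  qed
  thus "v \<in> \<Union>(EG)" by (auto simp: edges_def)
 qed
 ultimately show False using inf_V finite_subset by blast
qed

lemma space_cfg: "Cfg = PiE EG (\<lambda>_. UNIV)"
 by (simp add: cfg_space_def space_PiM)

lemma sets_bern: "sets (bern pe) = sets (cfg_space adj)"
 unfolding bern_perc_def cfg_space_def by (rule sets_PiM_cong) auto

lemma space_bern: "space (bern pe) = Cfg"
 by (rule sets_eq_imp_space_eq[OF sets_bern])

lemma prob_bern: "prob_space (bern pe)"
 unfolding bern_perc_def by (rule prob_space_PiM) (rule prob_space_measure_pmf)

lemma coord_set: "e \<in> EG \<Longrightarrow> {V \<in> Cfg. V e} \<in> sets (cfg_space adj)"
proof -
 assume e: "e \<in> EG"
 have "(\<lambda>V. V e) \<in> measurable (cfg_space adj) (count_space UNIV)"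
  unfolding cfg_space_def by (rule measurable_component_singleton[OF e])
 thus ?thesis using measurable_sets[of "\<lambda>V. V e" _ "count_space UNIV" "{True}"]
  by (simp add: vimage_def Int_def conj_commute)
qed

lemma os_Int: "I \<subseteq> EG \<Longrightarrow> os V \<inter> I = {i \<in> I. V i}" by (auto simp: os_def)

lemma local_event_sets:
 assumes "finite I" "I \<subseteq> EG"
 shows "{V \<in> Cfg. B (os V \<inter> I)} \<in> sets (cfg_space adj)"
 unfolding os_Int[OF assms(2)]
 by (rule cyl_in_algebra[OF sets.sigma_algebra_axioms assms(1)]) (use coord_set assms in auto)

lemma local_measure:
 assumes \<mu>: "prob_space \<mu>" "sets \<mu> = sets (cfg_space adj)" and I: "finite I" "I \<subseteq> EG"
 shows "measure \<mu> {V \<in> Cfg. B (os V \<inter> I)} =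
  (\<Sum>J\<in>{J \<in> Pow I. B J}. measure \<mu> {V \<in> Cfg. os V \<inter> I = J})"
proof -
 interpret prob_space \<mu> by (rule \<mu>)
 let ?X = "\<lambda>J. {V \<in> Cfg. os V \<inter> I = J}"
 have "{V \<in> Cfg. B (os V \<inter> I)} = (\<Union>J\<in>{J \<in> Pow I. B J}. ?X J)" (is "?L = ?R")
 proof (intro equalityI subsetI)
  fix V assume w: "V \<in> ?L"
  hence "os V \<inter> I \<in> {J \<in> Pow I. B J}" by simp
  thus "V \<in> ?R" using w by blast
 qed blast
 thus ?thesis
  using I(1) local_event_sets[OF I] by (simp only:) (rule finite_measure_finite_Union, auto simp: \<mu>(2) disjoint_family_on_def)
qed

lemma bern_local:
 assumes I: "finite I" "I \<subseteq> EG" and pe: "pe_ok pe I"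
 shows "measure (bern pe) {V \<in> Cfg. B (os V \<inter> I)} = PR I pe B"
proof -
 let ?\<mu> = "bern pe"
 interpret product_prob_space "\<lambda>e. measure_pmf (bernoulli_pmf (pe e))" "EG"
  by (unfold_locales)
 interpret prob_space ?\<mu> by (rule prob_bern)
 let ?X = "\<lambda>J. {V \<in> Cfg. os V \<inter> I = J}"
 have atom: "measure ?\<mu> (?X J) = wt I pe J" if J: "J \<subseteq> I" for J
 proof -
  have "?X J = prod_emb EG (\<lambda>e. measure_pmf (bernoulli_pmf (pe e))) I (Pi\<^sub>E I (\<lambda>i. {i \<in> J}))"
  proof (rule set_eqI)
   fix V :: "'v set \<Rightarrow> bool"
   have A: "os V \<inter> I = J \<longleftrightarrow> (\<forall>i\<in>I. V i = (i \<in> J))" unfolding os_Int[OF I(2)] using J by blast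
   have B: "restrict V I \<in> Pi\<^sub>E I (\<lambda>i. {i \<in> J}) \<longleftrightarrow> (\<forall>i\<in>I. V i = (i \<in> J))" by (simp add: PiE_iff)
   show "V \<in> ?X J \<longleftrightarrow> V \<in> prod_emb EG (\<lambda>e. measure_pmf (bernoulli_pmf (pe e))) I (Pi\<^sub>E I (\<lambda>i. {i \<in> J}))"
    unfolding prod_emb_def space_cfg by (simp add: A Pi_iff conj_commute)
  qed
  hence "measure ?\<mu> (?X J) = (\<Prod>i\<in>I. measure (measure_pmf (bernoulli_pmf (pe i))) {i \<in> J})"
   unfolding bern_perc_def using measure_PiM_emb[of I "\<lambda>i. {i \<in> J}"] I by simp
  also have "\<dots> = wt I pe J" unfolding wt_def
   
  proof (rule prod.cong[OF refl])
   fix i assume "i \<in> I"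
   hence "0 \<le> pe i" "pe i \<le> 1" using pe by (auto simp: pe_ok_def)
   thus "measure (measure_pmf (bernoulli_pmf (pe i))) {i \<in> J} = (if i \<in> J then pe i else 1 - pe i)"
    by (simp add: measure_pmf_single)
  qed
  finally show ?thesis .
 qed
 have "measure ?\<mu> {V \<in> Cfg. B (os V \<inter> I)} = (\<Sum>J\<in>{J \<in> Pow I. B J}. measure ?\<mu> (?X J))"
  by (rule local_measure[OF prob_bern sets_bern I])
 also have "\<dots> = (\<Sum>J\<in>{J \<in> Pow I. B J}. wt I pe J)" by (rule sum.cong) (auto simp: atom)
 also have "\<dots> = PR I pe B" unfolding PR_def Ev_def
  by (rule sum.mono_neutral_cong_left) (use I in auto)
 finally show ?thesis .
qed

text \<open>Finite-volume approximation of the percolation probability at \<open>z\<close>: it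
  decreases in \<open>k\<close> to the probability of an infinite cluster at \<open>z\<close>, and
  unlike that limit it depends on finitely many parameters.\<close>

definition thet :: "('v set \<Rightarrow> real) \<Rightarrow> 'v \<Rightarrow> nat \<Rightarrow> real" where
 "thet pe z k = PR (EB (Suc k) z) pe (exits k z)"

lemma exits_os: "exits k z (os V) \<longleftrightarrow> exits k z (os V \<inter> EB (Suc k) z)"
 using exits_local[of "os V" k z] edges_Idx by (auto simp: os_def)

lemma exits_sets: "{V \<in> Cfg. exits k z (os V)} \<in> sets (cfg_space adj)"
 using local_event_sets[OF finite_EB EB_edges, of "exits k z" "Suc k" z] unfolding exits_os[symmetric] .

lemma pe_ok_mono: "pe_ok pe E \<Longrightarrow> I \<subseteq> E \<Longrightarrow> pe_ok pe I" by (auto simp: pe_ok_def)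

lemma bern_exits:
 assumes "pe_ok pe EG"
 shows "measure (bern pe) {V \<in> Cfg. exits k z (os V)} = thet pe z k"
 using bern_local[OF finite_EB EB_edges pe_ok_mono[OF assms EB_edges], of "exits k z" "Suc k" z]
 unfolding exits_os[symmetric] thet_def .

lemma inf_at_sets: "{V \<in> Cfg. \<forall>k. exits k z (os V)} \<in> sets (cfg_space adj)"
proof -
 have "{V \<in> Cfg. \<forall>k. exits k z (os V)} = (\<Inter>k. {V \<in> Cfg. exits k z (os V)})" by auto
 thus ?thesis using exits_sets by (simp add: sets.countable_INT'')
qed

lemma has_inf_sets: "{V \<in> Cfg. inf_cl V} \<in> sets (cfg_space adj)"
proof -
 have "{V \<in> Cfg. inf_cl V} = (\<Union>v. {V \<in> Cfg. \<forall>k. exits k v (os V)})"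
  by (auto simp: has_inf_cluster_iff)
 thus ?thesis using sets.countable_UN''[OF countable_V inf_at_sets] by simp
qed

lemma thet_limit:
 assumes "pe_ok pe EG"
 shows "thet pe z \<longlonglongrightarrow> measure (bern pe) {V \<in> Cfg. \<forall>k. exits k z (os V)}"
proof -
 interpret prob_space "bern pe" by (rule prob_bern)
 let ?A = "\<lambda>k. {V \<in> Cfg. exits k z (os V)}"
 have "(\<lambda>k. measure (bern pe) (?A k)) \<longlonglongrightarrow> measure (bern pe) (\<Inter>k. ?A k)"
  by (rule finite_Lim_measure_decseq) (use exits_sets exits_decseq in "auto simp: sets_bern intro!: decseq_SucI")
 moreover have "(\<Inter>k. ?A k) = {V \<in> Cfg. \<forall>k. exits k z (os V)}" by auto
 ultimately show ?thesis by (simp add: bern_exits[OF assms])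
qed

lemma thet_decseq:
 assumes "pe_ok pe EG"
 shows "decseq (thet pe z)"
proof (rule decseq_SucI)
 interpret prob_space "bern pe" by (rule prob_bern)
 show "thet pe z (Suc k) \<le> thet pe z k" for k
  unfolding bern_exits[OF assms, symmetric]
  by (rule finite_measure_mono) (use exits_decseq exits_sets in "auto simp: sets_bern")
qed

lemma AE_no_inf_iff:
 assumes pe: "pe_ok pe EG"
 shows "(AE V in bern pe. \<not> inf_cl V) \<longleftrightarrow> (\<forall>z. thet pe z \<longlonglongrightarrow> 0)"
proof -
 interpret prob_space "bern pe" by (rule prob_bern)
 let ?B = "\<lambda>z. {V \<in> Cfg. \<forall>k. exits k z (os V)}"
 have AE1: "(AE V in bern pe. \<not> (\<forall>k. exits k z (os V))) \<longleftrightarrow> measure (bern pe) (?B z) = 0" for z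
 proof -
  have "(AE V in bern pe. \<not> (\<forall>k. exits k z (os V))) \<longleftrightarrow> emeasure (bern pe) (?B z) = 0"
   by (rule AE_iff_measurable) (use inf_at_sets in "auto simp: sets_bern space_bern")
  thus ?thesis by (simp add: emeasure_eq_measure)
 qed
 have "(AE V in bern pe. \<not> inf_cl V) \<longleftrightarrow>
  (\<forall>z. AE V in bern pe. \<not> (\<forall>k. exits k z (os V)))"
  unfolding has_inf_cluster_iff not_ex
  using AE_ball_countable[OF countable_V, where M = "bern pe" and P = "\<lambda>V z. \<not> (\<forall>k. exits k z (os V))"]
  by (simp del: not_all)
 also have "\<dots> \<longleftrightarrow> (\<forall>z. measure (bern pe) (?B z) = 0)" unfolding AE1 ..
 also have "\<dots> \<longleftrightarrow> (\<forall>z. thet pe z \<longlonglongrightarrow> 0)"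
 proof (rule all_cong1)
  fix z
  show "measure (bern pe) (?B z) = 0 \<longleftrightarrow> thet pe z \<longlonglongrightarrow> 0"
   using thet_limit[OF pe, of z] LIMSEQ_unique[OF thet_limit[OF pe, of z], of 0] by auto
 qed
 finally show ?thesis .
qed

text \<open>After deleting finitely many edges the old cluster is covered by the clusters of
  \<open>v\<close> and of the deleted endpoints, so one of these must be infinite.\<close>

lemma cl_delete:
 assumes "infinite (cl V v)" "finite F" "\<And>f. f \<in> F \<Longrightarrow> finite f"
 shows "\<exists>w. infinite (cl (V - F) w)"
proof (rule ccontr)
 assume "\<not> ?thesis"
 hence fin: "finite (cl (V - F) w)" for w by blast
 let ?T = "\<Union>w\<in>insert v (\<Union>F). cl (V - F) w"
 have "cl V v \<subseteq> ?T"
 proof (rule cl_subI)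
  show "v \<in> ?T" by auto
  fix s t assume s: "s \<in> ?T" "{s, t} \<in> V"
  show "t \<in> ?T"
  proof (cases "{s, t} \<in> F")
   case True
   hence "t \<in> \<Union>F" by auto
   thus ?thesis using cl_self[of t "V - F"] by blast
  next
   case False
   hence st: "{s, t} \<in> V - F" using s by simp
   obtain w where w: "w \<in> insert v (\<Union>F)" "s \<in> cl (V - F) w" using s(1) by blast
   have "t \<in> cl (V - F) w" by (rule cl_step[OF w(2) st])
   thus ?thesis using w(1) by blast
  qed
 qed
 moreover have "finite ?T" using assms fin by auto
 ultimately show False using assms(1) finite_subset by blast
qed

text \<open>Kolmogorov's law applies because altering the first \<open>m\<close> edges does not
  affect the existence of an infinite cluster.\<close>

lemma perc_zero_one:
 assumes pe: "pe_ok pe EG" and en: "bij_betw en (UNIV :: nat set) EG"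
 defines "X \<equiv> {V \<in> Cfg. inf_cl V}"
 shows "measure (bern pe) X = 0 \<or> measure (bern pe) X = 1"
proof -
 let ?\<mu> = "bern pe"
 interpret prob_space ?\<mu> by (rule prob_bern)
 let ?\<Omega> = "Cfg"
 define C where "C n = {V \<in> ?\<Omega>. V (en n)}" for n
 have enE: "en n \<in> EG" for n using en by (auto simp: bij_betw_def)
 have enI: "inj en" using en by (simp add: bij_betw_def)
 have enS: "e \<in> EG \<Longrightarrow> \<exists>n. e = en n" for e using en by (auto simp: bij_betw_def)
 have Cs: "C n \<in> sets ?\<mu>" for n unfolding C_def using coord_set[OF enE] by (simp add: sets_bern)
 have prodC: "prob (\<Inter>j\<in>J. C j) = (\<Prod>j\<in>J. pe (en j))" if J: "finite J" "J \<noteq> {}" for J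
 proof -
  have "(\<Inter>j\<in>J. C j) = {V \<in> ?\<Omega>. os V \<inter> en ` J = en ` J}"
   using J(2) enE by (auto simp: C_def os_def)
  moreover have sub: "en ` J \<subseteq> EG" using enE by blast
  ultimately have "prob (\<Inter>j\<in>J. C j) = PR (en ` J) pe (\<lambda>V. V = en ` J)"
   using bern_local[OF _ sub pe_ok_mono[OF pe sub], of "\<lambda>V. V = en ` J"] J by simp
  also have "\<dots> = wt (en ` J) pe (en ` J)" unfolding PR_def Ev_def
   by (subst sum.remove[of _ "en ` J"]) (use J in "auto intro!: sum.neutral")
  also have "\<dots> = (\<Prod>j\<in>J. pe (en j))" unfolding wt_def
   using enI by (subst prod.reindex) (auto simp: inj_on_def)
  finally show ?thesis .
 qed
 have ind: "indep_events C UNIV"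
 proof (rule indep_eventsI)
  fix J :: "nat set" assume J: "finite J" "J \<noteq> {}"
  have "prob (C j) = pe (en j)" for j using prodC[of "{j}"] by simp
  thus "prob (\<Inter>j\<in>J. C j) = (\<Prod>j\<in>J. prob (C j))" using prodC[OF J] by simp
 qed (rule Cs)
 show ?thesis
 proof (rule kolmogorov_0_1_law[of "\<lambda>i. sigma_sets (space ?\<mu>) {C i}"])
  show "sigma_algebra (space ?\<mu>) (sigma_sets (space ?\<mu>) {C i})" for i
   by (rule sigma_algebra_sigma_sets) (auto simp: C_def space_bern)
  show "indep_sets (\<lambda>i. sigma_sets (space ?\<mu>) {C i}) UNIV"
  proof (rule indep_sets_sigma)
   show "indep_sets (\<lambda>i. {C i}) UNIV" using ind unfolding indep_events_def_alt .
   show "Int_stable {C i}" for i by (simp add: Int_stable_def)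
  qed
  show "X \<in> tail_events (\<lambda>i. sigma_sets (space ?\<mu>) {C i})"
   unfolding tail_events_def
  proof
   fix m
   let ?S = "sigma_sets (space ?\<mu>) (\<Union>i\<in>{m..}. sigma_sets (space ?\<mu>) {C i})"
   have CC: "C i \<in> ?S" if "m \<le> i" for i
    using that by (intro sigma_sets.Basic UN_I[of i]) auto
   interpret S: sigma_algebra "space ?\<mu>" ?S
    by (rule sigma_algebra_sigma_sets) (use sigma_sets_into_sp[of "{C _}" "space ?\<mu>"] in "auto simp: C_def space_bern")
   let ?F = "en ` {..<m}"
   have fin_en: "finite (en n)" for n
   proof -
    obtain x y where "en n = {x, y}" using enE[of n] by (rule edgesE)
    thus ?thesis by simp
   qed
   have fF: "finite ?F" "\<And>f. f \<in> ?F \<Longrightarrow> finite f" using fin_en by auto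
   \<comment> \<open>With the first \<open>m\<close> edges deleted the event reads only later edges,
     which places it in the sigma-algebra they generate.\<close>
   have iff: "inf_cl V \<longleftrightarrow> (\<exists>v. \<forall>k. exits k v (os V - ?F))" for V
   proof
    assume "inf_cl V"
    then obtain v where "infinite (cl (os V) v)" by (auto simp: has_inf_cluster_iff infinite_cl_iff)
    from cl_delete[OF this fF] show "\<exists>v. \<forall>k. exits k v (os V - ?F)" by (simp add: infinite_cl_iff)
   next
    assume "\<exists>v. \<forall>k. exits k v (os V - ?F)"
    then obtain v where v: "\<And>k. exits k v (os V - ?F)" by blast
    have "exits k v (os V)" for k by (rule incrD[OF incr_exits _ v]) blast
    thus "inf_cl V" unfolding has_inf_cluster_iff by blast
   qed
   have loc: "{V \<in> space ?\<mu>. exits k v (os V - ?F)} \<in> ?S" for k v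
   proof -
    let ?I = "EB (Suc k) v - ?F"
    have eq: "(os V - ?F) \<inter> EB (Suc k) v = {i \<in> ?I. V i}" for V by (auto simp: os_def EB_def)
    have sub: "os V - ?F \<subseteq> Idx" for V using edges_Idx by (auto simp: os_def)
    have "{V \<in> space ?\<mu>. exits k v (os V - ?F)} = {V \<in> space ?\<mu>. exits k v {i \<in> ?I. V i}}"
     unfolding exits_local[OF sub, symmetric] eq ..
    also have "\<dots> \<in> ?S"
    proof (rule cyl_in_algebra[OF S.sigma_algebra_axioms])
     fix i assume i: "i \<in> ?I"
     then obtain n where n: "i = en n" using enS EB_edges by blast
     hence "m \<le> n" using i by (auto simp: not_less[symmetric])
     thus "{V \<in> space ?\<mu>. V i} \<in> ?S" using CC[of n] unfolding n C_def by (simp add: space_bern)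
    qed simp
    finally show ?thesis .
   qed
   have "X = (\<Union>v. \<Inter>k. {V \<in> space ?\<mu>. exits k v (os V - ?F)})"
    unfolding X_def space_bern iff by auto
   also have "\<dots> \<in> ?S" 
   proof (rule S.countable_UN''[OF countable_V])
    show "(\<Inter>k. {V \<in> space ?\<mu>. exits k v (os V - ?F)}) \<in> ?S" for v
     by (rule S.countable_INT) (use loc in auto)
   qed
   finally show "X \<in> ?S" .
  qed
 qed
qed

lemma enumeration_exists: "\<exists>en. bij_betw en (UNIV :: nat set) EG"
 using countable_edges infinite_edges bij_betw_from_nat_into by blast

lemma AE_inf_cluster:
 assumes pe: "pe_ok pe EG" and th: "0 < \<theta>" "\<And>k. \<theta> \<le> thet pe z k"
 shows "AE V in bern pe. inf_cl V"
proof -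
 interpret prob_space "bern pe" by (rule prob_bern)
 let ?X = "{V \<in> Cfg. inf_cl V}"
 have X: "?X \<in> sets (bern pe)" using has_inf_sets by (simp add: sets_bern)
 have "\<theta> \<le> measure (bern pe) {V \<in> Cfg. \<forall>k. exits k z (os V)}"
  by (rule LIMSEQ_le_const[OF thet_limit[OF pe]]) (use th in auto)
 also have "\<dots> \<le> measure (bern pe) ?X"
  by (rule finite_measure_mono[OF _ X]) (auto simp: has_inf_cluster_iff)
 finally have "measure (bern pe) ?X \<noteq> 0" using th by linarith
 obtain en where en: "bij_betw en (UNIV :: nat set) EG" using enumeration_exists by blast
 have "measure (bern pe) ?X = 1" using perc_zero_one[OF pe en] \<open>measure (bern pe) ?X \<noteq> 0\<close> by blast
 hence "AE V in bern pe. V \<in> ?X" using X by (simp add: prob_eq_1)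
 thus ?thesis by (rule eventually_mono) simp
qed

lemma thet_mono:
 assumes "pe_ok pe EG" "pe_ok pe' EG" "\<And>e. e \<in> EG \<Longrightarrow> pe e \<le> pe' e"
 shows "thet pe z k \<le> thet pe' z k"
proof -
 define cut where "cut f = (\<lambda>e. if e \<in> EG then f e else (0::real))" for f :: "'v set \<Rightarrow> real"
 have "PR (EB (Suc k) z) f (exits k z) = PR (EB (Suc k) z) (cut f) (exits k z)" for f
  by (rule PR_param_cong) (use EB_edges in "auto simp: cut_def")
 moreover have "PR (EB (Suc k) z) (cut pe) (exits k z) \<le> PR (EB (Suc k) z) (cut pe') (exits k z)"
  by (rule PR_mono_param[OF finite_EB incr_exits]) (use assms in "auto simp: cut_def pv_def pe_ok_def")
 ultimately show ?thesis unfolding thet_def by simp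
qed

definition hyb :: "'v set set \<Rightarrow> real \<Rightarrow> real \<Rightarrow> 'v set \<Rightarrow> real" where
 "hyb S p r e = (if e \<in> S then r else p)"

lemma thet_Pm:
 assumes "Suc k \<le> N"
 shows "PR (IB N z) (Pm S p r h) (exits k z) = thet (hyb S p r) z k"
proof -
 have "PR (IB N z) (Pm S p r h) (exits k z) = PR (IB N z) (Pm S p r h) (\<lambda>V. exits k z (V \<inter> EB (Suc k) z))"
  by (rule PR_cong, subst exits_local) (use IB_sub_Idx in blast)+
 also have "\<dots> = PR (IB N z \<inter> EB (Suc k) z) (Pm S p r h) (exits k z)" by (rule PR_restrict) simp
 also have "IB N z \<inter> EB (Suc k) z = EB (Suc k) z" using EB_IB[of "Suc k" z] IB_mono[OF assms, of z] by blast
 also have "PR (EB (Suc k) z) (Pm S p r h) (exits k z) = PR (EB (Suc k) z) (hyb S p r) (exits k z)"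
  by (rule PR_param_cong) (use edge_not_green EB_edges in "auto simp: Pm_def hyb_def")
 finally show ?thesis unfolding thet_def .
qed

text \<open>To see the ghost, the cluster must leave \<open>ball k z\<close> or meet one of the open
  ghost indices inside it. For fixed \<open>k\<close> the second contribution vanishes as
  \<open>h\<close> tends to 0.\<close>

lemma hits_le_thet:
 assumes ok: "okp a p r h"
 shows "HP N S p r h z \<le> thet (hyb S p r) z k + real (card (ball k z)) * h"
proof -
 let ?P = "Pm S p r h" and ?I = "IB (max N (Suc k)) z"
 have P: "pv ?P" by (rule okp_pv[OF ok])
 have "PR (IB N z) ?P (hits z) \<le> PR ?I ?P (hits z)"
  using IB_mono[of N "max N (Suc k)" z] by (intro PR_mono_index[OF incr_hits P]) auto
 also have "\<dots> \<le> PR ?I ?P (\<lambda>V. \<exists>b\<in>insert None (Some ` ball k z). case b of None \<Rightarrow> exits k z V | Some w \<Rightarrow> {w} \<in> V)"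
 proof (rule PR_mono[OF P])
  fix V assume "hits z V"
  then obtain w where "w \<in> cl V z" "{w} \<in> V" by (auto simp: hits_def)
  thus "\<exists>b\<in>insert None (Some ` ball k z). case b of None \<Rightarrow> exits k z V | Some w \<Rightarrow> {w} \<in> V"
   by (cases "w \<in> ball k z") (auto simp: exits_def)
 qed
 also have "\<dots> \<le> (\<Sum>b\<in>insert None (Some ` ball k z). PR ?I ?P (\<lambda>V. case b of None \<Rightarrow> exits k z V | Some w \<Rightarrow> {w} \<in> V))"
  by (rule PR_Ex_le[OF P]) simp
 also have "\<dots> = PR ?I ?P (exits k z) + (\<Sum>w\<in>ball k z. PR ?I ?P (\<lambda>V. {w} \<in> V))"
  by (subst sum.insert) (auto simp: sum.reindex)
 also have "(\<Sum>w\<in>ball k z. PR ?I ?P (\<lambda>V. {w} \<in> V)) \<le> (\<Sum>w\<in>ball k z. h)"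
 proof (rule sum_mono)
  fix w assume "w \<in> ball k z"
  moreover have "k \<le> max N (Suc k)" by arith
  ultimately have "w \<in> ball (max N (Suc k)) z" using ball_mono[of k "max N (Suc k)" z] by blast
  hence w: "{w} \<in> ?I" by (auto simp: IB_def Idx_def)
  have "PR ?I ?P (\<lambda>V. {w} \<in> V) = 1 - PR ?I ?P (\<lambda>V. \<not> {w} \<in> V)" using PR_not[of ?I ?P "\<lambda>V. {w} \<in> V"] by simp
  also have "PR ?I ?P (\<lambda>V. \<not> {w} \<in> V) = 1 - h"
   using PR_none[of ?I "{{w}}" ?P] w by (simp add: Pm_def)
  finally show "PR ?I ?P (\<lambda>V. {w} \<in> V) \<le> h" by simp
 qed
 finally show ?thesis using thet_Pm[of k "max N (Suc k)" z S p r h] by simp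
qed

text \<open>A cluster that leaves \<open>ball k z\<close> without seeing the ghost has at least
  \<open>Suc k\<close> closed ghost indices. For fixed \<open>h\<close> the error vanishes as
  \<open>k\<close> grows, so the two comparisons send \<open>k\<close> and \<open>h\<close> to their
  limits in opposite orders.\<close>

lemma thet_le_hits:
 assumes ok: "okp a p r h"
 shows "thet (hyb S p r) z k \<le> HP (Suc k) S p r h z + (1 - h) ^ Suc k"
proof -
 let ?P = "Pm S p r h" and ?I = "IB (Suc k) z"
 have P: "pv ?P" by (rule okp_pv[OF ok])
 have h: "0 \<le> h" "h \<le> 1" using ok by (auto simp: okp_def)
 have W: "{v. {v} \<in> ?I} = ball (Suc k) z" by (auto simp: IB_def Idx_def)
 let ?Bad = "\<lambda>V. of_bool (Suc k \<le> card (cl V z \<inter> {v. {v} \<in> ?I})) * of_bool (\<forall>w\<in>cl V z. {w} \<notin> V) :: real"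
 have "PR ?I ?P (exits k z) \<le> Ev ?I ?P (\<lambda>V. of_bool (hits z V) + ?Bad V)"
  unfolding PR_def
 proof (rule Ev_mono[OF P])
  fix V assume w: "V \<subseteq> ?I"
  show "of_bool (exits k z V) \<le> of_bool (hits z V) + ?Bad V"
  proof (cases "exits k z V \<and> \<not> hits z V")
   case True
   then obtain v where v: "v \<in> cl V z" "v \<notin> ball k z" by (auto simp: exits_def)
   have "V \<subseteq> Idx" using w IB_sub_Idx by blast
   from cluster_far[OF this v] have "Suc k \<le> card (cl V z \<inter> ball k z)" .
   also have "\<dots> \<le> card (cl V z \<inter> ball (Suc k) z)" using ball_mono[of k "Suc k" z] by (intro card_mono) auto
   finally show ?thesis using True unfolding W hits_def by simp
  qed auto
 qed
 also have "\<dots> = PR ?I ?P (hits z) + Ev ?I ?P ?Bad" unfolding PR_def by (rule Ev_add)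
 also have "Ev ?I ?P ?Bad \<le> (1 - h) ^ Suc k"
 proof (rule Ev_nogreen[OF finite_IB P])
  show "?P i = h" if "i \<in> greens" for i using that by (simp add: Pm_def)
  show "of_bool (Suc k \<le> n) * (1 - h) ^ n \<le> (1 - h) ^ Suc k" for n
   using h power_decreasing[of "Suc k" n "1 - h"] by (cases "Suc k \<le> n") auto
 qed
 finally show ?thesis using thet_Pm[OF order_refl, of k z S p r h] by simp
qed

end

section \<open>Random-cluster measures\<close>

text \<open>The classes of \<open>x\<close> and \<open>y\<close> are merged and all others remain
  the same. The resulting loss of one factor \<open>q\<close> is the origin of
  \<open>p_prime\<close>.\<close>

lemma quotient_add_edge:
 assumes fin: "finite \<A>" and R: "sym R" "R \<subseteq> \<A> \<times> \<A>" and xy: "x \<in> \<A>" "y \<in> \<A>" "(x, y) \<notin> R\<^sup>*"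
 shows "card (\<A> // R\<^sup>*) = Suc (card (\<A> // (R \<union> {(x, y), (y, x)})\<^sup>*))"
proof -
 let ?R' = "R \<union> {(x, y), (y, x)}"
 define C where "C v = R\<^sup>* `` {v}" for v
 define C' where "C' v = ?R'\<^sup>* `` {v}" for v
 have symR: "(b, a) \<in> R\<^sup>*" if "(a, b) \<in> R\<^sup>*" for a b using sym_rtrancl[OF R(1)] that by (auto dest: symD)
 have Cself: "v \<in> C v" for v by (simp add: C_def)
 have Ceq: "C a = C b" if "a \<in> C b" for a b
  using that symR unfolding C_def by (auto intro: rtrancl_trans)
 have ne: "C x \<noteq> C y" using xy(3) Cself[of y] by (auto simp: C_def)
 let ?U = "C x \<union> C y"
 have mono: "C v \<subseteq> C' v" for v unfolding C_def C'_def using rtrancl_mono[of R ?R'] by blast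
 have C'trans: "c \<in> C' a" if "b \<in> C' a" "c \<in> C' b" for a b c using that unfolding C'_def by (auto intro: rtrancl_trans)
 have xy': "y \<in> C' x" "x \<in> C' y" unfolding C'_def by auto
 have closed1: "C' v \<subseteq> ?U" if v: "v \<in> ?U" for v
 proof
  fix w assume "w \<in> C' v"
  hence "(v, w) \<in> ?R'\<^sup>*" by (simp add: C'_def)
  thus "w \<in> ?U"
  proof (induction rule: rtrancl_induct)
   case (step a b)
   have bb: "b \<in> C a" if "(a, b) \<in> R" using that by (auto simp: C_def)
   show ?case using step(2,3) bb Ceq Cself by blast
  qed (rule v)
 qed
 have C'U: "C' v = ?U" if v: "v \<in> ?U" for v
 proof
  show "C' v \<subseteq> ?U" by (rule closed1[OF v])
  have "x \<in> C' v"
  proof (cases "v \<in> C x")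
   case True
   hence "x \<in> C v" using Ceq Cself by blast
   thus ?thesis using mono by blast
  next
   case False
   hence "y \<in> C v" using v Ceq Cself by blast
   thus ?thesis using mono C'trans xy'(2) by blast
  qed
  thus "?U \<subseteq> C' v" using mono C'trans xy'(1) by blast
 qed
 have C'C: "C' v = C v" if v: "v \<notin> ?U" for v
 proof
  show "C' v \<subseteq> C v"
  proof
   fix w assume "w \<in> C' v"
   hence "(v, w) \<in> ?R'\<^sup>*" by (simp add: C'_def)
   thus "w \<in> C v"
   proof (induction rule: rtrancl_induct)
    case (step a b)
    have "a \<noteq> x" "a \<noteq> y" using step(3) v Ceq Cself by blast+
    hence "(a, b) \<in> R" using step(2) by auto
    thus ?case using step(3) by (auto simp: C_def)
   qed (rule Cself)
  qed
 qed (rule mono)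
 have Q: "\<A> // R\<^sup>* = C ` \<A>" "\<A> // ?R'\<^sup>* = C' ` \<A>" by (auto simp: quotient_def C_def C'_def)
 have "C' ` \<A> = insert ?U (C ` \<A> - {C x, C y})"
 proof (intro equalityI subsetI)
  fix A assume "A \<in> C' ` \<A>"
  then obtain v where v: "v \<in> \<A>" "A = C' v" by blast
  show "A \<in> insert ?U (C ` \<A> - {C x, C y})"
  proof (cases "v \<in> ?U")
   case False
   hence "A = C v" using v C'C by simp
   moreover have "C v \<noteq> C x" "C v \<noteq> C y" using False Cself by blast+
   ultimately show ?thesis using v by blast
  qed (use v C'U in simp)
 next
  fix A assume A: "A \<in> insert ?U (C ` \<A> - {C x, C y})"
  show "A \<in> C' ` \<A>"
  proof (cases "A = ?U")
   case True
   hence "A = C' x" using C'U Cself by blast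
   thus ?thesis using xy by blast
  next
   case False
   then obtain v where v: "v \<in> \<A>" "A = C v" "A \<noteq> C x" "A \<noteq> C y" using A by blast
   hence "v \<notin> ?U" using Ceq by blast
   thus ?thesis using v C'C by blast
  qed
 qed
 moreover have "?U \<notin> C ` \<A> - {C x, C y}"
 proof
  assume "?U \<in> C ` \<A> - {C x, C y}"
  then obtain v where v: "?U = C v" "?U \<noteq> C x" by blast
  hence "x \<in> C v" using Cself by blast
  thus False using Ceq v by blast
 qed
 ultimately have c': "card (C' ` \<A>) = Suc (card (C ` \<A> - {C x, C y}))" using fin by simp
 have "card (C ` \<A> - {C x, C y}) = card (C ` \<A>) - card {C x, C y}"
  using fin xy by (intro card_Diff_subset) auto
 moreover have "card {C x, C y} \<le> card (C ` \<A>)" using fin xy by (intro card_mono) auto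
 ultimately show ?thesis using c' ne unfolding Q by simp
qed

lemma quotient_same:
 assumes "sym R" "(x, y) \<in> R\<^sup>*"
 shows "(R \<union> {(x, y), (y, x)})\<^sup>* = R\<^sup>*"
proof (rule rtrancl_subset)
 show "R \<union> {(x, y), (y, x)} \<subseteq> R\<^sup>*"
  using assms(2) symD[OF sym_rtrancl[OF assms(1)] assms(2)] by auto
qed auto

definition WS :: "'i set \<Rightarrow> ('i set \<Rightarrow> real) \<Rightarrow> ('i set \<Rightarrow> bool) \<Rightarrow> real" where
 "WS E w A = (\<Sum>J\<in>Pow E. w J * of_bool (A J))"

definition indep_of :: "'i \<Rightarrow> ('i set \<Rightarrow> bool) \<Rightarrow> bool" where
 "indep_of e A \<longleftrightarrow> (\<forall>J. A (insert e J) = A (J - {e}))"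

lemma WS_split:
 assumes "finite E" "e \<in> E"
 shows "WS E w A = (\<Sum>J\<in>Pow (E - {e}). w J * of_bool (A J) + w (insert e J) * of_bool (A (insert e J)))"
proof -
 let ?f = "\<lambda>J. w J * of_bool (A J)" and ?P = "Pow (E - {e})"
 have "Pow E = ?P \<union> insert e ` ?P" using Pow_insert[of e "E - {e}"] assms(2) by (simp add: insert_absorb)
 hence "WS E w A = sum ?f ?P + sum ?f (insert e ` ?P)" unfolding WS_def
  by (simp only:) (rule sum.union_disjoint, use assms in auto)
 also have "sum ?f (insert e ` ?P) = (\<Sum>J\<in>?P. ?f (insert e J))"
 proof (rule sum.reindex_cong[OF _ refl refl])
  show "inj_on (insert e) ?P"
  proof (rule inj_onI)
   fix J K assume "J \<in> ?P" "K \<in> ?P" "insert e J = insert e K"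
   hence "J = insert e J - {e}" "K = insert e K - {e}" by auto
   thus "J = K" using \<open>insert e J = insert e K\<close> by simp
  qed
 qed
 finally show ?thesis by (simp add: sum.distrib)
qed

lemma WS_edge:
 assumes E: "finite E" "e \<in> E" and A: "indep_of e A"
 shows "WS E w (\<lambda>J. e \<in> J \<and> A J) = (\<Sum>J\<in>Pow (E - {e}). w (insert e J) * of_bool (A J))"
  and "WS E w A = (\<Sum>J\<in>Pow (E - {e}). (w J + w (insert e J)) * of_bool (A J))"
proof -
 have *: "A (insert e J) = A J" if "J \<in> Pow (E - {e})" for J
 proof -
  have "J - {e} = J" using that by auto
  thus ?thesis using A by (simp add: indep_of_def)
 qed
 show "WS E w (\<lambda>J. e \<in> J \<and> A J) = (\<Sum>J\<in>Pow (E - {e}). w (insert e J) * of_bool (A J))"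
  unfolding WS_split[OF E] by (rule sum.cong) (use * in auto)
 show "WS E w A = (\<Sum>J\<in>Pow (E - {e}). (w J + w (insert e J)) * of_bool (A J))"
  unfolding WS_split[OF E] by (rule sum.cong) (auto simp: * distrib_right)
qed

lemma WS_edge_upper:
 assumes E: "finite E" "e \<in> E" and A: "indep_of e A"
  and hi: "\<And>J. J \<subseteq> E - {e} \<Longrightarrow> A J \<Longrightarrow> w (insert e J) \<le> hi * (w J + w (insert e J))"
 shows "WS E w (\<lambda>J. e \<in> J \<and> A J) \<le> hi * WS E w A"
 unfolding WS_edge[OF E A] sum_distrib_left
 by (rule sum_mono) (use hi in "auto simp: mult.assoc")

lemma WS_edge_lower:
 assumes E: "finite E" "e \<in> E" and A: "indep_of e A"
  and lo: "\<And>J. J \<subseteq> E - {e} \<Longrightarrow> A J \<Longrightarrow> lo * (w J + w (insert e J)) \<le> w (insert e J)"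
 shows "lo * WS E w A \<le> WS E w (\<lambda>J. e \<in> J \<and> A J)"
 unfolding WS_edge[OF E A] sum_distrib_left
 by (rule sum_mono) (use lo in "auto simp: mult.assoc")

lemma WS_nonneg: "(\<And>J. J \<subseteq> E \<Longrightarrow> 0 \<le> w J) \<Longrightarrow> 0 \<le> WS E w A"
 unfolding WS_def by (intro sum_nonneg mult_nonneg_nonneg) auto

lemma WS_cases: "WS E w A = WS E w (\<lambda>J. B J \<and> A J) + WS E w (\<lambda>J. \<not> B J \<and> A J)"
 unfolding WS_def sum.distrib[symmetric] by (intro sum.cong) auto

text \<open>The edges of \<open>T\<close> are prescribed one after another; each has a conditional
  probability between \<open>m\<close> and \<open>M\<close>, so either prescription costs a factor
  at least \<open>b\<close>.\<close>

lemma WS_pattern: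
 assumes E: "finite E" and w: "\<And>J. J \<subseteq> E \<Longrightarrow> 0 \<le> w J"
  and T: "finite T" "T \<subseteq> E" "\<And>g. g \<in> T \<Longrightarrow> indep_of g A"
  and b: "0 \<le> b" "b \<le> m" "b \<le> 1 - M"
  and one: "\<And>g J. g \<in> E \<Longrightarrow> J \<subseteq> E - {g} \<Longrightarrow> m * (w J + w (insert g J)) \<le> w (insert g J) \<and> w (insert g J) \<le> M * (w J + w (insert g J))"
 shows "b ^ card T * WS E w A \<le> WS E w (\<lambda>J. (\<forall>g\<in>T. (g \<in> J) = o') \<and> A J)"
 using T
proof (induction T rule: finite_induct)
 case (insert g T)
 let ?A = "\<lambda>J. (\<forall>g\<in>T. (g \<in> J) = o') \<and> A J"
 have g: "g \<in> E" using insert.prems by blast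
 have ind: "indep_of g ?A"
 proof -
  have "A (insert g J) = A (J - {g})" for J using insert.prems(2)[of g] by (simp add: indep_of_def)
  thus ?thesis using insert.hyps(2) unfolding indep_of_def by auto
 qed
 have W0: "0 \<le> WS E w ?A" by (rule WS_nonneg[OF w])
 have "b * WS E w ?A \<le> WS E w (\<lambda>J. (g \<in> J) = o' \<and> ?A J)"
 proof (cases o')
  case True
  have "m * WS E w ?A \<le> WS E w (\<lambda>J. g \<in> J \<and> ?A J)"
   by (rule WS_edge_lower[OF E g ind]) (use one[OF g] in blast)
  thus ?thesis using True mult_right_mono[OF b(2) W0] by simp
 next
  case False
  have "WS E w (\<lambda>J. g \<in> J \<and> ?A J) \<le> M * WS E w ?A"
   by (rule WS_edge_upper[OF E g ind]) (use one[OF g] in blast)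
  moreover have "WS E w ?A = WS E w (\<lambda>J. g \<in> J \<and> ?A J) + WS E w (\<lambda>J. g \<notin> J \<and> ?A J)" by (rule WS_cases)
  moreover have "b * WS E w ?A \<le> (1 - M) * WS E w ?A" by (rule mult_right_mono[OF b(3) W0])
  ultimately have "b * WS E w ?A \<le> WS E w (\<lambda>J. g \<notin> J \<and> ?A J)" by (simp add: left_diff_distrib)
  thus ?thesis using False by simp
 qed
 hence 1: "b * WS E w ?A \<le> WS E w (\<lambda>J. (\<forall>g\<in>insert g T. (g \<in> J) = o') \<and> A J)"
  by (simp add: conj_assoc)
 have 2: "b * (b ^ card T * WS E w A) \<le> b * WS E w ?A"
  by (rule mult_left_mono[OF insert.IH b(1)]) (use insert.prems in auto)
 have c: "b ^ card (insert g T) * WS E w A = b * (b ^ card T * WS E w A)" using insert.hyps by simp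
 show ?case unfolding c by (rule order_trans[OF 2 1])
qed simp

text \<open>The weight is split according to whether \<open>T\<close> shows the forcing pattern.
  There the conditional probability of \<open>e\<close> is exactly the extreme value, elsewhere only
  the general bound holds, and the first part has relative weight at least
  \<open>b ^ card T\<close>.\<close>

lemma WS_forced:
 assumes E: "finite E" "e \<in> E" and w: "\<And>J. J \<subseteq> E \<Longrightarrow> 0 \<le> w J"
  and T: "finite T" "T \<subseteq> E" "e \<notin> T" "\<And>g. g \<in> insert e T \<Longrightarrow> indep_of g A"
  and b: "0 \<le> b" "b \<le> m" "b \<le> 1 - M" "m \<le> M"
  and one: "\<And>g J. g \<in> E \<Longrightarrow> J \<subseteq> E - {g} \<Longrightarrow> m * (w J + w (insert g J)) \<le> w (insert g J) \<and> w (insert g J) \<le> M * (w J + w (insert g J))"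
 shows "(\<And>J. J \<subseteq> E - {e} \<Longrightarrow> (\<forall>g\<in>T. (g \<in> J) = o') \<Longrightarrow> w (insert e J) = m * (w J + w (insert e J))) \<Longrightarrow>
   WS E w (\<lambda>J. e \<in> J \<and> A J) \<le> (M - (M - m) * b ^ card T) * WS E w A"
  and "(\<And>J. J \<subseteq> E - {e} \<Longrightarrow> (\<forall>g\<in>T. (g \<in> J) = o') \<Longrightarrow> w (insert e J) = M * (w J + w (insert e J))) \<Longrightarrow>
   (m + (M - m) * b ^ card T) * WS E w A \<le> WS E w (\<lambda>J. e \<in> J \<and> A J)"
proof -
 let ?pat = "\<lambda>J. \<forall>g\<in>T. (g \<in> J) = o'"
 have A: "A (insert e J) = A (J - {e})" for J using T(4)[of e] by (simp add: indep_of_def)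
 have P: "?pat (insert e J) = ?pat (J - {e})" for J by (rule ball_cong) (use T(3) in auto)
 have i1: "indep_of e (\<lambda>J. ?pat J \<and> A J)" unfolding indep_of_def P A by simp
 have i2: "indep_of e (\<lambda>J. \<not> ?pat J \<and> A J)" unfolding indep_of_def P A by simp
 have pat: "b ^ card T * WS E w A \<le> WS E w (\<lambda>J. ?pat J \<and> A J)"
  by (rule WS_pattern[OF E(1) w T(1,2) _ b(1,2,3) one]) (use T(4) in auto)
 have c1: "WS E w A = WS E w (\<lambda>J. ?pat J \<and> A J) + WS E w (\<lambda>J. \<not> ?pat J \<and> A J)" by (rule WS_cases)
 have c2: "WS E w (\<lambda>J. e \<in> J \<and> A J) = WS E w (\<lambda>J. e \<in> J \<and> ?pat J \<and> A J) + WS E w (\<lambda>J. e \<in> J \<and> \<not> ?pat J \<and> A J)"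
  unfolding WS_cases[of E w "\<lambda>J. e \<in> J \<and> A J" ?pat] by (intro arg_cong2[where f="(+)"] arg_cong[where f="WS E w"]) auto
 have key: "(M - m) * (b ^ card T * WS E w A) \<le> (M - m) * WS E w (\<lambda>J. ?pat J \<and> A J)"
  using b by (intro mult_left_mono[OF pat]) simp
 show "WS E w (\<lambda>J. e \<in> J \<and> A J) \<le> (M - (M - m) * b ^ card T) * WS E w A"
  if f: "\<And>J. J \<subseteq> E - {e} \<Longrightarrow> ?pat J \<Longrightarrow> w (insert e J) = m * (w J + w (insert e J))"
 proof -
  have "WS E w (\<lambda>J. e \<in> J \<and> ?pat J \<and> A J) \<le> m * WS E w (\<lambda>J. ?pat J \<and> A J)"
   by (rule WS_edge_upper[OF E i1]) (use f in simp)
  moreover have "WS E w (\<lambda>J. e \<in> J \<and> \<not> ?pat J \<and> A J) \<le> M * WS E w (\<lambda>J. \<not> ?pat J \<and> A J)"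
   by (rule WS_edge_upper[OF E i2]) (use one[OF E(2)] in blast)
  moreover have "M * WS E w A = M * WS E w (\<lambda>J. ?pat J \<and> A J) + M * WS E w (\<lambda>J. \<not> ?pat J \<and> A J)"
   unfolding c1 by (rule distrib_left)
  ultimately show ?thesis using key unfolding c2 left_diff_distrib mult.assoc by linarith
 qed
 show "(m + (M - m) * b ^ card T) * WS E w A \<le> WS E w (\<lambda>J. e \<in> J \<and> A J)"
  if f: "\<And>J. J \<subseteq> E - {e} \<Longrightarrow> ?pat J \<Longrightarrow> w (insert e J) = M * (w J + w (insert e J))"
 proof -
  have "M * WS E w (\<lambda>J. ?pat J \<and> A J) \<le> WS E w (\<lambda>J. e \<in> J \<and> ?pat J \<and> A J)"
   by (rule WS_edge_lower[OF E i1]) (use f in simp)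
  moreover have "m * WS E w (\<lambda>J. \<not> ?pat J \<and> A J) \<le> WS E w (\<lambda>J. e \<in> J \<and> \<not> ?pat J \<and> A J)"
   by (rule WS_edge_lower[OF E i2]) (use one[OF E(2)] in blast)
  moreover have "m * WS E w A = m * WS E w (\<lambda>J. ?pat J \<and> A J) + m * WS E w (\<lambda>J. \<not> ?pat J \<and> A J)"
   unfolding c1 by (rule distrib_left)
  ultimately show ?thesis using key unfolding c2 distrib_right left_diff_distrib mult.assoc by linarith
 qed
qed

lemma p_prime_bounds:
 assumes "0 \<le> p" "p \<le> 1" "0 < q"
 shows "0 < p + q * (1 - p)" "0 \<le> p_prime p q" "p_prime p q \<le> 1"
proof -
 show pos: "0 < p + q * (1 - p)"
 proof (cases "p = 0")
  case False
  thus ?thesis using assms by (intro add_pos_nonneg mult_nonneg_nonneg) auto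
 qed (use assms in simp)
 thus "0 \<le> p_prime p q" "p_prime p q \<le> 1" using assms by (auto simp: p_prime_def divide_le_eq_1)
qed

section \<open>Conditional edge probabilities of FK measures and local tests\<close>

context lf_graph
begin

definition fkr :: "'v set \<Rightarrow> 'v set set \<Rightarrow> 'v set set \<Rightarrow> ('v \<times> 'v) set" where
 "fkr \<A> \<nu> J = {(x, y). x \<in> \<A> \<and> y \<in> \<A> \<and> ({x, y} \<in> J \<or> (\<exists>B\<in>\<nu>. x \<in> B \<and> y \<in> B))}"

definition fkw :: "'v set \<Rightarrow> 'v set set \<Rightarrow> real \<Rightarrow> real \<Rightarrow> 'v set set \<Rightarrow> real" where
 "fkw \<A> \<nu> p q J = (\<Prod>e\<in>IE \<A>. if e \<in> J then p else 1 - p) * q ^ card (\<A> // (fkr \<A> \<nu> J)\<^sup>*)"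

lemma finite_ind_edges [simp]: "finite \<A> \<Longrightarrow> finite (IE \<A>)"
 unfolding ind_edges_def by (rule finite_subset[of _ "Pow \<A>"]) auto

lemma fk_weight_restrict:
 assumes "J \<subseteq> IE \<A>"
 shows "fk_weight adj \<A> \<nu> p q (restrict (\<lambda>e. e \<in> J) (IE \<A>)) = fkw \<A> \<nu> p q J"
proof -
 let ?E = "IE \<A>" and ?V = "restrict (\<lambda>e. e \<in> J) (IE \<A>)"
 have "{(x, y). x \<in> \<A> \<and> y \<in> \<A> \<and> (({x, y} \<in> ?E \<and> ?V {x, y}) \<or> (\<exists>B\<in>\<nu>. x \<in> B \<and> y \<in> B))} = fkr \<A> \<nu> J"
  unfolding fkr_def using assms by auto
 moreover have "(\<Prod>e\<in>?E. if ?V e then p else 1 - p) = (\<Prod>e\<in>?E. if e \<in> J then p else 1 - p)"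
  by (rule prod.cong) auto
 ultimately show ?thesis unfolding fk_weight_def fk_clusters_def fkw_def by simp
qed

lemma sum_PiE_bool:
 fixes f :: "('i \<Rightarrow> bool) \<Rightarrow> real"
 shows "(\<Sum>V\<in>PiE E (\<lambda>_. UNIV). f V) = (\<Sum>J\<in>Pow E. f (restrict (\<lambda>e. e \<in> J) E))"
proof (rule sum.reindex_bij_witness[where i = "\<lambda>J. restrict (\<lambda>e. e \<in> J) E" and j = "\<lambda>V. {e \<in> E. V e}"])
 fix V :: "'i \<Rightarrow> bool" assume V: "V \<in> PiE E (\<lambda>_. UNIV)"
 show *: "restrict (\<lambda>e. e \<in> {e \<in> E. V e}) E = V"
  using V by (auto simp: restrict_def PiE_iff extensional_def fun_eq_iff)
 show "f (restrict (\<lambda>e. e \<in> {e \<in> E. V e}) E) = f V" using * by simp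
qed auto

lemma fk_cyl_WS:
 "fk_cyl adj \<A> \<nu> p q F \<xi> = WS (IE \<A>) (fkw \<A> \<nu> p q) (\<lambda>J. \<forall>e\<in>F \<inter> IE \<A>. (e \<in> J) = \<xi> e) /
   WS (IE \<A>) (fkw \<A> \<nu> p q) (\<lambda>_. True)"
proof -
 let ?E = "IE \<A>"
 have 1: "(\<Sum>V\<in>PiE ?E (\<lambda>_. UNIV). if (\<forall>e\<in>F \<inter> ?E. V e = \<xi> e) then fk_weight adj \<A> \<nu> p q V else 0) =
   WS ?E (fkw \<A> \<nu> p q) (\<lambda>J. \<forall>e\<in>F \<inter> ?E. (e \<in> J) = \<xi> e)"
  unfolding sum_PiE_bool WS_def by (rule sum.cong) (auto simp: fk_weight_restrict)
 have 2: "(\<Sum>V\<in>PiE ?E (\<lambda>_. UNIV). fk_weight adj \<A> \<nu> p q V) = WS ?E (fkw \<A> \<nu> p q) (\<lambda>_. True)"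
  unfolding sum_PiE_bool WS_def by (rule sum.cong) (auto simp: fk_weight_restrict)
 show ?thesis unfolding fk_cyl_def 1 2 ..
qed

lemma sym_fkr: "sym (fkr \<A> \<nu> J)"
 unfolding sym_def fkr_def by (auto simp: insert_commute)

lemma fkw_nonneg: "0 \<le> p \<Longrightarrow> p \<le> 1 \<Longrightarrow> 0 < q \<Longrightarrow> 0 \<le> fkw \<A> \<nu> p q J"
 unfolding fkw_def by (intro mult_nonneg_nonneg prod_nonneg) auto

text \<open>If the endpoints are already connected, the number of clusters does not change and
  opening has conditional probability p; otherwise it drops by one and the probability is p/(p +
  q(1-p)). The product form avoids dividing by a weight that may vanish.\<close>

lemma fkw_insert:
 assumes fin: "finite \<A>" and e: "{x, y} \<in> IE \<A>" and J: "J \<subseteq> IE \<A> - {{x, y}}"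
  and pq: "0 \<le> p" "p \<le> 1" "0 < q"
 shows "fkw \<A> \<nu> p q (insert {x, y} J) =
  (if (x, y) \<in> (fkr \<A> \<nu> J)\<^sup>* then p else p_prime p q) * (fkw \<A> \<nu> p q J + fkw \<A> \<nu> p q (insert {x, y} J))"
proof -
 let ?E = "IE \<A>" and ?e = "{x, y}" and ?R = "fkr \<A> \<nu> J"
 define \<pi> where "\<pi> = (\<Prod>g\<in>?E - {?e}. if g \<in> J then p else 1 - p)"
 have xy: "x \<in> \<A>" "y \<in> \<A>" using e by (auto simp: ind_edges_def)
 have R': "fkr \<A> \<nu> (insert ?e J) = ?R \<union> {(x, y), (y, x)}"
  unfolding fkr_def using xy by (auto simp: doubleton_eq_iff insert_commute)
 have sub: "?R \<subseteq> \<A> \<times> \<A>" by (auto simp: fkr_def)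
 have p1: "(\<Prod>g\<in>?E. if g \<in> insert ?e J then p else 1 - p) = p * \<pi>"
  unfolding \<pi>_def by (subst prod.remove[OF _ e]) (auto simp: fin intro!: prod.cong)
 have p0: "(\<Prod>g\<in>?E. if g \<in> J then p else 1 - p) = (1 - p) * \<pi>"
  unfolding \<pi>_def using J by (subst prod.remove[OF _ e]) (auto simp: fin)
 let ?k = "card (\<A> // ?R\<^sup>*)" and ?k' = "card (\<A> // (?R \<union> {(x, y), (y, x)})\<^sup>*)"
 have w: "fkw \<A> \<nu> p q (insert ?e J) = p * \<pi> * q ^ ?k'" "fkw \<A> \<nu> p q J = (1 - p) * \<pi> * q ^ ?k"
  unfolding fkw_def R' p1 p0 by simp_all
 show ?thesis
 proof (cases "(x, y) \<in> ?R\<^sup>*")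
  case True
  hence "?k' = ?k" using quotient_same[OF sym_fkr True] by simp
  thus ?thesis using True unfolding w by (simp add: algebra_simps)
 next
  case False
  hence k: "?k = Suc ?k'" by (rule quotient_add_edge[OF fin sym_fkr sub xy])
  have "p_prime p q * (p + q * (1 - p)) = p" using p_prime_bounds(1)[OF pq] by (simp add: p_prime_def)
  hence "p * (\<pi> * q ^ ?k') = (p_prime p q * (p + q * (1 - p))) * (\<pi> * q ^ ?k')" by simp
  thus ?thesis using False unfolding w k by (simp add: algebra_simps)
 qed
qed

text \<open>The state of \<open>T\<close> alone decides whether the endpoints of \<open>e\<close>
  are connected without \<open>e\<close>, whatever the other edges and the boundary partition are.
  \<open>U\<close> is the part of the graph that the finite volume must contain for this.\<close>

definition forces :: "bool \<Rightarrow> 'v set set \<Rightarrow> 'v set \<Rightarrow> 'v set \<Rightarrow> bool" where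
 "forces o' T e U \<longleftrightarrow> (\<forall>\<A> \<nu> J x y. finite \<A> \<longrightarrow> U \<subseteq> \<A> \<longrightarrow> partition_on (bdry adj \<A>) \<nu> \<longrightarrow>
   J \<subseteq> IE \<A> - {e} \<longrightarrow> (\<forall>g\<in>T. (g \<in> J) = o') \<longrightarrow> e = {x, y} \<longrightarrow>
   ((x, y) \<in> (fkr \<A> \<nu> J)\<^sup>* \<longleftrightarrow> o'))"

lemma cyl_indep: "g \<notin> F \<Longrightarrow> indep_of g (\<lambda>J. \<forall>e\<in>F \<inter> E. (e \<in> J) = \<xi> e)"
 unfolding indep_of_def by auto

lemma fk_single:
 assumes fin: "finite \<A>" and pq: "0 \<le> p" "p \<le> 1" "0 < q"
  and g: "g \<in> IE \<A>" "J \<subseteq> IE \<A> - {g}"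
 shows "min p (p_prime p q) * (fkw \<A> \<nu> p q J + fkw \<A> \<nu> p q (insert g J)) \<le> fkw \<A> \<nu> p q (insert g J) \<and>
  fkw \<A> \<nu> p q (insert g J) \<le> max p (p_prime p q) * (fkw \<A> \<nu> p q J + fkw \<A> \<nu> p q (insert g J))"
proof -
 have "g \<in> EG" using g by (simp add: ind_edges_def)
 then obtain x y where xy: "g = {x, y}" by (rule edgesE)
 let ?c = "if (x, y) \<in> (fkr \<A> \<nu> J)\<^sup>* then p else p_prime p q"
 let ?t = "fkw \<A> \<nu> p q J + fkw \<A> \<nu> p q (insert g J)"
 have t: "0 \<le> ?t" using fkw_nonneg[OF pq] by simp
 have eq: "fkw \<A> \<nu> p q (insert g J) = ?c * ?t" unfolding xy by (rule fkw_insert[OF fin _ _ pq]) (use g xy in auto)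
 have "min p (p_prime p q) * ?t \<le> ?c * ?t" "?c * ?t \<le> max p (p_prime p q) * ?t"
  by (rule mult_right_mono[OF _ t], simp)+
 thus ?thesis using eq by simp
qed

lemma fk_cyl_edge:
 assumes fin: "finite \<A>" and pq: "0 \<le> p" "p \<le> 1" "0 < q" and e: "e \<in> IE \<A>" "e \<notin> F"
 shows "fk_cyl adj \<A> \<nu> p q (insert e F) (\<xi>(e := True)) \<le> max p (p_prime p q) * fk_cyl adj \<A> \<nu> p q F \<xi>"
  and "min p (p_prime p q) * fk_cyl adj \<A> \<nu> p q F \<xi> \<le> fk_cyl adj \<A> \<nu> p q (insert e F) (\<xi>(e := True))"
  and "forces o' T e U \<Longrightarrow> U \<subseteq> \<A> \<Longrightarrow> partition_on (bdry adj \<A>) \<nu> \<Longrightarrow> finite T \<Longrightarrow> T \<subseteq> IE \<A> \<Longrightarrow> e \<notin> T \<Longrightarrow> T \<inter> F = {} \<Longrightarrow>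
   0 \<le> b \<Longrightarrow> b \<le> min p (p_prime p q) \<Longrightarrow> b \<le> 1 - max p (p_prime p q) \<Longrightarrow> (if o' then p else p_prime p q) = min p (p_prime p q) \<Longrightarrow>
   fk_cyl adj \<A> \<nu> p q (insert e F) (\<xi>(e := True)) \<le>
    (max p (p_prime p q) - (max p (p_prime p q) - min p (p_prime p q)) * b ^ card T) * fk_cyl adj \<A> \<nu> p q F \<xi>"
  and "forces o' T e U \<Longrightarrow> U \<subseteq> \<A> \<Longrightarrow> partition_on (bdry adj \<A>) \<nu> \<Longrightarrow> finite T \<Longrightarrow> T \<subseteq> IE \<A> \<Longrightarrow> e \<notin> T \<Longrightarrow> T \<inter> F = {} \<Longrightarrow>
   0 \<le> b \<Longrightarrow> b \<le> min p (p_prime p q) \<Longrightarrow> b \<le> 1 - max p (p_prime p q) \<Longrightarrow> (if o' then p else p_prime p q) = max p (p_prime p q) \<Longrightarrow>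
   (min p (p_prime p q) + (max p (p_prime p q) - min p (p_prime p q)) * b ^ card T) * fk_cyl adj \<A> \<nu> p q F \<xi> \<le>
    fk_cyl adj \<A> \<nu> p q (insert e F) (\<xi>(e := True))"
proof -
 let ?E = "IE \<A>" and ?w = "fkw \<A> \<nu> p q" and ?m = "min p (p_prime p q)" and ?M = "max p (p_prime p q)"
 let ?A = "\<lambda>J. \<forall>e\<in>F \<inter> ?E. (e \<in> J) = \<xi> e" and ?Z = "WS ?E ?w (\<lambda>_. True)"
 have fE: "finite ?E" using fin by simp
 have w: "\<And>J. 0 \<le> ?w J" by (rule fkw_nonneg[OF pq])
 have Z: "0 \<le> ?Z" by (rule WS_nonneg) (rule w)
 have one: "\<And>g J. g \<in> ?E \<Longrightarrow> J \<subseteq> ?E - {g} \<Longrightarrow> ?m * (?w J + ?w (insert g J)) \<le> ?w (insert g J) \<and> ?w (insert g J) \<le> ?M * (?w J + ?w (insert g J))"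
  by (rule fk_single[OF fin pq])
 have lhs: "fk_cyl adj \<A> \<nu> p q (insert e F) (\<xi>(e := True)) = WS ?E ?w (\<lambda>J. e \<in> J \<and> ?A J) / ?Z"
 proof -
  have "(\<lambda>J. \<forall>g\<in>insert e F \<inter> ?E. (g \<in> J) = (\<xi>(e := True)) g) = (\<lambda>J. e \<in> J \<and> ?A J)" using e by auto
  thus ?thesis unfolding fk_cyl_WS by simp
 qed
 have rhs: "fk_cyl adj \<A> \<nu> p q F \<xi> = WS ?E ?w ?A / ?Z" by (rule fk_cyl_WS)
 have ind: "indep_of e ?A" by (rule cyl_indep[OF e(2)])
 have up: "WS ?E ?w (\<lambda>J. e \<in> J \<and> ?A J) / ?Z \<le> c * (WS ?E ?w ?A / ?Z)" if "WS ?E ?w (\<lambda>J. e \<in> J \<and> ?A J) \<le> c * WS ?E ?w ?A" for c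
  using divide_right_mono[OF that Z] by simp
 have lo: "c * (WS ?E ?w ?A / ?Z) \<le> WS ?E ?w (\<lambda>J. e \<in> J \<and> ?A J) / ?Z" if "c * WS ?E ?w ?A \<le> WS ?E ?w (\<lambda>J. e \<in> J \<and> ?A J)" for c
  using divide_right_mono[OF that Z] by simp
 show "fk_cyl adj \<A> \<nu> p q (insert e F) (\<xi>(e := True)) \<le> ?M * fk_cyl adj \<A> \<nu> p q F \<xi>"
  unfolding lhs rhs by (rule up, rule WS_edge_upper[OF fE e(1) ind]) (use one[OF e(1)] in blast)
 show "?m * fk_cyl adj \<A> \<nu> p q F \<xi> \<le> fk_cyl adj \<A> \<nu> p q (insert e F) (\<xi>(e := True))"
  unfolding lhs rhs by (rule lo, rule WS_edge_lower[OF fE e(1) ind]) (use one[OF e(1)] in blast)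
 have "e \<in> EG" using e by (simp add: ind_edges_def)
 then obtain x y where xy: "e = {x, y}" by (rule edgesE)
 have forced: "?w (insert e J) = (if o' then p else p_prime p q) * (?w J + ?w (insert e J))"
  if "forces o' T e U" "U \<subseteq> \<A>" "partition_on (bdry adj \<A>) \<nu>" "J \<subseteq> ?E - {e}" "\<forall>g\<in>T. (g \<in> J) = o'" for J
 proof -
  have "(x, y) \<in> (fkr \<A> \<nu> J)\<^sup>* \<longleftrightarrow> o'" using that fin xy unfolding forces_def by blast
  thus ?thesis using fkw_insert[OF fin, of x y J p q \<nu>] pq that(4) e xy by simp
 qed
 assume T: "forces o' T e U" "U \<subseteq> \<A>" "partition_on (bdry adj \<A>) \<nu>" "finite T" "T \<subseteq> ?E" "e \<notin> T" "T \<inter> F = {}"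
  and b: "0 \<le> b" "b \<le> ?m" "b \<le> 1 - ?M"
 have indT: "indep_of g ?A" if "g \<in> insert e T" for g by (rule cyl_indep) (use that T e in blast)
 have mM: "?m \<le> ?M" by simp
 show "fk_cyl adj \<A> \<nu> p q (insert e F) (\<xi>(e := True)) \<le> (?M - (?M - ?m) * b ^ card T) * fk_cyl adj \<A> \<nu> p q F \<xi>"
  if c: "(if o' then p else p_prime p q) = ?m"
  unfolding lhs rhs
  by (rule up, rule WS_forced(1)[OF fE e(1) w T(4,5,6) indT b mM one]) (use forced[OF T(1-3)] c in auto)
 show "(?m + (?M - ?m) * b ^ card T) * fk_cyl adj \<A> \<nu> p q F \<xi> \<le> fk_cyl adj \<A> \<nu> p q (insert e F) (\<xi>(e := True))"
  if c: "(if o' then p else p_prime p q) = ?M"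
  unfolding lhs rhs
  by (rule lo, rule WS_forced(2)[OF fE e(1) w T(4,5,6) indT b mM one]) (use forced[OF T(1-3)] c in auto)
qed

definition star :: "'v \<Rightarrow> 'v set \<Rightarrow> 'v set set" where
 "star x e = {g \<in> EG. x \<in> g} - {e}"

text \<open>With its other edges closed \<open>x0\<close> could still be connected through a
  boundary block. The finite volume contains all its neighbours, so \<open>x0\<close> is not a
  boundary vertex and lies in no block.\<close>

lemma star_forces:
 assumes e: "e \<in> EG" "x0 \<in> e"
 shows "forces False (star x0 e) e (ball (Suc 0) x0 \<union> e)"
 unfolding forces_def
proof (intro allI impI)
 fix \<A> \<nu> J x y
 assume "finite \<A>" and U: "ball (Suc 0) x0 \<union> e \<subseteq> \<A>" and \<nu>: "partition_on (bdry adj \<A>) \<nu>"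
  and J: "J \<subseteq> IE \<A> - {e}" and T: "\<forall>g\<in>star x0 e. (g \<in> J) = False" and xy: "e = {x, y}"
 obtain c d where cd: "e = {c, d}" "c \<noteq> d" using e(1) by (rule edgesE)
 hence ne: "x \<noteq> y" using xy by auto
 have nb: "x0 \<notin> bdry adj \<A>" using U ball_adj unfolding bdry_def by blast
 have iso: "b = x0" if "(x0, b) \<in> fkr \<A> \<nu> J" for b
 proof -
  have "x0 \<notin> B" if "B \<in> \<nu>" for B using \<nu> nb that by (auto simp: partition_on_def)
  hence b: "{x0, b} \<in> J" using that by (auto simp: fkr_def)
  hence "{x0, b} \<in> star x0 e" using J by (auto simp: star_def ind_edges_def)
  thus ?thesis using T b by blast
 qed
 have iso': "w = x0" if "(x0, w) \<in> (fkr \<A> \<nu> J)\<^sup>*" for w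
  using that by (induction rule: rtrancl_induct) (use iso in auto)
 have "(x, y) \<notin> (fkr \<A> \<nu> J)\<^sup>*"
 proof
  assume h: "(x, y) \<in> (fkr \<A> \<nu> J)\<^sup>*"
  hence h': "(y, x) \<in> (fkr \<A> \<nu> J)\<^sup>*" using symD[OF sym_rtrancl[OF sym_fkr]] by blast
  consider "x0 = x" | "x0 = y" using e(2) xy by blast
  thus False using iso' h h' ne by cases blast+
 qed
 thus "((x, y) \<in> (fkr \<A> \<nu> J)\<^sup>*) = False" by simp
qed

definition path_edges :: "'v list \<Rightarrow> 'v set set" where
 "path_edges ws = {{ws ! i, ws ! Suc i} |i. Suc i < length ws}"

lemma path_edges_sub:
 assumes "successively adj ws"
 shows "path_edges ws \<subseteq> EG"
 unfolding path_edges_def edges_def using assms by (auto simp: successively_conv_nth)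

lemma path_edges_card: "finite (path_edges ws)" "card (path_edges ws) \<le> length ws"
proof -
 have sub: "path_edges ws \<subseteq> (\<lambda>i. {ws ! i, ws ! Suc i}) ` {..<length ws}" unfolding path_edges_def by auto
 show "finite (path_edges ws)" by (rule finite_subset[OF sub]) simp
 have "card (path_edges ws) \<le> card ((\<lambda>i. {ws ! i, ws ! Suc i}) ` {..<length ws})" by (rule card_mono[OF _ sub]) simp
 also have "\<dots> \<le> card {..<length ws}" by (rule card_image_le) simp
 finally show "card (path_edges ws) \<le> length ws" by simp
qed

lemma cyc_not_path:
 assumes "cyc_path e ws"
 shows "e \<notin> path_edges ws"
proof
 assume "e \<in> path_edges ws"
 then obtain i where i: "Suc i < length ws" "e = {ws ! i, ws ! Suc i}" by (auto simp: path_edges_def)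
 let ?n = "length ws"
 have ws: "3 \<le> ?n" "distinct ws" "e = {hd ws, last ws}" using assms by (auto simp: cyc_path_def)
 hence "ws \<noteq> []" by auto
 hence e: "e = {ws ! 0, ws ! (?n - 1)}" using ws by (simp add: hd_conv_nth last_conv_nth)
 have "ws ! 0 \<in> {ws ! i, ws ! Suc i}" "ws ! (?n - 1) \<in> {ws ! i, ws ! Suc i}" using e i by auto
 moreover have "0 < ?n" "?n - 1 < ?n" using ws by auto
 ultimately have "0 = i \<or> 0 = Suc i" "?n - 1 = i \<or> ?n - 1 = Suc i"
  using i(1) nth_eq_iff_index_eq[OF ws(2)] by auto
 thus False using ws(1) by auto
qed

lemma cyc_forces:
 assumes ws: "cyc_path e ws"
 shows "forces True (path_edges ws) e (set ws)"
 unfolding forces_def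
proof (intro allI impI)
 fix \<A> \<nu> J x y
 assume "finite \<A>" and U: "set ws \<subseteq> \<A>" and "partition_on (bdry adj \<A>) \<nu>"
  and "J \<subseteq> IE \<A> - {e}" and T: "\<forall>g\<in>path_edges ws. (g \<in> J) = True" and xy: "e = {x, y}"
 have len: "3 \<le> length ws" "e = {hd ws, last ws}" using ws by (auto simp: cyc_path_def)
 hence ne: "ws \<noteq> []" by auto
 have "(ws ! 0, ws ! i) \<in> (fkr \<A> \<nu> J)\<^sup>*" if "i < length ws" for i
  using that
 proof (induction i)
  case (Suc i)
  have "{ws ! i, ws ! Suc i} \<in> J" using T Suc.prems by (auto simp: path_edges_def)
  hence "(ws ! i, ws ! Suc i) \<in> fkr \<A> \<nu> J" using U Suc.prems by (auto simp: fkr_def subset_iff)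
  moreover have "(ws ! 0, ws ! i) \<in> (fkr \<A> \<nu> J)\<^sup>*" using Suc by simp
  ultimately show ?case by (rule rtrancl_into_rtrancl[rotated])
 qed simp
 from this[of "length ws - 1"] have "(hd ws, last ws) \<in> (fkr \<A> \<nu> J)\<^sup>*"
  using ne by (simp add: hd_conv_nth last_conv_nth)
 moreover from this have "(last ws, hd ws) \<in> (fkr \<A> \<nu> J)\<^sup>*" using symD[OF sym_rtrancl[OF sym_fkr]] by blast
 moreover have "x = hd ws \<and> y = last ws \<or> x = last ws \<and> y = hd ws" using xy len(2) by (auto simp: doubleton_eq_iff)
 ultimately show "((x, y) \<in> (fkr \<A> \<nu> J)\<^sup>*) = True" by auto
qed

lemma cyc_path_map:
 assumes "H \<in> Aut" "cyc_path e ws"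
 shows "cyc_path (H ` e) (map H ws)"
proof -
 have "ws \<noteq> []" using assms(2) by (auto simp: cyc_path_def)
 moreover have "distinct (map H ws)" using assms aut_inj[OF assms(1)] by (auto simp: cyc_path_def distinct_map inj_on_def)
 moreover have "successively adj (map H ws)"
  using assms by (auto simp: cyc_path_def successively_conv_nth aut_adj)
 ultimately show ?thesis using assms by (auto simp: cyc_path_def hd_map last_map aut_adj)
qed

end

context qt_graph
begin

definition local_test :: "nat \<Rightarrow> nat \<Rightarrow> bool \<Rightarrow> 'v set \<Rightarrow> 'v set set \<Rightarrow> 'v set \<Rightarrow> bool" where
 "local_test r n o' e T U \<longleftrightarrow> finite T \<and> finite U \<and> T \<subseteq> EG \<and> e \<notin> T \<and> card T \<le> n \<and> forces o' T e U \<and>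
   (\<forall>g\<in>T. \<forall>v\<in>e. g \<subseteq> ball r v)"

lemma local_test_exists: "\<exists>r n. \<forall>o'. \<forall>e\<in>Cand. \<exists>T U. local_test r n o' e T U"
proof -
 obtain ws where ws: "cyc_path e0 ws" using cyc_path_exists[OF e0_cyc] by blast
 obtain D where D: "\<And>v. card {y. adj v y} \<le> D" using degree_bound by blast
 obtain a b where ab: "e0 = {a, b}" using e0_edge by (rule edgesE)
 obtain ra where ra: "set ws \<subseteq> ball ra a" using ball_exists_finite[of "set ws" a] by auto
 obtain rb where rb: "set ws \<subseteq> ball rb b" using ball_exists_finite[of "set ws" b] by auto
 \<comment> \<open>The cycle lies within \<open>ra\<close> of one endpoint of \<open>e0\<close> and
   \<open>rb\<close> of the other, and 2 covers the star. The bound \<open>n\<close> on the size of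
   a test likewise covers both kinds, so which of them is used may depend on q.\<close>
 define r where "r = ra + rb + 2"
 define n where "n = D + length ws"
 have star: "\<exists>T U. local_test r n False e T U" if e: "e \<in> Cand" for e
 proof -
  have eE: "e \<in> EG" by (rule Cand_edge[OF e])
  then obtain x y where xy: "e = {x, y}" by (rule edgesE)
  have "finite (star x e)" unfolding star_def using card_edges_at(1)[OF D, of x] by simp
  moreover have "card (star x e) \<le> card {g \<in> EG. x \<in> g}"
   unfolding star_def using card_edges_at(1)[OF D, of x] by (intro card_mono) auto
  moreover have "g \<subseteq> ball r v" if "g \<in> star x e" "v \<in> e" for g v
  proof -
   have "x \<in> ball (Suc 0) v" using edge_in_ball[OF eE that(2)] xy by blast
   moreover have "g \<subseteq> ball (Suc 0) x" using edge_in_ball[of g x] that(1) by (auto simp: star_def)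
   ultimately have "g \<subseteq> ball (Suc 0 + Suc 0) v" using ball_trans by blast
   moreover have "ball (Suc 0 + Suc 0) v \<subseteq> ball r v" by (rule ball_mono) (simp add: r_def)
   ultimately show ?thesis by blast
  qed
  moreover have "forces False (star x e) e (ball (Suc 0) x \<union> e)" by (rule star_forces[OF eE]) (simp add: xy)
  ultimately have "local_test r n False e (star x e) (ball (Suc 0) x \<union> e)"
   unfolding local_test_def n_def using card_edges_at(2)[OF D, of x] xy by (auto simp: star_def)
  thus ?thesis by blast
 qed
 have cyc: "\<exists>T U. local_test r n True e T U" if e: "e \<in> Cand" for e
 proof -
  obtain H where H: "H \<in> Aut" "e = H ` e0" using e by (auto simp: Cand_def)
  let ?ws = "map H ws"
  have c: "cyc_path e ?ws" unfolding H(2) by (rule cyc_path_map[OF H(1) ws])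
  have sub: "path_edges ?ws \<subseteq> EG" by (rule path_edges_sub) (use c in "simp add: cyc_path_def")
  have "g \<subseteq> ball r v" if "g \<in> path_edges ?ws" "v \<in> e" for g v
  proof -
   have "g \<subseteq> set ?ws" using that(1) by (auto simp: path_edges_def simp del: nth_map set_map)
   hence g: "g \<subseteq> H ` set ws" by simp
   have "ball ra a \<subseteq> ball r a" "ball rb b \<subseteq> ball r b" by (rule ball_mono, simp add: r_def)+
   hence "set ws \<subseteq> ball r a" "set ws \<subseteq> ball r b" using ra rb by blast+
   hence "H ` set ws \<subseteq> ball r (H a)" "H ` set ws \<subseteq> ball r (H b)"
    using ball_aut_sub[OF H(1), of r a] ball_aut_sub[OF H(1), of r b] by blast+
   thus ?thesis using g that(2) unfolding H(2) ab by auto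
  qed
  hence "local_test r n True e (path_edges ?ws) (set ?ws)"
   unfolding local_test_def using path_edges_card[of ?ws] sub cyc_not_path[OF c] cyc_forces[OF c] by (simp add: n_def)
  thus ?thesis by blast
 qed
 have "\<forall>o'. \<forall>e\<in>Cand. \<exists>T U. local_test r n o' e T U"
 proof (intro allI ballI)
  fix o' e assume "e \<in> Cand"
  thus "\<exists>T U. local_test r n o' e T U" by (cases o') (use star cyc in auto)
 qed
 thus ?thesis by blast
qed

end

context lf_graph
begin

definition cyl :: "'v set set \<Rightarrow> ('v set \<Rightarrow> bool) \<Rightarrow> ('v set \<Rightarrow> bool) set" where
 "cyl F \<xi> = {V \<in> Cfg. \<forall>e\<in>F. V e = \<xi> e}"

text \<open>Linear inequalities between cylinder probabilities pass to the weak limit; they are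
  required only for volumes containing \<open>U\<close>, which holds from some index on.\<close>

lemma fk_limit_le:
 assumes \<mu>: "fk_limit adj p q \<mu>" and F: "finite F" "F \<subseteq> EG" "finite G" "G \<subseteq> EG" "finite U"
  and le: "\<And>\<A> \<nu>. finite \<A> \<Longrightarrow> U \<subseteq> \<A> \<Longrightarrow> partition_on (bdry adj \<A>) \<nu> \<Longrightarrow>
   c * fk_cyl adj \<A> \<nu> p q F \<xi> \<le> d * fk_cyl adj \<A> \<nu> p q G \<eta>"
 shows "c * measure \<mu> (cyl F \<xi>) \<le> d * measure \<mu> (cyl G \<eta>)"
proof -
 let ?P = "\<lambda>\<A> \<nu>. (\<forall>n. finite (\<A> n)) \<and> (\<forall>n. \<A> n \<subseteq> \<A> (Suc n)) \<and> (\<Union>n. \<A> n) = UNIV \<and>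
    (\<forall>n. partition_on (bdry adj (\<A> n)) (\<nu> n)) \<and>
    (\<forall>F \<xi>. finite F \<longrightarrow> F \<subseteq> EG \<longrightarrow> (\<lambda>n. fk_cyl adj (\<A> n) (\<nu> n) p q F \<xi>) \<longlonglongrightarrow> measure \<mu> (cyl F \<xi>))"
 have "\<exists>\<A> \<nu>. ?P \<A> \<nu>" using \<mu> unfolding fk_limit_def cyl_def by (elim conjE)
 then obtain \<A> \<nu> where P: "?P \<A> \<nu>" by (elim exE)
 have L: "\<And>n. finite (\<A> n)" "\<And>n. \<A> n \<subseteq> \<A> (Suc n)" "(\<Union>n. \<A> n) = UNIV"
  "\<And>n. partition_on (bdry adj (\<A> n)) (\<nu> n)"
  "\<And>F \<xi>. finite F \<Longrightarrow> F \<subseteq> EG \<Longrightarrow> (\<lambda>n. fk_cyl adj (\<A> n) (\<nu> n) p q F \<xi>) \<longlonglongrightarrow> measure \<mu> (cyl F \<xi>)"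
  using P by simp_all
 have mono: "\<A> m \<subseteq> \<A> n" if "m \<le> n" for m n using lift_Suc_mono_le[of \<A>, OF L(2) that] .
 have "\<exists>n. U \<subseteq> \<A> n"
  using F(5)
 proof (induction U rule: finite_induct)
  case (insert u U)
  then obtain n where n: "U \<subseteq> \<A> n" by blast
  obtain m where m: "u \<in> \<A> m" using L(3) by blast
  have "insert u U \<subseteq> \<A> (max n m)" using n m mono[of n "max n m"] mono[of m "max n m"] by auto
  thus ?case by blast
 qed simp
 then obtain n0 where n0: "U \<subseteq> \<A> n0" by blast
 have ev: "eventually (\<lambda>n. c * fk_cyl adj (\<A> n) (\<nu> n) p q F \<xi> \<le> d * fk_cyl adj (\<A> n) (\<nu> n) p q G \<eta>) sequentially"
 proof (rule eventually_sequentiallyI[of n0])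
  fix n assume "n0 \<le> n"
  hence "U \<subseteq> \<A> n" using n0 mono[of n0 n] by blast
  thus "c * fk_cyl adj (\<A> n) (\<nu> n) p q F \<xi> \<le> d * fk_cyl adj (\<A> n) (\<nu> n) p q G \<eta>" by (rule le[OF L(1) _ L(4)])
 qed
 show ?thesis
  by (rule tendsto_le[OF sequentially_bot tendsto_mult_left[OF L(5)[OF F(3,4)]] tendsto_mult_left[OF L(5)[OF F(1,2)]] ev])
qed

lemma finite_edge: "e \<in> EG \<Longrightarrow> finite e"
 by (erule edgesE) simp

lemma ind_edgesI: "F \<subseteq> EG \<Longrightarrow> \<Union>F \<subseteq> \<A> \<Longrightarrow> F \<subseteq> IE \<A>"
 unfolding ind_edges_def by blast

lemma fk_limit_edge:
 assumes \<mu>: "fk_limit adj p q \<mu>" and pq: "0 \<le> p" "p \<le> 1" "0 < q"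
  and F: "finite F" "F \<subseteq> EG" and e: "e \<in> EG" "e \<notin> F"
 defines "m \<equiv> min p (p_prime p q)" and "M \<equiv> max p (p_prime p q)"
 shows "measure \<mu> (cyl (insert e F) (\<xi>(e := True))) \<le> M * measure \<mu> (cyl F \<xi>)"
  and "m * measure \<mu> (cyl F \<xi>) \<le> measure \<mu> (cyl (insert e F) (\<xi>(e := True)))"
  and "forces o' T e U \<Longrightarrow> finite U \<Longrightarrow> finite T \<Longrightarrow> T \<subseteq> EG \<Longrightarrow> e \<notin> T \<Longrightarrow> T \<inter> F = {} \<Longrightarrow>
   0 \<le> b \<Longrightarrow> b \<le> m \<Longrightarrow> b \<le> 1 - M \<Longrightarrow> (if o' then p else p_prime p q) = m \<Longrightarrow>
   measure \<mu> (cyl (insert e F) (\<xi>(e := True))) \<le> (M - (M - m) * b ^ card T) * measure \<mu> (cyl F \<xi>)"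
  and "forces o' T e U \<Longrightarrow> finite U \<Longrightarrow> finite T \<Longrightarrow> T \<subseteq> EG \<Longrightarrow> e \<notin> T \<Longrightarrow> T \<inter> F = {} \<Longrightarrow>
   0 \<le> b \<Longrightarrow> b \<le> m \<Longrightarrow> b \<le> 1 - M \<Longrightarrow> (if o' then p else p_prime p q) = M \<Longrightarrow>
   (m + (M - m) * b ^ card T) * measure \<mu> (cyl F \<xi>) \<le> measure \<mu> (cyl (insert e F) (\<xi>(e := True)))"
proof -
 have F': "finite (insert e F)" "insert e F \<subseteq> EG" using F e by auto
 have fe: "finite e" by (rule finite_edge[OF e(1)])
 have ie: "e \<in> IE \<A>" if "e \<subseteq> \<A>" for \<A> using that e by (simp add: ind_edges_def)
 have "1 * measure \<mu> (cyl (insert e F) (\<xi>(e := True))) \<le> M * measure \<mu> (cyl F \<xi>)"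
  by (rule fk_limit_le[OF \<mu> F' F fe]) (use fk_cyl_edge(1)[OF _ pq ie e(2)] in "simp add: M_def")
 thus "measure \<mu> (cyl (insert e F) (\<xi>(e := True))) \<le> M * measure \<mu> (cyl F \<xi>)" by simp
 have "m * measure \<mu> (cyl F \<xi>) \<le> 1 * measure \<mu> (cyl (insert e F) (\<xi>(e := True)))"
  by (rule fk_limit_le[OF \<mu> F F' fe]) (use fk_cyl_edge(2)[OF _ pq ie e(2)] in "simp add: m_def")
 thus "m * measure \<mu> (cyl F \<xi>) \<le> measure \<mu> (cyl (insert e F) (\<xi>(e := True)))" by simp
 assume T: "forces o' T e U" "finite U" "finite T" "T \<subseteq> EG" "e \<notin> T" "T \<inter> F = {}"
  and b: "0 \<le> b" "b \<le> m" "b \<le> 1 - M"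
 let ?U = "U \<union> e \<union> \<Union>T"
 have fU: "finite ?U" using T fe finite_edge by auto
 note b' = b(1) b(2)[unfolded m_def] b(3)[unfolded M_def]
 show "measure \<mu> (cyl (insert e F) (\<xi>(e := True))) \<le> (M - (M - m) * b ^ card T) * measure \<mu> (cyl F \<xi>)"
  if c: "(if o' then p else p_prime p q) = m"
 proof -
  have "1 * measure \<mu> (cyl (insert e F) (\<xi>(e := True))) \<le> (M - (M - m) * b ^ card T) * measure \<mu> (cyl F \<xi>)"
  proof (rule fk_limit_le[OF \<mu> F' F fU])
   fix \<A> \<nu> assume L: "finite \<A>" "?U \<subseteq> \<A>" "partition_on (bdry adj \<A>) \<nu>"
   show "1 * fk_cyl adj \<A> \<nu> p q (insert e F) (\<xi>(e := True)) \<le> (M - (M - m) * b ^ card T) * fk_cyl adj \<A> \<nu> p q F \<xi>"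
    unfolding m_def M_def mult_1
    by (rule fk_cyl_edge(3)[OF L(1) pq ie e(2) T(1) _ L(3) T(3) ind_edgesI[OF T(4)] T(5,6) b' c[unfolded m_def]]) (use L(2) in auto)
  qed
  thus ?thesis by simp
 qed
 show "(m + (M - m) * b ^ card T) * measure \<mu> (cyl F \<xi>) \<le> measure \<mu> (cyl (insert e F) (\<xi>(e := True)))"
  if c: "(if o' then p else p_prime p q) = M"
 proof -
  have "(m + (M - m) * b ^ card T) * measure \<mu> (cyl F \<xi>) \<le> 1 * measure \<mu> (cyl (insert e F) (\<xi>(e := True)))"
  proof (rule fk_limit_le[OF \<mu> F F' fU])
   fix \<A> \<nu> assume L: "finite \<A>" "?U \<subseteq> \<A>" "partition_on (bdry adj \<A>) \<nu>"
   show "(m + (M - m) * b ^ card T) * fk_cyl adj \<A> \<nu> p q F \<xi> \<le> 1 * fk_cyl adj \<A> \<nu> p q (insert e F) (\<xi>(e := True))"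
    unfolding m_def M_def mult_1
    by (rule fk_cyl_edge(4)[OF L(1) pq ie e(2) T(1) _ L(3) T(3) ind_edgesI[OF T(4)] T(5,6) b' c[unfolded M_def]]) (use L(2) in auto)
  qed
  thus ?thesis by simp
 qed
qed

end

section \<open>Monotone coupling\<close>

abbreviation unif :: "real measure" where "unif \<equiv> uniform_measure lborel {0..1}"

abbreviation unifs :: "(nat \<Rightarrow> real) measure" where "unifs \<equiv> PiM UNIV (\<lambda>_. unif)"

lemma prob_unif: "prob_space unif"
 by (rule prob_space_uniform_measure) auto

lemma measure_unif:
 assumes "0 \<le> c" "c \<le> 1"
 shows "measure unif {..<c} = c" "measure unif {c..} = 1 - c"
proof -
 interpret prob_space unif by (rule prob_unif)
 have "measure unif {..<c} = measure lborel ({0..1} \<inter> {..<c}) / measure lborel {0..1::real}"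
  by (rule measure_uniform_measure) auto
 also have "{0..1} \<inter> {..<c} = {0..<c}" using assms by auto
 finally show 1: "measure unif {..<c} = c" using assms by simp
 have "prob (space unif - {..<c}) = 1 - prob {..<c}" by (rule prob_compl) simp
 moreover have "space unif - {..<c} = {c..}" by auto
 ultimately show "measure unif {c..} = 1 - c" using 1 by simp
qed

text \<open>Edges are opened one by one: index \<open>n\<close> is added when its own uniform
  variable is below a threshold depending on the history. This realises a given family of
  conditional probabilities by independent variables.\<close>

primrec hist :: "(nat \<Rightarrow> nat set \<Rightarrow> real) \<Rightarrow> (nat \<Rightarrow> real) \<Rightarrow> nat \<Rightarrow> nat set" where
 "hist c u 0 = {}"
| "hist c u (Suc n) = (if u n < c n (hist c u n) then insert n (hist c u n) else hist c u n)"

definition hbox :: "(nat \<Rightarrow> nat set \<Rightarrow> real) \<Rightarrow> nat set \<Rightarrow> nat \<Rightarrow> real set" where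
 "hbox c b i = (if i \<in> b then {..<c i (b \<inter> {..<i})} else {c i (b \<inter> {..<i})..})"

definition kprod :: "(nat \<Rightarrow> nat set \<Rightarrow> real) \<Rightarrow> nat \<Rightarrow> nat set \<Rightarrow> real" where
 "kprod c n b = (\<Prod>i<n. if i \<in> b then c i (b \<inter> {..<i}) else 1 - c i (b \<inter> {..<i}))"

lemma hist_sub: "hist c u n \<subseteq> {..<n}"
 by (induction n) auto

lemma hist_mem: "i < n \<Longrightarrow> i \<in> hist c u n \<longleftrightarrow> i \<in> hist c u (Suc i)"
proof (induction n)
 case (Suc n)
 thus ?case by (cases "i = n") auto
qed simp

text \<open>The threshold at \<open>i\<close> reads the history below \<open>i\<close> only, so for
  a prescribed history the event is a product of intervals.\<close>

lemma hist_box: "b \<subseteq> {..<n} \<Longrightarrow> hist c u n = b \<longleftrightarrow> (\<forall>i<n. u i \<in> hbox c b i)"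
proof (induction n arbitrary: b)
 case (Suc n)
 let ?b = "b \<inter> {..<n}"
 have eq: "hbox c ?b i = hbox c b i" if "i < n" for i
 proof -
  have "?b \<inter> {..<i} = b \<inter> {..<i}" using that by auto
  thus ?thesis using that by (simp add: hbox_def)
 qed
 have "hist c u (Suc n) = b \<longleftrightarrow> hist c u n = ?b \<and> (u n < c n (hist c u n) \<longleftrightarrow> n \<in> b)"
  using hist_sub[of c u n] Suc.prems by (auto simp: less_Suc_eq)
 also have "\<dots> \<longleftrightarrow> (\<forall>i<n. u i \<in> hbox c b i) \<and> u n \<in> hbox c b n"
  using Suc.IH[of ?b] eq by (auto simp: hbox_def)
 also have "\<dots> \<longleftrightarrow> (\<forall>i<Suc n. u i \<in> hbox c b i)" by (auto simp: less_Suc_eq)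
 finally show ?case .
qed simp

lemma hist_measure:
 assumes c: "\<And>n b. 0 \<le> c n b \<and> c n b \<le> 1" and b: "b \<subseteq> {..<n}"
 shows "{u \<in> space unifs. hist c u n = b} \<in> sets unifs"
  and "measure unifs {u \<in> space unifs. hist c u n = b} = kprod c n b"
proof -
 interpret unif: prob_space unif by (rule prob_unif)
 interpret product_prob_space "\<lambda>_::nat. unif" UNIV by unfold_locales
 have eq: "{u \<in> space unifs. hist c u n = b} = prod_emb UNIV (\<lambda>_. unif) {..<n} (Pi\<^sub>E {..<n} (hbox c b))"
 proof (rule set_eqI)
  fix u :: "nat \<Rightarrow> real"
  have sp: "u \<in> PiE UNIV (\<lambda>_. space unif)" by (simp add: PiE_iff)
  thus "u \<in> {u \<in> space unifs. hist c u n = b} \<longleftrightarrow> u \<in> prod_emb UNIV (\<lambda>_. unif) {..<n} (Pi\<^sub>E {..<n} (hbox c b))"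
   unfolding prod_emb_def space_PiM mem_Collect_eq hist_box[OF b] Int_iff vimage_eq restrict_PiE_iff by auto
 qed
 have box: "hbox c b i \<in> sets unif" for i by (simp add: hbox_def)
 show "{u \<in> space unifs. hist c u n = b} \<in> sets unifs"
  unfolding eq by (rule sets_PiM_I) (use box in auto)
 have "measure unifs {u \<in> space unifs. hist c u n = b} = (\<Prod>i<n. measure unif (hbox c b i))"
  unfolding eq by (rule measure_PiM_emb) (use box in auto)
 also have "\<dots> = kprod c n b" unfolding kprod_def
 proof (rule prod.cong[OF refl])
  fix i
  have "0 \<le> c i (b \<inter> {..<i})" "c i (b \<inter> {..<i}) \<le> 1" using c by auto
  thus "measure unif (hbox c b i) = (if i \<in> b then c i (b \<inter> {..<i}) else 1 - c i (b \<inter> {..<i}))"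
   using measure_unif by (simp add: hbox_def)
 qed
 finally show "measure unifs {u \<in> space unifs. hist c u n = b} = kprod c n b" .
qed

section \<open>Stochastic domination along an enumeration of the edges\<close>

locale enum_graph = lf_graph adj for adj :: "'v \<Rightarrow> 'v \<Rightarrow> bool" +
 fixes en :: "nat \<Rightarrow> 'v set"
 assumes en: "bij_betw en UNIV (edges adj)"
begin

definition idx :: "'v set \<Rightarrow> nat" where "idx = inv_into UNIV en"

lemma en_edge: "en n \<in> EG" using en by (auto simp: bij_betw_def)

lemma inj_en: "inj en" using en by (simp add: bij_betw_def)

lemma idx_en [simp]: "idx (en n) = n" using inj_en by (simp add: idx_def)

lemma en_idx: "e \<in> EG \<Longrightarrow> en (idx e) = e" using en by (simp add: idx_def f_inv_into_f bij_betw_def)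

definition atom :: "nat \<Rightarrow> nat set \<Rightarrow> ('v set \<Rightarrow> bool) set" where
 "atom n b = {V \<in> Cfg. os V \<inter> en ` {..<n} = en ` b}"

lemma atom_iff:
 assumes "b \<subseteq> {..<n}"
 shows "V \<in> atom n b \<longleftrightarrow> V \<in> Cfg \<and> (\<forall>i<n. V (en i) \<longleftrightarrow> i \<in> b)"
proof -
 have "os V \<inter> en ` {..<n} = en ` {i. i < n \<and> V (en i)}" using en_edge by (auto simp: os_def)
 moreover have "en ` {i. i < n \<and> V (en i)} = en ` b \<longleftrightarrow> {i. i < n \<and> V (en i)} = b" by (rule inj_image_eq_iff[OF inj_en])
 moreover have "{i. i < n \<and> V (en i)} = b \<longleftrightarrow> (\<forall>i<n. V (en i) \<longleftrightarrow> i \<in> b)" using assms by auto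
 ultimately show ?thesis unfolding atom_def by simp
qed

lemma atom_sets: "atom n b \<in> sets (cfg_space adj)"
 unfolding atom_def by (rule local_event_sets) (use en_edge in auto)

definition cfgof :: "(nat \<Rightarrow> nat set \<Rightarrow> real) \<Rightarrow> (nat \<Rightarrow> real) \<Rightarrow> 'v set \<Rightarrow> bool" where
 "cfgof c u = restrict (\<lambda>e. idx e \<in> hist c u (Suc (idx e))) EG"

lemma cfgof_en: "cfgof c u (en i) \<longleftrightarrow> i \<in> hist c u (Suc i)"
 using en_edge by (simp add: cfgof_def)

lemma cfgof_measurable:
 assumes c: "\<And>n b. 0 \<le> c n b \<and> c n b \<le> 1"
 shows "cfgof c \<in> measurable unifs (cfg_space adj)"
 unfolding cfg_space_def cfgof_def[abs_def]
proof (rule measurable_restrict)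
 fix e
 let ?i = "idx e"
 have "{u \<in> space unifs. ?i \<in> hist c u (Suc ?i)} = (\<Union>b\<in>{b \<in> Pow {..<Suc ?i}. ?i \<in> b}. {u \<in> space unifs. hist c u (Suc ?i) = b})"
  using hist_sub[of c _ "Suc ?i"] by blast
 also have "\<dots> \<in> sets unifs"
 proof (rule sets.finite_UN)
  fix b assume "b \<in> {b \<in> Pow {..<Suc ?i}. ?i \<in> b}"
  hence "b \<subseteq> {..<Suc ?i}" by blast
  thus "{u \<in> space unifs. hist c u (Suc ?i) = b} \<in> sets unifs" by (rule hist_measure(1)[where c = c, OF c])
 qed simp
 finally show "(\<lambda>u. ?i \<in> hist c u (Suc ?i)) \<in> measurable unifs (count_space UNIV)"
  by (simp only: pred_def)
qed

lemma cfgof_atom: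
 assumes "b \<subseteq> {..<n}"
 shows "cfgof c u \<in> atom n b \<longleftrightarrow> hist c u n = b"
proof -
 have "cfgof c u \<in> Cfg" by (simp add: space_cfg cfgof_def)
 hence "cfgof c u \<in> atom n b \<longleftrightarrow> (\<forall>i<n. i \<in> hist c u n \<longleftrightarrow> i \<in> b)"
  unfolding atom_iff[OF assms] cfgof_en using hist_mem by auto
 also have "\<dots> \<longleftrightarrow> hist c u n = b" using hist_sub[of c u n] assms by auto
 finally show ?thesis .
qed

lemma measure_eq_atoms:
 assumes P: "prob_space P" "sets P = sets (cfg_space adj)" and Q: "prob_space Q" "sets Q = sets (cfg_space adj)"
  and eq: "\<And>n b. b \<subseteq> {..<n} \<Longrightarrow> measure P (atom n b) = measure Q (atom n b)"
 shows "P = Q"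
proof (rule measure_eqI_PiM_infinite)
 show "sets P = sets (PiM EG (\<lambda>_. count_space UNIV))" "sets Q = sets (PiM EG (\<lambda>_. count_space UNIV))"
  using P Q by (auto simp: cfg_space_def)
 interpret P: prob_space P by (rule P)
 interpret Q: prob_space Q by (rule Q)
 show "finite_measure P" by unfold_locales
 fix A :: "'v set \<Rightarrow> bool set" and J assume J: "finite J" "J \<subseteq> EG"
 \<comment> \<open>The extra 0 gives \<open>Max\<close> a nonempty argument when \<open>J\<close> is
   empty.\<close>
 define n where "n = Suc (Max (insert 0 (idx ` J)))"
 have Jn: "J \<subseteq> en ` {..<n}"
 proof
  fix e assume e: "e \<in> J"
  hence "idx e < n" using J(1) by (simp add: n_def less_Suc_eq_le)
  moreover have "e = en (idx e)" using e J(2) en_idx by auto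
  ultimately show "e \<in> en ` {..<n}" by blast
 qed
 let ?I = "en ` {..<n}"
 have I: "finite ?I" "?I \<subseteq> EG" using en_edge by auto
 let ?B = "\<lambda>K. \<forall>e\<in>J. (e \<in> K) \<in> A e"
 have "prod_emb EG (\<lambda>_. count_space UNIV) J (Pi\<^sub>E J A) = {V \<in> Cfg. ?B (os V \<inter> ?I)}"
 proof (rule set_eqI)
  fix V :: "'v set \<Rightarrow> bool"
  have k: "(e \<in> os V \<inter> ?I) = V e" if "e \<in> J" for e
  proof -
   have "e \<in> ?I" "e \<in> EG" using that Jn J(2) by blast+
   thus ?thesis by (simp add: os_def)
  qed
  have "?B (os V \<inter> ?I) \<longleftrightarrow> (\<forall>e\<in>J. V e \<in> A e)"
   by (rule ball_cong[OF refl]) (simp only: k)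
  thus "V \<in> prod_emb EG (\<lambda>_. count_space UNIV) J (Pi\<^sub>E J A) \<longleftrightarrow> V \<in> {V \<in> Cfg. ?B (os V \<inter> ?I)}"
   unfolding prod_emb_def space_cfg by (simp add: Pi_iff conj_commute)
 qed
 moreover have "measure P {V \<in> Cfg. ?B (os V \<inter> ?I)} = measure Q {V \<in> Cfg. ?B (os V \<inter> ?I)}"
  unfolding local_measure[OF P I, of ?B] local_measure[OF Q I, of ?B]
 proof (rule sum.cong[OF refl])
  fix K assume "K \<in> {K \<in> Pow ?I. ?B K}"
  then obtain b where "b \<subseteq> {..<n}" "K = en ` b" by (auto simp: subset_image_iff)
  thus "measure P {V \<in> Cfg. os V \<inter> ?I = K} = measure Q {V \<in> Cfg. os V \<inter> ?I = K}"
   using eq[of b n] by (simp add: atom_def)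
 qed
 ultimately show "emeasure P (prod_emb EG (\<lambda>_. count_space UNIV) J (Pi\<^sub>E J A)) =
  emeasure Q (prod_emb EG (\<lambda>_. count_space UNIV) J (Pi\<^sub>E J A))"
  by (simp add: P.emeasure_eq_measure Q.emeasure_eq_measure)
qed

lemma kernel_measure:
 assumes \<mu>: "prob_space \<mu>" "sets \<mu> = sets (cfg_space adj)"
  and K: "\<And>n b. b \<subseteq> {..<n} \<Longrightarrow> measure \<mu> (atom (Suc n) (insert n b)) = c n b * measure \<mu> (atom n b)"
  and b: "b \<subseteq> {..<n}"
 shows "measure \<mu> (atom n b) = kprod c n b"
 using b
proof (induction n arbitrary: b)
 case 0
 interpret prob_space \<mu> by (rule \<mu>)
 have "atom 0 b = space \<mu>" using 0 sets_eq_imp_space_eq[OF \<mu>(2)] by (auto simp: atom_def)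
 thus ?case using prob_space by (simp add: kprod_def)
next
 case (Suc n)
 interpret prob_space \<mu> by (rule \<mu>)
 let ?b = "b \<inter> {..<n}"
 have b': "?b \<subseteq> {..<n}" by blast
 have kp: "kprod c (Suc n) b = kprod c n ?b * (if n \<in> b then c n ?b else 1 - c n ?b)"
 proof -
  have "kprod c n b = kprod c n ?b" unfolding kprod_def
  proof (rule prod.cong[OF refl])
   fix i assume "i \<in> {..<n}"
   hence "?b \<inter> {..<i} = b \<inter> {..<i}" "i \<in> ?b \<longleftrightarrow> i \<in> b" by auto
   thus "(if i \<in> b then c i (b \<inter> {..<i}) else 1 - c i (b \<inter> {..<i})) =
    (if i \<in> ?b then c i (?b \<inter> {..<i}) else 1 - c i (?b \<inter> {..<i}))" by simp
  qed
  thus ?thesis by (simp add: kprod_def)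
 qed
 note IH = Suc.IH[OF b']
 show ?case
 proof (cases "n \<in> b")
  case True
  hence "b = insert n ?b" using Suc.prems by (auto simp: less_Suc_eq)
  hence "measure \<mu> (atom (Suc n) b) = c n ?b * measure \<mu> (atom n ?b)" using K[OF b'] by simp
  thus ?thesis using True IH kp by simp
 next
  case False
  hence bb: "b = ?b" using Suc.prems by (auto simp: less_Suc_eq)
  have sub: "insert n ?b \<subseteq> {..<Suc n}" "?b \<subseteq> {..<Suc n}" by auto
  have "atom n ?b = atom (Suc n) (insert n ?b) \<union> atom (Suc n) ?b"
   by (rule set_eqI) (simp only: Un_iff atom_iff[OF b'] atom_iff[OF sub(1)] atom_iff[OF sub(2)], auto simp: less_Suc_eq)
  moreover have "atom (Suc n) (insert n ?b) \<inter> atom (Suc n) ?b = {}"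
  proof (rule equals0I)
   fix V assume "V \<in> atom (Suc n) (insert n ?b) \<inter> atom (Suc n) ?b"
   thus False unfolding Int_iff atom_iff[OF sub(1)] atom_iff[OF sub(2)] by auto
  qed
  ultimately have "measure \<mu> (atom n ?b) = measure \<mu> (atom (Suc n) (insert n ?b)) + measure \<mu> (atom (Suc n) ?b)"
   using atom_sets by (simp add: finite_measure_Union \<mu>(2))
  hence "measure \<mu> (atom (Suc n) ?b) = (1 - c n ?b) * measure \<mu> (atom n ?b)"
   using K[OF b'] by (simp add: algebra_simps)
  thus ?thesis using False IH kp bb by simp
 qed
qed

lemma law_cfgof:
 assumes \<mu>: "prob_space \<mu>" "sets \<mu> = sets (cfg_space adj)" and c: "\<And>n b. 0 \<le> c n b \<and> c n b \<le> 1"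
  and K: "\<And>n b. b \<subseteq> {..<n} \<Longrightarrow> measure \<mu> (atom (Suc n) (insert n b)) = c n b * measure \<mu> (atom n b)"
 shows "distr unifs (cfg_space adj) (cfgof c) = \<mu>"
proof (rule measure_eq_atoms)
 have m: "cfgof c \<in> measurable unifs (cfg_space adj)" by (rule cfgof_measurable[OF c])
 have pu: "prob_space unifs" by (rule prob_space_PiM) (rule prob_unif)
 show "prob_space (distr unifs (cfg_space adj) (cfgof c))" by (rule prob_space.prob_space_distr[OF pu m])
 fix n b assume b: "b \<subseteq> {..<n :: nat}"
 have "measure (distr unifs (cfg_space adj) (cfgof c)) (atom n b) = measure unifs (cfgof c -` atom n b \<inter> space unifs)"
  by (rule measure_distr[OF m atom_sets])
 also have "cfgof c -` atom n b \<inter> space unifs = {u \<in> space unifs. hist c u n = b}" using cfgof_atom[OF b] by auto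
 also have "measure unifs \<dots> = kprod c n b" by (rule hist_measure(2)[OF c b])
 also have "\<dots> = measure \<mu> (atom n b)" using kernel_measure[OF \<mu> K b] by simp
 finally show "measure (distr unifs (cfg_space adj) (cfgof c)) (atom n b) = measure \<mu> (atom n b)" .
qed (use \<mu> in auto)

text \<open>The same uniform variables drive both processes. Thresholds are compared for all pairs
  of histories, since the two histories may differ; in the applications one side is a product
  measure with a threshold independent of the history.\<close>

lemma kernel_stoch_dom:
 assumes \<mu>: "prob_space \<mu>" "sets \<mu> = sets (cfg_space adj)" and c: "\<And>n b. 0 \<le> c n b \<and> c n b \<le> 1"
  and K: "\<And>n b. b \<subseteq> {..<n} \<Longrightarrow> measure \<mu> (atom (Suc n) (insert n b)) = c n b * measure \<mu> (atom n b)"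
  and \<nu>: "prob_space \<nu>" "sets \<nu> = sets (cfg_space adj)" and d: "\<And>n b. 0 \<le> d n b \<and> d n b \<le> 1"
  and D: "\<And>n b. b \<subseteq> {..<n} \<Longrightarrow> measure \<nu> (atom (Suc n) (insert n b)) = d n b * measure \<nu> (atom n b)"
  and le: "\<And>n b b'. c n b \<le> d n b'"
 shows "sdom \<mu> \<nu>"
 unfolding stoch_dom_def
proof (intro allI impI)
 fix A assume A: "increasing_event adj A"
 hence As: "A \<in> sets (cfg_space adj)" by (simp add: increasing_event_def)
 have pu: "prob_space unifs" by (rule prob_space_PiM) (rule prob_unif)
 interpret prob_space unifs by (rule pu)
 have m: "cfgof c \<in> measurable unifs (cfg_space adj)" "cfgof d \<in> measurable unifs (cfg_space adj)"
  by (rule cfgof_measurable, fact)+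
 have lawc: "distr unifs (cfg_space adj) (cfgof c) = \<mu>" by (rule law_cfgof[OF \<mu> c K])
 have lawd: "distr unifs (cfg_space adj) (cfgof d) = \<nu>" by (rule law_cfgof[OF \<nu> d D])
 have hsub: "hist c u n \<subseteq> hist d u n" for u n
 proof (induction n)
  case (Suc n)
  thus ?case using le[of n "hist c u n" "hist d u n"] by auto
 qed simp
 hence mono: "cfgof c u e \<longrightarrow> cfgof d u e" if "e \<in> EG" for u e
  using that hsub[of u "Suc (idx e)"] unfolding cfgof_def restrict_def by (simp del: hist.simps) blast
 have sp: "cfgof d u \<in> Cfg" for u by (simp add: space_cfg cfgof_def)
 have "measure \<mu> A = measure unifs (cfgof c -` A \<inter> space unifs)"
  using measure_distr[OF m(1) As] lawc by simp
 also have "\<dots> \<le> measure unifs (cfgof d -` A \<inter> space unifs)"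
 proof (rule finite_measure_mono)
  show "cfgof c -` A \<inter> space unifs \<subseteq> cfgof d -` A \<inter> space unifs"
  proof
   fix u assume u: "u \<in> cfgof c -` A \<inter> space unifs"
   hence "cfgof d u \<in> A" using A mono sp unfolding increasing_event_def by blast
   thus "u \<in> cfgof d -` A \<inter> space unifs" using u by simp
  qed
  show "cfgof d -` A \<inter> space unifs \<in> events" by (rule measurable_sets[OF m(2) As])
 qed
 also have "\<dots> = measure \<nu> A" using measure_distr[OF m(2) As] lawd by simp
 finally show "measure \<mu> A \<le> measure \<nu> A" .
qed

lemma bern_kernel:
 assumes pe: "pe_ok pe EG" and b: "b \<subseteq> {..<n}"
 shows "measure (bern pe) (atom (Suc n) (insert n b)) = pe (en n) * measure (bern pe) (atom n b)"
proof -
 have at: "measure (bern pe) (atom n b) = (\<Prod>i<n. if i \<in> b then pe (en i) else 1 - pe (en i))"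
  if b: "b \<subseteq> {..<n}" for n b
 proof -
  let ?I = "en ` {..<n}"
  have I: "finite ?I" "?I \<subseteq> EG" using en_edge by auto
  have "measure (bern pe) (atom n b) = PR ?I pe (\<lambda>V. V = en ` b)"
   unfolding atom_def by (rule bern_local[OF I pe_ok_mono[OF pe I(2)]])
  also have "\<dots> = wt ?I pe (en ` b)" unfolding PR_def Ev_def
   by (subst sum.remove[of _ "en ` b"]) (use b in "auto intro!: sum.neutral")
  also have "\<dots> = (\<Prod>i<n. if en i \<in> en ` b then pe (en i) else 1 - pe (en i))" unfolding wt_def
   using inj_en by (subst prod.reindex) (auto simp: inj_on_def)
  finally show ?thesis by (simp add: inj_image_mem_iff[OF inj_en])
 qed
 have "(\<Prod>i<n. if i \<in> insert n b then pe (en i) else 1 - pe (en i)) = (\<Prod>i<n. if i \<in> b then pe (en i) else 1 - pe (en i))"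
  by (rule prod.cong) auto
 moreover have "insert n b \<subseteq> {..<Suc n}" using b by auto
 ultimately show ?thesis using at[OF b] at[of "insert n b" "Suc n"] by simp
qed

lemma atom_mono: "b \<subseteq> {..<n} \<Longrightarrow> atom (Suc n) (insert n b) \<subseteq> atom n b"
proof
 fix V assume b: "b \<subseteq> {..<n}" and w: "V \<in> atom (Suc n) (insert n b)"
 have "insert n b \<subseteq> {..<Suc n}" using b by auto
 from w[unfolded atom_iff[OF this]] show "V \<in> atom n b" unfolding atom_iff[OF b] by auto
qed

lemma bern_dominates:
 assumes \<mu>: "prob_space \<mu>" "sets \<mu> = sets (cfg_space adj)" and pe: "pe_ok pe EG"
  and le: "\<And>n b. b \<subseteq> {..<n} \<Longrightarrow> measure \<mu> (atom (Suc n) (insert n b)) \<le> pe (en n) * measure \<mu> (atom n b)"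
 shows "sdom \<mu> (bern pe)"
proof -
 \<comment> \<open>On null atoms the conditional probability is set to 0, which keeps it below the
   Bernoulli parameter.\<close>
 define c where "c n b = (if b \<subseteq> {..<n} \<and> measure \<mu> (atom n b) \<noteq> 0
   then measure \<mu> (atom (Suc n) (insert n b)) / measure \<mu> (atom n b) else 0)" for n b
 have p: "0 \<le> pe (en n)" "pe (en n) \<le> 1" for n using pe en_edge by (auto simp: pe_ok_def)
 have cp: "0 \<le> c n b \<and> c n b \<le> pe (en n)" for n b
 proof (cases "b \<subseteq> {..<n} \<and> measure \<mu> (atom n b) \<noteq> 0")
  case True
  hence "0 < measure \<mu> (atom n b)" using measure_nonneg[of \<mu> "atom n b"] by linarith
  thus ?thesis using True le[of b n] by (simp add: c_def pos_divide_le_eq)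
 next
  case False
  hence "c n b = 0" unfolding c_def by (rule if_not_P)
  thus ?thesis using p by simp
 qed
 show ?thesis
 proof (rule kernel_stoch_dom[OF \<mu> _ _ prob_bern sets_bern _ bern_kernel[OF pe]])
  show "0 \<le> c n b \<and> c n b \<le> 1" for n b using cp[of n b] p(2)[of n] by linarith
  show "0 \<le> pe (en n) \<and> pe (en n) \<le> 1" for n and b :: "nat set" using p by blast
  show "c n b \<le> pe (en n)" for n b and b' :: "nat set" using cp by blast
  fix n b assume b: "b \<subseteq> {..<n :: nat}"
  show "measure \<mu> (atom (Suc n) (insert n b)) = c n b * measure \<mu> (atom n b)"
  proof (cases "measure \<mu> (atom n b) = 0")
   case True
   hence "measure \<mu> (atom (Suc n) (insert n b)) = 0"
    using le[OF b] measure_nonneg[of \<mu> "atom (Suc n) (insert n b)"] by simp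
   thus ?thesis using True by simp
  qed (use b in "simp add: c_def")
 qed
qed

lemma bern_dominated:
 assumes \<mu>: "prob_space \<mu>" "sets \<mu> = sets (cfg_space adj)" and pe: "pe_ok pe EG"
  and ge: "\<And>n b. b \<subseteq> {..<n} \<Longrightarrow> pe (en n) * measure \<mu> (atom n b) \<le> measure \<mu> (atom (Suc n) (insert n b))"
 shows "sdom (bern pe) \<mu>"
proof -
 interpret prob_space \<mu> by (rule \<mu>)
 \<comment> \<open>Here the threshold must lie above the Bernoulli parameter, so null atoms get the
   value 1.\<close>
 define c where "c n b = (if b \<subseteq> {..<n} \<and> measure \<mu> (atom n b) \<noteq> 0
   then measure \<mu> (atom (Suc n) (insert n b)) / measure \<mu> (atom n b) else 1)" for n b
 have p: "0 \<le> pe (en n)" "pe (en n) \<le> 1" for n using pe en_edge by (auto simp: pe_ok_def)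
 have mono: "measure \<mu> (atom (Suc n) (insert n b)) \<le> measure \<mu> (atom n b)" if "b \<subseteq> {..<n}" for n b
  by (rule finite_measure_mono[OF atom_mono[OF that]]) (simp add: \<mu>(2) atom_sets)
 have cp: "pe (en n) \<le> c n b \<and> c n b \<le> 1" for n b
 proof (cases "b \<subseteq> {..<n} \<and> measure \<mu> (atom n b) \<noteq> 0")
  case True
  hence "0 < measure \<mu> (atom n b)" using measure_nonneg[of \<mu> "atom n b"] by linarith
  thus ?thesis using True ge[of b n] mono[of b n] by (simp add: c_def pos_le_divide_eq)
 next
  case False
  hence "c n b = 1" unfolding c_def by (rule if_not_P)
  thus ?thesis using p by simp
 qed
 show ?thesis
 proof (rule kernel_stoch_dom[OF prob_bern sets_bern _ bern_kernel[OF pe] \<mu>])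
  show "0 \<le> c n b \<and> c n b \<le> 1" for n b using cp[of n b] p(1)[of n] by linarith
  show "0 \<le> pe (en n) \<and> pe (en n) \<le> 1" for n and b :: "nat set" using p by blast
  show "pe (en n) \<le> c n b'" for n b' and b :: "nat set" using cp by blast
  fix n b assume b: "b \<subseteq> {..<n :: nat}"
  show "measure \<mu> (atom (Suc n) (insert n b)) = c n b * measure \<mu> (atom n b)"
  proof (cases "measure \<mu> (atom n b) = 0")
   case True
   hence "measure \<mu> (atom (Suc n) (insert n b)) = 0"
    using mono[OF b] measure_nonneg[of \<mu> "atom (Suc n) (insert n b)"] by simp
   thus ?thesis using True by simp
  qed (use b in "simp add: c_def")
 qed
qed

lemma atom_cyl:
 assumes "b \<subseteq> {..<n}"
 shows "atom n b = cyl (en ` {..<n}) (\<lambda>e. idx e \<in> b)"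
  and "atom (Suc n) (insert n b) = cyl (insert (en n) (en ` {..<n})) ((\<lambda>e. idx e \<in> b)(en n := True))"
proof -
 show "atom n b = cyl (en ` {..<n}) (\<lambda>e. idx e \<in> b)"
  unfolding cyl_def by (rule set_eqI, subst atom_iff[OF assms]) auto
 have b: "insert n b \<subseteq> {..<Suc n}" using assms by auto
 have "en i \<noteq> en n" if "i < n" for i using inj_en that by (auto simp: inj_def)
 thus "atom (Suc n) (insert n b) = cyl (insert (en n) (en ` {..<n})) ((\<lambda>e. idx e \<in> b)(en n := True))"
  unfolding cyl_def by (intro set_eqI, subst atom_iff[OF b]) (auto simp: less_Suc_eq)
qed

end

lemma prod_encode_less: "prod_encode (a, 0) < prod_encode (a, Suc k)"
proof (induction k)
 case (Suc k)
 also have "prod_encode (a, Suc k) < prod_encode (a, Suc (Suc k))" by (simp add: prod_encode_def)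
 finally show ?case .
qed (simp add: prod_encode_def)

section \<open>Enumerations revealing each pattern edge before its test\<close>

context lf_graph
begin

text \<open>A test can be conditioned on only while it is still unrevealed. Since the tests are
  disjoint from each other and from \<open>S\<close>, each test edge has one owner and can be
  scheduled after it.\<close>

lemma ordered_enumeration:
 assumes disj: "\<And>e e'. e \<in> S \<Longrightarrow> e' \<in> S \<Longrightarrow> e \<noteq> e' \<Longrightarrow> T e \<inter> T e' = {}" and TS: "\<And>e. e \<in> S \<Longrightarrow> T e \<inter> S = {}"
 shows "\<exists>en :: nat \<Rightarrow> 'v set. bij_betw en UNIV EG \<and> (\<forall>i n. i < n \<longrightarrow> en n \<in> S \<longrightarrow> en i \<notin> T (en n))"
proof -
 let ?E = "EG"
 define \<iota> where "\<iota> = to_nat_on ?E"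
 have \<iota>: "inj_on \<iota> ?E" unfolding \<iota>_def by (rule inj_on_to_nat_on[OF countable_edges])
 define own where "own g = (SOME e. e \<in> S \<and> g \<in> T e)" for g
 \<comment> \<open>A test edge shares the first component of its owner and has a positive second
   one, while all edges outside tests have 0. Only such pairs are compared, where
   \<open>prod_encode\<close> is increasing in the second component; the rest merely needs
   injectivity.\<close>
 define key where "key g = (if \<exists>e\<in>S. g \<in> T e then prod_encode (\<iota> (own g), Suc (\<iota> g)) else prod_encode (\<iota> g, 0))" for g
 have inj: "inj_on key ?E"
 proof (rule inj_onI)
  fix g g' assume g: "g \<in> ?E" "g' \<in> ?E" "key g = key g'"
  hence "\<iota> g = \<iota> g'" unfolding key_def by (auto split: if_splits)
  thus "g = g'" using inj_onD[OF \<iota>] g by blast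
 qed
 let ?K = "key ` ?E"
 have infK: "infinite ?K" using infinite_edges finite_image_iff[OF inj] by blast
 define en where "en n = inv_into ?E key (enumerate ?K n)" for n
 have "bij_betw (inv_into ?E key \<circ> enumerate ?K) UNIV ?E"
  by (rule bij_betw_trans[OF bij_enumerate[OF infK] bij_betw_inv_into]) (simp add: bij_betw_def inj)
 hence bij: "bij_betw en UNIV ?E" unfolding en_def[abs_def] o_def .
 have key_en: "key (en n) = enumerate ?K n" for n
  unfolding en_def by (rule f_inv_into_f) (rule enumerate_in_set[OF infK])
 have "en i \<notin> T (en n)" if i: "i < n" and n: "en n \<in> S" for i n
 proof
  assume g: "en i \<in> T (en n)"
  let ?g = "en i" and ?e = "en n"
  have lt: "key ?g < key ?e" unfolding key_en by (rule enumerate_mono[OF i infK])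
  have "own ?g \<in> S \<and> ?g \<in> T (own ?g)" unfolding own_def by (rule someI_ex) (use g n in blast)
  hence "own ?g = ?e" using disj[OF _ n] g by blast
  hence "key ?g = prod_encode (\<iota> ?e, Suc (\<iota> ?g))" using g n unfolding key_def by auto
  moreover have "key ?e = prod_encode (\<iota> ?e, 0)" using TS n unfolding key_def by auto
  ultimately show False using lt prod_encode_less[of "\<iota> ?e" "\<iota> ?g"] by simp
 qed
 thus ?thesis using bij by blast
qed

end

context qt_graph
begin

text \<open>A test edge is within \<open>r\<close> of every endpoint of its owner, so a common test
  edge would bring two owners within \<open>2 * r\<close>; a pattern edge inside a foreign test
  would be even nearer.\<close>

lemma tests_separated:
 assumes S: "S \<subseteq> Cand" "sep (2 * r) S" and T: "\<And>e. e \<in> S \<Longrightarrow> local_test r n o' e (T e) (U e)"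
 shows "\<exists>en :: nat \<Rightarrow> 'v set. bij_betw en UNIV EG \<and> (\<forall>i n. i < n \<longrightarrow> en n \<in> S \<longrightarrow> en i \<notin> T (en n))"
proof (rule ordered_enumeration)
 have TT: "g \<in> EG \<and> g \<noteq> e \<and> (\<forall>v\<in>e. g \<subseteq> ball r v)" if "e \<in> S" "g \<in> T e" for e g
  using T[OF that(1)] that(2) unfolding local_test_def by blast
 have ne: "\<exists>v. v \<in> e" if "e \<in> EG" for e using that by (rule edgesE) blast
 have SE: "e \<in> EG" if "e \<in> S" for e using that S Cand_edge by blast
 show "T e \<inter> T e' = {}" if e: "e \<in> S" "e' \<in> S" "e \<noteq> e'" for e e'
 proof (rule ccontr)
  assume "T e \<inter> T e' \<noteq> {}"
  then obtain g where g: "g \<in> T e" "g \<in> T e'" by blast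
  obtain u where u: "u \<in> g" using ne TT[OF e(1) g(1)] by blast
  obtain v where v: "v \<in> e" using ne SE[OF e(1)] by blast
  obtain v' where v': "v' \<in> e'" using ne SE[OF e(2)] by blast
  have "u \<in> ball r v" "u \<in> ball r v'" using TT[OF e(1) g(1)] TT[OF e(2) g(2)] u v v' by blast+
  hence "v' \<in> ball (r + r) v" using ball_sym ball_trans by blast
  hence "near (2 * r) e e'" unfolding near_def using v v' by (auto simp: mult_2)
  thus False using S(2) e unfolding sep_def by blast
 qed
 show "T e \<inter> S = {}" if e: "e \<in> S" for e
 proof (rule ccontr)
  assume "T e \<inter> S \<noteq> {}"
  then obtain g where g: "g \<in> T e" "g \<in> S" by blast
  obtain u where u: "u \<in> g" using ne SE[OF g(2)] by blast
  obtain v where v: "v \<in> e" using ne SE[OF e] by blast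
  have "u \<in> ball r v" using TT[OF e g(1)] u v by blast
  hence "u \<in> ball (2 * r) v" using ball_mono[of r "2 * r" v] by auto
  hence "near (2 * r) e g" unfolding near_def using u v by blast
  thus False using S(2) e g TT[OF e g(1)] unfolding sep_def by blast
 qed
qed

text \<open>On \<open>S\<close> the test leading to the smaller of p and p' lowers the upper bound
  by \<open>(M - m) * b ^ n\<close>, because the whole test is still unrevealed when its owner is
  considered.\<close>

lemma fk_dominated:
 assumes S: "S \<subseteq> Cand" "sep (2 * r) S" and test: "\<And>o' e. e \<in> Cand \<Longrightarrow> \<exists>T U. local_test r n o' e T U"
  and pq: "0 \<le> p" "p \<le> 1" "0 < q"
 defines "m \<equiv> min p (p_prime p q)" and "M \<equiv> max p (p_prime p q)"
 assumes b: "0 \<le> b" "b \<le> m" "b \<le> 1 - M"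
  and PR: "M \<le> P" "P \<le> 1" "M - (M - m) * b ^ n \<le> R" "0 \<le> R" "R \<le> 1" and \<mu>: "fk_limit adj p q \<mu>"
 shows "sdom \<mu> (bern (hyb S P R))"
proof -
 \<comment> \<open>A forced connection gives p and a forced isolation p', so the useful test depends
   on which is smaller, that is, on whether q is below or above 1.\<close>
 define o' where "o' \<longleftrightarrow> p \<le> p_prime p q"
 have c: "(if o' then p else p_prime p q) = m" by (auto simp: o'_def m_def)
 have "\<exists>T U. local_test r n o' e T U" if "e \<in> S" for e using test that S by blast
 then obtain T U where T: "\<And>e. e \<in> S \<Longrightarrow> local_test r n o' e (T e) (U e)" by metis
 obtain en :: "nat \<Rightarrow> 'v set" where enu: "bij_betw en UNIV EG" "\<And>i n. i < n \<Longrightarrow> en n \<in> S \<Longrightarrow> en i \<notin> T (en n)"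
  using tests_separated[OF S T] by blast
 interpret enum_graph adj en by unfold_locales (rule enu(1))
 have M0: "0 \<le> M" "m \<le> M" using pq by (auto simp: M_def m_def)
 have b1: "b \<le> 1" using b M0 by linarith
 show ?thesis
 proof (rule bern_dominates)
  show "prob_space \<mu>" "sets \<mu> = sets (cfg_space adj)" using \<mu> by (auto simp: fk_limit_def)
  show "pe_ok (hyb S P R) EG" using PR M0 by (auto simp: pe_ok_def hyb_def)
  fix k and B :: "nat set" assume B: "B \<subseteq> {..<k}"
  let ?F = "en ` {..<k}" and ?e = "en k"
  have F: "finite ?F" "?F \<subseteq> EG" "?e \<in> EG" using en_edge by auto
  have eF: "?e \<notin> ?F" using inj_en by (auto simp: inj_def)
  show "measure \<mu> (atom (Suc k) (insert k B)) \<le> hyb S P R ?e * measure \<mu> (atom k B)"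
  proof (cases "?e \<in> S")
   case False
   have "measure \<mu> (atom (Suc k) (insert k B)) \<le> M * measure \<mu> (atom k B)"
    unfolding atom_cyl[OF B] M_def by (rule fk_limit_edge(1)[OF \<mu> pq F eF])
   also have "\<dots> \<le> P * measure \<mu> (atom k B)" by (rule mult_right_mono[OF PR(1)]) simp
   finally show ?thesis using False by (simp add: hyb_def)
  next
   case True
   have t: "forces o' (T ?e) ?e (U ?e)" "finite (U ?e)" "finite (T ?e)" "T ?e \<subseteq> EG" "?e \<notin> T ?e" "card (T ?e) \<le> n"
    using T[OF True] unfolding local_test_def by blast+
   have TF: "T ?e \<inter> ?F = {}" using enu(2) True by auto
   have "measure \<mu> (atom (Suc k) (insert k B)) \<le> (M - (M - m) * b ^ card (T ?e)) * measure \<mu> (atom k B)"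
    unfolding atom_cyl[OF B] M_def m_def
    by (rule fk_limit_edge(3)[OF \<mu> pq F eF t(1-5) TF b(1) b(2)[unfolded m_def] b(3)[unfolded M_def] c[unfolded m_def]])
   also have "\<dots> \<le> R * measure \<mu> (atom k B)"
   proof (rule mult_right_mono)
    have "(M - m) * b ^ n \<le> (M - m) * b ^ card (T ?e)"
     using M0 b b1 t(6) by (intro mult_left_mono power_decreasing) auto
    thus "M - (M - m) * b ^ card (T ?e) \<le> R" using PR by linarith
   qed simp
   finally show ?thesis using True by (simp add: hyb_def)
  qed
 qed
qed

text \<open>The mirror image of \<open>fk_dominated\<close>: now the test leading to the larger of p
  and p' raises the lower bound on \<open>S\<close>.\<close>

lemma fk_dominates:
 assumes S: "S \<subseteq> Cand" "sep (2 * r) S" and test: "\<And>o' e. e \<in> Cand \<Longrightarrow> \<exists>T U. local_test r n o' e T U"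
  and pq: "0 \<le> p" "p \<le> 1" "0 < q"
 defines "m \<equiv> min p (p_prime p q)" and "M \<equiv> max p (p_prime p q)"
 assumes b: "0 \<le> b" "b \<le> m" "b \<le> 1 - M"
  and PR: "0 \<le> P" "P \<le> m" "R \<le> m + (M - m) * b ^ n" "0 \<le> R" "R \<le> 1" and \<mu>: "fk_limit adj p q \<mu>"
 shows "sdom (bern (hyb S P R)) \<mu>"
proof -
 define o' where "o' \<longleftrightarrow> p_prime p q \<le> p"
 have c: "(if o' then p else p_prime p q) = M" by (auto simp: o'_def M_def)
 have "\<exists>T U. local_test r n o' e T U" if "e \<in> S" for e using test that S by blast
 then obtain T U where T: "\<And>e. e \<in> S \<Longrightarrow> local_test r n o' e (T e) (U e)" by metis
 obtain en :: "nat \<Rightarrow> 'v set" where enu: "bij_betw en UNIV EG" "\<And>i n. i < n \<Longrightarrow> en n \<in> S \<Longrightarrow> en i \<notin> T (en n)"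
  using tests_separated[OF S T] by blast
 interpret enum_graph adj en by unfold_locales (rule enu(1))
 have M0: "m \<le> 1" "m \<le> M" using pq by (auto simp: M_def m_def)
 have b1: "b \<le> 1" using b M0 by linarith
 show ?thesis
 proof (rule bern_dominated)
  show "prob_space \<mu>" "sets \<mu> = sets (cfg_space adj)" using \<mu> by (auto simp: fk_limit_def)
  show "pe_ok (hyb S P R) EG" using PR M0 by (auto simp: pe_ok_def hyb_def)
  fix k and B :: "nat set" assume B: "B \<subseteq> {..<k}"
  let ?F = "en ` {..<k}" and ?e = "en k"
  have F: "finite ?F" "?F \<subseteq> EG" "?e \<in> EG" using en_edge by auto
  have eF: "?e \<notin> ?F" using inj_en by (auto simp: inj_def)
  show "hyb S P R ?e * measure \<mu> (atom k B) \<le> measure \<mu> (atom (Suc k) (insert k B))"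
  proof (cases "?e \<in> S")
   case False
   have "P * measure \<mu> (atom k B) \<le> m * measure \<mu> (atom k B)" by (rule mult_right_mono[OF PR(2)]) simp
   also have "\<dots> \<le> measure \<mu> (atom (Suc k) (insert k B))"
    unfolding atom_cyl[OF B] m_def by (rule fk_limit_edge(2)[OF \<mu> pq F eF])
   finally show ?thesis using False by (simp add: hyb_def)
  next
   case True
   have t: "forces o' (T ?e) ?e (U ?e)" "finite (U ?e)" "finite (T ?e)" "T ?e \<subseteq> EG" "?e \<notin> T ?e" "card (T ?e) \<le> n"
    using T[OF True] unfolding local_test_def by blast+
   have TF: "T ?e \<inter> ?F = {}" using enu(2) True by auto
   have "R * measure \<mu> (atom k B) \<le> (m + (M - m) * b ^ card (T ?e)) * measure \<mu> (atom k B)"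
   proof (rule mult_right_mono)
    have "(M - m) * b ^ n \<le> (M - m) * b ^ card (T ?e)"
     using M0 b b1 t(6) by (intro mult_left_mono power_decreasing) auto
    thus "R \<le> m + (M - m) * b ^ card (T ?e)" using PR by linarith
   qed simp
   also have "\<dots> \<le> measure \<mu> (atom (Suc k) (insert k B))"
    unfolding atom_cyl[OF B] M_def m_def
    by (rule fk_limit_edge(4)[OF \<mu> pq F eF t(1-5) TF b(1) b(2)[unfolded m_def] b(3)[unfolded M_def] c[unfolded M_def]])
   finally show ?thesis using True by (simp add: hyb_def)
  qed
 qed
qed

end

section \<open>Shifting the critical point\<close>

lemma PR_elem_le:
 assumes I: "finite I" and P: "pv P"
 shows "PR I P (\<lambda>V. e \<in> V) \<le> P e"
proof -
 have single: "PR {e} P (\<lambda>V. e \<in> V) = P e" unfolding PR_def by (subst Ev_insert) auto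
 have "PR I P (\<lambda>V. e \<in> V) = PR I P (\<lambda>V. e \<in> V \<inter> {e})" by simp
 also have "\<dots> = PR (I \<inter> {e}) P (\<lambda>V. e \<in> V)" by (rule PR_restrict[OF I])
 also have "\<dots> \<le> P e"
 proof (cases "e \<in> I")
  case True
  hence "I \<inter> {e} = {e}" by blast
  thus ?thesis using single by simp
 next
  case False
  hence "I \<inter> {e} = {}" by blast
  moreover have "PR {} P (\<lambda>V. e \<in> V) = 0" by (simp add: PR_def)
  ultimately show ?thesis using P by (simp add: pv_def)
 qed
 finally show ?thesis .
qed

section \<open>Homogeneous percolation at low density and on either side of the critical
  point\<close>

context lf_graph
begin

text \<open>Seen from the ghost end \<open>w\<close>, the cluster explored without touching
  \<open>z\<close> must contain a vertex \<open>y\<close> joined to \<open>z\<close> by an open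
  edge. The connection from \<open>y\<close> to \<open>w\<close> never returns to \<open>z\<close>,
  so it is independent of that edge.\<close>

lemma hits_first_step:
 assumes h: "hits z V" and nz: "{z} \<notin> V"
 shows "\<exists>y. y \<noteq> z \<and> {z, y} \<in> V \<and> hits y (V - {{z, y}})"
proof -
 obtain w where w: "w \<in> cl V z" "{w} \<in> V" using h by (auto simp: hits_def)
 have wz: "w \<noteq> z" using w nz by blast
 let ?V = "V - touch {z}"
 have U: "cl ?V w \<subseteq> - {z}" by (rule cl_subI) (use wz in "auto simp: touch_def")
 have "\<exists>y\<in>cl ?V w. {z, y} \<in> V"
 proof (rule ccontr)
  assume no: "\<not> ?thesis"
  have "cl V w \<subseteq> cl ?V w"
  proof (rule cl_subI)
   fix s t assume s: "s \<in> cl ?V w" "{s, t} \<in> V"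
   have "t \<noteq> z" using no s by (auto simp: insert_commute)
   moreover have "s \<noteq> z" using U s(1) by blast
   ultimately have "{s, t} \<in> ?V" using s(2) by (auto simp: touch_def)
   thus "t \<in> cl ?V w" by (rule cl_step[OF s(1)])
  qed simp
  thus False using cl_sym[OF w(1)] U by blast
 qed
 then obtain y where y: "y \<in> cl ?V w" "{z, y} \<in> V" by blast
 have yz: "y \<noteq> z" using U y(1) by blast
 have "?V \<subseteq> V - {{z, y}}" by (auto simp: touch_def)
 hence "w \<in> cl (V - {{z, y}}) y" using cl_mono[of ?V "V - {{z, y}}" y] cl_sym[OF y(1)] by blast
 moreover have "{w} \<in> V - {{z, y}}" using w(2) yz by (auto simp: doubleton_eq_iff)
 ultimately have "hits y (V - {{z, y}})" unfolding hits_def by blast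
 thus ?thesis using yz y(2) by blast
qed

text \<open>Induction over the index set with a union bound over the first step: \<open>h\<close>
  for the ghost index at \<open>z\<close>, plus at most \<open>D\<close> neighbours contributing p *
  2h each, hence at most another \<open>h\<close>.\<close>

lemma small_density:
 assumes D: "\<And>v. card {y. adj v y} \<le> D" and p: "0 \<le> p" "p \<le> 1" "p * real D \<le> 1/2" and h: "0 < h" "h \<le> 1/2"
  and I: "finite I" "I \<subseteq> Idx"
 shows "PR I (Pm {} p p h) (hits z) \<le> 2 * h"
 using I
proof (induction "card I" arbitrary: I z rule: less_induct)
 case less
 let ?P = "Pm {} p p h"
 have P: "pv ?P" using p h by (auto simp: pv_def Pm_def)
 define N where "N = {y. adj z y \<and> {z, y} \<in> I}"
 have fN: "finite N" "card N \<le> D"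
 proof -
  have sub: "N \<subseteq> {y. adj z y}" by (auto simp: N_def)
  show "finite N" by (rule finite_subset[OF sub]) (simp add: lf)
  have "card N \<le> card {y. adj z y}" by (rule card_mono[OF _ sub]) (simp add: lf)
  thus "card N \<le> D" using D[of z] by simp
 qed
 let ?A = "\<lambda>b V. case b of None \<Rightarrow> {z} \<in> V | Some y \<Rightarrow> {z, y} \<in> V \<inter> {{z, y}} \<and> hits y (V - {{z, y}})"
 have "PR I ?P (hits z) \<le> PR I ?P (\<lambda>V. \<exists>b\<in>insert None (Some ` N). ?A b V)"
 proof (rule PR_mono[OF P])
  fix V assume w: "V \<subseteq> I" and hz: "hits z V"
  show "\<exists>b\<in>insert None (Some ` N). ?A b V"
  proof (cases "{z} \<in> V")
   case False
   from hits_first_step[OF hz False] obtain y where y: "y \<noteq> z" "{z, y} \<in> V" "hits y (V - {{z, y}})" by blast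
   have "{z, y} \<in> Idx" using y(2) w less.prems by blast
   hence "adj z y" using Idx_adj y(1) by blast
   hence "y \<in> N" using y w by (auto simp: N_def)
   thus ?thesis using y by (intro bexI[of _ "Some y"]) auto
  qed auto
 qed
 also have "\<dots> \<le> (\<Sum>b\<in>insert None (Some ` N). PR I ?P (?A b))" by (rule PR_Ex_le[OF P]) (use fN in simp)
 also have "\<dots> = PR I ?P (\<lambda>V. {z} \<in> V) + (\<Sum>y\<in>N. PR I ?P (\<lambda>V. {z, y} \<in> V \<inter> {{z, y}} \<and> hits y (V - {{z, y}})))"
  using fN by (subst sum.insert) (auto simp: sum.reindex)
 also have "PR I ?P (\<lambda>V. {z} \<in> V) \<le> h" using PR_elem_le[OF less.prems(1) P, of "{z}"] by (simp add: Pm_def)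
 also have "(\<Sum>y\<in>N. PR I ?P (\<lambda>V. {z, y} \<in> V \<inter> {{z, y}} \<and> hits y (V - {{z, y}}))) \<le> (\<Sum>y\<in>N. p * (2 * h))"
 proof (rule sum_mono)
  fix y assume y: "y \<in> N"
  hence e: "{z, y} \<in> EG" "{z, y} \<in> I" by (auto simp: N_def edges_def)
  have "PR I ?P (\<lambda>V. {z, y} \<in> V \<inter> {{z, y}} \<and> hits y (V - {{z, y}})) =
   PR (I \<inter> {{z, y}}) ?P (\<lambda>V. {z, y} \<in> V) * PR (I - {{z, y}}) ?P (hits y)"
   by (rule PR_indep[OF less.prems(1)])
  also have "\<dots> \<le> p * (2 * h)"
  proof (rule mult_mono)
   show "PR (I \<inter> {{z, y}}) ?P (\<lambda>V. {z, y} \<in> V) \<le> p"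
    using PR_elem_le[OF _ P, of "I \<inter> {{z, y}}" "{z, y}"] edge_not_green[OF e(1)] by (simp add: Pm_def)
   have "card (I - {{z, y}}) < card I" using e(2) less.prems(1) by (intro psubset_card_mono) auto
   thus "PR (I - {{z, y}}) ?P (hits y) \<le> 2 * h" by (rule less.hyps) (use less.prems in auto)
  qed (use p PR_nonneg[OF P] in auto)
  finally show "PR I ?P (\<lambda>V. {z, y} \<in> V \<inter> {{z, y}} \<and> hits y (V - {{z, y}})) \<le> p * (2 * h)" .
 qed
 also have "(\<Sum>y\<in>N. p * (2 * h)) \<le> h"
 proof -
  have "(\<Sum>y\<in>N. p * (2 * h)) = (p * real (card N)) * (2 * h)" by simp
  also have "\<dots> \<le> (p * real D) * (2 * h)" using p h fN by (intro mult_right_mono mult_left_mono) auto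
  also have "\<dots> \<le> 1/2 * (2 * h)" using p h by (intro mult_right_mono) auto
  finally show ?thesis by simp
 qed
 finally show ?case by simp
qed

lemma thet_nonneg: "pe_ok pe EG \<Longrightarrow> 0 \<le> thet pe z k"
 by (subst bern_exits[symmetric]) auto

lemma thet_tendsto_zeroI:
 assumes pe: "pe_ok pe EG" and small: "\<And>u. 0 < u \<Longrightarrow> \<exists>k. thet pe z k < u"
 shows "thet pe z \<longlonglongrightarrow> 0"
proof (rule LIMSEQ_I)
 fix u :: real assume "0 < u"
 then obtain k where k: "thet pe z k < u" using small by blast
 have "norm (thet pe z n - 0) < u" if "k \<le> n" for n
  using k decseqD[OF thet_decseq[OF pe] that, of z] thet_nonneg[OF pe, of z n] by simp
 thus "\<exists>no. \<forall>n\<ge>no. norm (thet pe z n - 0) < u" by blast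
qed

lemma pe_ok_const: "0 \<le> p \<Longrightarrow> p \<le> 1 \<Longrightarrow> pe_ok (\<lambda>_. p) EG"
 by (simp add: pe_ok_def)

lemma hyb_const: "hyb S p p = (\<lambda>_. p)"
 by (simp add: hyb_def fun_eq_iff)

lemma subcritical:
 assumes p: "0 \<le> p" "p < p_c adj"
 shows "p \<le> 1" "thet (\<lambda>_. p) z \<longlonglongrightarrow> 0"
proof -
 let ?A = "{p \<in> {0..1}. AE V in bern (\<lambda>_. p). \<not> inf_cl V}"
 have "\<exists>p'\<in>?A. p < p'"
 proof (rule ccontr)
  assume no: "\<not> ?thesis"
  \<comment> \<open>The supremum defining \<open>p_c\<close> is meaningful because density 0 belongs
    to the set.\<close>
  have "?A \<noteq> {}"
  proof -
   have "thet (\<lambda>_. 0) v k = 0" for v k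
   proof -
    have "cl {} v = {v}" by (rule equalityI[OF cl_subI]) auto
    hence "\<not> exits k v {}" by (simp add: exits_def)
    have "PR (EB (Suc k) v) (\<lambda>_. 0) (exits k v) = wt (EB (Suc k) v) (\<lambda>_. 0) {} * of_bool (exits k v {})"
     unfolding PR_def Ev_def
    proof (subst sum.remove[of _ "{}"])
     have "wt (EB (Suc k) v) (\<lambda>_. 0) J = 0" if J: "J \<in> Pow (EB (Suc k) v) - {{}}" for J
     proof -
      obtain e where "e \<in> J" "e \<in> EB (Suc k) v" using J by blast
      thus ?thesis unfolding wt_def by (intro prod_zero) auto
     qed
     thus "wt (EB (Suc k) v) (\<lambda>_. 0) {} * of_bool (exits k v {}) +
      (\<Sum>J\<in>Pow (EB (Suc k) v) - {{}}. wt (EB (Suc k) v) (\<lambda>_. 0) J * of_bool (exits k v J)) =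
      wt (EB (Suc k) v) (\<lambda>_. 0) {} * of_bool (exits k v {})" by simp
    qed simp_all
    thus ?thesis using \<open>\<not> exits k v {}\<close> by (simp add: thet_def)
   qed
   hence "thet (\<lambda>_. 0) v = (\<lambda>_. 0)" for v by (simp add: fun_eq_iff)
   hence "0 \<in> ?A" using AE_no_inf_iff[OF pe_ok_const[of 0]] by simp
   thus ?thesis by blast
  qed
  hence "p_c adj \<le> p" unfolding p_c_def by (rule cSup_least) (use no in auto)
  thus False using p by simp
 qed
 then obtain p' where p': "0 \<le> p'" "p' \<le> 1" "AE V in bern (\<lambda>_. p'). \<not> inf_cl V" "p < p'" by auto
 show "p \<le> 1" using p' by simp
 have ok: "pe_ok (\<lambda>_. p) EG" "pe_ok (\<lambda>_. p') EG" by (rule pe_ok_const; use p p' in simp)+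
 have t: "thet (\<lambda>_. p') z \<longlonglongrightarrow> 0" using p'(3) AE_no_inf_iff[OF ok(2)] by blast
 show "thet (\<lambda>_. p) z \<longlonglongrightarrow> 0"
 proof (rule thet_tendsto_zeroI[OF ok(1)])
  fix u :: real assume "0 < u"
  hence "eventually (\<lambda>k. thet (\<lambda>_. p') z k < u) sequentially" by (rule order_tendstoD(2)[OF t])
  then obtain k where "thet (\<lambda>_. p') z k < u" by (auto simp: eventually_sequentially)
  moreover have "thet (\<lambda>_. p) z k \<le> thet (\<lambda>_. p') z k" by (rule thet_mono[OF ok]) (use p' in simp)
  ultimately show "\<exists>k. thet (\<lambda>_. p) z k < u" by (meson le_less_trans)
 qed
qed

lemma supercritical:
 assumes p: "p_c adj < p" "0 \<le> p" "p \<le> 1"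
 shows "\<exists>z \<theta>. 0 < \<theta> \<and> (\<forall>k. \<theta> \<le> thet (\<lambda>_. p) z k)"
proof -
 let ?A = "{p \<in> {0..1}. AE V in bern (\<lambda>_. p). \<not> inf_cl V}"
 have ok: "pe_ok (\<lambda>_. p) EG" by (rule pe_ok_const; use p in simp)
 have "bdd_above ?A" by (rule bdd_aboveI[of _ 1]) auto
 hence "p \<notin> ?A" using cSup_upper[of p ?A] p(1) unfolding p_c_def by linarith
 hence "\<not> (\<forall>z. thet (\<lambda>_. p) z \<longlonglongrightarrow> 0)" using AE_no_inf_iff[OF ok] p by simp
 then obtain z where z: "\<not> thet (\<lambda>_. p) z \<longlonglongrightarrow> 0" by blast
 let ?l = "measure (bern (\<lambda>_. p)) {V \<in> Cfg. \<forall>k. exits k z (os V)}"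
 have l: "thet (\<lambda>_. p) z \<longlonglongrightarrow> ?l" by (rule thet_limit[OF ok])
 have "?l \<noteq> 0"
 proof
  assume "?l = 0"
  thus False using l z by simp
 qed
 hence "0 < ?l" by (simp add: zero_less_measure_iff)
 moreover have "?l \<le> thet (\<lambda>_. p) z k" for k by (rule decseq_ge[OF thet_decseq[OF ok] l])
 ultimately show ?thesis by blast
qed

lemma pow_small:
 assumes "0 < (h::real)" "h \<le> 1" "0 < u"
 shows "\<exists>k0. \<forall>k\<ge>k0. (1 - h) ^ Suc k < u"
proof -
 obtain k0 where k0: "(1 - h) ^ k0 < u" using real_arch_pow_inv[OF assms(3), of "1 - h"] assms by auto
 have "(1 - h) ^ Suc k < u" if "k0 \<le> k" for k
 proof -
  have "(1 - h) ^ Suc k \<le> (1 - h) ^ k0" using that assms by (intro power_decreasing) auto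
  thus ?thesis using k0 by simp
 qed
 thus ?thesis by blast
qed

end

context qt_graph
begin

text \<open>Needed so that densities near the critical point keep a positive distance from 0,
  without which no finite-energy constant would exist.\<close>

lemma p_c_pos: "0 < p_c adj"
proof -
 obtain D where D: "\<And>v. card {y. adj v y} \<le> D" using degree_bound by blast
 define p where "p = 1 / (2 * (real D + 1))"
 have p: "0 < p" "p \<le> 1/2" "p * real D \<le> 1/2" by (auto simp: p_def field_simps)
 have ok: "pe_ok (\<lambda>_. p) EG" by (rule pe_ok_const) (use p in auto)
 have "thet (\<lambda>_. p) z \<longlonglongrightarrow> 0" for z
 proof (rule thet_tendsto_zeroI[OF ok])
  fix u :: real assume u: "0 < u"
  define h where "h = min (1/2) (u / 4)"
  have h: "0 < h" "h \<le> 1/2" "2 * h \<le> u / 2" using u by (auto simp: h_def)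
  obtain k where k: "(1 - h) ^ Suc k < u / 2" using pow_small[of h "u/2"] h u by auto
  have okp: "okp p p p h" using p h by (simp add: okp_def)
  have "thet (hyb {} p p) z k \<le> PR (IB (Suc k) z) (Pm {} p p h) (hits z) + (1 - h) ^ Suc k" by (rule thet_le_hits[OF okp])
  also have "PR (IB (Suc k) z) (Pm {} p p h) (hits z) \<le> 2 * h"
   by (rule small_density[OF D _ _ p(3) h(1,2) finite_IB IB_sub_Idx]) (use p in auto)
  finally have "thet (\<lambda>_. p) z k < u" using k h(3) unfolding hyb_const by linarith
  thus "\<exists>k. thet (\<lambda>_. p) z k < u" by blast
 qed
 hence A: "p \<in> {p \<in> {0..1}. AE V in bern (\<lambda>_. p). \<not> inf_cl V}"
  using AE_no_inf_iff[OF ok] p by simp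
 have "p \<le> p_c adj" unfolding p_c_def by (rule cSup_upper[OF A]) (rule bdd_aboveI[of _ 1], auto)
 thus ?thesis using p by simp
qed

text \<open>Once the pattern is no denser than the background, raising it to the background bounds
  all patterns at once by one homogeneous measure.\<close>

lemma Mbar_hom_le:
 assumes ok: "okp a p r h" "okp a p p h" and rp: "r \<le> p"
 shows "Mbar L p r h z \<le> thet (\<lambda>_. p) z k + real (card (ball k z)) * h"
proof (rule Mbar_least)
 fix S I assume S: "S \<in> Fam L" and I: "I \<in> Fin"
 obtain N where N: "I \<subseteq> IB N z" using Fin_sub_IB[OF I] by blast
 have "PR I (Pm S p r h) (hits z) \<le> HP N S p r h z"
  by (rule PR_mono_index[OF incr_hits okp_pv[OF ok(1)] finite_IB N])
 also have "\<dots> \<le> HP N S p p h z"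
  by (rule PR_mono_param[OF finite_IB incr_hits okp_pv[OF ok(1)] okp_pv[OF ok(2)]]) (use rp in "simp add: Pm_def")
 also have "\<dots> \<le> thet (hyb S p p) z k + real (card (ball k z)) * h" by (rule hits_le_thet[OF ok(2)])
 finally show "PR I (Pm S p r h) (hits z) \<le> thet (\<lambda>_. p) z k + real (card (ball k z)) * h" unfolding hyb_const .
qed

text \<open>Background and pattern start at pc + c\<eta>/4 and \<eta> below it. Moving by \<eta>/2
  along the monotone path lowers the background by c\<eta>/2, to pc - c\<eta>/4, while the pattern
  is still no denser; comparison with a homogeneous subcritical measure finishes.\<close>

lemma subcritical_pattern:
 assumes a: "0 < a" "a \<le> 1" "4 * a \<le> p_c adj" "p_c adj \<le> 1 - 4 * a"
 shows "\<exists>c>0. c \<le> 1 \<and> (\<forall>\<eta> S z. 0 < \<eta> \<longrightarrow> \<eta> \<le> a \<longrightarrow> S \<in> Fam L \<longrightarrow>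
  thet (hyb S (p_c adj + c * \<eta> / 4) (p_c adj + c * \<eta> / 4 - \<eta>)) z \<longlonglongrightarrow> 0)"
proof -
 obtain c where c: "0 < c" "c \<le> 1" and imp: "\<And>p r h \<eta> z. okp a p r h \<Longrightarrow> 0 \<le> \<eta> \<Longrightarrow> okp a (p - c * \<eta>) (r + \<eta>) h \<Longrightarrow>
  Mbar L p r h z \<le> Mbar L (p - c * \<eta>) (r + \<eta>) h z" using improvement[OF a(1,2), of L] by blast
 have "thet (hyb S (p_c adj + c * \<eta> / 4) (p_c adj + c * \<eta> / 4 - \<eta>)) z \<longlonglongrightarrow> 0"
  if e: "0 < \<eta>" "\<eta> \<le> a" and S: "S \<in> Fam L" for \<eta> S z
 proof -
  define P where "P = p_c adj + c * \<eta> / 4"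
  define R where "R = P - \<eta>"
  define Q where "Q = p_c adj - c * \<eta> / 4"
  have ce: "0 < c * \<eta>" "c * \<eta> \<le> \<eta>" using c e by (auto simp: mult_left_le_one_le)
  have PQ: "P - c * (\<eta> / 2) = Q" by (simp add: P_def Q_def)
  have rQ: "R + \<eta> / 2 \<le> Q" using ce unfolding R_def P_def Q_def by linarith
  have okk: "okp a P R h" "okp a Q (R + \<eta> / 2) h" "okp a Q Q h" if "0 < h" "h \<le> 1/2" for h
   using that a ce e unfolding okp_def P_def Q_def R_def by linarith+
  have peS: "pe_ok (hyb S P R) EG"
   using okk(1)[of "1/2"] by (auto simp: pe_ok_def hyb_def okp_def)
  have Q: "0 \<le> Q" "Q < p_c adj" using a ce e unfolding Q_def by linarith+
  have tQ: "thet (\<lambda>_. Q) z \<longlonglongrightarrow> 0" by (rule subcritical(2)[OF Q])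
  have "thet (hyb S P R) z \<longlonglongrightarrow> 0"
  proof (rule thet_tendsto_zeroI[OF peS])
   fix u :: real assume u: "0 < u"
   \<comment> \<open>The order of choices matters: first the scale \<open>k'\<close> for the
     homogeneous measure, then \<open>h\<close> small for that ball, then \<open>k\<close> large for
     that \<open>h\<close>. Each error is at most u/3.\<close>
   have "eventually (\<lambda>k. thet (\<lambda>_. Q) z k < u / 3) sequentially" by (rule order_tendstoD(2)[OF tQ]) (use u in simp)
   then obtain k' where k': "thet (\<lambda>_. Q) z k' < u / 3" by (auto simp: eventually_sequentially)
   define B where "B = real (card (ball k' z))"
   define h where "h = min (1/2) (u / (3 * (B + 1)))"
   have B: "0 \<le> B" by (simp add: B_def)
   have "0 < u / (3 * (B + 1))" using u B by simp
   hence h: "0 < h" "h \<le> 1/2" unfolding h_def by linarith+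
   have Bh: "B * h \<le> u / 3"
   proof -
    have "B * h \<le> (B + 1) * (u / (3 * (B + 1)))" using B h by (intro mult_mono) (auto simp: h_def)
    also have "\<dots> = u / 3" using B by (simp add: field_simps)
    finally show ?thesis .
   qed
   obtain k where k: "(1 - h) ^ Suc k < u / 3" using pow_small[of h "u/3"] h u by auto
   have "thet (hyb S P R) z k \<le> HP (Suc k) S P R h z + (1 - h) ^ Suc k"
    by (rule thet_le_hits[OF okk(1)[OF h]])
   also have "HP (Suc k) S P R h z \<le> Mbar L P R h z"
    by (rule Mbar_upper[OF okk(1)[OF h] S IB_Fin])
   also have "\<dots> \<le> Mbar L (P - c * (\<eta> / 2)) (R + \<eta> / 2) h z"
    by (rule imp[OF okk(1)[OF h]]) (use e okk(2)[OF h] PQ in auto)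
   also have "\<dots> = Mbar L Q (R + \<eta> / 2) h z" unfolding PQ ..
   also have "\<dots> \<le> thet (\<lambda>_. Q) z k' + B * h" unfolding B_def by (rule Mbar_hom_le[OF okk(2,3)[OF h] rQ])
   finally have "thet (hyb S P R) z k < u" using k' Bh k by linarith
   thus "\<exists>k. thet (hyb S P R) z k < u" by blast
  qed
  thus ?thesis by (simp add: P_def R_def)
 qed
 thus ?thesis using c by blast
qed

text \<open>A diagonal choice: nested infinite sets of indices on which the patterns agree on larger
  and larger boxes. The requirement \<open>j \<ge> k\<close> allows a bound at scale
  \<open>j\<close> to be weakened to scale \<open>k\<close>.\<close>

lemma pattern_limit:
 fixes Sj :: "nat \<Rightarrow> 'v set set"
 shows "\<exists>S. \<forall>k. \<exists>j\<ge>k. S \<inter> IB k z = Sj j \<inter> IB k z"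
proof -
 define good where "good k J \<longleftrightarrow> infinite J \<and> (\<forall>i\<in>J. \<forall>j\<in>J. Sj i \<inter> IB k z = Sj j \<inter> IB k z)" for k J
 have refine: "\<exists>J'\<subseteq>J. good k J'" if J: "infinite J" for k J
 proof -
  have "finite ((\<lambda>j. Sj j \<inter> IB k z) ` J)"
   by (rule finite_subset[of _ "Pow (IB k z)"]) auto
  from pigeonhole_infinite[OF J this] obtain j0 where j0: "j0 \<in> J" "infinite {a \<in> J. Sj a \<inter> IB k z = Sj j0 \<inter> IB k z}" by blast
  thus ?thesis unfolding good_def by (intro exI[of _ "{a \<in> J. Sj a \<inter> IB k z = Sj j0 \<inter> IB k z}"]) auto
 qed
 have "\<exists>J. \<forall>k. good k (J k) \<and> J (Suc k) \<subseteq> J k"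
 proof (rule dependent_nat_choice)
  show "\<exists>J. good 0 J" using refine[of UNIV 0] by auto
  show "\<exists>J'. good (Suc k) J' \<and> J' \<subseteq> J" if "good k J" for J k
   using refine[of J "Suc k"] that by (auto simp: good_def)
 qed
 then obtain J where J: "\<And>k. good k (J k)" "\<And>k. J (Suc k) \<subseteq> J k" by blast
 have Jmono: "J n \<subseteq> J m" if "m \<le> n" for m n using lift_Suc_antimono_le[of J, OF J(2) that] .
 have "\<exists>j\<in>J k. k \<le> j" for k
 proof -
  have "infinite (J k)" using J(1) by (simp add: good_def)
  thus ?thesis using infinite_nat_iff_unbounded_le by blast
 qed
 then obtain j where j: "\<And>k. j k \<in> J k" "\<And>k. k \<le> j k" by metis
 define S where "S = (\<Union>k. Sj (j k) \<inter> IB k z)"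
 have "S \<inter> IB k z = Sj (j k) \<inter> IB k z" for k
 proof (intro equalityI subsetI)
  fix e assume e: "e \<in> S \<inter> IB k z"
  then obtain n where n: "e \<in> Sj (j n)" "e \<in> IB n z" by (auto simp: S_def)
  show "e \<in> Sj (j k) \<inter> IB k z"
  proof (cases "n \<le> k")
   case True
   have "j k \<in> J n" using Jmono[OF True] j(1) by blast
   hence "Sj (j n) \<inter> IB n z = Sj (j k) \<inter> IB n z" using J(1)[of n] j(1)[of n] unfolding good_def by blast
   thus ?thesis using n e by blast
  next
   case False
   hence "j n \<in> J k" using Jmono[of k n] j(1)[of n] by auto
   hence "Sj (j n) \<inter> IB k z = Sj (j k) \<inter> IB k z" using J(1)[of k] j(1)[of k] unfolding good_def by blast
   thus ?thesis using n e by blast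
  qed
 qed (auto simp: S_def)
 thus ?thesis using j(2) by blast
qed

text \<open>The gain at each scale \<open>j\<close> comes with its own \<open>h\<close> and its own
  pattern. Since \<open>thet\<close> at scale \<open>k\<close> reads only a box and decreases in
  \<open>k\<close>, the common bound \<theta>/4 passes to a limit pattern; separation and membership
  in \<open>Cand\<close> are local and pass as well.\<close>

lemma supercritical_pattern:
 assumes a: "0 < a" "a \<le> 1" "4 * a \<le> p_c adj" "p_c adj \<le> 1 - 4 * a"
 shows "\<exists>c>0. c \<le> 1 \<and> (\<forall>\<eta>. 0 < \<eta> \<longrightarrow> \<eta> \<le> a \<longrightarrow>
  (\<exists>S z \<theta>. S \<subseteq> Cand \<and> sep L S \<and> 0 < \<theta> \<and>
   (\<forall>k. \<theta> \<le> thet (hyb S (p_c adj - c * \<eta> / 4) (p_c adj - c * \<eta> / 4 + \<eta>)) z k)))"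
proof -
 obtain c where c: "0 < c" "c \<le> 1" and imp: "\<And>p r h \<eta> z. okp a p r h \<Longrightarrow> 0 \<le> \<eta> \<Longrightarrow> okp a (p - c * \<eta>) (r + \<eta>) h \<Longrightarrow>
  Mbar L p r h z \<le> Mbar L (p - c * \<eta>) (r + \<eta>) h z" using improvement[OF a(1,2), of L] by blast
 have "\<exists>S z \<theta>. S \<subseteq> Cand \<and> sep L S \<and> 0 < \<theta> \<and>
   (\<forall>k. \<theta> \<le> thet (hyb S (p_c adj - c * \<eta> / 4) (p_c adj - c * \<eta> / 4 + \<eta>)) z k)"
  if e: "0 < \<eta>" "\<eta> \<le> a" for \<eta>
 proof -
  define P where "P = p_c adj - c * \<eta> / 4"
  define R where "R = P + \<eta>"
  define Q where "Q = p_c adj + c * \<eta> / 4"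
  have ce: "0 < c * \<eta>" "c * \<eta> \<le> \<eta>" using c e by (auto simp: mult_left_le_one_le)
  have PQ: "Q - c * (\<eta> / 2) = P" by (simp add: P_def Q_def)
  have rQ: "Q + \<eta> / 2 \<le> R" using ce unfolding R_def P_def Q_def by linarith
  have okk: "okp a P R h" "okp a P (Q + \<eta> / 2) h" "okp a Q Q h" if "0 < h" "h \<le> 1/2" for h
   using that a ce e unfolding okp_def P_def Q_def R_def by linarith+
  have peR: "pe_ok (hyb S P R) EG" "pe_ok (hyb S P (Q + \<eta> / 2)) EG" for S
   using okk(1,2)[of "1/2"] by (auto simp: pe_ok_def hyb_def okp_def)
  have Q: "p_c adj < Q" "0 \<le> Q" "Q \<le> 1" using a ce e unfolding Q_def by linarith+
  obtain z \<theta> where th: "0 < \<theta>" "\<And>k. \<theta> \<le> thet (\<lambda>_. Q) z k" using supercritical[OF Q] by blast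
  \<comment> \<open>Three losses of \<theta>/4 are spent: cutting off at a finite scale, choosing a
    nearly optimal pattern, and open ghost indices in \<open>ball j z\<close>. The last determines
    \<open>h\<close> in terms of \<open>j\<close>.\<close>
  have each: "\<exists>S\<in>Fam L. \<theta> / 4 \<le> thet (hyb S P R) z j" for j
  proof -
   define B where "B = real (card (ball j z))"
   define h where "h = min (1/2) (\<theta> / (4 * (B + 1)))"
   have B: "0 \<le> B" by (simp add: B_def)
   have "0 < \<theta> / (4 * (B + 1))" using th B by simp
   hence h: "0 < h" "h \<le> 1/2" unfolding h_def by linarith+
   have Bh: "B * h \<le> \<theta> / 4"
   proof -
    have "B * h \<le> (B + 1) * (\<theta> / (4 * (B + 1)))" using B h by (intro mult_mono) (auto simp: h_def)
    also have "\<dots> = \<theta> / 4" using B by (simp add: field_simps)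
    finally show ?thesis .
   qed
   obtain k where k: "(1 - h) ^ Suc k < \<theta> / 4" using pow_small[of h "\<theta>/4"] h th by auto
   obtain S0 where S0: "S0 \<in> Fam L" using Fam_nonempty by blast
   have "\<theta> \<le> thet (hyb S0 Q Q) z k" unfolding hyb_const by (rule th(2))
   also have "\<dots> \<le> HP (Suc k) S0 Q Q h z + (1 - h) ^ Suc k" by (rule thet_le_hits[OF okk(3)[OF h]])
   also have "HP (Suc k) S0 Q Q h z \<le> Mbar L Q Q h z" by (rule Mbar_upper[OF okk(3)[OF h] S0 IB_Fin])
   also have "\<dots> \<le> Mbar L (Q - c * (\<eta> / 2)) (Q + \<eta> / 2) h z"
    by (rule imp[OF okk(3)[OF h]]) (use e okk(2)[OF h] PQ in auto)
   also have "\<dots> = Mbar L P (Q + \<eta> / 2) h z" unfolding PQ ..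
   finally have M: "3 * \<theta> / 4 < Mbar L P (Q + \<eta> / 2) h z" using k by linarith
   obtain S N where S: "S \<in> Fam L" and N: "Mbar L P (Q + \<eta> / 2) h z - \<theta> / 4 < HP N S P (Q + \<eta> / 2) h z"
    using Mbar_approx[OF okk(2)[OF h], of "\<theta> / 4" L z] th(1) by auto
   have "HP N S P (Q + \<eta> / 2) h z \<le> thet (hyb S P (Q + \<eta> / 2)) z j + B * h"
    unfolding B_def by (rule hits_le_thet[OF okk(2)[OF h]])
   moreover have "thet (hyb S P (Q + \<eta> / 2)) z j \<le> thet (hyb S P R) z j"
    by (rule thet_mono[OF peR(2,1)]) (use rQ in "simp add: hyb_def")
   ultimately have "\<theta> / 4 \<le> thet (hyb S P R) z j" using M N Bh by linarith
   thus ?thesis using S by blast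
  qed
  then obtain Sj where Sj: "\<And>j. Sj j \<in> Fam L" "\<And>j. \<theta> / 4 \<le> thet (hyb (Sj j) P R) z j" by metis
  obtain S where S: "\<And>k. \<exists>j\<ge>k. S \<inter> IB k z = Sj j \<inter> IB k z" using pattern_limit[of z Sj] by blast
  have "thet (hyb S P R) z k \<ge> \<theta> / 4" for k
  proof -
   obtain j where j: "Suc k \<le> j" "S \<inter> IB (Suc k) z = Sj j \<inter> IB (Suc k) z" using S by blast
   have "thet (hyb S P R) z k = thet (hyb (Sj j) P R) z k" unfolding thet_def
   proof (rule PR_param_cong)
    fix i assume "i \<in> EB (Suc k) z"
    hence "i \<in> IB (Suc k) z" using EB_IB by blast
    hence "i \<in> S \<longleftrightarrow> i \<in> Sj j" using j(2) by blast
    thus "hyb S P R i = hyb (Sj j) P R i" by (simp add: hyb_def)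
   qed
   moreover have "thet (hyb (Sj j) P R) z j \<le> thet (hyb (Sj j) P R) z k"
    by (rule decseqD[OF thet_decseq[OF peR(1)]]) (use j in simp)
   ultimately show ?thesis using Sj(2)[of j] by linarith
  qed
  moreover have SC: "S \<inter> IB k z \<subseteq> Cand" for k
  proof -
   obtain j where "S \<inter> IB k z = Sj j \<inter> IB k z" using S by blast
   thus ?thesis using Sj(1)[of j] by (auto simp: Fam_def)
  qed
  \<comment> \<open>The limit is controlled only on the boxes \<open>IB k z\<close>; intersecting
    with \<open>Idx\<close> removes everything else and does not alter the densities of
    edges.\<close>
  moreover have "S \<inter> Idx \<subseteq> Cand"
  proof
   fix i assume i: "i \<in> S \<inter> Idx"
   hence "{i} \<in> Fin" by (simp add: Fin_def)
   then obtain k where "{i} \<subseteq> IB k z" using Fin_sub_IB by blast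
   thus "i \<in> Cand" using SC[of k] i by blast
  qed
  moreover have "sep L (S \<inter> Idx)" unfolding sep_def
  proof (intro ballI impI)
   fix i i' assume i: "i \<in> S \<inter> Idx" "i' \<in> S \<inter> Idx" "i \<noteq> i'"
   hence "{i, i'} \<in> Fin" by (simp add: Fin_def)
   then obtain k where k: "{i, i'} \<subseteq> IB k z" using Fin_sub_IB by blast
   obtain j where "S \<inter> IB k z = Sj j \<inter> IB k z" using S by blast
   hence "i \<in> Sj j" "i' \<in> Sj j" using k i by blast+
   thus "\<not> near L i i'" using Sj(1)[of j] i(3) by (auto simp: Fam_def sep_def)
  qed
  moreover have "thet (hyb (S \<inter> Idx) P R) z k = thet (hyb S P R) z k" for k unfolding thet_def
   by (rule PR_param_cong) (use EB_edges edges_Idx in "auto simp: hyb_def")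
  ultimately have "S \<inter> Idx \<subseteq> Cand \<and> sep L (S \<inter> Idx) \<and> 0 < \<theta> / 4 \<and> (\<forall>k. \<theta> / 4 \<le> thet (hyb (S \<inter> Idx) P R) z k)"
   using th(1) by simp
  thus ?thesis unfolding R_def P_def by blast
 qed
 thus ?thesis using c by blast
qed

end

text \<open>Put d = p + q(1-p), which lies between 1 and q. Then p' = p/d, 1-p' = q(1-p)/d, and p
  and p' differ by p(1-p)|q-1|/d. The constant \<kappa> treats q and 1/q alike, so all estimates
  hold on both sides of q = 1.\<close>

lemma fk_densities:
 assumes pq: "0 \<le> p" "p \<le> 1" "0 < (q::real)"
 defines "m \<equiv> min p (p_prime p q)" and "M \<equiv> max p (p_prime p q)" and "\<kappa> \<equiv> min q (1 / q)"
 shows "\<kappa> * M \<le> m" "\<kappa> * (1 - m) \<le> 1 - M" "M * (1 - M) * (1 - \<kappa>) \<le> M - m" "m * (1 - m) * (1 - \<kappa>) \<le> M - m"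
proof -
 define d where "d = p + q * (1 - p)"
 note p01 = pq(1,2)
 have d0: "0 < d" unfolding d_def by (rule p_prime_bounds(1)[OF pq])
 have p': "p_prime p q = p / d" by (simp add: p_prime_def d_def)
 have d1: "d - 1 = (q - 1) * (1 - p)" by (simp add: d_def algebra_simps)
 have dq: "q - d = (q - 1) * p" by (simp add: d_def algebra_simps)
 have c': "1 - p / d = q * (1 - p) / d"
 proof -
  have "1 - p / d = (d - p) / d" using d0 by (simp add: diff_divide_distrib)
  thus ?thesis by (simp add: d_def)
 qed
 have "\<kappa> * M \<le> m \<and> \<kappa> * (1 - m) \<le> 1 - M \<and> M * (1 - M) * (1 - \<kappa>) \<le> M - m \<and> m * (1 - m) * (1 - \<kappa>) \<le> M - m"
 proof (cases "1 \<le> q")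
  case True
  have "0 \<le> (q - 1) * (1 - p)" "0 \<le> (q - 1) * p" using True pq by auto
  hence d: "1 \<le> d" "d \<le> q" using d1 dq by linarith+
  have "p / d \<le> p" using d pq by (simp add: divide_le_eq mult_le_cancel_left1)
  hence mM: "m = p / d" "M = p" by (auto simp: m_def M_def p')
  have "1 / q \<le> 1" using True by simp
  hence k: "\<kappa> = 1 / q" using True unfolding \<kappa>_def by linarith
  have 1: "1 / q * p \<le> p / d" using d pq d0 by (simp add: frac_le)
  have 2: "1 / q * (1 - p / d) \<le> 1 - p"
  proof -
   have "1 / q * (1 - p / d) = (1 - p) / d" unfolding c' using pq by simp
   also have "\<dots> \<le> 1 - p" using d pq d0 by (simp add: divide_le_eq mult_le_cancel_left1)
   finally show ?thesis .
  qed
  have diff: "p - p / d = p * (1 - p) * (q - 1) / d"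
  proof -
   have "p - p / d = p * (d - 1) / d" using d0 by (simp add: right_diff_distrib diff_divide_distrib)
   thus ?thesis unfolding d1 by (simp add: mult_ac)
  qed
  have n: "0 \<le> p * (1 - p) * (q - 1)" using True pq by simp
  have 3: "p * (1 - p) * (1 - 1 / q) \<le> p - p / d"
  proof -
   have "p * (1 - p) * (1 - 1 / q) = p * (1 - p) * (q - 1) / q" using pq by (simp add: field_simps)
   also have "\<dots> \<le> p * (1 - p) * (q - 1) / d" using d d0 n by (intro divide_left_mono) auto
   finally show ?thesis unfolding diff .
  qed
  have 4: "p / d * (1 - p / d) * (1 - 1 / q) \<le> p - p / d"
  proof -
   have "p / d * (1 - p / d) * (1 - 1 / q) = p * (1 - p) * (q - 1) / d / d" unfolding c' using pq d0 by (simp add: field_simps)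
   also have "\<dots> \<le> p * (1 - p) * (q - 1) / d / 1"
    using d d0 n by (intro divide_left_mono) auto
   also have "\<dots> = p * (1 - p) * (q - 1) / d" by simp
   finally show ?thesis unfolding diff .
  qed
  show ?thesis using 1 2 3 4 unfolding mM k by blast
 next
  case False
  hence q1: "q < 1" by simp
  have e1: "1 - d = (1 - q) * (1 - p)" unfolding d_def by algebra
  have e2: "d - q = (1 - q) * p" unfolding d_def by algebra
  have "0 \<le> 1 - d" unfolding e1 using q1 p01 by (intro mult_nonneg_nonneg) auto
  moreover have "0 \<le> d - q" unfolding e2 using q1 p01 by (intro mult_nonneg_nonneg) auto
  ultimately have d: "d \<le> 1" "q \<le> d" by auto
  have "p \<le> p / d" using d d0 pq by (simp add: le_divide_eq mult_left_le)
  hence mM: "m = p" "M = p / d" by (auto simp: m_def M_def p')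
  have k: "\<kappa> = q" using q1 pq by (auto simp: \<kappa>_def min_def le_divide_eq mult_le_one)
  have 1: "q * (p / d) \<le> p"
  proof -
   have "q * p \<le> d * p" using d pq by (intro mult_right_mono) auto
   thus ?thesis using d0 by (simp add: divide_le_eq mult.commute)
  qed
  have 2: "q * (1 - p) \<le> 1 - p / d" unfolding c' using d d0 pq by (simp add: le_divide_eq mult_left_le)
  have diff: "p / d - p = p * (1 - p) * (1 - q) / d"
  proof -
   have "p / d - p = p * (1 - d) / d" using d0 by (simp add: right_diff_distrib diff_divide_distrib)
   also note e1
   finally show ?thesis by (simp add: mult_ac)
  qed
  have n: "0 \<le> p * (1 - p) * (1 - q)" using q1 pq by simp
  have 3: "p / d * (1 - p / d) * (1 - q) \<le> p / d - p"
  proof -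
   have "p / d * (1 - p / d) * (1 - q) = (q / d) * (p * (1 - p) * (1 - q) / d)" unfolding c' by simp
   also have "\<dots> \<le> 1 * (p * (1 - p) * (1 - q) / d)"
    using d d0 n by (intro mult_right_mono) (auto simp: divide_le_eq)
   finally show ?thesis unfolding diff by simp
  qed
  have 4: "p * (1 - p) * (1 - q) \<le> p / d - p"
   unfolding diff using d d0 n by (simp add: le_divide_eq mult_left_le)
  show ?thesis using 1 2 3 4 unfolding mM k by blast
 qed
 thus "\<kappa> * M \<le> m" "\<kappa> * (1 - m) \<le> 1 - M" "M * (1 - M) * (1 - \<kappa>) \<le> M - m" "m * (1 - m) * (1 - \<kappa>) \<le> M - m" by blast+
qed

section \<open>Transfer of almost sure statements and conclusion\<close>

context lf_graph
begin

lemma increasing_has_inf: "increasing_event adj {V \<in> Cfg. inf_cl V}"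
 unfolding increasing_event_def
proof (intro conjI ballI impI)
 fix V V' assume w: "V \<in> {V \<in> Cfg. inf_cl V}" and sp: "V' \<in> Cfg"
  and le: "\<forall>e\<in>EG. V e \<longrightarrow> V' e"
 from w obtain v where v: "\<And>k. exits k v (os V)" by (auto simp: has_inf_cluster_iff)
 have "os V \<subseteq> os V'" using le by (auto simp: os_def)
 hence "exits k v (os V')" for k by (rule incrD[OF incr_exits _ v])
 thus "V' \<in> {V \<in> Cfg. inf_cl V}" using sp by (auto simp: has_inf_cluster_iff)
qed (rule has_inf_sets)

lemma AE_inf_iff:
 assumes "prob_space \<mu>" "sets \<mu> = sets (cfg_space adj)"
 defines "X \<equiv> {V \<in> Cfg. inf_cl V}"
 shows "(AE V in \<mu>. \<not> inf_cl V) \<longleftrightarrow> measure \<mu> X = 0"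
  and "(AE V in \<mu>. inf_cl V) \<longleftrightarrow> measure \<mu> X = 1"
proof -
 interpret prob_space \<mu> by (rule assms)
 have sp: "space \<mu> = Cfg" by (rule sets_eq_imp_space_eq[OF assms(2)])
 have X: "X \<in> events" using has_inf_sets assms(2) by (simp add: X_def)
 have "(AE V in \<mu>. \<not> inf_cl V) \<longleftrightarrow> emeasure \<mu> X = 0"
  by (rule AE_iff_measurable[OF X]) (simp add: X_def sp)
 thus "(AE V in \<mu>. \<not> inf_cl V) \<longleftrightarrow> measure \<mu> X = 0" by (simp add: emeasure_eq_measure)
 have "measure \<mu> X = 1 \<longleftrightarrow> (AE V in \<mu>. V \<in> X)" by (rule prob_eq_1[OF X])
 also have "\<dots> \<longleftrightarrow> (AE V in \<mu>. inf_cl V)"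
  by (rule AE_cong) (simp add: X_def sp)
 finally show "(AE V in \<mu>. inf_cl V) \<longleftrightarrow> measure \<mu> X = 1" by blast
qed

lemma transfer_inf_cluster:
 assumes \<mu>: "fk_limit adj p q \<mu>"
 shows "AE V in bern pe. \<not> inf_cl V \<Longrightarrow> sdom \<mu> (bern pe) \<Longrightarrow>
   AE V in \<mu>. \<not> inf_cl V"
  and "AE V in bern pe. inf_cl V \<Longrightarrow> sdom (bern pe) \<mu> \<Longrightarrow>
   AE V in \<mu>. inf_cl V"
proof -
 have m: "prob_space \<mu>" "sets \<mu> = sets (cfg_space adj)" using \<mu> by (auto simp: fk_limit_def)
 interpret prob_space \<mu> by (rule m)
 let ?X = "{V \<in> Cfg. inf_cl V}"
 show "AE V in \<mu>. \<not> inf_cl V"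
  if "AE V in bern pe. \<not> inf_cl V" "sdom \<mu> (bern pe)"
 proof -
  have "measure \<mu> ?X \<le> measure (bern pe) ?X" using that(2) increasing_has_inf by (simp add: stoch_dom_def)
  moreover have "measure (bern pe) ?X = 0" using that(1) AE_inf_iff(1)[OF prob_bern sets_bern] by blast
  ultimately have "measure \<mu> ?X = 0" using measure_nonneg[of \<mu> ?X] by linarith
  thus ?thesis using AE_inf_iff(1)[OF m] by blast
 qed
 show "AE V in \<mu>. inf_cl V"
  if "AE V in bern pe. inf_cl V" "sdom (bern pe) \<mu>"
 proof -
  have "measure (bern pe) ?X \<le> measure \<mu> ?X" using that(2) increasing_has_inf by (simp add: stoch_dom_def)
  moreover have "measure (bern pe) ?X = 1" using that(1) AE_inf_iff(2)[OF prob_bern sets_bern] by blast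
  ultimately have "measure \<mu> ?X = 1" using prob_le_1[of ?X] by linarith
  thus ?thesis using AE_inf_iff(2)[OF m] by blast
 qed
qed

end

context qt_graph
begin

lemma fk_main:
 assumes pc: "p_c adj < 1" and q: "0 < q" "q \<noteq> 1"
 shows "\<exists>\<delta> \<delta>' :: real. \<delta> > 0 \<and> \<delta>' > 0 \<and>
   (\<forall>p::real. 0 \<le> p \<and> p \<le> 1 \<longrightarrow>
    (max p (p_prime p q) < p_c adj + \<delta>' \<longrightarrow>
      (\<exists>pe :: 'v set \<Rightarrow> real. (\<forall>e\<in>EG. 0 \<le> pe e \<and> pe e \<le> 1) \<and>
       (AE V in bern pe. \<not> inf_cl V) \<and>
       (\<forall>\<mu>. fk_limit adj p q \<mu> \<longrightarrow> sdom \<mu> (bern pe))) \<and>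
      (\<forall>\<mu>. fk_limit adj p q \<mu> \<longrightarrow> (AE V in \<mu>. \<not> inf_cl V))) \<and>
    (min p (p_prime p q) > p_c adj - \<delta> \<longrightarrow>
      (\<exists>pe :: 'v set \<Rightarrow> real. (\<forall>e\<in>EG. 0 \<le> pe e \<and> pe e \<le> 1) \<and>
       (AE V in bern pe. inf_cl V) \<and>
       (\<forall>\<mu>. fk_limit adj p q \<mu> \<longrightarrow> sdom (bern pe) \<mu>)) \<and>
      (\<forall>\<mu>. fk_limit adj p q \<mu> \<longrightarrow> (AE V in \<mu>. inf_cl V))))"
proof -
 obtain r n where test: "\<And>o' e. e \<in> Cand \<Longrightarrow> \<exists>T U. local_test r n o' e T U" using local_test_exists by blast
 let ?L = "2 * r"
 have sep_empty: "sep ?L {}" by (simp add: sep_def)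
 define pc where "pc = p_c adj"
 \<comment> \<open>A quarter of the distance to 0 and 1: background and pattern move by at most
   \<open>a\<close> around the critical point, so every density involved stays in [a, 1-a].\<close>
 define a where "a = min pc (1 - pc) / 4"
 have a: "0 < a" "a \<le> 1" "4 * a \<le> pc" "pc \<le> 1 - 4 * a"
  using p_c_pos pc by (auto simp: a_def pc_def)
 define \<kappa> where "\<kappa> = min q (1 / q)"
 have \<kappa>: "0 < \<kappa>" "\<kappa> < 1"
 proof -
  show "0 < \<kappa>" using q by (simp add: \<kappa>_def)
  have "q < 1 \<or> 1 / q < 1" using q by (cases "q < 1") auto
  thus "\<kappa> < 1" unfolding \<kappa>_def by linarith
 qed
 \<comment> \<open>A lower bound, uniform in p, for the gain \<open>(M - m) * b ^ n\<close> from the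
   tests with \<open>b = \<kappa> * a\<close>: near the critical point \<open>fk_densities\<close>
   bounds the gap below by a * a * (1 - \<kappa>). It is positive because q differs from 1.\<close>
 define \<eta> where "\<eta> = a * a * (1 - \<kappa>) * (\<kappa> * a) ^ n"
 have ka: "0 < \<kappa> * a" "\<kappa> * a \<le> a" using \<kappa> a by (auto simp: mult_left_le_one_le)
 have e: "0 < \<eta>" "\<eta> \<le> a"
 proof -
  show "0 < \<eta>" unfolding \<eta>_def using \<kappa> a ka by (intro mult_pos_pos zero_less_power) auto
  have "a * a * (1 - \<kappa>) * (\<kappa> * a) ^ n \<le> a * 1 * 1 * 1"
   using \<kappa> a ka by (intro mult_mono power_le_one mult_nonneg_nonneg) auto
  thus "\<eta> \<le> a" by (simp add: \<eta>_def)
 qed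
 obtain c1 where c1: "0 < c1" "c1 \<le> 1" and sub: "\<And>\<eta> S z. 0 < \<eta> \<Longrightarrow> \<eta> \<le> a \<Longrightarrow> S \<in> Fam ?L \<Longrightarrow>
  thet (hyb S (pc + c1 * \<eta> / 4) (pc + c1 * \<eta> / 4 - \<eta>)) z \<longlonglongrightarrow> 0"
  using subcritical_pattern[of a ?L] a unfolding pc_def by blast
 obtain c2 where c2: "0 < c2" "c2 \<le> 1" and sup: "\<And>\<eta>. 0 < \<eta> \<Longrightarrow> \<eta> \<le> a \<Longrightarrow>
  \<exists>S z \<theta>. S \<subseteq> Cand \<and> sep ?L S \<and> 0 < \<theta> \<and> (\<forall>k. \<theta> \<le> thet (hyb S (pc - c2 * \<eta> / 4) (pc - c2 * \<eta> / 4 + \<eta>)) z k)"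
  using supercritical_pattern[of a ?L] a unfolding pc_def by blast
 \<comment> \<open>The shift of the background that a pattern change of size \<eta> pays for, as
   calibrated in \<open>subcritical_pattern\<close>; \<delta> is its supercritical
   counterpart.\<close>
 define \<delta>' where "\<delta>' = c1 * \<eta> / 4"
 define \<delta> where "\<delta> = c2 * \<eta> / 4"
 have c1e: "0 < c1 * \<eta>" "c1 * \<eta> \<le> \<eta>" using c1 e by (auto simp: mult_left_le_one_le)
 have c2e: "0 < c2 * \<eta>" "c2 * \<eta> \<le> \<eta>" using c2 e by (auto simp: mult_left_le_one_le)
 have d': "0 < \<delta>'" "\<delta>' \<le> a" using c1e e(2) a unfolding \<delta>'_def by linarith+
 have d: "0 < \<delta>" "\<delta> \<le> a" using c2e e(2) a unfolding \<delta>_def by linarith+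
 have part1: "\<exists>pe. pe_ok pe EG \<and> (AE V in bern pe. \<not> inf_cl V) \<and>
   (\<forall>\<mu>. fk_limit adj p q \<mu> \<longrightarrow> sdom \<mu> (bern pe))"
  if p: "0 \<le> p" "p \<le> 1" and less: "max p (p_prime p q) < pc + \<delta>'" for p
 proof -
  define m where "m = min p (p_prime p q)"
  define M where "M = max p (p_prime p q)"
  note den = fk_densities[OF p q(1), folded m_def M_def \<kappa>_def]
  have mM: "0 \<le> m" "m \<le> M" "M \<le> 1" using p p_prime_bounds[OF p q(1)] by (auto simp: m_def M_def)
  show ?thesis
  \<comment> \<open>Strictly below the critical point the homogeneous measure of density
    \<open>M\<close> suffices. Otherwise \<open>M\<close> lies within \<delta>' of it, hence in
    [a, 1-a], and the gap \<open>M - m\<close> is bounded below.\<close>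
  proof (cases "M < pc")
   case True
   have ok: "pe_ok (\<lambda>_. M) EG" by (rule pe_ok_const) (use mM in auto)
   have "thet (\<lambda>_. M) z \<longlonglongrightarrow> 0" for z by (rule subcritical(2)) (use mM True in "auto simp: pc_def")
   hence AE: "AE V in bern (\<lambda>_. M). \<not> inf_cl V" using AE_no_inf_iff[OF ok] by blast
   have "sdom \<mu> (bern (hyb {} M M))" if "fk_limit adj p q \<mu>" for \<mu>
    using fk_dominated[OF empty_subsetI sep_empty test p q(1), of 0 M M \<mu>] mM that unfolding m_def M_def by simp
   thus ?thesis using AE ok unfolding hyb_const by blast
  next
   case False
   obtain S where S: "S \<in> Fam ?L" using Fam_nonempty by blast
   hence SC: "S \<subseteq> Cand" "sep ?L S" by (auto simp: Fam_def)
   let ?P = "pc + \<delta>'" and ?R = "pc + \<delta>' - \<eta>"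
   have MP: "M < ?P" using less by (simp add: M_def)
   have Ma: "a \<le> M" "a \<le> 1 - M" using False MP a d' by linarith+
   have PR: "?P \<le> 1" "0 \<le> ?R" "?R \<le> 1" using a d' e by linarith+
   have ok: "pe_ok (hyb S ?P ?R) EG" using PR a d' by (auto simp: pe_ok_def hyb_def)
   have "thet (hyb S ?P ?R) z \<longlonglongrightarrow> 0" for z using sub[OF e S, of z] by (simp add: \<delta>'_def)
   hence AE: "AE V in bern (hyb S ?P ?R). \<not> inf_cl V" using AE_no_inf_iff[OF ok] by blast
   have b: "\<kappa> * a \<le> m" "\<kappa> * a \<le> 1 - M"
    using den(1) mult_left_mono[OF Ma(1), of \<kappa>] \<kappa> ka(2) Ma(2) by linarith+
   have "a * a * (1 - \<kappa>) \<le> M * (1 - M) * (1 - \<kappa>)" using Ma a \<kappa> by (intro mult_mono) auto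
   hence "a * a * (1 - \<kappa>) \<le> M - m" using den(3) by linarith
   hence "\<eta> \<le> (M - m) * (\<kappa> * a) ^ n" unfolding \<eta>_def using ka by (intro mult_right_mono) auto
   hence R: "M - (M - m) * (\<kappa> * a) ^ n \<le> ?R" using MP by linarith
   have "sdom \<mu> (bern (hyb S ?P ?R))" if "fk_limit adj p q \<mu>" for \<mu>
    using fk_dominated[OF SC test p q(1), of "\<kappa> * a" ?P ?R \<mu>] ka b R MP PR that unfolding m_def M_def by simp
   thus ?thesis using AE ok by blast
  qed
 qed
 have part2: "\<exists>pe. pe_ok pe EG \<and> (AE V in bern pe. inf_cl V) \<and>
   (\<forall>\<mu>. fk_limit adj p q \<mu> \<longrightarrow> sdom (bern pe) \<mu>)"
  if p: "0 \<le> p" "p \<le> 1" and gr: "min p (p_prime p q) > pc - \<delta>" for p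
 proof -
  define m where "m = min p (p_prime p q)"
  define M where "M = max p (p_prime p q)"
  note den = fk_densities[OF p q(1), folded m_def M_def \<kappa>_def]
  have mM: "0 \<le> m" "m \<le> M" "M \<le> 1" using p p_prime_bounds[OF p q(1)] by (auto simp: m_def M_def)
  show ?thesis
  \<comment> \<open>As in the first part, now with \<open>m\<close>: above the critical point no
    pattern is used, and otherwise \<open>m\<close> lies within \<delta> of it.\<close>
  proof (cases "pc < m")
   case True
   have ok: "pe_ok (\<lambda>_. m) EG" by (rule pe_ok_const) (use mM in auto)
   obtain z \<theta> where "0 < \<theta>" "\<And>k. \<theta> \<le> thet (\<lambda>_. m) z k"
    using supercritical[of m] True mM unfolding pc_def by auto
   hence AE: "AE V in bern (\<lambda>_. m). inf_cl V" by (rule AE_inf_cluster[OF ok])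
   have "sdom (bern (hyb {} m m)) \<mu>" if "fk_limit adj p q \<mu>" for \<mu>
    using fk_dominates[OF empty_subsetI sep_empty test p q(1), of 0 m m \<mu>] mM that unfolding m_def M_def by simp
   thus ?thesis using AE ok unfolding hyb_const by blast
  next
   case False
   let ?P = "pc - \<delta>" and ?R = "pc - \<delta> + \<eta>"
   obtain S z \<theta> where SC: "S \<subseteq> Cand" "sep ?L S" and th: "0 < \<theta>" "\<And>k. \<theta> \<le> thet (hyb S ?P ?R) z k"
    using sup[OF e] unfolding \<delta>_def by blast
   have Pm: "?P < m" using gr by (simp add: m_def)
   have ma: "a \<le> m" "a \<le> 1 - m" using False Pm a d by linarith+
   have PR: "0 \<le> ?P" "?P \<le> 1" "0 \<le> ?R" "?R \<le> 1" using a d e by linarith+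
   have ok: "pe_ok (hyb S ?P ?R) EG" using PR by (auto simp: pe_ok_def hyb_def)
   have AE: "AE V in bern (hyb S ?P ?R). inf_cl V" by (rule AE_inf_cluster[OF ok th])
   have b: "\<kappa> * a \<le> m" "\<kappa> * a \<le> 1 - M"
    using den(2) mult_left_mono[OF ma(2), of \<kappa>] \<kappa> ka(2) ma(1) by linarith+
   have "a * a * (1 - \<kappa>) \<le> m * (1 - m) * (1 - \<kappa>)" using ma a \<kappa> by (intro mult_mono) auto
   hence "a * a * (1 - \<kappa>) \<le> M - m" using den(4) by linarith
   hence "\<eta> \<le> (M - m) * (\<kappa> * a) ^ n" unfolding \<eta>_def using ka by (intro mult_right_mono) auto
   hence R: "?R \<le> m + (M - m) * (\<kappa> * a) ^ n" using Pm by linarith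
   have "sdom (bern (hyb S ?P ?R)) \<mu>" if "fk_limit adj p q \<mu>" for \<mu>
    using fk_dominates[OF SC test p q(1), of "\<kappa> * a" ?P ?R \<mu>] ka b R Pm PR that unfolding m_def M_def by simp
   thus ?thesis using AE ok by blast
  qed
 qed
 have pos: "0 < \<delta>" "0 < \<delta>'" by (rule d(1), rule d'(1))
 show ?thesis
 proof (rule exI[of _ \<delta>], rule exI[of _ \<delta>'], intro conjI pos allI impI)
  fix p :: real assume p: "0 \<le> p \<and> p \<le> 1"
  {
   assume "max p (p_prime p q) < p_c adj + \<delta>'"
   with part1[of p] p obtain pe where pe: "pe_ok pe EG"
    "AE V in bern pe. \<not> inf_cl V" "\<forall>\<mu>. fk_limit adj p q \<mu> \<longrightarrow> sdom \<mu> (bern pe)" unfolding pc_def by blast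
   thus "\<exists>pe :: 'v set \<Rightarrow> real. (\<forall>e\<in>EG. 0 \<le> pe e \<and> pe e \<le> 1) \<and>
       (AE V in bern pe. \<not> inf_cl V) \<and>
       (\<forall>\<mu>. fk_limit adj p q \<mu> \<longrightarrow> sdom \<mu> (bern pe))" unfolding pe_ok_def by blast
   show "AE V in \<mu>. \<not> inf_cl V" if "fk_limit adj p q \<mu>" for \<mu>
    using transfer_inf_cluster(1)[OF that pe(2)] pe(3) that by blast
  }
  {
   assume "min p (p_prime p q) > p_c adj - \<delta>"
   with part2[of p] p obtain pe where pe: "pe_ok pe EG"
    "AE V in bern pe. inf_cl V" "\<forall>\<mu>. fk_limit adj p q \<mu> \<longrightarrow> sdom (bern pe) \<mu>" unfolding pc_def by blast
   thus "\<exists>pe :: 'v set \<Rightarrow> real. (\<forall>e\<in>EG. 0 \<le> pe e \<and> pe e \<le> 1) \<and>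
       (AE V in bern pe. inf_cl V) \<and>
       (\<forall>\<mu>. fk_limit adj p q \<mu> \<longrightarrow> sdom (bern pe) \<mu>)" unfolding pe_ok_def by blast
   show "AE V in \<mu>. inf_cl V" if "fk_limit adj p q \<mu>" for \<mu>
    using transfer_inf_cluster(2)[OF that pe(2)] pe(3) that by blast
  }
 qed
qed

end

theorem theorem1p2:
  fixes adj :: "'v \<Rightarrow> 'v \<Rightarrow> bool"
  assumes "simple_graph adj"
    and "infinite (UNIV :: 'v set)"
    and "locally_finite adj"
    and "connected_graph adj"
    and "quasi_transitive adj"
    and "p_c adj < 1"
    and "\<exists>e\<in>edges adj. edge_on_cycle adj e \<and> edge_on_biinfinite_path adj e"
  shows "\<forall>q::real. 0 < q \<and> q \<noteq> 1 \<longrightarrow>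
    (\<exists>\<delta> \<delta>' :: real. \<delta> > 0 \<and> \<delta>' > 0 \<and>
      (\<forall>p::real. 0 \<le> p \<and> p \<le> 1 \<longrightarrow>
        (max p (p_prime p q) < p_c adj + \<delta>' \<longrightarrow>
           (\<exists>pe :: 'v set \<Rightarrow> real. (\<forall>e\<in>edges adj. 0 \<le> pe e \<and> pe e \<le> 1) \<and>
              (AE \<omega> in bern_perc adj pe. \<not> has_inf_cluster adj \<omega>) \<and>
              (\<forall>\<mu>. fk_limit adj p q \<mu> \<longrightarrow> stoch_dom adj \<mu> (bern_perc adj pe))) \<and>
           (\<forall>\<mu>. fk_limit adj p q \<mu> \<longrightarrow> (AE \<omega> in \<mu>. \<not> has_inf_cluster adj \<omega>))) \<and>
        (min p (p_prime p q) > p_c adj - \<delta> \<longrightarrow>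
           (\<exists>pe :: 'v set \<Rightarrow> real. (\<forall>e\<in>edges adj. 0 \<le> pe e \<and> pe e \<le> 1) \<and>
              (AE \<omega> in bern_perc adj pe. has_inf_cluster adj \<omega>) \<and>
              (\<forall>\<mu>. fk_limit adj p q \<mu> \<longrightarrow> stoch_dom adj (bern_perc adj pe) \<mu>)) \<and>
           (\<forall>\<mu>. fk_limit adj p q \<mu> \<longrightarrow> (AE \<omega> in \<mu>. has_inf_cluster adj \<omega>)))))"
proof -
  obtain e where e: "e \<in> edges adj" "edge_on_cycle adj e" "edge_on_biinfinite_path adj e" using assms(7) by blast
  interpret qt_graph adj e
    by unfold_locales (use assms e in \<open>auto simp: simple_graph_def locally_finite_def connected_graph_def\<close>)
  show ?thesis by (intro allI impI fk_main) (use assms(6) in auto)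
qed

end
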